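(* Let $n=2$ and let $g$ be a holomorphic function on $X\cap D$ such that $c^{(\infty)}_{\kappa,\varepsilon_0}(g)<\infty$. Then there exist a neighborhood $\mathcal{U}$ of $bD$ and an extension $\tilde g\in C^\infty(D\cap\mathcal{U})$ of $g$ such that: (i) for all non-negative integers $N$, $|\rho|^{N+1}\tilde g$ vanishes to order $N$ on $bD$; (ii) for all non-negative integers $\alpha,\beta$, the function $\left|\frac{\partial^{\alpha+\beta}\tilde g}{\partial\overline{\eta_\zeta}^{\alpha}\partial\overline{v_\zeta}^{\beta}}\right||\rho|^{\alpha+\frac\beta2}$ is bounded on $D\cap\mathcal{U}$, up to a uniform multiplicative constant, by $c^{(\infty)}_{\kappa,\varepsilon_0}(g)$; (iii) for all non-negative integers $\alpha,\beta$ with $\alpha+\beta\geq1$, $\frac{\partial^{\alpha+\beta}\tilde g}{\partial\overline{\eta_\zeta}^{\alpha}\partial\overline{v_\zeta}^{\beta}}=0$ on $X\cap D\cap\mathcal{U}$.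
   Context: $D$ is a bounded strictly convex domain of $\mathbb{C}^2$, $D=\{z:\rho(z)<0\}$, where $\rho$ is a smooth strictly convex function on $\mathbb{C}^2$ whose gradient does not vanish in a neighborhood of the boundary $bD$; $D_r=\{z:\rho(z)<r\}$. $X=\{z: f(z)=0\}$ is an analytic set, where $f$ is a holomorphic function in a neighborhood of $\overline D$, assumed to be a minimal defining function of $X$; $X\cap D\neq\emptyset$ and $X\cap bD$ is transverse in the sense of tangent cones. For $\zeta$ near $bD$, $\eta_\zeta$ is the outer unit normal at $\zeta$ to $\{\rho=\rho(\zeta)\}$ and $v_\zeta$ a smooth field of unit complex tangent vectors to these level sets. The derivative $\frac{\partial^{\alpha+\beta}\tilde g}{\partial\overline{\eta_\zeta}^{\alpha}\partial\overline{v_\zeta}^{\beta}}(\zeta)$ is $\frac{\partial^{\alpha+\beta}}{\partial\overline{\lambda}^{\alpha}\partial\overline{\mu}^{\beta}}\tilde g(\zeta+\lambda\eta_\zeta+\mu v_\zeta)$ at $\lambda=\mu=0$. $\kappa$ and $\varepsilon_0$ are fixed sufficiently small positive real numbers. For $z\in D$, $|v|=1$, $\varepsilon>0$: $\tau(z,v,\varepsilon)=\sup\{\tau>0:\ \rho(z+\lambda v)-\rho(z)<\varepsilon\text{ for all }|\lambda|<\tau\}$, and $\Lambda_{z,v}=\{\lambda\in\mathbb{C}:\ |\lambda|<3\kappa\,\tau(z,v,|\rho(z)|),\ z+\lambda v\in X\}$. Put $g_{z,v}[\lambda]=g(z+\lambda v)$ and, for pairwise distinct elements of $\Lambda_{z,v}$,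 $g_{z,v}[\lambda_1,\ldots,\lambda_{k+1}]=\frac{g_{z,v}[\lambda_1,\ldots,\lambda_k]-g_{z,v}[\lambda_2,\ldots,\lambda_{k+1}]}{\lambda_1-\lambda_{k+1}}$. Then $$c^{(\infty)}_{\kappa,\varepsilon_0}(g)=\sup\left|g_{\zeta+z_1^*\eta_\zeta,v_\zeta}[\lambda_1,\ldots,\lambda_k]\right|\tau(\zeta,v_\zeta,|\rho(\zeta)|)^{k-1},$$ the supremum being over $\zeta\in D\setminus D_{-\varepsilon_0}$, $z_1^*\in\mathbb{C}$ with $|z_1^*|\leq\kappa|\rho(\zeta)|$, $k\geq1$ and pairwise distinct $\lambda_1,\ldots,\lambda_k\in\Lambda_{\zeta+z_1^*\eta_\zeta,v_\zeta}$. *)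

theory Defs
  imports "HOL-Analysis.Analysis"
begin

section \<open>Smooth functions\<close>

text \<open>
  Iterated directional (real Frechet) derivatives: \<open>dir_derivs f [v\<^sub>1, \<dots>, v\<^sub>k]\<close> is
  \<open>D\<^bsub>v\<^sub>1\<^esub> \<dots> D\<^bsub>v\<^sub>k\<^esub> f\<close>. It is meant for \<open>f\<close> defined near the point of evaluation.
\<close>

primrec dir_derivs :: "('a::real_normed_vector \<Rightarrow> 'b::real_normed_vector) \<Rightarrow> 'a list \<Rightarrow> 'a \<Rightarrow> 'b" where
  "dir_derivs f [] = f"
| "dir_derivs f (v # vs) = (\<lambda>x. frechet_derivative (dir_derivs f vs) (at x) v)"

text \<open>
  \<open>C\<^sup>\<infinity>\<close> on an open set of a finite-dimensional space. Continuity of the derivatives of each order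
  follows from the existence of those of the next order.
\<close>

definition smooth_on :: "'a::euclidean_space set \<Rightarrow> ('a \<Rightarrow> 'b::real_normed_vector) \<Rightarrow> bool" where
  "smooth_on S f \<longleftrightarrow> (\<forall>vs. \<forall>x\<in>S. dir_derivs f vs differentiable (at x))"

text \<open>
  \<open>h\<close>, defined in \<open>D\<close> near the boundary of the open set \<open>D\<close>, vanishes to order \<open>N\<close> on that boundary:
  all its derivatives of order at most \<open>N\<close> (including \<open>h\<close> itself) extend continuously by \<open>0\<close>.
\<close>

definition vanishes_to_order_on_boundary ::
    "nat \<Rightarrow> 'a::euclidean_space set \<Rightarrow> ('a \<Rightarrow> 'b::real_normed_vector) \<Rightarrow> bool" where
  "vanishes_to_order_on_boundary N D h \<longleftrightarrow>
     (\<forall>p\<in>frontier D. \<forall>vs. length vs \<le> N \<longrightarrow> (dir_derivs h vs \<longlongrightarrow> 0) (at p within D))"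

definition strictly_convex_fun :: "('a::real_vector \<Rightarrow> real) \<Rightarrow> bool" where
  "strictly_convex_fun \<rho> \<longleftrightarrow>
     (\<forall>x y t. x \<noteq> y \<longrightarrow> 0 < t \<longrightarrow> t < 1 \<longrightarrow>
        \<rho> ((1 - t) *\<^sub>R x + t *\<^sub>R y) < (1 - t) * \<rho> x + t * \<rho> y)"

section \<open>Holomorphic functions and analytic sets in \<open>\<complex>\<^sup>n\<close>\<close>

text \<open>Complex differentiability at every point of an open set of \<open>\<complex>\<^sup>n\<close>.\<close>

definition Cn_holomorphic_on :: "(complex^'n \<Rightarrow> complex) \<Rightarrow> (complex^'n) set \<Rightarrow> bool" where
  "Cn_holomorphic_on f S \<longleftrightarrow>
     (\<forall>x\<in>S. \<exists>f'. (f has_derivative f') (at x) \<and> (\<forall>c v. f' (c *s v) = c * f' v))"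

definition zero_set_on :: "(complex^'n) set \<Rightarrow> (complex^'n \<Rightarrow> complex) \<Rightarrow> (complex^'n) set" where
  "zero_set_on \<Omega> f = {z \<in> \<Omega>. f z = 0}"

text \<open>
  Minimal defining function (Chirka, Complex Analytic Sets, Section 2.9): every holomorphic function
  on an open subset that vanishes on the zero set of \<open>f\<close> is divisible by \<open>f\<close> there.
\<close>

definition minimal_defining_function :: "(complex^'n) set \<Rightarrow> (complex^'n \<Rightarrow> complex) \<Rightarrow> bool" where
  "minimal_defining_function \<Omega> f \<longleftrightarrow>
     Cn_holomorphic_on f \<Omega> \<and>
     (\<forall>V h. open V \<and> V \<subseteq> \<Omega> \<and> Cn_holomorphic_on h V \<and> (\<forall>z\<in>V \<inter> zero_set_on \<Omega> f. h z = 0) \<longrightarrow>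
        (\<exists>q. Cn_holomorphic_on q V \<and> (\<forall>z\<in>V. h z = f z * q z)))"

text \<open>
  Holomorphic function on a (possibly singular) analytic subset \<open>A\<close> of an open set: locally the
  restriction of holomorphic functions of the ambient space.
\<close>

definition holomorphic_on_analytic_set :: "(complex^'n \<Rightarrow> complex) \<Rightarrow> (complex^'n) set \<Rightarrow> bool" where
  "holomorphic_on_analytic_set g A \<longleftrightarrow>
     (\<forall>p\<in>A. \<exists>V G. open V \<and> p \<in> V \<and> Cn_holomorphic_on G V \<and> (\<forall>x\<in>V \<inter> A. G x = g x))"

section \<open>Geometry of the level sets of \<open>\<rho>\<close>\<close>

definition gradient :: "('a::real_inner \<Rightarrow> real) \<Rightarrow> 'a \<Rightarrow> 'a" where
  "gradient \<rho> x = (THE d. GDERIV \<rho> x :> d)"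

definition sublevel :: "('a \<Rightarrow> real) \<Rightarrow> real \<Rightarrow> 'a set" where
  "sublevel \<rho> r = {z. \<rho> z < r}"

definition outer_unit_normal :: "('a::real_inner \<Rightarrow> real) \<Rightarrow> 'a \<Rightarrow> 'a" where
  "outer_unit_normal \<rho> \<zeta> = gradient \<rho> \<zeta> /\<^sub>R norm (gradient \<rho> \<zeta>)"

definition level_tangent_space :: "('a::real_inner \<Rightarrow> real) \<Rightarrow> 'a \<Rightarrow> 'a set" where
  "level_tangent_space \<rho> \<zeta> = {w. w \<bullet> gradient \<rho> \<zeta> = 0}"

definition complex_tangent_space :: "(complex^'n \<Rightarrow> real) \<Rightarrow> complex^'n \<Rightarrow> (complex^'n) set" where
  "complex_tangent_space \<rho> \<zeta> = {w. \<forall>c. c *s w \<in> level_tangent_space \<rho> \<zeta>}"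

definition tangent_cone :: "'a::real_normed_vector set \<Rightarrow> 'a \<Rightarrow> 'a set" where
  "tangent_cone X p =
     {w. \<exists>(x :: nat \<Rightarrow> 'a) (t :: nat \<Rightarrow> real). (\<forall>n. x n \<in> X \<and> t n > 0) \<and> x \<longlonglongrightarrow> p \<and>
           (\<lambda>n. t n *\<^sub>R (x n - p)) \<longlonglongrightarrow> w}"

text \<open>
  The tangent cone of an analytic curve in \<open>\<complex>\<^sup>2\<close> is a finite union of complex lines; each of them has
  to be transverse to the (real) tangent space of the boundary.
\<close>

definition transverse_tangent_cones :: "(complex^2) set \<Rightarrow> (complex^2 \<Rightarrow> real) \<Rightarrow> bool" where
  "transverse_tangent_cones X \<rho> \<longleftrightarrow>
     (\<forall>p \<in> X \<inter> frontier (sublevel \<rho> 0). \<forall>w \<in> tangent_cone X p. w \<noteq> 0 \<longrightarrow>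
        {c *s w + t | c t. t \<in> level_tangent_space \<rho> p} = UNIV)"

section \<open>The quantity \<open>c\<^sup>(\<^sup>\<infinity>\<^sup>)\<close>\<close>

definition tau :: "(complex^'n \<Rightarrow> real) \<Rightarrow> complex^'n \<Rightarrow> complex^'n \<Rightarrow> real \<Rightarrow> real" where
  "tau \<rho> z v \<epsilon> = Sup {t. t > 0 \<and> (\<forall>l. cmod l < t \<longrightarrow> \<rho> (z + l *s v) - \<rho> z < \<epsilon>)}"

definition Lambda_set ::
    "(complex^'n \<Rightarrow> real) \<Rightarrow> (complex^'n) set \<Rightarrow> real \<Rightarrow> complex^'n \<Rightarrow> complex^'n \<Rightarrow> complex set" where
  "Lambda_set \<rho> X \<kappa> z v = {l. cmod l < 3 * \<kappa> * tau \<rho> z v \<bar>\<rho> z\<bar> \<and> z + l *s v \<in> X}"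

text \<open>Divided differences \<open>h[\<lambda>\<^sub>1, \<dots>, \<lambda>\<^sub>k]\<close>; the value on the empty list is a dummy.\<close>

fun divided_diff :: "(complex \<Rightarrow> complex) \<Rightarrow> complex list \<Rightarrow> complex" where
  "divided_diff h [] = 0"
| "divided_diff h [x] = h x"
| "divided_diff h (x # y # ys) =
     (divided_diff h (butlast (x # y # ys)) - divided_diff h (y # ys)) / (x - last (y # ys))"

definition c_infty ::
    "(complex^2 \<Rightarrow> real) \<Rightarrow> (complex^2) set \<Rightarrow> (complex^2 \<Rightarrow> complex^2) \<Rightarrow> real \<Rightarrow> real
      \<Rightarrow> (complex^2 \<Rightarrow> complex) \<Rightarrow> ennreal" where
  "c_infty \<rho> X v \<kappa> \<epsilon>\<^sub>0 g =
     Sup {ennreal (cmod (divided_diff (\<lambda>l. g (\<zeta> + z\<^sub>1 *s outer_unit_normal \<rho> \<zeta> + l *s v \<zeta>)) ls)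
                    * tau \<rho> \<zeta> (v \<zeta>) \<bar>\<rho> \<zeta>\<bar> ^ (length ls - 1)) | \<zeta> z\<^sub>1 ls.
            \<zeta> \<in> sublevel \<rho> 0 - sublevel \<rho> (- \<epsilon>\<^sub>0) \<and> cmod z\<^sub>1 \<le> \<kappa> * \<bar>\<rho> \<zeta>\<bar> \<and>
            ls \<noteq> [] \<and> distinct ls \<and>
            set ls \<subseteq> Lambda_set \<rho> X \<kappa> (\<zeta> + z\<^sub>1 *s outer_unit_normal \<rho> \<zeta>) (v \<zeta>)}"

section \<open>Antiholomorphic derivatives in the moving frame\<close>

text \<open>The Wirtinger operator \<open>\<partial>/\<partial>\<lambda>\<^sup>- = (\<partial>/\<partial>x + \<i> \<partial>/\<partial>y) / 2\<close>, where \<open>\<lambda> = x + \<i>y\<close>.\<close>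

definition dbar :: "(complex \<Rightarrow> complex) \<Rightarrow> complex \<Rightarrow> complex" where
  "dbar F l = (frechet_derivative F (at l) 1 + \<i> * frechet_derivative F (at l) \<i>) / 2"

text \<open>The directions \<open>\<eta>\<close> and \<open>v\<close> are frozen, i.e. they are not differentiated.\<close>

definition dbar_frame ::
    "nat \<Rightarrow> nat \<Rightarrow> complex^'n \<Rightarrow> complex^'n \<Rightarrow> (complex^'n \<Rightarrow> complex) \<Rightarrow> complex^'n \<Rightarrow> complex" where
  "dbar_frame \<alpha> \<beta> \<eta> v G \<zeta> =
     (dbar ^^ \<alpha>) (\<lambda>l. (dbar ^^ \<beta>) (\<lambda>m. G (\<zeta> + l *s \<eta> + m *s v)) 0) 0"

end

theory Submission
  imports Defs "HOL-Complex_Analysis.Complex_Analysis"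
begin

text \<open>
  The extension is glued from local holomorphic extensions on polydiscs adapted to the boundary. At a
  point \<open>\<zeta>\<close> at which \<open>q = \<bar>\<rho> \<zeta>\<bar>\<close>, the polydisc has size of order \<open>q\<close> along the normal \<open>\<eta>\<^sub>\<zeta>\<close> and \<open>\<surd>q\<close> along
  the complex tangent \<open>v\<^sub>\<zeta>\<close>; since \<open>\<rho>\<close> varies to second order in tangential directions, \<open>\<rho>\<close> is comparable
  to its value at the centre on such a polydisc, and \<open>\<tau>(\<zeta>, v\<^sub>\<zeta>, q)\<close> is at least a constant times \<open>\<surd>q\<close>
  (locale \<open>boundary_frame\<close>, \<open>tau_lower\<close>).

  Local extensions. By transversality of the tangent cones, \<open>X\<close> lies near a boundary point in a cone
  around the normal direction, and away from that point it is a union of boundedly many graphs of bounded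
  slope over the normal coordinate (\<open>transverse_imp_graph_like\<close>). Both persist for nearby frames, with
  uniform constants by compactness of the boundary (\<open>uniformly_thin\<close>). So the radius of the polydisc
  in the direction \<open>v\<^sub>\<zeta>\<close> can be chosen within a factor two such that \<open>X\<close> avoids that part of its boundary.
  Then \<open>X\<close> is a branched covering of the normal coordinate, with a bounded number of sheets, and \<open>g\<close> is
  extended by polynomial interpolation along the lines in the direction \<open>v\<^sub>\<zeta>\<close>. In Newton's form the
  coefficients are the divided differences of \<open>g\<close>, so \<open>c_infty\<close> bounds the interpolant. Its coefficients
  are symmetric in the points of \<open>X\<close> on a line, hence holomorphic in the normal coordinate off the zeros
  of the discriminant, and by Riemann's theorem across them (\<open>interpolating_extension\<close>). The discriminant
  does not vanish identically because \<open>f\<close> is a minimal defining function (\<open>minimal_imp_disc_nonzero\<close>).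

  Gluing. A maximal separated set of centres gives a covering of bounded overlap (\<open>overlap_bound\<close>), with
  a partition of unity. Cutoff functions and, by Cauchy's estimates, local extensions satisfy symbol
  estimates: derivatives along vectors of size \<open>q\<close> in the direction \<open>\<eta>\<^sub>\<zeta>\<close> and \<open>\<surd>q\<close> in the direction \<open>v\<^sub>\<zeta>\<close> cost
  a constant only (\<open>symbol_bd\<close>, \<open>glue_local_extensions\<close>). These estimates are the bounds (ii). A fixed
  vector is admissible after multiplication by a constant times \<open>q\<close>, so \<open>N\<close> ordinary derivatives cost at
  most a factor \<open>q\<close> to the power \<open>- N\<close>, and \<open>\<bar>\<rho>\<bar>\<close> to the power \<open>N + 1\<close> more than compensates for it, which
  is (i). Antiholomorphic derivatives fall on the weights only; these have sum one, and at a point of \<open>X\<close>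
  all local extensions take the same value, whence (iii).
\<close>

section \<open>Iterated directional derivatives\<close>

lemma dir_derivs_snoc: "dir_derivs f (vs @ [w]) = dir_derivs (dir_derivs f [w]) vs"
  by (induction vs) auto

lemma dir_derivs_append: "dir_derivs f (vs @ ws) = dir_derivs (dir_derivs f ws) vs"
  by (induction vs) auto

lemma frechet_derivative_cong_open:
  assumes "open S" "x \<in> S" "\<And>y. y \<in> S \<Longrightarrow> f y = g y"
  shows "frechet_derivative f (at x) = frechet_derivative g (at x)"
proof -
  have "(f has_derivative D) (at x) \<longleftrightarrow> (g has_derivative D) (at x)" for D
    using has_derivative_transform_within_open[of f D x UNIV S g]
      has_derivative_transform_within_open[of g D x UNIV S f] assms by auto
  then show ?thesis unfolding frechet_derivative_def by simp
qed

lemma dir_derivs_cong_open: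
  assumes "open S" "\<And>y. y \<in> S \<Longrightarrow> f y = g y"
  shows "x \<in> S \<Longrightarrow> dir_derivs f vs x = dir_derivs g vs x"
proof (induction vs arbitrary: x)
  case (Cons v vs)
  then show ?case
    using frechet_derivative_cong_open[OF assms(1) Cons.prems, of "dir_derivs f vs" "dir_derivs g vs"]
    by simp
qed (use assms in auto)

lemma differentiable_cong_open:
  assumes "open S" "x \<in> S" "\<And>y. y \<in> S \<Longrightarrow> f y = g y" "f differentiable (at x)"
  shows "g differentiable (at x)"
  using assms unfolding differentiable_def by (metis has_derivative_transform_within_open)

lemma smooth_on_cong_open:
  assumes "open S" "\<And>y. y \<in> S \<Longrightarrow> f y = g y" "smooth_on S f"
  shows "smooth_on S g"
  unfolding smooth_on_def
proof (intro allI ballI)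
  fix vs x assume "x \<in> S"
  then show "dir_derivs g vs differentiable (at x)"
    using assms differentiable_cong_open[OF assms(1) \<open>x \<in> S\<close>, of "dir_derivs f vs" "dir_derivs g vs"]
      dir_derivs_cong_open[OF assms(1), of f g] assms(2) unfolding smooth_on_def by blast
qed

lemma smooth_on_subset: "smooth_on T f \<Longrightarrow> S \<subseteq> T \<Longrightarrow> smooth_on S f"
  by (auto simp: smooth_on_def)

lemma smooth_on_dir_derivs: "smooth_on S f \<Longrightarrow> smooth_on S (dir_derivs f ws)"
  unfolding smooth_on_def by (metis dir_derivs_append)

lemma smooth_on_differentiable: "smooth_on S f \<Longrightarrow> x \<in> S \<Longrightarrow> f differentiable (at x)"
  unfolding smooth_on_def by (metis dir_derivs.simps(1))

lemma smooth_on_has_derivative: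
  "smooth_on S f \<Longrightarrow> x \<in> S \<Longrightarrow> (f has_derivative frechet_derivative f (at x)) (at x)"
  using smooth_on_differentiable frechet_derivative_works by blast

lemma smooth_on_continuous_on: "smooth_on S f \<Longrightarrow> continuous_on S f"
  by (meson differentiable_imp_continuous_on differentiable_at_withinI differentiable_on_def
      smooth_on_differentiable)

lemma smooth_on_local:
  assumes "\<And>x. x \<in> S \<Longrightarrow> \<exists>T. open T \<and> x \<in> T \<and> smooth_on T f"
  shows "smooth_on S f"
  using assms unfolding smooth_on_def by blast

text \<open>
  Smoothness is an assertion about infinitely many derivatives; the closure properties below are
  proved for finitely many of them first, by induction on the following truncation.
\<close>

definition smooth_upto :: "nat \<Rightarrow> 'a::euclidean_space set \<Rightarrow> ('a \<Rightarrow> 'b::real_normed_vector) \<Rightarrow> bool" where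
  "smooth_upto n S f \<longleftrightarrow> (\<forall>vs. length vs \<le> n \<longrightarrow> (\<forall>x\<in>S. dir_derivs f vs differentiable (at x)))"

lemma smooth_on_iff_upto: "smooth_on S f \<longleftrightarrow> (\<forall>n. smooth_upto n S f)"
  unfolding smooth_on_def smooth_upto_def by blast

lemma all_lists_snoc:
  "(\<forall>vs. length vs \<le> Suc n \<longrightarrow> P vs) \<longleftrightarrow> P [] \<and> (\<forall>w vs. length vs \<le> n \<longrightarrow> P (vs @ [w]))"
proof (intro iffI conjI allI impI)
  fix vs :: "'a list" assume *: "P [] \<and> (\<forall>w vs. length vs \<le> n \<longrightarrow> P (vs @ [w]))" "length vs \<le> Suc n"
  then show "P vs" by (cases vs rule: rev_cases) auto
qed auto

lemma smooth_upto_Suc: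
  "smooth_upto (Suc n) S f \<longleftrightarrow>
     (\<forall>x\<in>S. f differentiable (at x)) \<and> (\<forall>w. smooth_upto n S (dir_derivs f [w]))"
  unfolding smooth_upto_def all_lists_snoc dir_derivs_snoc by auto

lemma smooth_upto_0: "smooth_upto 0 S f \<longleftrightarrow> (\<forall>x\<in>S. f differentiable (at x))"
  unfolding smooth_upto_def by auto

lemma smooth_upto_mono: "smooth_upto n S f \<Longrightarrow> m \<le> n \<Longrightarrow> smooth_upto m S f"
  unfolding smooth_upto_def by auto

lemma smooth_upto_differentiable: "smooth_upto n S f \<Longrightarrow> x \<in> S \<Longrightarrow> f differentiable (at x)"
  unfolding smooth_upto_def by (metis dir_derivs.simps(1) le0 list.size(3))

lemma smooth_upto_cong_open:
  assumes "open S" "\<And>y. y \<in> S \<Longrightarrow> f y = g y" "smooth_upto n S f"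
  shows "smooth_upto n S g"
  unfolding smooth_upto_def
proof (intro allI ballI impI)
  fix vs :: "'a list" and x assume "x \<in> S" "length vs \<le> n"
  then show "dir_derivs g vs differentiable (at x)"
    using assms differentiable_cong_open[OF assms(1) \<open>x \<in> S\<close>, of "dir_derivs f vs" "dir_derivs g vs"]
      dir_derivs_cong_open[OF assms(1), of f g] assms(2) unfolding smooth_upto_def by blast
qed

text \<open>
  Derivatives are measured only along the vectors from \<open>Q\<close>, the admissible directions at the point
  \<open>x\<close>. Anisotropic weights are encoded in the size of these vectors, so that the constants in the
  estimates do not depend on the scale.
\<close>

definition symbol_bd ::
    "nat \<Rightarrow> ('a::euclidean_space \<Rightarrow> 'b::real_normed_vector) \<Rightarrow> 'a \<Rightarrow> 'a set \<Rightarrow> real \<Rightarrow> bool" where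
  "symbol_bd n u x Q C \<longleftrightarrow> (\<forall>vs. length vs \<le> n \<longrightarrow> set vs \<subseteq> Q \<longrightarrow> norm (dir_derivs u vs x) \<le> C)"

lemma symbol_bd_Suc:
  "symbol_bd (Suc n) u x Q C \<longleftrightarrow> norm (u x) \<le> C \<and> (\<forall>w\<in>Q. symbol_bd n (dir_derivs u [w]) x Q C)"
  unfolding symbol_bd_def all_lists_snoc dir_derivs_snoc by auto

lemma symbol_bd_0: "symbol_bd 0 u x Q C \<longleftrightarrow> norm (u x) \<le> C"
  unfolding symbol_bd_def by auto

lemma symbol_bd_norm: "symbol_bd n u x Q C \<Longrightarrow> norm (u x) \<le> C"
  unfolding symbol_bd_def by (metis dir_derivs.simps(1) empty_subsetI le0 list.set(1) list.size(3))

lemma symbol_bd_mono: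
  "symbol_bd n u x Q C \<Longrightarrow> m \<le> n \<Longrightarrow> Q' \<subseteq> Q \<Longrightarrow> C \<le> C' \<Longrightarrow> symbol_bd m u x Q' C'"
  unfolding symbol_bd_def by (meson order_trans)

lemma symbol_bd_cong_open:
  assumes "open S" "x \<in> S" "\<And>y. y \<in> S \<Longrightarrow> f y = g y"
  shows "symbol_bd n f x Q C \<longleftrightarrow> symbol_bd n g x Q C"
  unfolding symbol_bd_def using dir_derivs_cong_open[OF assms(1,3) assms(2)] by simp

lemma dir_derivs_linear_comp:
  assumes L: "bounded_linear L" and "open S" "smooth_on S u"
  shows "x \<in> S \<Longrightarrow> dir_derivs (\<lambda>x. L (u x)) vs x = L (dir_derivs u vs x)"
proof (induction vs arbitrary: x)
  case (Cons v vs)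
  have "frechet_derivative (dir_derivs (\<lambda>x. L (u x)) vs) (at x) =
        frechet_derivative (\<lambda>x. L (dir_derivs u vs x)) (at x)"
    by (rule frechet_derivative_cong_open[OF assms(2) Cons.prems]) (use Cons.IH in auto)
  moreover have "((\<lambda>x. L (dir_derivs u vs x)) has_derivative
       (\<lambda>h. L (frechet_derivative (dir_derivs u vs) (at x) h))) (at x)"
    using bounded_linear.has_derivative[OF L] smooth_on_has_derivative[OF smooth_on_dir_derivs[OF assms(3)] Cons.prems]
    by blast
  ultimately show ?case using frechet_derivative_at by (metis dir_derivs.simps(2))
qed simp

lemma smooth_on_linear_comp:
  assumes L: "bounded_linear L" and "open S" "smooth_on S u"
  shows "smooth_on S (\<lambda>x. L (u x))"
  unfolding smooth_on_def
proof (intro allI ballI)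
  fix vs x assume "x \<in> S"
  have "(\<lambda>x. L (dir_derivs u vs x)) differentiable (at x)"
    using bounded_linear.has_derivative[OF L smooth_on_has_derivative[OF smooth_on_dir_derivs[OF assms(3)] \<open>x \<in> S\<close>]]
    unfolding differentiable_def by blast
  then show "dir_derivs (\<lambda>x. L (u x)) vs differentiable (at x)"
    using differentiable_cong_open[OF assms(2) \<open>x \<in> S\<close>, of "\<lambda>x. L (dir_derivs u vs x)"]
      dir_derivs_linear_comp[OF assms] by simp
qed

lemma dir_derivs_add:
  assumes "open S" "smooth_on S f" "smooth_on S g"
  shows "x \<in> S \<Longrightarrow> dir_derivs (\<lambda>x. f x + g x) vs x = dir_derivs f vs x + dir_derivs g vs x"
proof (induction vs arbitrary: x)
  case (Cons v vs)
  have "frechet_derivative (dir_derivs (\<lambda>x. f x + g x) vs) (at x) =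
        frechet_derivative (\<lambda>x. dir_derivs f vs x + dir_derivs g vs x) (at x)"
    by (rule frechet_derivative_cong_open[OF assms(1) Cons.prems]) (use Cons.IH in auto)
  moreover
  have "((\<lambda>x. dir_derivs f vs x + dir_derivs g vs x) has_derivative
       (\<lambda>h. frechet_derivative (dir_derivs f vs) (at x) h + frechet_derivative (dir_derivs g vs) (at x) h)) (at x)"
    by (intro has_derivative_add smooth_on_has_derivative[OF smooth_on_dir_derivs[OF assms(2)] Cons.prems]
        smooth_on_has_derivative[OF smooth_on_dir_derivs[OF assms(3)] Cons.prems])
  from frechet_derivative_at[OF this]
  have "frechet_derivative (\<lambda>x. dir_derivs f vs x + dir_derivs g vs x) (at x) =
      (\<lambda>h. frechet_derivative (dir_derivs f vs) (at x) h + frechet_derivative (dir_derivs g vs) (at x) h)"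
    by simp
  ultimately show ?case by simp
qed simp

lemma smooth_upto_add:
  assumes "open S" shows "smooth_upto n S f \<Longrightarrow> smooth_upto n S g \<Longrightarrow> smooth_upto n S (\<lambda>x. f x + g x)"
proof (induction n arbitrary: f g)
  case 0 then show ?case by (auto simp: smooth_upto_0)
next
  case (Suc n)
  have *: "dir_derivs f [w] x + dir_derivs g [w] x = dir_derivs (\<lambda>x. f x + g x) [w] x" if "x \<in> S" for x w
  proof -
    have "f differentiable (at x)" "g differentiable (at x)"
      using Suc.prems that by (auto simp: smooth_upto_Suc)
    then have "((\<lambda>x. f x + g x) has_derivative
        (\<lambda>h. frechet_derivative f (at x) h + frechet_derivative g (at x) h)) (at x)"
      by (intro has_derivative_add) (auto simp: frechet_derivative_works)
    from frechet_derivative_at[OF this] show ?thesis by (simp add: fun_eq_iff)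
  qed
  have "smooth_upto n S (dir_derivs (\<lambda>x. f x + g x) [w])" for w
    by (rule smooth_upto_cong_open[OF assms * Suc.IH]) (use Suc.prems in \<open>auto simp: smooth_upto_Suc\<close>)
  then show ?case using Suc.prems by (auto simp: smooth_upto_Suc)
qed

lemma smooth_on_add: "open S \<Longrightarrow> smooth_on S f \<Longrightarrow> smooth_on S g \<Longrightarrow> smooth_on S (\<lambda>x. f x + g x)"
  by (simp add: smooth_on_iff_upto smooth_upto_add)

lemma dir_derivs_const: "dir_derivs (\<lambda>x. c) vs = (\<lambda>x. if vs = [] then c else 0)"
proof (induction vs)
  case (Cons v vs) then show ?case by (cases "vs = []") auto
qed auto

lemma smooth_on_const: "smooth_on S (\<lambda>x. c)"
  unfolding smooth_on_def dir_derivs_const by auto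

lemma smooth_on_sum:
  assumes "open S" "finite I" "\<And>i. i \<in> I \<Longrightarrow> smooth_on S (f i)"
  shows "smooth_on S (\<lambda>x. \<Sum>i\<in>I. f i x)"
  using assms(2,3) by (induction I rule: finite_induct) (auto intro: smooth_on_const smooth_on_add[OF assms(1)])

lemma dir_derivs_sum:
  assumes "open S" "x \<in> S" "finite I" "\<And>i. i \<in> I \<Longrightarrow> smooth_on S (f i)"
  shows "dir_derivs (\<lambda>x. \<Sum>i\<in>I. f i x) vs x = (\<Sum>i\<in>I. dir_derivs (f i) vs x)"
  using assms(3,4)
  by (induction I rule: finite_induct)
    (auto simp: dir_derivs_const dir_derivs_add[OF assms(1) _ smooth_on_sum[OF assms(1)] assms(2)])

lemma frechet_mult:
  fixes f g :: "'a::euclidean_space \<Rightarrow> 'b::real_normed_field"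
  assumes "f differentiable (at x)" "g differentiable (at x)"
  shows "dir_derivs (\<lambda>x. f x * g x) [w] x = f x * dir_derivs g [w] x + dir_derivs f [w] x * g x"
proof -
  have "((\<lambda>x. f x * g x) has_derivative
     (\<lambda>h. f x * frechet_derivative g (at x) h + frechet_derivative f (at x) h * g x)) (at x)"
    using assms by (intro has_derivative_mult) (auto simp: frechet_derivative_works)
  then show ?thesis using frechet_derivative_at by (metis (mono_tags, lifting) dir_derivs.simps)
qed

lemma smooth_upto_mult:
  fixes f g :: "'a::euclidean_space \<Rightarrow> 'b::real_normed_field"
  assumes "open S" shows "smooth_upto n S f \<Longrightarrow> smooth_upto n S g \<Longrightarrow> smooth_upto n S (\<lambda>x. f x * g x)"
proof (induction n arbitrary: f g)
  case 0 then show ?case by (auto simp: smooth_upto_0)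
next
  case (Suc n)
  have *: "f x * dir_derivs g [w] x + dir_derivs f [w] x * g x = dir_derivs (\<lambda>x. f x * g x) [w] x"
    if "x \<in> S" for x w
    using Suc.prems that by (subst frechet_mult) (auto simp: smooth_upto_Suc)
  have "smooth_upto n S (dir_derivs (\<lambda>x. f x * g x) [w])" for w
    by (rule smooth_upto_cong_open[OF assms * smooth_upto_add[OF assms Suc.IH Suc.IH]])
      (use Suc.prems smooth_upto_mono[of "Suc n" S _ n] in \<open>auto simp: smooth_upto_Suc\<close>)
  then show ?case using Suc.prems by (auto simp: smooth_upto_Suc)
qed

lemma smooth_on_mult:
  fixes f g :: "'a::euclidean_space \<Rightarrow> 'b::real_normed_field"
  shows "open S \<Longrightarrow> smooth_on S f \<Longrightarrow> smooth_on S g \<Longrightarrow> smooth_on S (\<lambda>x. f x * g x)"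
  by (simp add: smooth_on_iff_upto smooth_upto_mult)

lemma smooth_on_power:
  fixes f :: "'a::euclidean_space \<Rightarrow> 'b::real_normed_field"
  shows "open S \<Longrightarrow> smooth_on S f \<Longrightarrow> smooth_on S (\<lambda>x. f x ^ n)"
  by (induction n) (auto intro: smooth_on_const smooth_on_mult)

lemma dir_derivs_inverse:
  fixes f :: "'a::euclidean_space \<Rightarrow> 'b::real_normed_field"
  assumes "f differentiable (at x)" "f x \<noteq> 0"
  shows "dir_derivs (\<lambda>x. inverse (f x)) [w] x = - (dir_derivs f [w] x * (inverse (f x) * inverse (f x)))"
proof -
  have "((\<lambda>x. inverse (f x)) has_derivative
     (\<lambda>h. - (inverse (f x) * frechet_derivative f (at x) h * inverse (f x)))) (at x)"
    by (rule Deriv.has_derivative_inverse) (use assms in \<open>auto simp: frechet_derivative_works\<close>)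
  then have "frechet_derivative (\<lambda>x. inverse (f x)) (at x) =
     (\<lambda>h. - (inverse (f x) * frechet_derivative f (at x) h * inverse (f x)))"
    by (rule frechet_derivative_at[symmetric])
  then show ?thesis by simp
qed

lemma smooth_upto_inverse:
  fixes f :: "'a::euclidean_space \<Rightarrow> 'b::real_normed_field"
  assumes "open S" "\<And>x. x \<in> S \<Longrightarrow> f x \<noteq> 0"
  shows "smooth_upto n S f \<Longrightarrow> smooth_upto n S (\<lambda>x. inverse (f x))"
proof (induction n)
  case 0 then show ?case using assms(2) by (auto simp: smooth_upto_0 intro!: differentiable_compose[of inverse, OF _ differentiable_at_withinI] derivative_intros)
next
  case (Suc n)
  have sm: "smooth_upto n S (\<lambda>x. inverse (f x))" using Suc smooth_upto_mono[of "Suc n" S _ n] by auto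
  have *: "((\<lambda>x. - 1) x) * (dir_derivs f [w] x * (inverse (f x) * inverse (f x))) = dir_derivs (\<lambda>x. inverse (f x)) [w] x"
    if "x \<in> S" for x w
    using Suc.prems that assms by (subst dir_derivs_inverse) (auto simp: smooth_upto_Suc)
  have "smooth_upto n S (dir_derivs (\<lambda>x. inverse (f x)) [w])" for w
    by (rule smooth_upto_cong_open[OF assms(1) *], assumption,
        intro smooth_upto_mult[OF assms(1)] sm smooth_on_const[unfolded smooth_on_iff_upto, rule_format])
      (use Suc.prems in \<open>auto simp: smooth_upto_Suc\<close>)
  then show ?case using smooth_upto_differentiable[OF sm] by (auto simp: smooth_upto_Suc)
qed

lemma smooth_on_inverse:
  fixes f :: "'a::euclidean_space \<Rightarrow> 'b::real_normed_field"
  shows "open S \<Longrightarrow> (\<And>x. x \<in> S \<Longrightarrow> f x \<noteq> 0) \<Longrightarrow> smooth_on S f \<Longrightarrow> smooth_on S (\<lambda>x. inverse (f x))"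
  by (simp add: smooth_on_iff_upto smooth_upto_inverse)

lemma dir_derivs_comp_real:
  fixes u :: "'a::euclidean_space \<Rightarrow> real"
  assumes "u differentiable (at x)" "(\<psi> has_real_derivative d) (at (u x))"
  shows "dir_derivs (\<lambda>x. \<psi> (u x)) [w] x = dir_derivs u [w] x * d"
    and "(\<lambda>x. \<psi> (u x)) differentiable (at x)"
proof -
  have "(\<psi> has_derivative (\<lambda>h. h * d)) (at (u x))"
    using assms(2) by (simp add: has_field_derivative_def mult_commute_abs)
  then have "((\<lambda>x. \<psi> (u x)) has_derivative (\<lambda>h. frechet_derivative u (at x) h * d)) (at x)"
    using has_derivative_compose[of u "frechet_derivative u (at x)" x UNIV \<psi> "\<lambda>h. h * d"] assms(1)
    by (simp add: frechet_derivative_works)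
  then show "dir_derivs (\<lambda>x. \<psi> (u x)) [w] x = dir_derivs u [w] x * d"
      "(\<lambda>x. \<psi> (u x)) differentiable (at x)"
    using frechet_derivative_at[symmetric] by (fastforce simp: differentiable_def)+
qed

lemma smooth_upto_comp_real:
  fixes u :: "'a::euclidean_space \<Rightarrow> real"
  assumes "open S" "\<And>k t. (\<psi> k has_real_derivative \<psi> (Suc k) t) (at t)"
  shows "smooth_upto n S u \<Longrightarrow> smooth_upto n S (\<lambda>x. \<psi> k (u x))"
proof (induction n arbitrary: k)
  case 0 then show ?case using dir_derivs_comp_real(2)[OF _ assms(2)] by (auto simp: smooth_upto_0)
next
  case (Suc n)
  have sm: "smooth_upto n S (\<lambda>x. \<psi> k (u x))" for k using Suc smooth_upto_mono[of "Suc n" S _ n] by auto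
  have *: "dir_derivs u [w] x * \<psi> (Suc k) (u x) = dir_derivs (\<lambda>x. \<psi> k (u x)) [w] x" if "x \<in> S" for x w
    using Suc.prems that by (subst dir_derivs_comp_real(1)[OF _ assms(2)]) (auto simp: smooth_upto_Suc)
  have "smooth_upto n S (dir_derivs (\<lambda>x. \<psi> k (u x)) [w])" for w
    by (rule smooth_upto_cong_open[OF assms(1) *])
      (use Suc.prems in \<open>auto intro!: smooth_upto_mult[OF assms(1)] sm simp: smooth_upto_Suc\<close>)
  then show ?case using smooth_upto_differentiable[OF sm] by (auto simp: smooth_upto_Suc)
qed

lemma smooth_on_comp_real:
  fixes u :: "'a::euclidean_space \<Rightarrow> real"
  assumes "open S" "\<And>k t. (\<psi> k has_real_derivative \<psi> (Suc k) t) (at t)" "smooth_on S u"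
  shows "smooth_on S (\<lambda>x. \<psi> k (u x))"
  using smooth_upto_comp_real[of S \<psi>, OF assms(1,2)] assms(3) by (simp add: smooth_on_iff_upto)

section \<open>Weighted derivative estimates\<close>

lemma symbol_bd_add:
  assumes "open S" "x \<in> S" "smooth_on S f" "smooth_on S g" "symbol_bd n f x Q A" "symbol_bd n g x Q B"
  shows "symbol_bd n (\<lambda>x. f x + g x) x Q (A + B)"
  using assms(5,6) unfolding symbol_bd_def dir_derivs_add[OF assms(1,3,4,2)]
  by (meson add_mono norm_triangle_le)

lemma symbol_bd_linear_comp:
  assumes "bounded_linear L" "open S" "x \<in> S" "smooth_on S u" "symbol_bd n u x Q A" "\<And>y. norm (L y) \<le> K * norm y" "K \<ge> 0"
  shows "symbol_bd n (\<lambda>x. L (u x)) x Q (K * A)"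
  unfolding symbol_bd_def dir_derivs_linear_comp[OF assms(1,2,4,3)]
  by (meson assms(5,6,7) mult_left_mono order_trans symbol_bd_def)

lemma symbol_bd_sum:
  assumes "open S" "x \<in> S" "finite I" "\<And>i. i \<in> I \<Longrightarrow> smooth_on S (f i)"
    "\<And>i. i \<in> I \<Longrightarrow> symbol_bd n (f i) x Q A"
  shows "symbol_bd n (\<lambda>x. \<Sum>i\<in>I. f i x) x Q (real (card I) * A)"
  unfolding symbol_bd_def
proof (intro allI impI)
  fix vs assume vs: "length vs \<le> n" "set vs \<subseteq> Q"
  have "norm (\<Sum>i\<in>I. dir_derivs (f i) vs x) \<le> (\<Sum>i\<in>I. A)"
    using assms(5) vs unfolding symbol_bd_def by (intro sum_norm_le) auto
  then show "norm (dir_derivs (\<lambda>x. \<Sum>i\<in>I. f i x) vs x) \<le> real (card I) * A"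
    using dir_derivs_sum[OF assms(1-4)] by simp
qed

lemma symbol_bd_nonneg: "symbol_bd n f x Q A \<Longrightarrow> 0 \<le> A"
  by (meson norm_ge_zero order_trans symbol_bd_norm)

text \<open>
  Leibniz' rule: every derivative at most doubles the number of terms.
\<close>

lemma symbol_bd_mult:
  fixes f g :: "'a::euclidean_space \<Rightarrow> 'b::real_normed_field"
  assumes S: "open S" "x \<in> S"
  shows "smooth_on S f \<Longrightarrow> smooth_on S g \<Longrightarrow> symbol_bd n f x Q A \<Longrightarrow> symbol_bd n g x Q B
     \<Longrightarrow> symbol_bd n (\<lambda>x. f x * g x) x Q (2 ^ n * A * B)"
proof (induction n arbitrary: f g)
  case 0 then show ?case by (auto simp: symbol_bd_0 norm_mult intro: mult_mono order_trans[OF norm_ge_zero])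
next
  case (Suc n)
  have nn: "0 \<le> A" "0 \<le> B" using symbol_bd_nonneg Suc.prems by blast+
  have mono: "symbol_bd n f x Q A" "symbol_bd n g x Q B"
    using Suc.prems symbol_bd_mono[of "Suc n" _ x Q _ n Q] by auto
  have "symbol_bd n (dir_derivs (\<lambda>x. f x * g x) [w]) x Q (2 ^ Suc n * A * B)" if w: "w \<in> Q" for w
  proof -
    have *: "dir_derivs (\<lambda>x. f x * g x) [w] y = f y * dir_derivs g [w] y + dir_derivs f [w] y * g y"
      if "y \<in> S" for y
      using frechet_mult Suc.prems(1,2) smooth_on_differentiable that by blast
    have 1: "symbol_bd n (\<lambda>y. f y * dir_derivs g [w] y) x Q (2 ^ n * A * B)"
      by (rule Suc.IH) (use Suc.prems w mono in \<open>auto simp: symbol_bd_Suc intro!: smooth_on_dir_derivs[of _ _ "[w]", simplified]\<close>)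
    have 2: "symbol_bd n (\<lambda>y. dir_derivs f [w] y * g y) x Q (2 ^ n * A * B)"
      by (rule Suc.IH) (use Suc.prems w mono in \<open>auto simp: symbol_bd_Suc intro!: smooth_on_dir_derivs[of _ _ "[w]", simplified]\<close>)
    have "symbol_bd n (\<lambda>y. f y * dir_derivs g [w] y + dir_derivs f [w] y * g y) x Q
         (2 ^ n * A * B + 2 ^ n * A * B)"
      by (rule symbol_bd_add[OF S _ _ 1 2]) (intro smooth_on_mult S Suc.prems smooth_on_dir_derivs)+
    then show ?thesis
      using symbol_bd_cong_open[OF S, of "dir_derivs (\<lambda>x. f x * g x) [w]"
          "\<lambda>y. f y * dir_derivs g [w] y + dir_derivs f [w] y * g y"] *
      by (simp add: algebra_simps)
  qed
  moreover have "norm (f x * g x) \<le> 2 ^ Suc n * A * B"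
  proof -
    have "norm (f x) \<le> A" "norm (g x) \<le> B" using symbol_bd_norm Suc.prems by blast+
    then have "norm (f x * g x) \<le> 1 * (A * B)" using nn by (simp add: norm_mult mult_mono)
    also have "\<dots> \<le> 2 ^ Suc n * (A * B)" using nn by (intro mult_right_mono one_le_power) auto
    finally show ?thesis by (simp add: mult_ac)
  qed
  ultimately show ?case by (simp add: symbol_bd_Suc)
qed

text \<open>
  By induction from \<open>D (1 / f) = - D f / f\<^sup>2\<close>. The order of the quantifiers matters: one constant serves
  all functions, points and sets of directions.
\<close>

lemma symbol_bd_inverse:
  "\<exists>K. \<forall>(f :: 'a::euclidean_space \<Rightarrow> 'b::real_normed_field) x S Q. open S \<longrightarrow> x \<in> S \<longrightarrow> smooth_on S f \<longrightarrow>
     (\<forall>y\<in>S. f y \<noteq> 0) \<longrightarrow> symbol_bd n f x Q A \<longrightarrow> norm (inverse (f x)) \<le> B \<longrightarrow>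
     symbol_bd n (\<lambda>y. inverse (f y)) x Q K"
proof (induction n)
  case 0 show ?case by (rule exI[of _ B]) (auto simp: symbol_bd_0)
next
  case (Suc n)
  then obtain K where K: "\<And>(f :: 'a \<Rightarrow> 'b) x S Q. open S \<Longrightarrow> x \<in> S \<Longrightarrow> smooth_on S f \<Longrightarrow>
     (\<And>y. y \<in> S \<Longrightarrow> f y \<noteq> 0) \<Longrightarrow> symbol_bd n f x Q A \<Longrightarrow> norm (inverse (f x)) \<le> B \<Longrightarrow>
     symbol_bd n (\<lambda>y. inverse (f y)) x Q K" by metis
  let ?K = "2 ^ n * A * (2 ^ n * K * K)"
  have "symbol_bd (Suc n) (\<lambda>y. inverse (f y)) x Q (max B ?K)"
    if a: "open S" "x \<in> S" "smooth_on S f" "\<And>y. y \<in> S \<Longrightarrow> f y \<noteq> 0"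
     "symbol_bd (Suc n) f x Q A" "norm (inverse (f x)) \<le> B" for f :: "'a \<Rightarrow> 'b" and x S Q
  proof -
    have mono: "symbol_bd n f x Q A"
      using a symbol_bd_mono[of "Suc n" _ x Q _ n Q] by auto
    have si: "smooth_on S (\<lambda>y. inverse (f y))" using a smooth_on_inverse by blast
    have i: "symbol_bd n (\<lambda>y. inverse (f y)) x Q K" by (rule K[OF a(1-4) mono a(6)])
    have "symbol_bd n (dir_derivs (\<lambda>y. inverse (f y)) [w]) x Q ?K" if w: "w \<in> Q" for w
    proof -
      have sd: "smooth_on S (dir_derivs f [w])" by (intro smooth_on_dir_derivs a)
      have dd: "symbol_bd n (\<lambda>y. dir_derivs f [w] y * (inverse (f y) * inverse (f y))) x Q ?K"
        by (rule symbol_bd_mult[OF a(1,2) sd smooth_on_mult[OF a(1) si si] _ symbol_bd_mult[OF a(1,2) si si i i]])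
          (use a w in \<open>simp add: symbol_bd_Suc\<close>)
      have "symbol_bd n (\<lambda>y. - (dir_derivs f [w] y * (inverse (f y) * inverse (f y)))) x Q (1 * ?K)"
        by (rule symbol_bd_linear_comp[OF bounded_linear_minus[OF bounded_linear_ident] a(1,2) _ dd])
          (auto intro!: smooth_on_mult sd[simplified] si a)
      then show ?thesis
        using symbol_bd_cong_open[OF a(1,2), of "dir_derivs (\<lambda>y. inverse (f y)) [w]"]
          dir_derivs_inverse[OF smooth_on_differentiable[OF a(3)] a(4)] by simp
    qed
    then have "symbol_bd n (dir_derivs (\<lambda>y. inverse (f y)) [w]) x Q (max B ?K)" if "w \<in> Q" for w
      using that symbol_bd_mono[of n _ x Q ?K n Q "max B ?K"] by auto
    moreover have "norm (inverse (f x)) \<le> max B ?K" using a(6) by simp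
    ultimately show ?thesis unfolding symbol_bd_Suc by blast
  qed
  then show ?case by blast
qed

text \<open>
  By induction from the chain rule, for a function \<open>\<psi> 0\<close> with derivatives \<open>\<psi> k\<close>, all of them bounded on
  the range \<open>T\<close>; again with one constant for all functions, points and directions.
\<close>

lemma symbol_bd_comp_real:
  fixes \<psi> :: "nat \<Rightarrow> real \<Rightarrow> real"
  assumes \<psi>: "\<And>k t. (\<psi> k has_real_derivative \<psi> (Suc k) t) (at t)"
    and bd: "\<And>k. \<exists>B. \<forall>t\<in>T. \<bar>\<psi> k t\<bar> \<le> B"
  shows "\<exists>K. \<forall>(u :: 'a::euclidean_space \<Rightarrow> real) x S Q. open S \<longrightarrow> x \<in> S \<longrightarrow> smooth_on S u \<longrightarrow>
     u x \<in> T \<longrightarrow> symbol_bd n u x Q A \<longrightarrow> symbol_bd n (\<lambda>y. \<psi> k (u y)) x Q K"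
proof (induction n arbitrary: k)
  case 0 show ?case using bd[of k] by (auto simp: symbol_bd_0)
next
  case (Suc n)
  obtain K where K: "\<And>(u :: 'a \<Rightarrow> real) x S Q. open S \<Longrightarrow> x \<in> S \<Longrightarrow> smooth_on S u \<Longrightarrow>
     u x \<in> T \<Longrightarrow> symbol_bd n u x Q A \<Longrightarrow> symbol_bd n (\<lambda>y. \<psi> (Suc k) (u y)) x Q K" using Suc by blast
  obtain B where B: "\<And>t. t \<in> T \<Longrightarrow> \<bar>\<psi> k t\<bar> \<le> B" using bd by blast
  let ?K = "2 ^ n * A * K"
  have "symbol_bd (Suc n) (\<lambda>y. \<psi> k (u y)) x Q (max B ?K)"
    if a: "open S" "x \<in> S" "smooth_on S u" "u x \<in> T" "symbol_bd (Suc n) u x Q A" for u :: "'a \<Rightarrow> real" and x S Q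
  proof -
    have mono: "symbol_bd n u x Q A"
      using a symbol_bd_mono[of "Suc n" _ x Q _ n Q] by auto
    have si: "smooth_on S (\<lambda>y. \<psi> k (u y))" for k by (rule smooth_on_comp_real[of S \<psi>, OF a(1) \<psi> a(3)])
    have i: "symbol_bd n (\<lambda>y. \<psi> (Suc k) (u y)) x Q K" by (rule K[OF a(1-4) mono])
    have "symbol_bd n (dir_derivs (\<lambda>y. \<psi> k (u y)) [w]) x Q ?K" if w: "w \<in> Q" for w
    proof -
      have sd: "smooth_on S (dir_derivs u [w])" by (intro smooth_on_dir_derivs a)
      have dd: "symbol_bd n (\<lambda>y. dir_derivs u [w] y * \<psi> (Suc k) (u y)) x Q ?K"
        by (rule symbol_bd_mult[OF a(1,2) sd si _ i]) (use a w in \<open>simp add: symbol_bd_Suc\<close>)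
      then show ?thesis
        using symbol_bd_cong_open[OF a(1,2), of "dir_derivs (\<lambda>y. \<psi> k (u y)) [w]"]
          dir_derivs_comp_real(1)[OF smooth_on_differentiable[OF a(3)] \<psi>] by simp
    qed
    then have "symbol_bd n (dir_derivs (\<lambda>y. \<psi> k (u y)) [w]) x Q (max B ?K)" if "w \<in> Q" for w
      using that symbol_bd_mono[of n _ x Q ?K n Q "max B ?K"] by auto
    moreover have "norm (\<psi> k (u x)) \<le> max B ?K" using B[OF a(4)] by simp
    ultimately show ?thesis unfolding symbol_bd_Suc by blast
  qed
  then show ?case by blast
qed

lemma dir_derivs_affine:
  assumes "bounded_linear L"
  shows "dir_derivs (\<lambda>x. L x + c) vs = (case vs of [] \<Rightarrow> \<lambda>x. L x + c | [w] \<Rightarrow> \<lambda>x. L w | _ \<Rightarrow> \<lambda>x. 0)"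
proof (induction vs)
  case (Cons v vs)
  have "((\<lambda>x. L x + c) has_derivative L) (at x)" for x
    by (rule derivative_eq_intros refl bounded_linear_imp_has_derivative assms)+ simp
  then have *: "frechet_derivative (\<lambda>x. L x + c) (at x) = L" for x by (metis frechet_derivative_at)
  show ?case using Cons by (cases vs rule: list.exhaust) (auto simp: * split: list.splits)
qed auto

lemma smooth_on_affine: "bounded_linear L \<Longrightarrow> smooth_on S (\<lambda>x. L x + c)"
  unfolding smooth_on_def
proof (intro allI ballI)
  fix vs x assume L: "bounded_linear L"
  show "dir_derivs (\<lambda>x. L x + c) vs differentiable (at x)"
    unfolding dir_derivs_affine[OF L]
    using bounded_linear_imp_differentiable[OF L] by (auto split: list.splits)
qed

lemma symbol_bd_affine:
  assumes "bounded_linear L" "norm (L x + c) \<le> A" "\<And>w. w \<in> Q \<Longrightarrow> norm (L w) \<le> A"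
  shows "symbol_bd n (\<lambda>x. L x + c) x Q A"
  unfolding symbol_bd_def dir_derivs_affine[OF assms(1)]
  using assms(2,3) order_trans[OF norm_ge_zero assms(2)] by (auto split: list.splits)

section \<open>Holomorphic functions of several variables\<close>

lemma norm_vec_smult: "norm (c *s (w :: complex^'n)) = cmod c * norm w"
  unfolding norm_vec_def by (simp add: norm_mult L2_set_right_distrib)

lemma scaleR_vec_smult: "r *\<^sub>R (w :: complex^'n) = of_real r *s w"
  by (simp add: vec_eq_iff scaleR_conv_of_real[symmetric])

lemma bounded_linear_vec_smult_left: "bounded_linear (\<lambda>c. c *s (w :: complex^'n))"
  by (rule bounded_linear_intro[where K="norm w"])
    (auto simp: vec_eq_iff algebra_simps norm_vec_smult)

lemma continuous_on_vec_smult [continuous_intros]: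
  assumes "continuous_on S f" "continuous_on S g"
  shows "continuous_on S (\<lambda>x. f x *s (g x :: complex^'n))"
  unfolding vector_scalar_mult_def by (intro continuous_intros assms)

lemma Cn_holomorphic_on_subset: "Cn_holomorphic_on f T \<Longrightarrow> S \<subseteq> T \<Longrightarrow> Cn_holomorphic_on f S"
  by (auto simp: Cn_holomorphic_on_def)

lemma Cn_holomorphic_has_derivative:
  assumes "Cn_holomorphic_on f S" "x \<in> S"
  shows "(f has_derivative frechet_derivative f (at x)) (at x)"
    and "frechet_derivative f (at x) (c *s v) = c * frechet_derivative f (at x) v"
proof -
  obtain f' where f': "(f has_derivative f') (at x)" "\<And>c v. f' (c *s v) = c * f' v"
    using assms unfolding Cn_holomorphic_on_def by blast
  then have "frechet_derivative f (at x) = f'" by (simp add: frechet_derivative_at[symmetric])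
  with f' show "(f has_derivative frechet_derivative f (at x)) (at x)"
    "frechet_derivative f (at x) (c *s v) = c * frechet_derivative f (at x) v" by auto
qed

lemma Cn_holomorphic_continuous_on: "Cn_holomorphic_on f S \<Longrightarrow> continuous_on S f"
  by (meson Cn_holomorphic_has_derivative(1) continuous_at_imp_continuous_on has_derivative_continuous)

lemma Cn_holomorphic_along_line:
  assumes "Cn_holomorphic_on f S" "a + t *s w \<in> S"
  shows "((\<lambda>t. f (a + t *s w)) has_field_derivative dir_derivs f [w] (a + t *s w)) (at t)"
proof -
  have "((\<lambda>t. a + t *s w) has_derivative (\<lambda>h. h *s w)) (at t)"
    using bounded_linear.has_derivative[OF bounded_linear_vec_smult_left has_derivative_ident]
    by (auto intro!: derivative_eq_intros)
  from has_derivative_compose[OF this Cn_holomorphic_has_derivative(1)[OF assms]]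
  have "((\<lambda>t. f (a + t *s w)) has_derivative
      (\<lambda>h. frechet_derivative f (at (a + t *s w)) (h *s w))) (at t)" .
  then show ?thesis
    unfolding has_field_derivative_def Cn_holomorphic_has_derivative(2)[OF assms] dir_derivs.simps
    by (simp add: mult_commute_abs)
qed

lemma Cn_holomorphic_line_holomorphic:
  assumes "Cn_holomorphic_on f S" "\<And>t. t \<in> T \<Longrightarrow> a + t *s w \<in> S"
  shows "(\<lambda>t. f (a + t *s w)) holomorphic_on T"
  using Cn_holomorphic_along_line[OF assms(1) assms(2)]
  by (meson DERIV_subset field_differentiable_def holomorphic_on_def subset_UNIV)

lemma Cn_holomorphic_onI:
  assumes "\<And>x. x \<in> S \<Longrightarrow> (f has_derivative f' x) (at x)" "\<And>x c v. x \<in> S \<Longrightarrow> f' x (c *s v) = c * f' x v"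
  shows "Cn_holomorphic_on f S"
  using assms unfolding Cn_holomorphic_on_def by blast

text \<open>
  Cauchy's formula on the complex line through \<open>x\<close> in the direction \<open>w\<close>. It expresses a derivative by
  values of \<open>f\<close> on a fixed circle, which gives its regularity in \<open>x\<close>.
\<close>

lemma Cn_dir_deriv_integral:
  assumes f: "Cn_holomorphic_on f S" and r: "r > 0" and S: "\<And>t. cmod t \<le> r \<Longrightarrow> x + t *s w \<in> S"
  shows "dir_derivs f [w] x =
      integral {0..1} (\<lambda>\<theta>. f (x + (circlepath 0 r \<theta>) *s w) / circlepath 0 r \<theta>)"
proof -
  let ?F = "\<lambda>t. f (x + t *s w)"
  have h: "?F holomorphic_on cball 0 r"
    by (rule Cn_holomorphic_line_holomorphic[OF f]) (use S in auto)
  have *: "contour_integral (circlepath 0 r) (\<lambda>u. ?F u / u^2) = (2 * pi * \<i>) * deriv ?F 0"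
    using DERIV_imp_deriv Cauchy_derivative_integral_circlepath(2)[of 0 r ?F 0] h r
      holomorphic_on_imp_continuous_on[OF h] holomorphic_on_subset[OF h ball_subset_cball] by fastforce
  have d: "deriv ?F 0 = dir_derivs f [w] x"
    using Cn_holomorphic_along_line[OF f, of x 0 w] S[of 0] r by (simp add: DERIV_imp_deriv)
  have c0: "circlepath 0 r t \<noteq> 0" for t using r by (simp add: circlepath)
  have c1: "vector_derivative (circlepath 0 r) (at t) = 2 * pi * \<i> * circlepath 0 r t" for t
    unfolding vector_derivative_circlepath by (simp add: circlepath)
  have "2 * pi * \<i> * dir_derivs f [w] x =
     integral {0..1} (\<lambda>t. ?F (circlepath 0 r t) / (circlepath 0 r t)^2 * (2 * pi * \<i> * circlepath 0 r t))"
    using * unfolding contour_integral_integral c1 d by simp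
  also have "\<dots> = integral {0..1} (\<lambda>t. 2 * pi * \<i> * (?F (circlepath 0 r t) / circlepath 0 r t))"
    by (rule integral_cong) (use c0 in \<open>simp add: power2_eq_square field_simps\<close>)
  finally show "dir_derivs f [w] x =
      integral {0..1} (\<lambda>\<theta>. f (x + (circlepath 0 r \<theta>) *s w) / circlepath 0 r \<theta>)"
    unfolding integral_mult_right by simp
qed

lemma continuous_on_circlepath: "continuous_on T (circlepath z r)"
  unfolding circlepath by (intro continuous_intros)

lemma open_thicken_line:
  assumes "open S" "x0 \<in> S"
  obtains r d where "r > 0" "d > 0" "\<And>x t. x \<in> ball x0 d \<Longrightarrow> cmod t \<le> r \<Longrightarrow> x + t *s (w :: complex^'n) \<in> S"
proof -
  obtain e where e: "e > 0" "ball x0 e \<subseteq> S" using assms open_contains_ball by blast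
  let ?r = "e / (2 * (1 + norm w))"
  have "x + t *s w \<in> S" if "x \<in> ball x0 (e/2)" "cmod t \<le> ?r" for x t
  proof -
    have "norm (t *s w) \<le> ?r * norm w" using mult_right_mono[OF that(2) norm_ge_zero[of w]] by (simp add: norm_vec_smult)
    also have "\<dots> \<le> e/2" using e
      using norm_ge_zero[of w] by (auto simp: field_simps add_pos_nonneg)
    finally have "dist x0 (x + t *s w) < e"
      using that norm_triangle_ineq[of "x - x0" "t *s w"] by (auto simp: dist_norm algebra_simps norm_minus_commute)
    then show ?thesis using e by auto
  qed
  moreover have "?r > 0" using e by (simp add: add_pos_nonneg)
  ultimately show ?thesis using that[of ?r "e/2"] e by auto
qed

lemma Cn_dir_deriv_continuous_on:
  assumes f: "Cn_holomorphic_on f S" and S: "open S"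
  shows "continuous_on S (dir_derivs f [w])"
proof (rule continuous_at_imp_continuous_on, intro ballI)
  fix x0 assume x0: "x0 \<in> S"
  obtain r d where rd: "r > 0" "d > 0" "\<And>x t. x \<in> ball x0 d \<Longrightarrow> cmod t \<le> r \<Longrightarrow> x + t *s w \<in> S"
    using open_thicken_line[OF S x0, of w] by metis
  have c0: "circlepath 0 r t \<noteq> 0" "cmod (circlepath 0 r t) = r" for t using rd(1) by (auto simp: circlepath norm_mult)
  have "continuous_on (ball x0 d \<times> cbox 0 1)
      (\<lambda>(x,\<theta>). f (x + (circlepath 0 r \<theta>) *s w) / circlepath 0 r \<theta>)"
    unfolding split_beta
    by (intro continuous_intros continuous_on_compose2[OF continuous_on_circlepath]
          continuous_on_compose2[OF Cn_holomorphic_continuous_on[OF f]])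
       (use rd c0 in auto)
  then have "continuous_on (ball x0 d)
      (\<lambda>x. integral (cbox 0 1) (\<lambda>\<theta>. f (x + (circlepath 0 r \<theta>) *s w) / circlepath 0 r \<theta>))"
    by (rule integral_continuous_on_param)
  then have "continuous_on (ball x0 d) (dir_derivs f [w])"
  proof (rule continuous_on_eq)
    fix x assume "x \<in> ball x0 d"
    from Cn_dir_deriv_integral[OF f rd(1) rd(3)[OF this]]
    show "integral (cbox 0 1) (\<lambda>\<theta>. f (x + (circlepath 0 r \<theta>) *s w) / circlepath 0 r \<theta>) = dir_derivs f [w] x"
      by simp
  qed
  then show "isCont (dir_derivs f [w]) x0"
    using rd(2) continuous_on_eq_continuous_at by (metis centre_in_ball open_ball)
qed

text \<open>
  Directional derivatives of holomorphic functions are holomorphic: differentiate Cauchy's formula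
  along the line under the integral sign.
\<close>

lemma Cn_holomorphic_dir_deriv:
  fixes f :: "complex^'n \<Rightarrow> complex"
  assumes f: "Cn_holomorphic_on f S" and S: "open S"
  shows "Cn_holomorphic_on (dir_derivs f [w]) S"
  unfolding Cn_holomorphic_on_def
proof
  fix x0 assume x0: "x0 \<in> S"
  obtain r d where rd: "r > 0" "d > 0" "\<And>x t. x \<in> ball x0 d \<Longrightarrow> cmod t \<le> r \<Longrightarrow> x + t *s w \<in> S"
    using open_thicken_line[OF S x0, of w] by metis
  have c0: "circlepath 0 r t \<noteq> 0" "cmod (circlepath 0 r t) = r" for t using rd(1) by (auto simp: circlepath norm_mult)
  have inS: "x + (circlepath 0 r \<theta>) *s w \<in> S" if "x \<in> ball x0 d" for x \<theta> using rd c0 that by simp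
  define fx where "fx x \<theta> = Blinfun (\<lambda>u. frechet_derivative f (at (x + (circlepath 0 r \<theta>) *s w)) u / circlepath 0 r \<theta>)"
    for x \<theta>
  have fx: "blinfun_apply (fx x \<theta>) = (\<lambda>u. frechet_derivative f (at (x + (circlepath 0 r \<theta>) *s w)) u / circlepath 0 r \<theta>)"
    if "x \<in> ball x0 d" for x \<theta>
    unfolding fx_def
    by (intro bounded_linear_Blinfun_apply bounded_linear_compose[OF bounded_linear_divide]
        has_derivative_bounded_linear[OF Cn_holomorphic_has_derivative(1)[OF f inS[OF that]]])
  have D: "((\<lambda>x. f (x + (circlepath 0 r \<theta>) *s w) / circlepath 0 r \<theta>) has_derivative blinfun_apply (fx x \<theta>))
     (at x within ball x0 d)" if "x \<in> ball x0 d" for x \<theta>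
  proof -
    have "((\<lambda>x. x + (circlepath 0 r \<theta>) *s w) has_derivative (\<lambda>u. u)) (at x)"
      by (auto intro!: derivative_eq_intros)
    from has_derivative_compose[OF this Cn_holomorphic_has_derivative(1)[OF f inS[OF that]]]
    have "((\<lambda>x. f (x + (circlepath 0 r \<theta>) *s w)) has_derivative
       frechet_derivative f (at (x + (circlepath 0 r \<theta>) *s w))) (at x)" by simp
    from bounded_linear.has_derivative[OF bounded_linear_divide this, of "circlepath 0 r \<theta>"]
    show ?thesis unfolding fx[OF that] by (rule has_derivative_at_withinI)
  qed
  have cfx: "continuous_on (ball x0 d \<times> cbox 0 1) (\<lambda>(x, \<theta>). fx x \<theta>)"
  proof (rule continuous_on_blinfun_componentwise)
    fix i :: "complex^'n" assume "i \<in> Basis"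
    have "continuous_on (ball x0 d \<times> cbox 0 1)
        (\<lambda>(x,\<theta>). dir_derivs f [i] (x + (circlepath 0 r \<theta>) *s w) / circlepath 0 r \<theta>)"
      unfolding split_beta
      by (intro continuous_intros continuous_on_compose2[OF continuous_on_circlepath]
            continuous_on_compose2[OF Cn_dir_deriv_continuous_on[OF f S]])
         (use inS c0 in auto)
    then show "continuous_on (ball x0 d \<times> cbox 0 1) (\<lambda>x. blinfun_apply (case x of (x, \<theta>) \<Rightarrow> fx x \<theta>) i)"
      by (rule continuous_on_eq) (auto simp: fx)
  qed
  have int: "(\<lambda>\<theta>. f (x + (circlepath 0 r \<theta>) *s w) / circlepath 0 r \<theta>) integrable_on cbox 0 1"
    if "x \<in> ball x0 d" for x
    by (intro integrable_continuous continuous_intros continuous_on_compose2[OF continuous_on_circlepath]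
          continuous_on_compose2[OF Cn_holomorphic_continuous_on[OF f]])
       (use inS that c0 in auto)
  have x0d: "x0 \<in> ball x0 d" using rd by simp
  have "((\<lambda>x. integral (cbox 0 1) (\<lambda>\<theta>. f (x + (circlepath 0 r \<theta>) *s w) / circlepath 0 r \<theta>)) has_derivative
     blinfun_apply (integral (cbox 0 1) (fx x0))) (at x0 within ball x0 d)"
    by (rule leibniz_rule[OF D int cfx x0d convex_ball])
  then have "((\<lambda>x. integral (cbox 0 1) (\<lambda>\<theta>. f (x + (circlepath 0 r \<theta>) *s w) / circlepath 0 r \<theta>)) has_derivative
     blinfun_apply (integral (cbox 0 1) (fx x0))) (at x0)"
    using at_within_open[OF x0d open_ball] by simp
  moreover have "integral (cbox 0 1) (\<lambda>\<theta>. f (x + (circlepath 0 r \<theta>) *s w) / circlepath 0 r \<theta>) = dir_derivs f [w] x"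
    if "x \<in> ball x0 d" for x
    using Cn_dir_deriv_integral[OF f rd(1), of x w] rd(3)[OF that] by simp
  ultimately have der: "(dir_derivs f [w] has_derivative blinfun_apply (integral (cbox 0 1) (fx x0))) (at x0)"
    by (rule has_derivative_transform_within_open[OF _ open_ball x0d])
  have cfx0: "continuous_on (cbox 0 1) (fx x0)"
  proof -
    have "continuous_on (cbox 0 1) (\<lambda>\<theta>::real. (x0, \<theta>))" by (intro continuous_intros)
    from continuous_on_compose2[OF cfx this] show ?thesis using x0d by (simp add: image_subset_iff)
  qed
  have lin: "blinfun_apply (integral (cbox 0 1) (fx x0)) (c *s v) = c * blinfun_apply (integral (cbox 0 1) (fx x0)) v" for c v
  proof -
    have i: "fx x0 integrable_on cbox 0 1" using cfx0 by (rule integrable_continuous)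
    have 1: "blinfun_apply (integral (cbox 0 1) (fx x0)) u = integral (cbox 0 1) (\<lambda>\<theta>. fx x0 \<theta> u)" for u
      using blinfun_apply_integral[OF i] .
    have "integral (cbox 0 1) (\<lambda>\<theta>. fx x0 \<theta> (c *s v)) = integral (cbox 0 1) (\<lambda>\<theta>. c * fx x0 \<theta> v)"
      using Cn_holomorphic_has_derivative(2)[OF f inS[OF x0d]] by (intro integral_cong) (simp add: fx[OF x0d])
    then show ?thesis unfolding 1 by (simp add: integral_mult_right)
  qed
  from der lin show "\<exists>f'. (dir_derivs f [w] has_derivative f') (at x0) \<and> (\<forall>c v. f' (c *s v) = c * f' v)" by blast
qed

lemma Cn_holomorphic_dir_derivs:
  assumes "Cn_holomorphic_on f S" "open S"
  shows "Cn_holomorphic_on (dir_derivs f vs) S"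
proof (induction vs)
  case (Cons v vs)
  then show ?case using Cn_holomorphic_dir_deriv[OF Cons assms(2), of v] by simp
qed (use assms in auto)

lemma Cn_holomorphic_smooth_on:
  assumes "Cn_holomorphic_on f S" "open S"
  shows "smooth_on S f"
  unfolding smooth_on_def
  using Cn_holomorphic_has_derivative(1)[OF Cn_holomorphic_dir_derivs[OF assms]] differentiable_def by blast

lemma Cn_dir_deriv_Cauchy_bound:
  assumes f: "Cn_holomorphic_on f S" and r: "r > 0" and S: "\<And>t. cmod t \<le> r \<Longrightarrow> x + t *s w \<in> S"
    and bd: "\<And>t. cmod t \<le> r \<Longrightarrow> cmod (f (x + t *s w)) \<le> A"
  shows "cmod (dir_derivs f [w] x) \<le> A / r"
proof -
  let ?F = "\<lambda>t. f (x + t *s w)"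
  have h: "?F holomorphic_on cball 0 r"
    by (rule Cn_holomorphic_line_holomorphic[OF f]) (use S in auto)
  have d: "deriv ?F 0 = dir_derivs f [w] x"
    using Cn_holomorphic_along_line[OF f, of x 0 w] S[of 0] r by (simp add: DERIV_imp_deriv)
  have "cmod ((deriv ^^ 1) ?F 0) \<le> fact 1 * A / r ^ 1"
    by (rule Cauchy_inequality)
      (use h r bd in \<open>auto intro: holomorphic_on_imp_continuous_on holomorphic_on_subset\<close>)
  then show ?thesis using d by simp
qed

text \<open>
  Iterated Cauchy estimates. The set \<open>R t\<close> stands for the points that can be reached from \<open>x\<close> by steps of
  total length \<open>t\<close> along complex multiples of vectors from \<open>Q\<close>; each of the at most \<open>n\<close> derivatives uses
  up the same share of the available length \<open>s\<close>.
\<close>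

lemma Cn_holomorphic_symbol_bd:
  assumes f: "Cn_holomorphic_on f S" and S: "open S" and s: "s > 0" and A: "A \<ge> 0"
    and R: "\<And>t x. t \<ge> 0 \<Longrightarrow> x \<in> R (t::real) \<Longrightarrow> t \<le> s \<Longrightarrow> x \<in> S \<and> cmod (f x) \<le> A"
    and step: "\<And>t \<sigma> x w c. t \<ge> 0 \<Longrightarrow> \<sigma> \<ge> 0 \<Longrightarrow> x \<in> R t \<Longrightarrow> w \<in> Q \<Longrightarrow> cmod c \<le> \<sigma> \<Longrightarrow> x + c *s w \<in> R (t + \<sigma>)"
    and x: "x \<in> R 0"
  shows "symbol_bd n f x Q (A * max 1 ((real n + 1) / s) ^ n)"
  unfolding symbol_bd_def
proof (intro allI impI)
  fix vs assume vs: "length vs \<le> n" "set vs \<subseteq> Q"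
  define \<sigma> where "\<sigma> = s / (real n + 1)"
  have \<sigma>: "\<sigma> > 0" using s by (simp add: \<sigma>_def)
  have main: "cmod (dir_derivs f vs y) \<le> A / \<sigma> ^ length vs"
    if "set vs \<subseteq> Q" "t \<ge> 0" "t + length vs * \<sigma> \<le> s" "y \<in> R t" for vs t y
    using that
  proof (induction vs arbitrary: t y)
    case Nil then show ?case using R by auto
  next
    case (Cons v vs)
    have "cmod (dir_derivs (dir_derivs f vs) [v] y) \<le> (A / \<sigma> ^ length vs) / \<sigma>"
    proof (rule Cn_dir_deriv_Cauchy_bound[OF Cn_holomorphic_dir_derivs[OF f S] \<sigma>])
      fix c assume c: "cmod c \<le> \<sigma>"
      have in_R: "y + c *s v \<in> R (t + \<sigma>)" using step[of t \<sigma> y v c] Cons.prems c \<sigma> by auto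
      have le: "t + \<sigma> + length vs * \<sigma> \<le> s" using Cons.prems(3) by (simp add: algebra_simps)
      then have "t + \<sigma> \<le> s" using \<sigma> by (smt (verit) mult_nonneg_nonneg of_nat_0_le_iff)
      then show "y + c *s v \<in> S" using R[OF _ in_R] Cons.prems \<sigma> by auto
      show "cmod (dir_derivs f vs (y + c *s v)) \<le> A / \<sigma> ^ length vs"
        by (rule Cons.IH[of "t + \<sigma>"]) (use Cons.prems \<sigma> le in_R in auto)
    qed
    then show ?case by (simp add: field_simps)
  qed
  have "cmod (dir_derivs f vs x) \<le> A / \<sigma> ^ length vs"
  proof (rule main[of vs 0])
    have "length vs * \<sigma> \<le> (real n + 1) * \<sigma>" using vs \<sigma> by (intro mult_right_mono) auto
    then show "0 + length vs * \<sigma> \<le> s" by (simp add: \<sigma>_def)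
  qed (use vs x in auto)
  also have "\<dots> = A * ((real n + 1) / s) ^ length vs" by (simp add: \<sigma>_def power_divide)
  also have "\<dots> \<le> A * max 1 ((real n + 1) / s) ^ n"
  proof (rule mult_left_mono[OF _ A])
    have "((real n + 1) / s) ^ length vs \<le> max 1 ((real n + 1) / s) ^ length vs"
      using s by (intro power_mono) auto
    also have "\<dots> \<le> max 1 ((real n + 1) / s) ^ n" using vs by (intro power_increasing) auto
    finally show "((real n + 1) / s) ^ length vs \<le> max 1 ((real n + 1) / s) ^ n" .
  qed
  finally show "norm (dir_derivs f vs x) \<le> A * max 1 ((real n + 1) / s) ^ n" .
qed

section \<open>Unitary frames\<close>

definition herm :: "complex^'n \<Rightarrow> complex^'n \<Rightarrow> complex" where
  "herm w u = (\<Sum>i\<in>UNIV. w $ i * cnj (u $ i))"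

lemma herm_add: "herm (w + w') u = herm w u + herm w' u"
  by (simp add: herm_def distrib_right sum.distrib)

lemma herm_diff: "herm (w - w') u = herm w u - herm w' u"
  by (simp add: herm_def left_diff_distrib sum_subtractf)

lemma herm_diff_right: "herm w (u - u') = herm w u - herm w u'"
  by (simp add: herm_def right_diff_distrib sum_subtractf)

lemma herm_smult: "herm (c *s w) u = c * herm w u"
  by (simp add: herm_def sum_distrib_left mult_ac)

lemma herm_0 [simp]: "herm 0 u = 0"
  by (simp add: herm_def)

lemma herm_commute: "herm u w = cnj (herm w u)"
  by (simp add: herm_def mult_ac)

lemma Re_herm: "Re (herm w u) = w \<bullet> u"
  by (simp add: herm_def inner_vec_def inner_complex_def)

lemma herm_self: "herm w w = of_real ((norm w)\<^sup>2)"
  by (simp add: complex_eq_iff Re_herm power2_norm_eq_inner)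
    (simp add: herm_def)

lemma norm_herm_le: "cmod (herm w u) \<le> norm w * norm u"
proof (cases "herm w u = 0")
  case False
  define c where "c = cnj (herm w u) / of_real (cmod (herm w u))"
  have c: "cmod c = 1" using False by (simp add: c_def norm_divide)
  have "c * herm w u = of_real ((cmod (herm w u))\<^sup>2) / of_real (cmod (herm w u))"
    unfolding complex_norm_square by (simp add: c_def)
  then have "c * herm w u = of_real (cmod (herm w u))"
    by (simp add: power2_eq_square)
  then have "cmod (herm w u) = Re (herm (c *s w) u)" by (simp add: herm_smult)
  also have "\<dots> \<le> norm (c *s w) * norm u" unfolding Re_herm by (rule norm_cauchy_schwarz)
  finally show ?thesis by (simp add: norm_vec_smult c)
qed auto

lemma bounded_linear_herm: "bounded_linear (\<lambda>w. herm w u)"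
  by (rule bounded_linear_intro[where K="norm u"])
    (auto simp: herm_add norm_herm_le scaleR_vec_smult herm_smult scaleR_conv_of_real)

lemma continuous_on_herm [continuous_intros]:
  "continuous_on S f \<Longrightarrow> continuous_on S (\<lambda>x. herm (f x) u)"
  by (rule bounded_linear.continuous_on[OF bounded_linear_herm])

definition unitary_frame :: "complex^2 \<Rightarrow> complex^2 \<Rightarrow> bool" where
  "unitary_frame \<eta> v \<longleftrightarrow> norm \<eta> = 1 \<and> norm v = 1 \<and> herm v \<eta> = 0"

lemma unitary_frameD:
  assumes "unitary_frame \<eta> v"
  shows "herm \<eta> \<eta> = 1" "herm v v = 1" "herm v \<eta> = 0" "herm \<eta> v = 0" "norm \<eta> = 1" "norm v = 1"
  using assms herm_commute[of \<eta> v] by (auto simp: unitary_frame_def herm_self)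

lemma unitary_frame_decomp:
  assumes "unitary_frame \<eta> v"
  shows "herm w \<eta> *s \<eta> + herm w v *s v = w"
proof -
  define d where "d = w - (herm w \<eta> *s \<eta> + herm w v *s v)"
  have 1: "herm d \<eta> = 0" "herm d v = 0"
    using unitary_frameD[OF assms] by (auto simp: d_def herm_diff herm_add herm_smult)
  define p q r s where "p = \<eta>$1" and "q = \<eta>$2" and "r = v$1" and "s = v$2"
  have e: "r * cnj p + s * cnj q = 0" "p * cnj p + q * cnj q = 1" "r * cnj r + s * cnj s = 1"
    "d$1 * cnj p + d$2 * cnj q = 0" "d$1 * cnj r + d$2 * cnj s = 0"
    using unitary_frameD[OF assms] 1 by (auto simp: herm_def UNIV_2 p_def q_def r_def s_def)
  have e': "p * cnj r + q * cnj s = 0" using arg_cong[OF e(1), of cnj] by (simp add: mult_ac)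
  have "d$1 * cnj (p * s - q * r) = 0" "d$2 * cnj (p * s - q * r) = 0"
  proof -
    have "d$1 * cnj (p * s - q * r) = (d$1 * cnj p + d$2 * cnj q) * cnj s - (d$1 * cnj r + d$2 * cnj s) * cnj q"
      "d$2 * cnj (p * s - q * r) = (d$1 * cnj r + d$2 * cnj s) * cnj p - (d$1 * cnj p + d$2 * cnj q) * cnj r"
      by (simp_all add: algebra_simps)
    then show "d$1 * cnj (p * s - q * r) = 0" "d$2 * cnj (p * s - q * r) = 0" unfolding e(4,5) by simp_all
  qed
  moreover have "cnj (p * s - q * r) \<noteq> 0"
  proof
    assume "cnj (p * s - q * r) = 0"
    then have ps: "p * s = q * r" by (metis complex_cnj_zero_iff eq_iff_diff_eq_0)
    have "p * (r * cnj r + s * cnj s) - r * (p * cnj r + q * cnj s) - cnj s * (p * s - q * r) = 0"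
      "q * (r * cnj r + s * cnj s) - s * (p * cnj r + q * cnj s) + cnj r * (p * s - q * r) = 0"
      by (simp_all add: algebra_simps)
    then have "p = 0" "q = 0" unfolding e(3) e' ps by simp_all
    with e(2) show False by simp
  qed
  ultimately have "d$1 = 0" "d$2 = 0" by auto
  then have "d = 0" by (simp add: vec_eq_iff forall_2)
  then show ?thesis by (simp add: d_def)
qed

lemma unitary_frame_norm:
  assumes "unitary_frame \<eta> v"
  shows "(norm w)\<^sup>2 = (cmod (herm w \<eta>))\<^sup>2 + (cmod (herm w v))\<^sup>2"
proof -
  have "of_real ((norm w)\<^sup>2) = herm w w" by (simp add: herm_self)
  also have "\<dots> = herm (herm w \<eta> *s \<eta> + herm w v *s v) w" using unitary_frame_decomp[OF assms, of w] by simp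
  also have "\<dots> = herm w \<eta> * cnj (herm w \<eta>) + herm w v * cnj (herm w v)"
    unfolding herm_add herm_smult herm_commute[of \<eta> w] herm_commute[of v w] by simp
  also have "\<dots> = of_real ((cmod (herm w \<eta>))\<^sup>2 + (cmod (herm w v))\<^sup>2)"
    unfolding of_real_add complex_norm_square ..
  finally show ?thesis using of_real_eq_iff by blast
qed

lemma unitary_frame_norm_le:
  assumes "unitary_frame \<eta> v"
  shows "norm w \<le> cmod (herm w \<eta>) + cmod (herm w v)"
  using norm_triangle_ineq[of "herm w \<eta> *s \<eta>" "herm w v *s v"] unitary_frame_decomp[OF assms, of w]
    unitary_frameD(5,6)[OF assms] by (simp add: norm_vec_smult)

section \<open>Newton's identities\<close>

text \<open>
  The elementary symmetric functions of \<open>g y\<close>, \<open>y \<in> Z\<close>, counted with multiplicity \<open>m y\<close>, are the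
  coefficients of this polynomial.
\<close>

definition sym_gen :: "'a set \<Rightarrow> ('a \<Rightarrow> nat) \<Rightarrow> ('a \<Rightarrow> complex) \<Rightarrow> complex fps" where
  "sym_gen Z m g = (\<Prod>y\<in>Z. (1 + fps_const (g y) * fps_X) ^ m y)"

lemma sym_gen_top:
  assumes "finite Z"
  shows "(\<forall>n > (\<Sum>y\<in>Z. m y). fps_nth (sym_gen Z m g) n = 0) \<and>
     fps_nth (sym_gen Z m g) (\<Sum>y\<in>Z. m y) = (\<Prod>y\<in>Z. g y ^ m y)"
proof -
  define top where "top E N c \<longleftrightarrow> (\<forall>n>N. fps_nth E n = 0) \<and> fps_nth E N = c" for E :: "complex fps" and N c
  have top_mult: "top (E * E') (N + N') (c * c')" if "top E N c" "top E' N' c'" for E E' N N' c c'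
    unfolding top_def
  proof (intro conjI allI impI)
    fix n assume n: "n > N + N'"
    have "fps_nth E i * fps_nth E' (n - i) = 0" if "i \<le> n" for i
      using \<open>top E N c\<close> \<open>top E' N' c'\<close> n that unfolding top_def by (cases "i > N") auto
    then show "fps_nth (E * E') n = 0" unfolding fps_mult_nth by (intro sum.neutral) auto
  next
    have "fps_nth E i * fps_nth E' (N + N' - i) = (if i = N then c * c' else 0)" if "i \<le> N + N'" for i
      using \<open>top E N c\<close> \<open>top E' N' c'\<close> that unfolding top_def
      by (cases "i > N"; cases "i = N") auto
    then have "fps_nth (E * E') (N + N') = (\<Sum>i=0..N+N'. if i = N then c * c' else 0)"
      unfolding fps_mult_nth by (intro sum.cong) auto
    then show "fps_nth (E * E') (N + N') = c * c'" by simp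
  qed
  have lin: "top (1 + fps_const (g y) * fps_X) 1 (g y)" for y unfolding top_def by (auto simp: fps_X_def)
  have top_1: "top 1 0 1" unfolding top_def by auto
  have pow: "top ((1 + fps_const (g y) * fps_X) ^ k) k (g y ^ k)" for y k
  proof (induction k)
    case (Suc k) from top_mult[OF lin[of y] Suc] show ?case by simp
  qed (simp add: top_1)
  have "top (sym_gen Z m g) (\<Sum>y\<in>Z. m y) (\<Prod>y\<in>Z. g y ^ m y)"
    using assms unfolding sym_gen_def
    by (induction Z rule: finite_induct) (auto simp: top_1 intro!: top_mult pow)
  then show ?thesis unfolding top_def .
qed

text \<open>
  The logarithmic derivative of the generating function is a sum of geometric series, whose
  coefficients are the power sums. Multiplied out, this is Newton's identity.
\<close>

lemma newton_identity:
  assumes "finite Z"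
  shows "of_nat (Suc n) * fps_nth (sym_gen Z m g) (Suc n) =
     (\<Sum>i=0..n. fps_nth (sym_gen Z m g) i * ((- 1) ^ (n - i) * (\<Sum>y\<in>Z. of_nat (m y) * g y ^ Suc (n - i))))"
proof -
  define L where "L Z = (\<Sum>y\<in>Z. fps_const (of_nat (m y) * g y) * Abs_fps (\<lambda>n. (- g y) ^ n))" for Z
  have inv: "(1 + fps_const b * fps_X) * Abs_fps (\<lambda>n. (- b) ^ n) = 1" for b :: complex
  proof (rule fps_ext)
    fix n show "fps_nth ((1 + fps_const b * fps_X) * Abs_fps (\<lambda>n. (- b) ^ n)) n = fps_nth 1 n"
      by (cases n) (auto simp: distrib_right mult.assoc)
  qed
  have dpow: "fps_deriv ((1 + fps_const b * fps_X) ^ k) =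
     (1 + fps_const b * fps_X) ^ k * (fps_const (of_nat k * b) * Abs_fps (\<lambda>n. (- b) ^ n))" for b :: complex and k
  proof -
    define l and B where "l = 1 + fps_const b * fps_X" and "B = Abs_fps (\<lambda>n. (- b) ^ n)"
    have lB: "l * B = 1" and dl: "fps_deriv l = fps_const b" unfolding l_def B_def using inv by auto
    have "fps_deriv (l ^ k) = l ^ k * (fps_const (of_nat k * b) * B)"
    proof (induction k)
      case (Suc k)
      have c: "fps_const (of_nat (Suc k) * b) = fps_const b + fps_const (of_nat k * b)"
        by (simp add: algebra_simps)
      have "fps_deriv (l ^ Suc k) = fps_const b * l ^ k * (l * B) + l * (l ^ k * (fps_const (of_nat k * b) * B))"
        unfolding lB by (simp add: dl Suc)
      also have "\<dots> = l ^ Suc k * ((fps_const b + fps_const (of_nat k * b)) * B)"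
        by (simp only: power_Suc) (simp only: algebra_simps)
      finally show ?case unfolding c .
    qed simp
    then show ?thesis unfolding l_def B_def .
  qed
  have D: "fps_deriv (sym_gen Z m g) = sym_gen Z m g * L Z"
    using assms
  proof (induction Z rule: finite_induct)
    case (insert y Z)
    then have "sym_gen (insert y Z) m g = (1 + fps_const (g y) * fps_X) ^ m y * sym_gen Z m g"
      by (simp add: sym_gen_def)
    moreover have "L (insert y Z) = fps_const (of_nat (m y) * g y) * Abs_fps (\<lambda>n. (- g y) ^ n) + L Z"
      using insert by (simp add: L_def)
    ultimately show ?case by (simp only: fps_deriv_mult insert.IH dpow) (simp only: algebra_simps)
  qed (simp add: sym_gen_def L_def)
  have Ln: "fps_nth (L Z) k = (- 1) ^ k * (\<Sum>y\<in>Z. of_nat (m y) * g y ^ Suc k)" for k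
    unfolding L_def fps_sum_nth
    by (simp add: sum_distrib_left) (rule sum.cong, simp, simp add: power_minus[of "g _"])
  have "of_nat (Suc n) * fps_nth (sym_gen Z m g) (Suc n) = fps_nth (fps_deriv (sym_gen Z m g)) n" by simp
  also have "\<dots> = (\<Sum>i=0..n. fps_nth (sym_gen Z m g) i * fps_nth (L Z) (n - i))"
    unfolding D fps_mult_nth ..
  finally show ?thesis unfolding Ln .
qed

text \<open>
  Newton's identities express the elementary symmetric functions, the last of which is the product, by
  the power sums. This is useful because a single zero of a function with a parameter need not depend
  holomorphically on the parameter, whereas the power sums do, being contour integrals.
\<close>

lemma holomorphic_prod_of_power_sums:
  fixes Z :: "complex \<Rightarrow> 'a set"
  assumes fin: "\<And>x. x \<in> A \<Longrightarrow> finite (Z x)" and N: "\<And>x. x \<in> A \<Longrightarrow> (\<Sum>y\<in>Z x. m x y) = N"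
    and p: "\<And>k. (\<lambda>x. \<Sum>y\<in>Z x. of_nat (m x y) * g x y ^ Suc k) holomorphic_on A"
  shows "(\<lambda>x. \<Prod>y\<in>Z x. g x y ^ m x y) holomorphic_on A"
proof -
  let ?e = "\<lambda>n x. fps_nth (sym_gen (Z x) (m x) (g x)) n"
  have "?e n holomorphic_on A" for n
  proof (induction n rule: less_induct)
    case (less n)
    show ?case
    proof (cases n)
      case 0
      have "fps_nth (sym_gen Y m' g') 0 = 1" for Y :: "'a set" and m' g'
        unfolding sym_gen_def by (induction Y rule: infinite_finite_induct) (auto simp: fps_power_zeroth)
      then show ?thesis using 0 by simp
    next
      case (Suc j)
      have "(\<lambda>x. 1 / of_nat (Suc j) * (\<Sum>i=0..j. ?e i x * ((- 1) ^ (j - i) * (\<Sum>y\<in>Z x. of_nat (m x y) * g x y ^ Suc (j - i)))))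
         holomorphic_on A"
        by (intro holomorphic_intros p less) (use Suc in auto)
      moreover have "1 / of_nat (Suc j) * (\<Sum>i=0..j. ?e i x * ((- 1) ^ (j - i) * (\<Sum>y\<in>Z x. of_nat (m x y) * g x y ^ Suc (j - i))))
          = ?e n x" if "x \<in> A" for x
        unfolding newton_identity[OF fin[OF that], symmetric] Suc by (simp del: of_nat_Suc)
      ultimately show ?thesis by (rule holomorphic_transform)
    qed
  qed
  moreover have "?e N x = (\<Prod>y\<in>Z x. g x y ^ m x y)" if "x \<in> A" for x
    using sym_gen_top[OF fin[OF that]] N[OF that] by metis
  ultimately show ?thesis by (rule holomorphic_transform)
qed

section \<open>Zeros of a holomorphic function on parallel complex discs\<close>

definition zeros_in :: "(complex \<Rightarrow> complex \<Rightarrow> complex) \<Rightarrow> complex \<Rightarrow> real \<Rightarrow> complex \<Rightarrow> complex set" where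
  "zeros_in F c R x = {y \<in> ball c R. F x y = 0}"

definition mult_at :: "(complex \<Rightarrow> complex \<Rightarrow> complex) \<Rightarrow> complex \<Rightarrow> complex \<Rightarrow> nat" where
  "mult_at F x y = nat (zorder (F x) y)"

definition affine_pt :: "complex^'n \<Rightarrow> complex^'n \<Rightarrow> complex^'n \<Rightarrow> complex \<Rightarrow> complex \<Rightarrow> complex^'n" where
  "affine_pt a \<eta> v x y = a + x *s \<eta> + y *s v"

lemma affine_pt_alt: "affine_pt a \<eta> v x y = (a + y *s v) + x *s \<eta>"
  by (simp add: affine_pt_def)

lemma continuous_on_affine_pt [continuous_intros]:
  "continuous_on T g \<Longrightarrow> continuous_on T h \<Longrightarrow> continuous_on T (\<lambda>z. affine_pt a \<eta> v (g z) (h z))"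
  unfolding affine_pt_def by (intro continuous_intros)

text \<open>
  The setting of Weierstrass' preparation theorem: in the coordinates \<open>x\<close> along \<open>\<eta>\<close> and \<open>y\<close> along \<open>v\<close>,
  the zeros of \<open>f\<close> over the parameter domain \<open>A\<close> do not meet the boundary of the disc in which \<open>y\<close>
  varies, so they can neither enter nor leave it.
\<close>

locale weierstrass_disc =
  fixes f :: "complex^2 \<Rightarrow> complex" and S :: "(complex^2) set" and a \<eta> v :: "complex^2"
    and A :: "complex set" and c :: complex and R :: real
  assumes hol: "Cn_holomorphic_on f S" and opS: "open S" and opA: "open A" and cvA: "convex A"
    and R: "0 < R"
    and inS: "\<And>x y. x \<in> A \<Longrightarrow> cmod (y - c) \<le> R \<Longrightarrow> affine_pt a \<eta> v x y \<in> S"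
    and nz: "\<And>x y. x \<in> A \<Longrightarrow> cmod (y - c) = R \<Longrightarrow> f (affine_pt a \<eta> v x y) \<noteq> 0"
begin

abbreviation "pt \<equiv> affine_pt a \<eta> v"
abbreviation "F \<equiv> \<lambda>x y. f (pt x y)"
abbreviation "F2 \<equiv> \<lambda>x y. dir_derivs f [v] (pt x y)"
abbreviation "Z \<equiv> zeros_in F c R"
abbreviation "\<mu> \<equiv> mult_at F"

lemma D_y: "Cn_holomorphic_on g S \<Longrightarrow> pt x y \<in> S \<Longrightarrow>
    ((\<lambda>y. g (pt x y)) has_field_derivative dir_derivs g [v] (pt x y)) (at y)"
  unfolding affine_pt_def by (rule Cn_holomorphic_along_line)

lemma D_x: "Cn_holomorphic_on g S \<Longrightarrow> pt x y \<in> S \<Longrightarrow>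
    ((\<lambda>x. g (pt x y)) has_field_derivative dir_derivs g [\<eta>] (pt x y)) (at x)"
  unfolding affine_pt_alt by (rule Cn_holomorphic_along_line)

lemma hol_f2: "Cn_holomorphic_on (dir_derivs f [v]) S"
  by (rule Cn_holomorphic_dir_deriv[OF hol opS])

lemma cont_pt: "Cn_holomorphic_on g S \<Longrightarrow> continuous_on (A \<times> cball c R) (\<lambda>(x,y). g (pt x y))"
  unfolding split_beta
  by (intro continuous_on_compose2[OF Cn_holomorphic_continuous_on] continuous_intros)
    (auto intro!: inS simp: dist_norm norm_minus_commute)

lemma open_y: "open {y. pt x y \<in> S}"
proof -
  have "continuous_on UNIV (\<lambda>y. pt x y)" by (intro continuous_intros)
  from open_vimage[OF opS this] show ?thesis by (simp add: vimage_def)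
qed

lemma bigger_disc:
  assumes "x \<in> A" "open T" "cball c R \<subseteq> T"
  obtains R' where "R < R'" "ball c R' \<subseteq> T" "\<And>y. y \<in> ball c R' \<Longrightarrow> pt x y \<in> S"
proof -
  let ?T = "T \<inter> {y. pt x y \<in> S}"
  have "open ?T" using open_y assms by auto
  moreover have "cball c R \<subseteq> ?T" using assms inS by (auto simp: dist_norm norm_minus_commute)
  ultimately obtain e where e: "e > 0" "(\<Union>y\<in>cball c R. ball y e) \<subseteq> ?T"
    using compact_subset_open_imp_ball_epsilon_subset[of "cball c R" ?T] by auto
  have "ball c (R + e) \<subseteq> ?T"
  proof
    fix y assume y: "y \<in> ball c (R + e)"
    show "y \<in> ?T"
    proof (cases "y \<in> cball c R")
      case True then show ?thesis using \<open>cball c R \<subseteq> ?T\<close> by blast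
    next
      case False
      define d where "d = dist c y"
      have d: "d > R" "d < R + e" using False y by (auto simp: d_def)
      define w where "w = c + of_real (R / d) * (y - c)"
      have d': "cmod (y - c) = d" by (simp add: d_def dist_norm norm_minus_commute)
      have "dist c w = cmod (of_real (R / d) * (y - c))" by (simp add: w_def dist_norm)
      also have "\<dots> = R" using d R unfolding norm_mult d' norm_of_real by simp
      finally have wR: "dist c w = R" .
      have "y - w = of_real (1 - R / d) * (y - c)" by (simp add: w_def algebra_simps)
      then have "dist w y = \<bar>1 - R / d\<bar> * d"
        unfolding dist_norm norm_minus_commute[of w] by (simp only: norm_mult norm_of_real d')
      also have "\<dots> = d - R" using d R by (simp add: left_diff_distrib)
      finally have "y \<in> ball w e" "w \<in> cball c R" using d wR by auto
      then show ?thesis using e(2) by blast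
    qed
  qed
  moreover have "R < R + e" using e(1) by simp
  ultimately show ?thesis using that[of "R + e"] by blast
qed

lemma F_holomorphic:
  assumes "\<And>y. y \<in> T \<Longrightarrow> pt x y \<in> S" shows "F x holomorphic_on T"
  using D_y[OF hol assms] by (meson DERIV_subset field_differentiable_def holomorphic_on_def subset_UNIV)

lemma F_nonconst:
  assumes "x \<in> A" "R < R'" shows "\<exists>w\<in>ball c R'. F x w \<noteq> 0"
  by (rule bexI[of _ "c + of_real R"]) (use nz[OF assms(1), of "c + of_real R"] R assms in \<open>auto simp: dist_norm\<close>)

lemma finite_zeros_cball:
  assumes "x \<in> A" shows "finite {y \<in> cball c R. F x y = 0}"
proof (cases "\<exists>y\<in>cball c R. F x y = 0")
  case True
  obtain R' where R': "R < R'" "\<And>y. y \<in> ball c R' \<Longrightarrow> pt x y \<in> S"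
    using bigger_disc[OF assms open_UNIV] by auto
  have "\<not> F x constant_on ball c R'"
    using True F_nonconst[OF assms R'(1)] R'(1) unfolding constant_on_def by force
  then show ?thesis
    using holomorphic_compact_finite_zeros[of "F x" "ball c R'" "cball c R"] R'
      F_holomorphic[of "ball c R'" x] by (simp add: subset_eq)
next
  case False
  then have "{y \<in> cball c R. F x y = 0} = {}" by blast
  then show ?thesis by (metis finite.emptyI)
qed

lemma finite_Z: "x \<in> A \<Longrightarrow> finite (Z x)"
  by (rule finite_subset[OF _ finite_zeros_cball[of x]]) (auto simp: zeros_in_def)

lemma mult_pos:
  assumes "x \<in> A" "y \<in> Z x" shows "\<mu> x y > 0" "int (\<mu> x y) = zorder (F x) y"
proof -
  obtain R' where R': "R < R'" "\<And>y. y \<in> ball c R' \<Longrightarrow> pt x y \<in> S"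
    using bigger_disc[OF assms(1) open_UNIV] by auto
  have "y \<in> ball c R'" "F x y = 0" using assms(2) R' by (auto simp: zeros_in_def)
  then have "zorder (F x) y > 0"
    using zorder_exist_zero[of "F x" "ball c R'" y] F_holomorphic R' F_nonconst[OF assms(1) R'(1)] by force
  then show "\<mu> x y > 0" "int (\<mu> x y) = zorder (F x) y" by (auto simp: mult_at_def)
qed

lemma deriv_F: "pt x y \<in> S \<Longrightarrow> deriv (F x) y = F2 x y"
  using D_y[OF hol] by (simp add: DERIV_imp_deriv)

lemma mult_simple:
  assumes "x \<in> A" "y \<in> Z x" "F2 x y \<noteq> 0" shows "\<mu> x y = 1"
proof -
  obtain R' where R': "R < R'" "\<And>y. y \<in> ball c R' \<Longrightarrow> pt x y \<in> S"
    using bigger_disc[OF assms(1) open_UNIV] by auto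
  have y: "y \<in> ball c R'" "F x y = 0" using assms(2) R' by (auto simp: zeros_in_def)
  have "zorder (F x) y = 1"
    by (rule zorder_zero_eqI[OF F_holomorphic[OF R'(2)] open_ball y(1)]) (use y assms(3) deriv_F R' in auto)
  then show ?thesis by (simp add: mult_at_def)
qed

text \<open>
  The argument principle with a weight.
\<close>

lemma weighted_zero_sum:
  assumes x: "x \<in> A" and T: "open T" "cball c R \<subseteq> T" and h: "h holomorphic_on T"
  shows "contour_integral (circlepath c R) (\<lambda>y. F2 x y * h y / F x y) =
     2 * pi * \<i> * (\<Sum>y\<in>Z x. of_nat (\<mu> x y) * h y)"
proof -
  obtain R0 where R0: "R < R0" "ball c R0 \<subseteq> T" "\<And>y. y \<in> ball c R0 \<Longrightarrow> pt x y \<in> S"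
    using bigger_disc[OF x T] by metis
  define R' where "R' = (R + R0) / 2"
  have R': "R < R'" "R' < R0" using R0 by (auto simp: R'_def)
  let ?pz = "{w \<in> ball c R'. F x w = 0 \<or> w \<in> {}}"
  have fin: "finite ?pz"
  proof (cases "\<exists>y\<in>ball c R0. F x y = 0")
    case True
    then have "\<not> F x constant_on ball c R0"
      using F_nonconst[OF x R0(1)] unfolding constant_on_def by force
    then have "finite {w \<in> cball c R'. F x w = 0}"
      using holomorphic_compact_finite_zeros[of "F x" "ball c R0" "cball c R'"] R0 R'
        F_holomorphic[of "ball c R0" x] by (simp add: subset_eq)
    then show ?thesis by (rule rev_finite_subset) auto
  next
    case False
    then have "?pz = {}" using R' by auto
    then show ?thesis by (metis finite.emptyI)
  qed
  have w1: "winding_number (circlepath c R) y = 1" if "y \<in> ball c R" for y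
    using that by (intro winding_number_circlepath) (auto simp: dist_norm norm_minus_commute)
  have w0: "winding_number (circlepath c R) y = 0" if "y \<notin> cball c R" for y
    by (rule winding_number_zero_outside[of _ "cball c R"]) (use that R in \<open>auto simp: path_image_circlepath sphere_cball\<close>)
  have "contour_integral (circlepath c R) (\<lambda>y. F2 x y * h y / F x y) =
      contour_integral (circlepath c R) (\<lambda>y. deriv (F x) y * h y / F x y)"
    by (rule contour_integral_eq) (use deriv_F R0 R in \<open>auto simp: path_image_circlepath\<close>)
  also have "\<dots> = 2 * pi * \<i> * (\<Sum>p\<in>?pz. winding_number (circlepath c R) p * h p * zorder (F x) p)"
  proof (rule argument_principle)
    show "F x holomorphic_on ball c R' - {}" using F_holomorphic[of "ball c R'" x] R0 R' by simp
    show "h holomorphic_on ball c R'" by (rule holomorphic_on_subset[OF h]) (use R0 R' in auto)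
    show "path_image (circlepath c R) \<subseteq> ball c R' - ?pz"
      using R R' nz[OF x] by (auto simp: path_image_circlepath dist_norm norm_minus_commute)
    show "\<forall>z. z \<notin> ball c R' \<longrightarrow> winding_number (circlepath c R) z = 0" using w0 R' by auto
    show "finite ?pz" by (rule fin)
  qed auto
  also have "(\<Sum>p\<in>?pz. winding_number (circlepath c R) p * h p * zorder (F x) p) =
      (\<Sum>p\<in>Z x. of_nat (\<mu> x p) * h p)"
  proof (rule sum.mono_neutral_cong_right[OF fin])
    show "Z x \<subseteq> ?pz" using R' by (auto simp: zeros_in_def)
    show "\<forall>p\<in>?pz - Z x. winding_number (circlepath c R) p * h p * zorder (F x) p = 0"
    proof
      fix p assume "p \<in> ?pz - Z x"
      then have "p \<notin> cball c R" using nz[OF x, of p]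
        by (auto simp: zeros_in_def dist_norm norm_minus_commute less_le)
      then show "winding_number (circlepath c R) p * h p * zorder (F x) p = 0" using w0 by simp
    qed
    fix p assume p: "p \<in> Z x"
    then have "winding_number (circlepath c R) p = 1" using w1 by (auto simp: zeros_in_def)
    moreover have "(of_int (zorder (F x) p) :: complex) = of_nat (\<mu> x p)"
      using mult_pos(2)[OF x p] by (metis of_int_of_nat_eq)
    ultimately show "winding_number (circlepath c R) p * h p * zorder (F x) p = of_nat (\<mu> x p) * h p"
      by simp
  qed
  finally show ?thesis .
qed

lemma circle_param_holomorphic:
  assumes H: "\<And>x y. x \<in> A \<Longrightarrow> cmod (y - c) = R \<Longrightarrow> ((\<lambda>x. H x y) has_field_derivative H1 x y) (at x)"
    and cH: "continuous_on (A \<times> sphere c R) (\<lambda>(x,y). H x y)"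
    and cH1: "continuous_on (A \<times> sphere c R) (\<lambda>(x,y). H1 x y)"
  shows "(\<lambda>x. contour_integral (circlepath c R) (H x)) holomorphic_on A"
proof -
  let ?g = "circlepath c R" and ?d = "\<lambda>t::real. 2 * pi * \<i> * R * exp (2 * of_real pi * \<i> * t)"
  have g: "cmod (?g t - c) = R" "?g t \<in> sphere c R" for t
    using R by (auto simp: circlepath norm_mult dist_norm)
  have "(\<lambda>x. integral (cbox 0 1) (\<lambda>t. H x (?g t) * ?d t)) holomorphic_on A"
  proof (rule leibniz_rule_holomorphic[where fx="\<lambda>x t. H1 x (?g t) * ?d t"])
    fix x t assume "x \<in> A"
    show "((\<lambda>x. H x (?g t) * ?d t) has_field_derivative H1 x (?g t) * ?d t) (at x within A)"
      by (rule DERIV_cmult_right[OF DERIV_subset[OF H[OF \<open>x \<in> A\<close> g(1)]]]) simp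
  next
    fix x assume "x \<in> A"
    have "continuous_on (cbox 0 1) (\<lambda>t. (\<lambda>(x,y). H x y) (x, ?g t))"
      by (rule continuous_on_compose2[OF cH])
         (use \<open>x \<in> A\<close> g in \<open>auto intro!: continuous_intros continuous_on_circlepath\<close>)
    then show "(\<lambda>t. H x (?g t) * ?d t) integrable_on cbox 0 1"
      by (intro integrable_continuous continuous_intros) simp
  next
    have "continuous_on (A \<times> cbox 0 1) (\<lambda>z. (\<lambda>(x,y). H1 x y) (fst z, ?g (snd z)))"
      by (rule continuous_on_compose2[OF cH1])
         (use g in \<open>auto intro!: continuous_intros continuous_on_compose2[OF continuous_on_circlepath]\<close>)
    then show "continuous_on (A \<times> cbox 0 1) (\<lambda>(x, t). H1 x (?g t) * ?d t)"
      unfolding split_beta by (intro continuous_intros) simp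
  qed (rule cvA)
  then show ?thesis
    unfolding contour_integral_integral vector_derivative_circlepath by simp
qed

text \<open>
  The weights \<open>G x y\<close>, with \<open>x\<close>-derivative \<open>G1 x y\<close>, for which the sum over the zeros may be written as a
  contour integral and differentiated under the integral sign.
\<close>

definition weight :: "(complex \<Rightarrow> complex \<Rightarrow> complex) \<Rightarrow> (complex \<Rightarrow> complex \<Rightarrow> complex) \<Rightarrow> bool" where
  "weight G G1 \<longleftrightarrow>
     (\<forall>x\<in>A. \<exists>T. open T \<and> cball c R \<subseteq> T \<and> G x holomorphic_on T) \<and>
     (\<forall>x\<in>A. \<forall>y. cmod (y - c) = R \<longrightarrow> ((\<lambda>x. G x y) has_field_derivative G1 x y) (at x)) \<and>
     continuous_on (A \<times> sphere c R) (\<lambda>(x,y). G x y) \<and> continuous_on (A \<times> sphere c R) (\<lambda>(x,y). G1 x y)"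

lemma weight_sum_holomorphic:
  assumes "weight G G1"
  shows "(\<lambda>x. \<Sum>y\<in>Z x. of_nat (\<mu> x y) * G x y) holomorphic_on A"
proof -
  let ?f1 = "\<lambda>x y. dir_derivs f [\<eta>] (pt x y)" and ?f12 = "\<lambda>x y. dir_derivs (dir_derivs f [v]) [\<eta>] (pt x y)"
  have sub: "A \<times> sphere c R \<subseteq> A \<times> cball c R" by auto
  have cont: "continuous_on (A \<times> sphere c R) (\<lambda>(x,y). g (pt x y))" if "Cn_holomorphic_on g S" for g
    by (rule continuous_on_subset[OF cont_pt[OF that] sub])
  note cs = cont[OF hol, unfolded split_beta] cont[OF hol_f2, unfolded split_beta]
      cont[OF Cn_holomorphic_dir_deriv[OF hol opS], unfolded split_beta]
      cont[OF Cn_holomorphic_dir_deriv[OF hol_f2 opS], unfolded split_beta]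
  note G = assms[unfolded weight_def split_beta]
  have nz': "F (fst z) (snd z) \<noteq> 0" if "z \<in> A \<times> sphere c R" for z
    using nz[of "fst z" "snd z"] that by (auto simp: dist_norm norm_minus_commute)
  have "(\<lambda>x. contour_integral (circlepath c R) (\<lambda>y. F2 x y * G x y / F x y)) holomorphic_on A"
  proof (rule circle_param_holomorphic)
    fix x y assume xy: "x \<in> A" "cmod (y - c) = R"
    have S: "pt x y \<in> S" using inS xy by simp
    show "((\<lambda>x. F2 x y * G x y / F x y) has_field_derivative
       ((?f12 x y * G x y + G1 x y * F2 x y) * F x y - (F2 x y * G x y) * ?f1 x y) / (F x y * F x y)) (at x)"
      using G xy nz[OF xy] by (intro DERIV_divide DERIV_mult D_x[OF hol S] D_x[OF hol_f2 S]) auto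
  next
    show "continuous_on (A \<times> sphere c R) (\<lambda>(x, y). F2 x y * G x y / F x y)"
      unfolding split_beta using G nz' by (intro continuous_intros cs) auto
    show "continuous_on (A \<times> sphere c R)
      (\<lambda>(x, y). ((?f12 x y * G x y + G1 x y * F2 x y) * F x y - (F2 x y * G x y) * ?f1 x y) / (F x y * F x y))"
      unfolding split_beta using G nz' by (intro continuous_intros cs) auto
  qed
  then have "(\<lambda>x. 1 / (2 * pi * \<i>) * contour_integral (circlepath c R) (\<lambda>y. F2 x y * G x y / F x y)) holomorphic_on A"
    by (intro holomorphic_intros)
  then show ?thesis
  proof (rule holomorphic_transform)
    fix x assume x: "x \<in> A"
    then obtain T where "open T" "cball c R \<subseteq> T" "G x holomorphic_on T" using G by blast
    from weighted_zero_sum[OF x this]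
    show "1 / (2 * pi * \<i>) * contour_integral (circlepath c R) (\<lambda>y. F2 x y * G x y / F x y) =
       (\<Sum>y\<in>Z x. of_nat (\<mu> x y) * G x y)" by simp
  qed
qed

lemma weight_1: "weight (\<lambda>x y. 1) (\<lambda>x y. 0)"
  unfolding weight_def by (auto intro!: derivative_eq_intros continuous_intros)

lemma weight_id: "weight (\<lambda>x y. y) (\<lambda>x y. 0)"
  unfolding weight_def split_beta
  by (auto intro!: derivative_eq_intros continuous_intros exI[of _ UNIV] holomorphic_intros)

lemma weight_F2_power: "weight (\<lambda>x y. F2 x y ^ k)
    (\<lambda>x y. of_nat k * F2 x y ^ (k - 1) * dir_derivs (dir_derivs f [v]) [\<eta>] (pt x y))"
proof -
  have cont: "continuous_on (A \<times> sphere c R) (\<lambda>z. g (pt (fst z) (snd z)))" if "Cn_holomorphic_on g S" for g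
    using continuous_on_subset[OF cont_pt[OF that, unfolded split_beta], of "A \<times> sphere c R"] by force
  show ?thesis
    unfolding weight_def split_beta
  proof (intro conjI ballI allI impI)
    fix x assume "x \<in> A"
    have "(\<lambda>y. F2 x y) holomorphic_on {y. pt x y \<in> S}"
      using D_y[OF hol_f2] by (intro holomorphic_onI)
        (metis (mono_tags, lifting) DERIV_subset field_differentiable_def mem_Collect_eq subset_UNIV)
    then show "\<exists>T. open T \<and> cball c R \<subseteq> T \<and> (\<lambda>y. F2 x y ^ k) holomorphic_on T"
      using open_y inS[OF \<open>x \<in> A\<close>]
      by (intro exI[of _ "{y. pt x y \<in> S}"]) (auto simp: dist_norm norm_minus_commute intro!: holomorphic_intros)
  next
    fix x y assume "x \<in> A" "cmod (y - c) = R"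
    then have "pt x y \<in> S" using inS by simp
    from DERIV_power[OF D_x[OF hol_f2 this], of k]
    show "((\<lambda>x. F2 x y ^ k) has_field_derivative
       of_nat k * F2 x y ^ (k - 1) * dir_derivs (dir_derivs f [v]) [\<eta>] (pt x y)) (at x)"
      by (simp add: mult_ac)
  qed (intro continuous_intros cont hol_f2 Cn_holomorphic_dir_deriv[OF hol_f2 opS])+
qed

definition num :: "complex \<Rightarrow> nat" where "num x = (\<Sum>y\<in>Z x. \<mu> x y)"

text \<open>
  The number of zeros, counted with multiplicity, is an integer and a holomorphic function of the
  parameter, as the weighted sum for the weight \<open>1\<close>.
\<close>

lemma num_constant:
  assumes "x \<in> A" "x' \<in> A" shows "num x = num x'"
proof -
  have "(\<lambda>x. \<Sum>y\<in>Z x. of_nat (\<mu> x y) * 1) holomorphic_on A" by (rule weight_sum_holomorphic[OF weight_1])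
  then have "(\<lambda>x. of_nat (num x) :: complex) holomorphic_on A" by (simp add: num_def)
  then have "(\<lambda>x. of_nat (num x) :: complex) constant_on A"
  proof (intro continuous_discrete_range_constant convex_connected cvA holomorphic_on_imp_continuous_on)
    fix x assume "x \<in> A"
    have "1 \<le> cmod (of_nat (num y) - of_nat (num x))" if "of_nat (num y) \<noteq> (of_nat (num x) :: complex)" for y
    proof -
      have "cmod (of_nat (num y) - of_nat (num x)) = \<bar>real_of_int (int (num y) - int (num x))\<bar>"
        by (metis (no_types, lifting) norm_of_int of_int_diff of_int_of_nat_eq)
      also have "\<dots> = real_of_int \<bar>int (num y) - int (num x)\<bar>" by simp
      also have "\<dots> \<ge> 1" using that by (simp del: of_int_abs add: abs_if)
      finally show ?thesis .
    qed
    then show "\<exists>e>0. \<forall>y. y \<in> A \<and> of_nat (num y) \<noteq> (of_nat (num x) :: complex) \<longrightarrow>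
        e \<le> cmod (of_nat (num y) - of_nat (num x))" by (intro exI[of _ 1]) auto
  qed
  then have "of_nat (num x) = (of_nat (num x') :: complex)" using assms unfolding constant_on_def by metis
  then show ?thesis by simp
qed

lemma card_Z_le_num: "x \<in> A \<Longrightarrow> card (Z x) \<le> num x"
  unfolding num_def using sum_mono[of "Z x" "\<lambda>_. 1" "\<mu> x"] mult_pos(1)[of x]
  by (force simp: Suc_le_eq)

text \<open>
  The resultant of \<open>F\<close> and \<open>\<partial>F/\<partial>y\<close>, up to a factor without zeros. It serves as the discriminant: it
  vanishes where some zero is multiple.
\<close>

definition disc :: "complex \<Rightarrow> complex" where "disc x = (\<Prod>y\<in>Z x. F2 x y ^ \<mu> x y)"

lemma disc_holomorphic: "disc holomorphic_on A"
proof (cases "A = {}")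
  case True then show ?thesis by (simp add: holomorphic_on_def)
next
  case False
  then obtain x0 where "x0 \<in> A" by blast
  show ?thesis unfolding disc_def
  proof (rule holomorphic_prod_of_power_sums)
    show "(\<Sum>y\<in>Z x. \<mu> x y) = num x0" if "x \<in> A" for x
      using num_constant[OF that \<open>x0 \<in> A\<close>] by (simp add: num_def)
    show "(\<lambda>x. \<Sum>y\<in>Z x. of_nat (\<mu> x y) * F2 x y ^ Suc k) holomorphic_on A" for k
      by (rule weight_sum_holomorphic[OF weight_F2_power])
  qed (rule finite_Z)
qed

lemma disc_nonzero_iff: "x \<in> A \<Longrightarrow> disc x \<noteq> 0 \<longleftrightarrow> (\<forall>y\<in>Z x. F2 x y \<noteq> 0)"
  unfolding disc_def using finite_Z[of x] mult_pos(1)[of x] by auto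

lemma disc_nonzero_card: "x \<in> A \<Longrightarrow> disc x \<noteq> 0 \<Longrightarrow> card (Z x) = num x"
  unfolding num_def using mult_simple[of x] disc_nonzero_iff[of x] by auto

text \<open>
  The zero is the mean of all zeros, counted with multiplicity.
\<close>

lemma single_zero_holomorphic:
  assumes "A \<noteq> {}" "\<And>x. x \<in> A \<Longrightarrow> card (Z x) = 1"
  obtains \<phi> where "\<phi> holomorphic_on A" "\<And>x. x \<in> A \<Longrightarrow> Z x = {\<phi> x}"
proof -
  obtain x0 where x0: "x0 \<in> A" using assms by blast
  define \<phi> where "\<phi> x = (THE y. y \<in> Z x)" for x
  have \<phi>: "Z x = {\<phi> x}" if xA: "x \<in> A" for x
  proof -
    obtain y where "Z x = {y}" by (rule card_1_singletonE[OF assms(2)[OF xA]])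
    then show ?thesis by (simp add: \<phi>_def)
  qed
  have n: "\<mu> x (\<phi> x) = num x0" if "x \<in> A" for x
    using num_constant[OF that x0] \<phi>[OF that] by (simp add: num_def)
  have n0: "num x0 > 0" using n[OF x0] mult_pos(1)[OF x0, of "\<phi> x0"] \<phi>[OF x0] by simp
  have "(\<lambda>x. 1 / of_nat (num x0) * (\<Sum>y\<in>Z x. of_nat (\<mu> x y) * y)) holomorphic_on A"
    by (intro holomorphic_intros weight_sum_holomorphic[OF weight_id])
  then have "\<phi> holomorphic_on A"
    by (rule holomorphic_transform) (use n n0 \<phi> in auto)
  then show ?thesis using that \<phi> by blast
qed

text \<open>
  Disjoint discs about the zeros over \<open>x0\<close> and a neighbourhood of \<open>x0\<close> over which the zeros do not
  leave these discs, so that each of the discs is again a setting of the same kind.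
\<close>

definition separating :: "complex \<Rightarrow> real \<Rightarrow> real \<Rightarrow> real \<Rightarrow> bool" where
  "separating x0 e0 e d \<longleftrightarrow> 0 < e \<and> e < e0 \<and> 0 < d \<and> ball x0 d \<subseteq> A \<and>
    (\<forall>y\<in>Z x0. cball y e \<subseteq> ball c R) \<and>
    (\<forall>y\<in>Z x0. \<forall>y'\<in>Z x0. y \<noteq> y' \<longrightarrow> cball y e \<inter> cball y' e = {}) \<and>
    (\<forall>y\<in>Z x0. weierstrass_disc f S a \<eta> v (ball x0 d) y e) \<and>
    (\<forall>y\<in>Z x0. zeros_in F y e x0 = {y}) \<and>
    (\<forall>x\<in>ball x0 d. Z x \<subseteq> (\<Union>y\<in>Z x0. ball y e))"

text \<open>
  The same configuration in the case that each of the discs contains a single zero.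
\<close>

definition sheets :: "complex \<Rightarrow> real \<Rightarrow> real \<Rightarrow> real \<Rightarrow> (complex \<Rightarrow> complex \<Rightarrow> complex) \<Rightarrow> bool" where
  "sheets x0 e0 e d \<phi> \<longleftrightarrow> 0 < e \<and> e < e0 \<and> 0 < d \<and> ball x0 d \<subseteq> A \<and>
    (\<forall>y\<in>Z x0. cball y e \<subseteq> ball c R) \<and>
    (\<forall>y\<in>Z x0. \<forall>y'\<in>Z x0. y \<noteq> y' \<longrightarrow> cball y e \<inter> cball y' e = {}) \<and>
    (\<forall>y\<in>Z x0. \<phi> y holomorphic_on ball x0 d) \<and>
    (\<forall>y\<in>Z x0. \<forall>x\<in>ball x0 d. zeros_in F y e x = {\<phi> y x}) \<and>
    (\<forall>x\<in>ball x0 d. Z x = (\<lambda>y. \<phi> y x) ` Z x0)"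

lemma separatingD:
  assumes "separating x0 e0 e d"
  shows "0 < e" "e < e0" "0 < d" "ball x0 d \<subseteq> A"
    "\<And>y. y \<in> Z x0 \<Longrightarrow> cball y e \<subseteq> ball c R"
    "\<And>y y'. y \<in> Z x0 \<Longrightarrow> y' \<in> Z x0 \<Longrightarrow> y \<noteq> y' \<Longrightarrow> cball y e \<inter> cball y' e = {}"
    "\<And>y. y \<in> Z x0 \<Longrightarrow> weierstrass_disc f S a \<eta> v (ball x0 d) y e"
    "\<And>y. y \<in> Z x0 \<Longrightarrow> zeros_in F y e x0 = {y}"
    "\<And>x. x \<in> ball x0 d \<Longrightarrow> Z x \<subseteq> (\<Union>y\<in>Z x0. ball y e)"
  using assms by (simp_all add: separating_def)

lemma sheetsD:
  assumes "sheets x0 e0 e d \<phi>"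
  shows "0 < e" "e < e0" "0 < d" "ball x0 d \<subseteq> A"
    "\<And>y. y \<in> Z x0 \<Longrightarrow> cball y e \<subseteq> ball c R"
    "\<And>y y'. y \<in> Z x0 \<Longrightarrow> y' \<in> Z x0 \<Longrightarrow> y \<noteq> y' \<Longrightarrow> cball y e \<inter> cball y' e = {}"
    "\<And>y. y \<in> Z x0 \<Longrightarrow> \<phi> y holomorphic_on ball x0 d"
    "\<And>y x. y \<in> Z x0 \<Longrightarrow> x \<in> ball x0 d \<Longrightarrow> zeros_in F y e x = {\<phi> y x}"
    "\<And>x. x \<in> ball x0 d \<Longrightarrow> Z x = (\<lambda>y. \<phi> y x) ` Z x0"
proof -
  note 1 = assms[unfolded sheets_def]
  note 2 = 1[THEN conjunct2] note 3 = 2[THEN conjunct2] note 4 = 3[THEN conjunct2]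
  note 5 = 4[THEN conjunct2] note 6 = 5[THEN conjunct2] note 7 = 6[THEN conjunct2]
  note 8 = 7[THEN conjunct2] note 9 = 8[THEN conjunct2]
  show "0 < e" "e < e0" "0 < d" "ball x0 d \<subseteq> A"
    by (rule 1[THEN conjunct1] 2[THEN conjunct1] 3[THEN conjunct1] 4[THEN conjunct1])+
  show "cball y e \<subseteq> ball c R" if "y \<in> Z x0" for y
    by (rule 5[THEN conjunct1, rule_format, OF that])
  show "cball y e \<inter> cball y' e = {}" if "y \<in> Z x0" "y' \<in> Z x0" "y \<noteq> y'" for y y'
    by (rule 6[THEN conjunct1, rule_format, OF that])
  show "\<phi> y holomorphic_on ball x0 d" if "y \<in> Z x0" for y
    by (rule 7[THEN conjunct1, rule_format, OF that])
  show "zeros_in F y e x = {\<phi> y x}" if "y \<in> Z x0" "x \<in> ball x0 d" for x y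
    by (rule 8[THEN conjunct1, rule_format, OF that])
  show "Z x = (\<lambda>y. \<phi> y x) ` Z x0" if "x \<in> ball x0 d" for x
    by (rule 9[rule_format, OF that])
qed

text \<open>
  The zeros vary continuously: \<open>F x0\<close> has no zero on the compact complement of the small discs, and by
  the tube lemma this remains true for parameters near \<open>x0\<close>.
\<close>

lemma zeros_stable:
  assumes x0: "x0 \<in> A" and e0: "e0 > 0"
  shows "\<exists>e d. separating x0 e0 e d"
proof -
  have fin: "finite (Z x0)" by (rule finite_Z[OF x0])
  have "\<exists>r>0. cball y r \<subseteq> ball c R \<and> (\<forall>y'\<in>Z x0. y' \<noteq> y \<longrightarrow> 2 * r < dist y y')" if y: "y \<in> Z x0" for y
  proof -
    have "y \<in> ball c R" using y by (simp add: zeros_in_def)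
    then obtain r1 where r1: "r1 > 0" "cball y r1 \<subseteq> ball c R" using open_contains_cball open_ball by blast
    obtain r2 where r2: "r2 > 0" "\<forall>y'\<in>Z x0. y' \<noteq> y \<longrightarrow> r2 \<le> dist y y'"
      using finite_set_avoid[OF fin, of y] by blast
    have "2 * min r1 (r2/3) < dist y y'" if "y' \<in> Z x0" "y' \<noteq> y" for y'
    proof -
      have "r2 \<le> dist y y'" "2 * min r1 (r2/3) \<le> 2 * (r2 / 3)" using r2(2) that by auto
      then show ?thesis using r2(1) by linarith
    qed
    moreover have "cball y (min r1 (r2/3)) \<subseteq> ball c R" using r1(2) by auto
    ultimately show ?thesis using r1 r2 by (intro exI[of _ "min r1 (r2/3)"]) auto
  qed
  then obtain r where r: "\<And>y. y \<in> Z x0 \<Longrightarrow> r y > 0 \<and> cball y (r y) \<subseteq> ball c R \<and> (\<forall>y'\<in>Z x0. y' \<noteq> y \<longrightarrow> 2 * r y < dist y y')"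
    by metis
  define e where "e = Min (insert (e0/2) (r ` Z x0))"
  have e: "e > 0" "e < e0" "\<And>y. y \<in> Z x0 \<Longrightarrow> e \<le> r y"
  proof -
    show "e > 0" unfolding e_def using fin r e0 by (subst Min_gr_iff) auto
    have "e \<le> e0/2" unfolding e_def using fin by (intro Min_le) auto
    then show "e < e0" using e0 by linarith
    show "e \<le> r y" if "y \<in> Z x0" for y unfolding e_def using fin that by (intro Min_le) auto
  qed
  have sub: "cball y e \<subseteq> ball c R" if "y \<in> Z x0" for y
    using r[OF that] e(3)[OF that] by (meson cball_subset_cball_iff order_trans subset_cball)
  have dj: "2 * e < dist y y'" if "y \<in> Z x0" "y' \<in> Z x0" "y \<noteq> y'" for y y'
    using r[OF that(1)] e(3)[OF that(1)] that by fastforce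
  have dj': "cball y e \<inter> cball y' e = {}" if "y \<in> Z x0" "y' \<in> Z x0" "y \<noteq> y'" for y y'
  proof (rule ccontr)
    assume "cball y e \<inter> cball y' e \<noteq> {}"
    then obtain u where "dist y u \<le> e" "dist y' u \<le> e" by (metis disjoint_iff mem_cball)
    then show False using dj[OF that] dist_triangle2[of y y' u] by linarith
  qed
  define K where "K = cball c R - (\<Union>y\<in>Z x0. ball y e)"
  have "compact K" unfolding K_def by (intro compact_diff compact_cball open_UN ballI open_ball)
  have K0: "F x0 y \<noteq> 0" if "y \<in> K" for y
  proof
    assume "F x0 y = 0"
    moreover have "y \<in> cball c R" "y \<notin> (\<Union>y\<in>Z x0. ball y e)" using that by (auto simp: K_def)
    moreover have "y \<in> Z x0"
      using calculation nz[OF x0, of y] by (auto simp: zeros_in_def dist_norm norm_minus_commute less_le)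
    ultimately show False using e(1) by (metis UN_I centre_in_ball)
  qed
  let ?D = "{z. (fst z \<in> A \<and> pt (fst z) (snd z) \<in> S) \<and> F (fst z) (snd z) \<noteq> 0}"
  have "open ?D"
  proof -
    have o1: "open {z :: complex \<times> complex. fst z \<in> A \<and> pt (fst z) (snd z) \<in> S}"
    proof -
      have "open (fst -` A \<inter> (\<lambda>z. pt (fst z) (snd z)) -` S)"
        by (intro open_Int open_vimage opA opS continuous_intros)
      then show ?thesis by (simp add: vimage_def Collect_conj_eq[symmetric])
    qed
    have "continuous_on {z. fst z \<in> A \<and> pt (fst z) (snd z) \<in> S} (\<lambda>z. F (fst z) (snd z))"
      by (intro continuous_on_compose2[OF Cn_holomorphic_continuous_on[OF hol]] continuous_intros) auto
    from continuous_open_preimage[OF this o1, of "- {0}"]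
    have "open ({z. fst z \<in> A \<and> pt (fst z) (snd z) \<in> S} \<inter> (\<lambda>z. F (fst z) (snd z)) -` (- {0}))" by auto
    moreover have "{z. fst z \<in> A \<and> pt (fst z) (snd z) \<in> S} \<inter> (\<lambda>z. F (fst z) (snd z)) -` (- {0}) = ?D" by auto
    ultimately show ?thesis by simp
  qed
  moreover have "{x0} \<times> K \<subseteq> ?D"
    using x0 K0 inS[OF x0] by (auto simp: K_def dist_norm norm_minus_commute)
  ultimately have "\<exists>X0. x0 \<in> X0 \<and> open X0 \<and> X0 \<times> K \<subseteq> ?D"
    by (rule Elementary_Topology.tube_lemma[OF \<open>compact K\<close>])
  then obtain X0 where X0: "x0 \<in> X0" "open X0" "X0 \<times> K \<subseteq> ?D" by blast
  have "open (X0 \<inter> A)" "x0 \<in> X0 \<inter> A" using X0 opA x0 by auto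
  then obtain d where d: "d > 0" "ball x0 d \<subseteq> X0 \<inter> A" using open_contains_ball by blast
  have nzK: "F x y \<noteq> 0" if "x \<in> ball x0 d" "y \<in> K" for x y
  proof -
    have "(x, y) \<in> X0 \<times> K" using d that by blast
    then have "(x, y) \<in> ?D" using X0(3) by blast
    then show ?thesis by simp
  qed
  have sphK: "y' \<in> K" if y: "y \<in> Z x0" and y': "cmod (y' - y) = e" for y y'
  proof -
    have "y' \<notin> ball u e" if "u \<in> Z x0" for u
    proof (cases "u = y")
      case True then show ?thesis using y' by (simp add: dist_norm norm_minus_commute)
    next
      case False
      have "y' \<in> cball y e" using y' by (simp add: dist_norm norm_minus_commute)
      then show ?thesis using dj'[OF y that] False by (auto simp: disjoint_iff)
    qed
    moreover have "y' \<in> cball y e" using y' by (simp add: dist_norm norm_minus_commute)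
    then have "y' \<in> cball c R" using sub[OF y] ball_subset_cball by blast
    ultimately show ?thesis unfolding K_def by auto
  qed
  show ?thesis
  unfolding separating_def
  proof (rule exI[of _ e], rule exI[of _ d], intro conjI ballI impI)
    fix y assume y: "y \<in> Z x0"
    show "weierstrass_disc f S a \<eta> v (ball x0 d) y e"
    proof
      fix x y' assume x: "x \<in> ball x0 d"
      show "pt x y' \<in> S" if "cmod (y' - y) \<le> e"
      proof -
        have "y' \<in> cball y e" using that by (simp add: dist_norm norm_minus_commute)
        then have "y' \<in> ball c R" using sub[OF y] by blast
        then show ?thesis using inS[of x y'] x d by (auto simp: dist_norm norm_minus_commute)
      qed
      show "f (pt x y') \<noteq> 0" if "cmod (y' - y) = e" using nzK[OF x sphK[OF y that]] .
    qed (use hol opS e in auto)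
    show "zeros_in F y e x0 = {y}"
    proof -
      have "u = y" if "u \<in> ball y e" "F x0 u = 0" for u
      proof (rule ccontr)
        assume "u \<noteq> y"
        moreover have "u \<in> Z x0" using that sub[OF y] by (auto simp: zeros_in_def subset_eq)
        ultimately show False using dj[OF y, of u] that e(1) by auto
      qed
      moreover have "y \<in> zeros_in F y e x0" using y e(1) by (auto simp: zeros_in_def)
      ultimately show ?thesis by (auto simp: zeros_in_def)
    qed
  next
    fix x assume x: "x \<in> ball x0 d"
    show "Z x \<subseteq> (\<Union>y\<in>Z x0. ball y e)"
    proof
      fix u assume u: "u \<in> Z x"
      then have "u \<notin> K" using nzK[OF x] by (auto simp: zeros_in_def)
      then show "u \<in> (\<Union>y\<in>Z x0. ball y e)" using u by (auto simp: K_def zeros_in_def)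
    qed
  qed (use e d sub dj' in auto)
qed

text \<open>
  No zero disappears: the number of zeros in a small disc about \<open>y0\<close> is constant and positive.
\<close>

lemma zeros_lower:
  assumes x0: "x0 \<in> A" and y0: "y0 \<in> Z x0" and e0: "e0 > 0"
  obtains d where "d > 0" "ball x0 d \<subseteq> A" "\<And>x. x \<in> ball x0 d \<Longrightarrow> \<exists>y\<in>Z x. dist y0 y < e0"
proof -
  obtain e d where "separating x0 e0 e d" using zeros_stable[OF x0 e0] by blast
  note ed = separatingD[OF this]
  interpret sub: weierstrass_disc f S a \<eta> v "ball x0 d" y0 e by (rule ed(7)[OF y0])
  show ?thesis
  proof (rule that[OF ed(3,4)])
    fix x assume x: "x \<in> ball x0 d"
    have x0': "x0 \<in> ball x0 d" using ed by simp
    have "sub.num x = sub.num x0" by (rule sub.num_constant[OF x x0'])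
    also have "\<dots> > 0" using sub.mult_pos(1)[OF x0', of y0] ed(8)[OF y0] by (simp add: sub.num_def)
    finally have "zeros_in F y0 e x \<noteq> {}" by (auto simp: sub.num_def)
    then show "\<exists>y\<in>Z x. dist y0 y < e0" using ed(2) ed(5)[OF y0] by (force simp: zeros_in_def)
  qed
qed

text \<open>
  Each small disc about a zero over \<open>x0\<close> contains at least one zero over every nearby parameter, and if
  the number of distinct zeros is maximal at \<open>x0\<close>, it contains no other one.
\<close>

lemma local_sheets:
  assumes x0: "x0 \<in> A" and e0: "e0 > 0" and mx: "\<And>x. x \<in> A \<Longrightarrow> card (Z x) \<le> card (Z x0)"
  shows "\<exists>e d \<phi>. sheets x0 e0 e d \<phi>"
proof -
  obtain e d where "separating x0 e0 e d" using zeros_stable[OF x0 e0] by blast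
  note ed = separatingD[OF this]
  have x0': "x0 \<in> ball x0 d" using ed by simp
  have fin: "finite (zeros_in F y e x)" if "y \<in> Z x0" "x \<in> ball x0 d" for x y
    using weierstrass_disc.finite_Z[OF ed(7)[OF that(1)] that(2)] .
  have ge1: "card (zeros_in F y e x) \<ge> 1" if y: "y \<in> Z x0" and x: "x \<in> ball x0 d" for x y
  proof -
    interpret sub: weierstrass_disc f S a \<eta> v "ball x0 d" y e by (rule ed(7)[OF y])
    have "sub.num x = sub.num x0" by (rule sub.num_constant[OF x x0'])
    also have "\<dots> > 0" using sub.mult_pos(1)[OF x0', of y] ed(8)[OF y] by (simp add: sub.num_def)
    finally have "zeros_in F y e x \<noteq> {}" by (auto simp: sub.num_def)
    then show ?thesis using fin[OF y x] by (simp add: Suc_le_eq card_gt_0_iff)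
  qed
  have Zx: "Z x = (\<Union>y\<in>Z x0. zeros_in F y e x)" if x: "x \<in> ball x0 d" for x
  proof
    show "Z x \<subseteq> (\<Union>y\<in>Z x0. zeros_in F y e x)"
      using ed(9)[OF x] unfolding zeros_in_def by blast
    show "(\<Union>y\<in>Z x0. zeros_in F y e x) \<subseteq> Z x"
      using ed(5) ball_subset_cball unfolding zeros_in_def by blast
  qed
  have one: "card (zeros_in F y e x) = 1" if y: "y \<in> Z x0" and x: "x \<in> ball x0 d" for x y
  proof -
    have "card (Z x) = (\<Sum>y\<in>Z x0. card (zeros_in F y e x))"
      unfolding Zx[OF x]
    proof (rule card_UN_disjoint)
      show "\<forall>y\<in>Z x0. \<forall>y'\<in>Z x0. y \<noteq> y' \<longrightarrow> zeros_in F y e x \<inter> zeros_in F y' e x = {}"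
      proof (intro ballI impI)
        fix y y' assume "y \<in> Z x0" "y' \<in> Z x0" "y \<noteq> y'"
        from ed(6)[OF this] show "zeros_in F y e x \<inter> zeros_in F y' e x = {}"
          unfolding zeros_in_def using ball_subset_cball by blast
      qed
    qed (use finite_Z[OF x0] fin x in auto)
    moreover have "card (Z x) \<le> card (Z x0)" using mx[of x] x ed(4) by blast
    ultimately have le: "(\<Sum>y\<in>Z x0. card (zeros_in F y e x)) \<le> (\<Sum>y\<in>Z x0. 1)" by simp
    show ?thesis
    proof (rule ccontr)
      assume "card (zeros_in F y e x) \<noteq> 1"
      then have "1 < card (zeros_in F y e x)" using ge1[OF y x] by linarith
      then have "(\<Sum>y\<in>Z x0. 1) < (\<Sum>y\<in>Z x0. card (zeros_in F y e x))"
        by (intro sum_strict_mono_ex1 finite_Z[OF x0]) (use ge1 x y in auto)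
      with le show False by linarith
    qed
  qed
  have "\<exists>\<phi>. \<phi> holomorphic_on ball x0 d \<and> (\<forall>x\<in>ball x0 d. zeros_in F y e x = {\<phi> x})" if y: "y \<in> Z x0" for y
  proof -
    interpret sub: weierstrass_disc f S a \<eta> v "ball x0 d" y e by (rule ed(7)[OF y])
    obtain \<phi> where "\<phi> holomorphic_on ball x0 d" "\<And>x. x \<in> ball x0 d \<Longrightarrow> zeros_in F y e x = {\<phi> x}"
      using sub.single_zero_holomorphic one[OF y] x0' by (metis empty_iff)
    then show ?thesis by blast
  qed
  then obtain \<phi> where \<phi>: "\<And>y. y \<in> Z x0 \<Longrightarrow> \<phi> y holomorphic_on ball x0 d"
     "\<And>y x. y \<in> Z x0 \<Longrightarrow> x \<in> ball x0 d \<Longrightarrow> zeros_in F y e x = {\<phi> y x}" by metis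
  have "Z x = (\<lambda>y. \<phi> y x) ` Z x0" if x: "x \<in> ball x0 d" for x
    unfolding Zx[OF x] using \<phi>(2)[OF _ x] by auto
  then have "sheets x0 e0 e d \<phi>"
    unfolding sheets_def by (intro conjI ballI impI ed \<phi>)
  then show ?thesis by blast
qed

end

section \<open>Sheets of the zero set\<close>

lemma Cn_holomorphic_const: "Cn_holomorphic_on (\<lambda>z. c) S"
  by (rule Cn_holomorphic_onI[where f'="\<lambda>x v. 0"]) auto

lemma Cn_holomorphic_add:
  assumes "Cn_holomorphic_on f S" "Cn_holomorphic_on g S"
  shows "Cn_holomorphic_on (\<lambda>z. f z + g z) S"
proof (rule Cn_holomorphic_onI)
  fix x assume x: "x \<in> S"
  show "((\<lambda>z. f z + g z) has_derivative (\<lambda>v. frechet_derivative f (at x) v + frechet_derivative g (at x) v)) (at x)"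
    by (intro has_derivative_add Cn_holomorphic_has_derivative(1)[OF assms(1) x] Cn_holomorphic_has_derivative(1)[OF assms(2) x])
  show "frechet_derivative f (at x) (c *s v) + frechet_derivative g (at x) (c *s v) =
      c * (frechet_derivative f (at x) v + frechet_derivative g (at x) v)" for c v
    unfolding Cn_holomorphic_has_derivative(2)[OF assms(1) x] Cn_holomorphic_has_derivative(2)[OF assms(2) x]
    by (simp add: algebra_simps)
qed

lemma Cn_holomorphic_mult:
  assumes "Cn_holomorphic_on f S" "Cn_holomorphic_on g S"
  shows "Cn_holomorphic_on (\<lambda>z. f z * g z) S"
proof (rule Cn_holomorphic_onI)
  fix x assume x: "x \<in> S"
  show "((\<lambda>z. f z * g z) has_derivative (\<lambda>v. f x * frechet_derivative g (at x) v + frechet_derivative f (at x) v * g x)) (at x)"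
    by (intro has_derivative_mult Cn_holomorphic_has_derivative(1)[OF assms(1) x] Cn_holomorphic_has_derivative(1)[OF assms(2) x])
  show "f x * frechet_derivative g (at x) (c *s v) + frechet_derivative f (at x) (c *s v) * g x =
      c * (f x * frechet_derivative g (at x) v + frechet_derivative f (at x) v * g x)" for c v
    unfolding Cn_holomorphic_has_derivative(2)[OF assms(1) x] Cn_holomorphic_has_derivative(2)[OF assms(2) x]
    by (simp add: algebra_simps)
qed

lemma Cn_holomorphic_sum:
  "(\<And>i. i \<in> I \<Longrightarrow> Cn_holomorphic_on (f i) S) \<Longrightarrow> Cn_holomorphic_on (\<lambda>z. \<Sum>i\<in>I. f i z) S"
  by (induction I rule: infinite_finite_induct) (auto intro: Cn_holomorphic_const Cn_holomorphic_add)

lemma Cn_holomorphic_power: "Cn_holomorphic_on f S \<Longrightarrow> Cn_holomorphic_on (\<lambda>z. f z ^ n) S"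
  by (induction n) (auto intro: Cn_holomorphic_const Cn_holomorphic_mult)

lemma Cn_holomorphic_of_coordinate:
  assumes "\<phi> holomorphic_on T" "open T" "\<And>z. z \<in> S \<Longrightarrow> herm (z - a) u \<in> T"
  shows "Cn_holomorphic_on (\<lambda>z. \<phi> (herm (z - a) u)) S"
proof (rule Cn_holomorphic_onI)
  fix x assume x: "x \<in> S"
  have "(\<phi> has_field_derivative deriv \<phi> (herm (x - a) u)) (at (herm (x - a) u))"
    using holomorphic_derivI[OF assms(1,2) assms(3)[OF x]] .
  then have d: "(\<phi> has_derivative (\<lambda>h. deriv \<phi> (herm (x - a) u) * h)) (at (herm (x - a) u))"
    by (simp add: has_field_derivative_def)
  have "((\<lambda>z. z - a) has_derivative (\<lambda>h. h)) (at x)" by (auto intro!: derivative_eq_intros)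
  then have "((\<lambda>z. herm (z - a) u) has_derivative (\<lambda>h. herm h u)) (at x)"
    by (rule bounded_linear.has_derivative[OF bounded_linear_herm])
  from has_derivative_compose[OF this d]
  show "((\<lambda>z. \<phi> (herm (z - a) u)) has_derivative (\<lambda>h. deriv \<phi> (herm (x - a) u) * herm h u)) (at x)" .
qed (simp add: herm_smult)

lemma Cn_holomorphic_coordinate: "Cn_holomorphic_on (\<lambda>z. herm (z - a) u) S"
  using Cn_holomorphic_of_coordinate[of "\<lambda>x. x" UNIV S a u] by (simp add: holomorphic_on_id[unfolded id_def])

lemma affine_pt_coordinates:
  assumes "unitary_frame \<eta> v"
  shows "herm (affine_pt a \<eta> v x y - a) \<eta> = x" "herm (affine_pt a \<eta> v x y - a) v = y"
    "affine_pt a \<eta> v (herm (z - a) \<eta>) (herm (z - a) v) = z"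
  using unitary_frameD[OF assms] unitary_frame_decomp[OF assms, of "z - a"]
  by (simp_all add: affine_pt_def herm_add herm_diff herm_smult add.assoc)

context weierstrass_disc
begin

text \<open>
  A minimal defining function has simple zeros over a generic point: where the number of distinct
  zeros is maximal, the zero set is a graph \<open>y = \<phi> x\<close> near each of them, and \<open>y - \<phi> x\<close> is not a
  multiple of \<open>f\<close> if \<open>\<partial>f/\<partial>y\<close> vanishes.
\<close>

lemma minimal_imp_disc_nonzero:
  assumes fr: "unitary_frame \<eta> v" and ne: "A \<noteq> {}"
    and min: "\<And>V h. open V \<Longrightarrow> V \<subseteq> S \<Longrightarrow> Cn_holomorphic_on h V \<Longrightarrow> (\<forall>z\<in>V. f z = 0 \<longrightarrow> h z = 0) \<Longrightarrow>
       \<exists>q. Cn_holomorphic_on q V \<and> (\<forall>z\<in>V. h z = f z * q z)"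
  shows "\<exists>x\<in>A. disc x \<noteq> 0"
proof -
  obtain x1 where x1: "x1 \<in> A" using ne by blast
  have "\<exists>x. x \<in> A \<and> (\<forall>x'. x' \<in> A \<longrightarrow> card (Z x') \<le> card (Z x))"
  proof (rule ex_has_greatest_nat)
    show "x1 \<in> A" by (rule x1)
    show "\<forall>x'. x' \<in> A \<longrightarrow> card (Z x') < Suc (num x1)"
      using card_Z_le_num num_constant[OF _ x1] by (metis le_imp_less_Suc)
  qed
  then obtain x0 where x0: "x0 \<in> A" "\<And>x'. x' \<in> A \<Longrightarrow> card (Z x') \<le> card (Z x0)" by blast
  have "disc x0 \<noteq> 0"
  proof
    assume "disc x0 = 0"
    then obtain y where y: "y \<in> Z x0" "F2 x0 y = 0" using disc_nonzero_iff[OF x0(1)] by blast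
    obtain e d \<phi> where "sheets x0 1 e d \<phi>" using local_sheets[OF x0(1) zero_less_one x0(2)] by blast
    note sh = sheetsD[OF this]
    have x0d: "x0 \<in> ball x0 d" using sh(3) by simp
    define V where "V = {z. herm (z - a) \<eta> \<in> ball x0 d \<and> herm (z - a) v \<in> ball y e}"
    have coord: "pt (herm (z - a) \<eta>) (herm (z - a) v) = z" for z
      using affine_pt_coordinates(3)[OF fr] .
    have "open ((\<lambda>z. herm (z - a) \<eta>) -` ball x0 d \<inter> (\<lambda>z. herm (z - a) v) -` ball y e)"
      by (intro open_Int open_vimage continuous_intros open_ball)
    then have V: "open V" by (simp add: V_def vimage_def Collect_conj_eq[symmetric])
    have VS: "V \<subseteq> S"
    proof
      fix z assume z: "z \<in> V"
      have "herm (z - a) v \<in> ball c R" using z sh(5)[OF y(1)] ball_subset_cball unfolding V_def by blast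
      then have "pt (herm (z - a) \<eta>) (herm (z - a) v) \<in> S"
        using inS z sh(4) by (auto simp: V_def dist_norm norm_minus_commute)
      then show "z \<in> S" unfolding coord .
    qed
    define h where "h z = herm (z - a) v + (- 1) * \<phi> y (herm (z - a) \<eta>)" for z
    have hh: "Cn_holomorphic_on h V"
      unfolding h_def
      by (intro Cn_holomorphic_add Cn_holomorphic_coordinate Cn_holomorphic_mult Cn_holomorphic_const
          Cn_holomorphic_of_coordinate[OF sh(7)[OF y(1)] open_ball]) (simp add: V_def)
    have "\<forall>z\<in>V. f z = 0 \<longrightarrow> h z = 0"
    proof (intro ballI impI)
      fix z assume z: "z \<in> V" "f z = 0"
      have "f (pt (herm (z - a) \<eta>) (herm (z - a) v)) = 0" unfolding coord by (rule z(2))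
      then have "herm (z - a) v \<in> zeros_in F y e (herm (z - a) \<eta>)"
        using z(1) unfolding zeros_in_def V_def by simp
      then show "h z = 0" using sh(8)[OF y(1)] z(1) by (simp add: V_def h_def)
    qed
    from min[OF V VS hh this] obtain q where q: "Cn_holomorphic_on q V" "\<And>z. z \<in> V \<Longrightarrow> h z = f z * q z" by blast
    define z0 where "z0 = pt x0 y"
    have c0: "herm (z0 - a) \<eta> = x0" "herm (z0 - a) v = y"
      unfolding z0_def using affine_pt_coordinates[OF fr] by auto
    have z0V: "z0 \<in> V" using sh(1,3) by (simp add: V_def c0)
    have hv: "dir_derivs h [v] z0 = 1"
    proof -
      have "h (z0 + t *s v) = t + (y - \<phi> y x0)" for t
      proof -
        have 1: "z0 + t *s v - a = (z0 - a) + t *s v" by simp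
        have "herm (z0 + t *s v - a) \<eta> = x0" "herm (z0 + t *s v - a) v = y + t"
          unfolding 1 herm_add herm_smult c0 using unitary_frameD[OF fr] by auto
        then show ?thesis by (simp add: h_def)
      qed
      then have "((\<lambda>t. h (z0 + t *s v)) has_field_derivative 1) (at 0)"
        by (auto intro!: derivative_eq_intros)
      moreover have "((\<lambda>t. h (z0 + t *s v)) has_field_derivative dir_derivs h [v] z0) (at 0)"
        using Cn_holomorphic_along_line[OF hh, of z0 0 v] z0V by simp
      ultimately show ?thesis by (metis DERIV_unique)
    qed
    have fz: "f z0 = 0" using y(1) by (simp add: zeros_in_def z0_def)
    have "dir_derivs h [v] z0 = dir_derivs (\<lambda>z. f z * q z) [v] z0"
      by (rule dir_derivs_cong_open[OF V q(2) z0V])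
    also have "\<dots> = f z0 * dir_derivs q [v] z0 + dir_derivs f [v] z0 * q z0"
    proof (rule frechet_mult)
      show "f differentiable at z0" "q differentiable at z0"
        using Cn_holomorphic_has_derivative(1)[OF hol, of z0] Cn_holomorphic_has_derivative(1)[OF q(1) z0V] VS z0V
        by (auto simp: differentiable_def)
    qed
    also have "\<dots> = 0" using fz y(2) by (simp add: z0_def)
    finally show False using hv by simp
  qed
  then show ?thesis using x0 by blast
qed

definition sheet :: "(complex \<Rightarrow> complex) \<Rightarrow> bool" where
  "sheet \<phi> \<longleftrightarrow> \<phi> holomorphic_on A \<and> (\<forall>x\<in>A. \<phi> x \<in> Z x)"

text \<open>
  Locally, a continuous choice of zeros is one of the holomorphic sheets.
\<close>

lemma continuous_section_holomorphic:
  assumes disc: "\<And>x. x \<in> A \<Longrightarrow> disc x \<noteq> 0"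
    and \<phi>: "continuous_on A \<phi>" "\<And>x. x \<in> A \<Longrightarrow> \<phi> x \<in> Z x"
  shows "sheet \<phi>"
  unfolding sheet_def
proof (intro conjI ballI \<phi>)
  have "\<exists>T. open T \<and> x0 \<in> T \<and> \<phi> holomorphic_on T" if x0: "x0 \<in> A" for x0
  proof -
    have mx: "card (Z x') \<le> card (Z x0)" if "x' \<in> A" for x'
      using disc_nonzero_card[OF _ disc] num_constant[OF x0 that] x0 that by simp
    obtain e d \<psi> where "sheets x0 1 e d \<psi>" using local_sheets[OF x0 zero_less_one mx] by blast
    note sh = sheetsD[OF this]
    have "open (A \<inter> \<phi> -` ball (\<phi> x0) e)" by (rule continuous_open_preimage[OF \<phi>(1) opA open_ball])
    then have o: "open (A \<inter> \<phi> -` ball (\<phi> x0) e \<inter> ball x0 d)" by auto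
    have "\<psi> (\<phi> x0) holomorphic_on (A \<inter> \<phi> -` ball (\<phi> x0) e \<inter> ball x0 d)"
      by (rule holomorphic_on_subset[OF sh(7)[OF \<phi>(2)[OF x0]]]) auto
    then have "\<phi> holomorphic_on (A \<inter> \<phi> -` ball (\<phi> x0) e \<inter> ball x0 d)"
    proof (rule holomorphic_transform)
      fix x assume x: "x \<in> A \<inter> \<phi> -` ball (\<phi> x0) e \<inter> ball x0 d"
      then have "\<phi> x \<in> zeros_in F (\<phi> x0) e x" using \<phi>(2)[of x] by (auto simp: zeros_in_def)
      then show "\<psi> (\<phi> x0) x = \<phi> x" using sh(8)[OF \<phi>(2)[OF x0]] x by auto
    qed
    moreover have "x0 \<in> A \<inter> \<phi> -` ball (\<phi> x0) e \<inter> ball x0 d" using x0 sh(1,3) by simp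
    ultimately show ?thesis using o by blast
  qed
  then show "\<phi> holomorphic_on A"
    by (metis analytic_on_def analytic_imp_holomorphic open_contains_ball holomorphic_on_subset)
qed

text \<open>
  Where the discriminant has no zero, the number of distinct zeros is constant, and the sheets trivialize
  the zero set locally.
\<close>

lemma zeros_covering:
  assumes disc: "\<And>x. x \<in> A \<Longrightarrow> disc x \<noteq> 0" and xz: "x1 \<in> A" "Z x1 \<noteq> {}"
  shows "covering_space {p. fst p \<in> A \<and> snd p \<in> Z (fst p)} fst A" (is "covering_space ?C fst A")
proof
  show "continuous_on ?C fst" by (intro continuous_intros)
  have cz: "card (Z x) = card (Z x1)" if "x \<in> A" for x
    using disc_nonzero_card[OF _ disc] num_constant[OF xz(1) that] xz(1) that by simp
  have pos: "card (Z x1) > 0" using xz finite_Z by (simp add: card_gt_0_iff)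
  have ne: "Z x \<noteq> {}" if "x \<in> A" for x using cz[OF that] pos by auto
  show "fst ` ?C = A"
  proof
    show "A \<subseteq> fst ` ?C"
    proof
      fix x assume "x \<in> A"
      moreover obtain y where "y \<in> Z x" using ne[OF \<open>x \<in> A\<close>] by blast
      ultimately show "x \<in> fst ` ?C" by (intro image_eqI[of _ _ "(x, y)"]) auto
    qed
  qed auto
  fix x0 assume x0: "x0 \<in> A"
  have mx: "card (Z x') \<le> card (Z x0)" if "x' \<in> A" for x' using cz x0 that by simp
  obtain e d \<phi> where "sheets x0 1 e d \<phi>" using local_sheets[OF x0 zero_less_one mx] by blast
  note sh = sheetsD[OF this]
  let ?T = "ball x0 d"
  define U where "U y = ?C \<inter> (?T \<times> ball y e)" for y
  have inU: "p \<in> U y \<longleftrightarrow> fst p \<in> ?T \<and> snd p = \<phi> y (fst p)" if y: "y \<in> Z x0" for p y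
  proof
    assume "p \<in> U y"
    then have "fst p \<in> ?T" "snd p \<in> zeros_in F y e (fst p)" by (auto simp: U_def zeros_in_def)
    then show "fst p \<in> ?T \<and> snd p = \<phi> y (fst p)" using sh(8)[OF y] by auto
  next
    assume p: "fst p \<in> ?T \<and> snd p = \<phi> y (fst p)"
    then have "snd p \<in> zeros_in F y e (fst p)" using sh(8)[OF y] by auto
    then have "snd p \<in> ball y e" by (simp add: zeros_in_def)
    moreover have "snd p \<in> Z (fst p)" using sh(9)[of "fst p"] p y by auto
    ultimately show "p \<in> U y" using p sh(4) by (auto simp: U_def mem_Times_iff)
  qed
  show "\<exists>T. x0 \<in> T \<and> openin (top_of_set A) T \<and>
      (\<exists>v. \<Union>v = ?C \<inter> fst -` T \<and> (\<forall>u\<in>v. openin (top_of_set ?C) u) \<and> pairwise disjnt v \<and>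
         (\<forall>u\<in>v. \<exists>q. homeomorphism u T fst q))"
  proof (rule exI[of _ ?T], intro conjI, goal_cases)
    case 1 show ?case using sh(3) by simp
  next
    case 2 show ?case using sh(4) open_openin_trans opA by blast
  next
    case 3
    show ?case
    proof (rule exI[of _ "U ` Z x0"], intro conjI ballI)
      show "\<Union> (U ` Z x0) = ?C \<inter> fst -` ?T"
      proof
        show "\<Union> (U ` Z x0) \<subseteq> ?C \<inter> fst -` ?T" by (auto simp: U_def)
        show "?C \<inter> fst -` ?T \<subseteq> \<Union> (U ` Z x0)"
        proof
          fix p assume p: "p \<in> ?C \<inter> fst -` ?T"
          then obtain y where "y \<in> Z x0" "snd p = \<phi> y (fst p)" using sh(9)[of "fst p"] by auto
          then show "p \<in> \<Union> (U ` Z x0)" using inU[of y p] p by auto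
        qed
      qed
      show "openin (top_of_set ?C) u" if "u \<in> U ` Z x0" for u
        using that unfolding U_def by (auto intro!: openin_open_Int open_Times)
      show "pairwise disjnt (U ` Z x0)"
      proof (rule pairwise_imageI)
        fix y y' assume yy: "y \<in> Z x0" "y' \<in> Z x0" "y \<noteq> y'"
        have "ball y e \<inter> ball y' e = {}" using sh(6)[OF yy] ball_subset_cball by blast
        then show "disjnt (U y) (U y')" by (auto simp: disjnt_def U_def)
      qed
      fix u assume "u \<in> U ` Z x0"
      then obtain y where y: "y \<in> Z x0" "u = U y" by blast
      have "homeomorphism u ?T fst (\<lambda>x. (x, \<phi> y x))"
      proof
        show "continuous_on u fst" by (intro continuous_intros)
        show "continuous_on ?T (\<lambda>x. (x, \<phi> y x))"
          by (intro continuous_intros holomorphic_on_imp_continuous_on sh(7) y)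
        show "fst ` u \<subseteq> ?T" unfolding y(2) U_def by auto
        show "(\<lambda>x. (x, \<phi> y x)) ` ?T \<subseteq> u" unfolding y(2) using inU[OF y(1)] by auto
        show "(fst p, \<phi> y (fst p)) = p" if "p \<in> u" for p
          using inU[OF y(1), of p] that y(2) by (metis prod.collapse)
        show "fst (x, \<phi> y x) = x" for x by simp
      qed
      then show "\<exists>q. homeomorphism u ?T fst q" by blast
    qed
  qed
qed

text \<open>
  The parameter domain is simply connected, so its identity map lifts to the covering by the zeros.
\<close>

lemma sheet_through:
  assumes disc: "\<And>x. x \<in> A \<Longrightarrow> disc x \<noteq> 0" and x0: "x0 \<in> A" "y0 \<in> Z x0"
  shows "\<exists>\<phi>. sheet \<phi> \<and> \<phi> x0 = y0"
proof -
  have cov: "covering_space {p. fst p \<in> A \<and> snd p \<in> Z (fst p)} fst A" (is "covering_space ?C fst A")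
    by (rule zeros_covering[OF disc x0(1)]) (use x0 in auto)
  obtain g where g: "continuous_on A g" "g \<in> A \<rightarrow> ?C" "g x0 = (x0, y0)" "\<And>x. x \<in> A \<Longrightarrow> fst (g x) = x"
  proof (rule covering_space_lift_strong[OF cov, of "(x0, y0)" x0 A "\<lambda>x. x"])
    show "simply_connected A" using convex_imp_simply_connected[OF cvA] .
    show "locally path_connected A" using convex_imp_locally_path_connected[OF cvA] .
  qed (use x0 in \<open>auto intro: that\<close>)
  have "sheet (\<lambda>x. snd (g x))"
  proof (rule continuous_section_holomorphic[OF disc])
    show "continuous_on A (\<lambda>x. snd (g x))" by (intro continuous_intros g)
    show "snd (g x) \<in> Z x" if "x \<in> A" for x
    proof -
      have "g x \<in> ?C" using g(2) that by (rule funcset_mem)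
      then show ?thesis using g(4)[OF that] by simp
    qed
  qed
  then show ?thesis using g(3) by (intro exI[of _ "\<lambda>x. snd (g x)"]) simp
qed

lemma sheet_unique:
  assumes disc: "\<And>x. x \<in> A \<Longrightarrow> disc x \<noteq> 0" and \<phi>: "sheet \<phi>" "sheet \<psi>"
    and x0: "x0 \<in> A" "\<phi> x0 = \<psi> x0" and x: "x \<in> A"
  shows "\<phi> x = \<psi> x"
proof -
  have cov: "covering_space {p. fst p \<in> A \<and> snd p \<in> Z (fst p)} fst A"
    by (rule zeros_covering[OF disc x0(1)]) (use x0 \<phi> in \<open>auto simp: sheet_def\<close>)
  have cont: "continuous_on A \<phi>" "continuous_on A \<psi>"
    using \<phi> holomorphic_on_imp_continuous_on by (auto simp: sheet_def)
  have "(x, \<phi> x) = (x, \<psi> x)"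
    by (rule covering_space_lift_unique[of _ fst A "\<lambda>x. (x, \<phi> x)" x0 "\<lambda>x. (x, \<psi> x)" A "\<lambda>x. x", OF cov])
      (use \<phi> x0 x convex_connected[OF cvA] cont in \<open>auto simp: sheet_def intro!: continuous_intros\<close>)
  then show ?thesis by simp
qed

end

text \<open>Cauchy's estimate for a function of linear growth, on a disc whose size is that of its centre.\<close>

lemma linear_growth_lipschitz:
  assumes h: "\<phi> holomorphic_on ball a (cmod a / 2)" and a: "a \<noteq> 0"
    and bd: "\<And>x. x \<in> ball a (cmod a / 2) \<Longrightarrow> cmod (\<phi> x) \<le> M * cmod x" and M: "M \<ge> 0"
    and x: "x \<in> ball a (cmod a / 4)" "x' \<in> ball a (cmod a / 4)"
  shows "cmod (\<phi> x - \<phi> x') \<le> 8 * M * cmod (x - x')"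
proof (rule field_differentiable_bound[OF convex_ball])
  fix z assume z: "z \<in> ball a (cmod a / 4)"
  have a': "cmod a > 0" using a by simp
  have sub: "w \<in> ball a (cmod a / 2)" if "w \<in> cball z (cmod a / 5)" for w
  proof -
    have "dist a z < cmod a / 4" "dist z w \<le> cmod a / 5" using z that by auto
    then have "dist a w < cmod a / 2" using dist_triangle[of a w z] a' by linarith
    then show ?thesis by simp
  qed
  have "(\<phi> has_field_derivative deriv \<phi> z) (at z)"
    by (rule holomorphic_derivI[OF h open_ball]) (rule sub, use a' in simp)
  then show "(\<phi> has_field_derivative deriv \<phi> z) (at z within ball a (cmod a / 4))"
    by (rule DERIV_subset) simp
  have "cmod ((deriv ^^ 1) \<phi> z) \<le> fact 1 * (3/2 * M * cmod a) / (cmod a / 5) ^ 1"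
  proof (rule Cauchy_inequality)
    show "\<phi> holomorphic_on ball z (cmod a / 5)" "continuous_on (cball z (cmod a / 5)) \<phi>"
      using sub holomorphic_on_subset[OF h] holomorphic_on_imp_continuous_on
      by (meson ball_subset_cball order_trans subsetI)+
    fix w assume "cmod (z - w) = cmod a / 5"
    then have w: "w \<in> ball a (cmod a / 2)" by (intro sub) (simp add: dist_norm)
    have "cmod w \<le> 3/2 * cmod a" using w norm_triangle_ineq[of "w - a" a] by (simp add: dist_norm norm_minus_commute)
    then have "M * cmod w \<le> M * (3/2 * cmod a)" using M by (rule mult_left_mono)
    then show "cmod (\<phi> w) \<le> 3/2 * M * cmod a" using bd[OF w] by simp
  qed (use a' in auto)
  also have "\<dots> \<le> 8 * M" using a' M by simp
  finally show "cmod (deriv \<phi> z) \<le> 8 * M" by simp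
qed (use x in auto)

section \<open>Interpolation on the zeros\<close>

text \<open>
  The interpolation polynomial, defined by Neville's recursion because it runs parallel to the recursion
  of the divided differences, which are the leading coefficients.
\<close>

fun neville :: "(complex \<Rightarrow> complex) \<Rightarrow> complex list \<Rightarrow> complex poly" where
  "neville h [] = 0"
| "neville h [x] = [:h x:]"
| "neville h (x # y # ys) = smult (1 / (x - last (y # ys)))
     ([:- last (y # ys), 1:] * neville h (butlast (x # y # ys)) - [:- x, 1:] * neville h (y # ys))"

lemma coeff_linear_mult: "coeff ([:b, 1:] * p) (Suc n) = coeff p n + b * coeff p (Suc n)"
  for p :: "complex poly" by simp

lemma neville_degree: "ls \<noteq> [] \<Longrightarrow> degree (neville h ls) < length ls"
proof (induction h ls rule: neville.induct)
  case (3 h x y ys)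
  define zs where "zs = butlast (x # y # ys)"
  have zs: "zs \<noteq> []" "length zs = Suc (length ys)" by (simp_all add: zs_def)
  let ?p = "neville h zs" and ?q = "neville h (y # ys)"
  have lin: "degree ([:b, 1:] * r) \<le> Suc (degree r)" for b and r :: "complex poly"
    using degree_mult_le[of "[:b, 1:]" r] by simp
  have "degree ?p < length (y # ys)" using 3(1)[folded zs_def, OF zs(1)] zs(2) by simp
  moreover have "degree ?q < length (y # ys)" using 3(2) by simp
  ultimately have "degree ([:- last (y # ys), 1:] * ?p - [:- x, 1:] * ?q) \<le> length (y # ys)"
    by (intro degree_diff_le order_trans[OF lin]) auto
  then have "degree (neville h (x # y # ys)) \<le> length (y # ys)"
    unfolding neville.simps zs_def by (rule order_trans[OF degree_smult_le])
  then show ?case by simp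
qed auto

lemma neville_top_coeff:
  "ls \<noteq> [] \<Longrightarrow> coeff (neville h ls) (length ls - 1) = divided_diff h ls"
proof (induction h ls rule: neville.induct)
  case (3 h x y ys)
  define zs where "zs = butlast (x # y # ys)"
  have zs: "zs \<noteq> []" "length zs = Suc (length ys)" by (simp_all add: zs_def)
  let ?p = "neville h zs" and ?q = "neville h (y # ys)"
  have p: "coeff ?p (Suc (length ys)) = 0" "coeff ?q (Suc (length ys)) = 0"
    using neville_degree[OF zs(1), of h] zs(2) neville_degree[of "y # ys" h] by (auto intro!: coeff_eq_0)
  have "coeff ?p (length ys) = divided_diff h zs"
    using 3(1)[folded zs_def, OF zs(1)] zs(2) by simp
  moreover have "coeff ?q (length ys) = divided_diff h (y # ys)" using 3(2) by simp
  moreover have l: "length (x # y # ys) - 1 = Suc (length ys)" by simp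
  ultimately show ?case
    unfolding neville.simps divided_diff.simps l coeff_smult coeff_diff zs_def[symmetric] coeff_linear_mult p by simp
qed auto

lemma neville_interpolates:
  "distinct ls \<Longrightarrow> t \<in> set ls \<Longrightarrow> poly (neville h ls) t = h t"
proof (induction h ls rule: neville.induct)
  case (3 h x y ys)
  let ?l = "last (y # ys)"
  have l: "?l \<in> set (y # ys)" by (rule last_in_set) simp
  have xl: "x \<noteq> ?l" using l 3(3) by (metis distinct.simps(2))
  have dq: "distinct (y # ys)" and dp: "distinct (butlast (x # y # ys))"
    using 3(3) by (simp, rule distinct_butlast)
  have set: "set (x # y # ys) = insert ?l (set (butlast (x # y # ys)))"
  proof -
    have "x # y # ys = butlast (x # y # ys) @ [?l]" using append_butlast_last_id[of "x # y # ys"] by simp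
    then have "set (x # y # ys) = set (butlast (x # y # ys) @ [?l])" by (rule arg_cong)
    then show ?thesis by (simp only: set_append list.set Un_insert_right Un_empty_right)
  qed
  have p: "poly (neville h (butlast (x # y # ys))) t = h t" if "t \<noteq> ?l"
    by (rule 3(1)[OF dp]) (use that 3(4) set in auto)
  have q: "poly (neville h (y # ys)) t = h t" if "t \<noteq> x"
    by (rule 3(2)[OF dq]) (use that 3(4) in auto)
  have "poly (neville h (x # y # ys)) t = 1 / (x - ?l) *
     ((t - ?l) * poly (neville h (butlast (x # y # ys))) t - (t - x) * poly (neville h (y # ys)) t)"
    by (simp del: butlast.simps last.simps add: algebra_simps)
  also have "\<dots> = 1 / (x - ?l) * ((t - ?l) * h t - (t - x) * h t)"
    using p q by (cases "t = ?l"; cases "t = x") (simp_all del: butlast.simps last.simps)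
  also have "\<dots> = h t" using xl by (simp add: field_simps del: last.simps)
  finally show ?case .
qed auto

lemma poly_eq_by_values:
  fixes p q :: "complex poly"
  assumes "finite T" "degree p < card T" "degree q < card T" "\<And>t. t \<in> T \<Longrightarrow> poly p t = poly q t"
  shows "p = q"
proof (rule ccontr)
  assume "p \<noteq> q"
  then have pq: "p - q \<noteq> 0" by simp
  have "T \<subseteq> {t. poly (p - q) t = 0}" using assms(4) by auto
  then have "card T \<le> card {t. poly (p - q) t = 0}" by (rule card_mono[OF poly_roots_finite[OF pq]])
  also have "\<dots> \<le> degree (p - q)" by (rule card_poly_roots_bound[OF pq])
  also have "\<dots> < card T" by (rule degree_diff_less) (use assms in auto)
  finally show False by simp
qed

text \<open>
  The interpolation polynomial does not depend on the order of the nodes, since its degree and its values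
  determine it. Hence it may be formed with an arbitrary enumeration of a set of zeros.
\<close>

lemma neville_cong_set:
  assumes "distinct ls" "distinct ls'" "set ls = set ls'"
  shows "neville h ls = neville h ls'"
proof (cases "ls = []")
  case False
  then have "ls' \<noteq> []" using assms by auto
  show ?thesis
  proof (intro poly_eq_by_values[of "set ls"])
    have l: "card (set ls) = length ls" "card (set ls) = length ls'"
      using assms distinct_card by metis+
    show "degree (neville h ls) < card (set ls)" "degree (neville h ls') < card (set ls)"
      using neville_degree[OF False, of h] neville_degree[OF \<open>ls' \<noteq> []\<close>, of h] l by auto
  qed (use assms in \<open>auto simp: neville_interpolates\<close>)
qed (use assms in auto)

lemma poly_as_sum:
  fixes p :: "complex poly"
  assumes "degree p \<le> n" shows "poly p x = (\<Sum>i\<le>n. coeff p i * x ^ i)"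
  unfolding poly_altdef by (rule sum.mono_neutral_left) (use assms in \<open>auto simp: coeff_eq_0\<close>)

definition node_poly :: "complex list \<Rightarrow> complex poly" where
  "node_poly ls = (\<Prod>l\<leftarrow>ls. [:- l, 1:])"

lemma node_poly_simps [simp]: "node_poly [] = 1" "node_poly (l # ls) = [:- l, 1:] * node_poly ls"
  by (simp_all add: node_poly_def)

lemma node_poly_degree: "degree (node_poly ls) = length ls \<and> lead_coeff (node_poly ls) = 1"
proof (induction ls)
  case (Cons l ls)
  have "node_poly ls \<noteq> 0" using Cons by auto
  then have "degree (node_poly (l # ls)) = Suc (length ls)"
    using Cons unfolding node_poly_simps by (subst degree_mult_eq) auto
  moreover have "lead_coeff (node_poly (l # ls)) = 1"
    unfolding node_poly_simps lead_coeff_mult conjunct2[OF Cons] by simp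
  ultimately show ?case by simp
qed simp

lemma node_poly_root: "t \<in> set ls \<Longrightarrow> poly (node_poly ls) t = 0"
  by (induction ls) auto

text \<open>Newton's form of the interpolation polynomial, one node at a time.\<close>

lemma neville_snoc:
  assumes "distinct (ls @ [a])"
  shows "neville h (ls @ [a]) = neville h ls + smult (divided_diff h (ls @ [a])) (node_poly ls)"
proof (cases "ls = []")
  case False
  let ?n = "length ls" and ?d = "divided_diff h (ls @ [a])"
  let ?D = "neville h (ls @ [a]) - smult ?d (node_poly ls)"
  have 1: "degree (neville h (ls @ [a])) \<le> ?n" using neville_degree[of "ls @ [a]" h] by simp
  have "degree ?D \<le> ?n" using 1 node_poly_degree[of ls]
    by (intro degree_diff_le order_trans[OF degree_smult_le]) auto
  moreover have "coeff ?D ?n = 0"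
  proof -
    have "coeff (node_poly ls) ?n = 1" using node_poly_degree[of ls] by metis
    then show ?thesis using neville_top_coeff[of "ls @ [a]" h] by simp
  qed
  ultimately have "degree ?D < ?n"
    using False by (metis le_neq_implies_less length_greater_0_conv leading_coeff_0_iff degree_0)
  then have "?D = neville h ls"
    using neville_degree[OF False, of h] assms
    by (intro poly_eq_by_values[of "set ls"]) (auto simp: distinct_card neville_interpolates node_poly_root)
  then show ?thesis by (simp add: algebra_simps)
qed simp

text \<open>
  In Newton's form, each term is a divided difference times a product of distances, all of them at most
  \<open>T\<close>; the powers of \<open>T\<close> match the weights of the divided differences.
\<close>

lemma neville_bound:
  fixes B T :: real
  assumes "distinct ls" "\<And>k. 1 \<le> k \<Longrightarrow> k \<le> length ls \<Longrightarrow> cmod (divided_diff h (take k ls)) * T ^ (k - 1) \<le> B"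
    and "\<And>l. l \<in> set ls \<Longrightarrow> cmod (y - l) \<le> T"
  shows "cmod (poly (neville h ls) y) \<le> real (length ls) * B"
  using assms
proof (induction ls rule: rev_induct)
  case (snoc a ls)
  have node: "cmod (poly (node_poly ls) y) \<le> T ^ length ls" if "\<And>l. l \<in> set ls \<Longrightarrow> cmod (y - l) \<le> T" for ls
    using that
  proof (induction ls)
    case (Cons l ls)
    have "poly (node_poly (l # ls)) y = (y - l) * poly (node_poly ls) y" by (simp add: algebra_simps)
    moreover have "cmod (y - l) \<le> T" "cmod (poly (node_poly ls) y) \<le> T ^ length ls" using Cons by auto
    moreover have "0 \<le> T" using calculation(2) norm_ge_zero order_trans by blast
    ultimately show ?case
      by (simp only: norm_mult length_Cons power_Suc) (intro mult_mono, auto)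
  qed simp
  have dd: "cmod (divided_diff h (ls @ [a])) * T ^ length ls \<le> B"
    using snoc.prems(2)[of "length (ls @ [a])"] by simp
  have IH: "cmod (poly (neville h ls) y) \<le> real (length ls) * B"
  proof (rule snoc.IH)
    fix k assume "1 \<le> k" "k \<le> length ls"
    then show "cmod (divided_diff h (take k ls)) * T ^ (k - 1) \<le> B" using snoc.prems(2)[of k] by simp
  qed (use snoc.prems in auto)
  have "cmod (poly (neville h (ls @ [a])) y) \<le>
      cmod (poly (neville h ls) y) + cmod (divided_diff h (ls @ [a])) * cmod (poly (node_poly ls) y)"
    unfolding neville_snoc[OF snoc.prems(1)] poly_add poly_smult by (metis norm_mult norm_triangle_ineq)
  also have "cmod (divided_diff h (ls @ [a])) * cmod (poly (node_poly ls) y) \<le>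
      cmod (divided_diff h (ls @ [a])) * T ^ length ls"
    by (intro mult_left_mono node) (use snoc.prems in auto)
  finally show ?case using IH dd by (simp add: algebra_simps)
qed simp

text \<open>
  A rough bound, whose only purpose is to make the coefficients bounded near the zeros of the
  discriminant.
\<close>

lemma neville_coeff_bound:
  fixes B R :: real
  assumes "distinct ls" "\<And>k. 1 \<le> k \<Longrightarrow> k \<le> length ls \<Longrightarrow> cmod (divided_diff h (take k ls)) \<le> B"
    and "\<And>l. l \<in> set ls \<Longrightarrow> cmod l \<le> R" and R: "0 \<le> R"
  shows "cmod (coeff (neville h ls) i) \<le> real (length ls) * (B * (1 + R) ^ length ls)"
  using assms(1-3)
proof (induction ls rule: rev_induct)
  case (snoc a ls)
  have node: "cmod (coeff (node_poly ls) i) \<le> (1 + R) ^ length ls" if "\<And>l. l \<in> set ls \<Longrightarrow> cmod l \<le> R" for ls i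
    using that
  proof (induction ls arbitrary: i)
    case Nil then show ?case by (cases i) auto
  next
    case (Cons l ls)
    have l: "cmod l \<le> R" using Cons by simp
    have IH: "cmod (coeff (node_poly ls) j) \<le> (1 + R) ^ length ls" for j using Cons by simp
    have m: "cmod (l * coeff (node_poly ls) j) \<le> R * (1 + R) ^ length ls" for j
      unfolding norm_mult by (intro mult_mono l IH R norm_ge_zero)
    show ?case
    proof (cases i)
      case 0
      then have "cmod (coeff (node_poly (l # ls)) i) = cmod (l * coeff (node_poly ls) 0)" by simp
      also have "\<dots> \<le> (1 + R) ^ length (l # ls)"
      proof -
        have "(1 + R) ^ length (l # ls) = (1 + R) ^ length ls + R * (1 + R) ^ length ls"
          by (simp add: distrib_right)
        moreover have "0 \<le> (1 + R) ^ length ls" using R by simp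
        ultimately show ?thesis using m[of 0] by linarith
      qed
      finally show ?thesis .
    next
      case (Suc j)
      have "coeff (node_poly (l # ls)) i = coeff (node_poly ls) j - l * coeff (node_poly ls) (Suc j)"
        using Suc by simp
      then have "cmod (coeff (node_poly (l # ls)) i) \<le> (1 + R) ^ length ls + R * (1 + R) ^ length ls"
        using order_trans[OF norm_triangle_ineq4 add_mono[OF IH[of j] m[of "Suc j"]]] by simp
      then show ?thesis by (simp add: algebra_simps)
    qed
  qed
  have dd: "cmod (divided_diff h (ls @ [a])) \<le> B"
    using snoc.prems(2)[of "length (ls @ [a])"] by simp
  then have B: "B \<ge> 0" using norm_ge_zero order_trans by blast
  have IH: "cmod (coeff (neville h ls) i) \<le> real (length ls) * (B * (1 + R) ^ length ls)"
  proof (rule snoc.IH)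
    fix k assume "1 \<le> k" "k \<le> length ls"
    then show "cmod (divided_diff h (take k ls)) \<le> B" using snoc.prems(2)[of k] by simp
  qed (use snoc.prems in auto)
  have up: "(1 + R) ^ length ls \<le> (1 + R) ^ length (ls @ [a])" using R by (intro power_increasing) auto
  have "cmod (coeff (neville h (ls @ [a])) i) \<le>
      cmod (coeff (neville h ls) i) + cmod (divided_diff h (ls @ [a])) * cmod (coeff (node_poly ls) i)"
    unfolding neville_snoc[OF snoc.prems(1)] coeff_add coeff_smult by (metis norm_mult norm_triangle_ineq)
  also have "\<dots> \<le> real (length ls) * (B * (1 + R) ^ length ls) + B * (1 + R) ^ length ls"
    by (intro add_mono IH mult_mono dd node B) (use snoc.prems in auto)
  also have "\<dots> = real (length (ls @ [a])) * (B * (1 + R) ^ length ls)" by (simp add: algebra_simps)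
  also have "\<dots> \<le> real (length (ls @ [a])) * (B * (1 + R) ^ length (ls @ [a]))"
    by (intro mult_left_mono up B) auto
  finally show ?case .
qed simp

lemma neville_coeff_holomorphic:
  assumes "\<And>\<phi>. \<phi> \<in> set \<phi>s \<Longrightarrow> \<phi> holomorphic_on U" "\<And>\<phi>. \<phi> \<in> set \<phi>s \<Longrightarrow> (\<lambda>x. h x (\<phi> x)) holomorphic_on U"
    and "\<And>x. x \<in> U \<Longrightarrow> distinct (map (\<lambda>\<phi>. \<phi> x) \<phi>s)"
  shows "(\<lambda>x. coeff (neville (h x) (map (\<lambda>\<phi>. \<phi> x) \<phi>s)) i) holomorphic_on U"
  using assms
proof (induction \<phi>s arbitrary: i rule: length_induct)
  case (1 \<phi>s)
  consider "\<phi>s = []" | \<phi> where "\<phi>s = [\<phi>]" | \<phi> \<psi> \<psi>s where "\<phi>s = \<phi> # \<psi> # \<psi>s"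
    by (metis list.exhaust)
  then show ?case
  proof cases
    case 2
    then show ?thesis using 1(3)[of \<phi>] by (cases i) auto
  next
    case (3 \<phi> \<psi> \<psi>s)
    let ?p = "butlast \<phi>s" and ?q = "\<psi> # \<psi>s" and ?l = "last (\<psi> # \<psi>s)"
    have sq: "set ?q \<subseteq> set \<phi>s" using 3 by auto
    have sp: "set ?p \<subseteq> set \<phi>s" using in_set_butlastD[of _ \<phi>s] by blast
    have "?l \<in> set ?q" by (rule last_in_set) simp
    note sets = sp sq subsetD[OF sq this]
    have p: "(\<lambda>x. coeff (neville (h x) (map (\<lambda>\<phi>. \<phi> x) ?p)) j) holomorphic_on U" for j
      by (rule 1(1)[rule_format])
        (use 3 sets 1(2,3,4) in \<open>auto simp: map_butlast intro: distinct_butlast simp del: butlast.simps\<close>)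
    have q: "(\<lambda>x. coeff (neville (h x) (map (\<lambda>\<phi>. \<phi> x) ?q)) j) holomorphic_on U" for j
      by (rule 1(1)[rule_format]) (use 3 sets 1(2,3,4) in auto)
    have l: "last (map (\<lambda>\<phi>. \<phi> x) ?q) = ?l x" for x by (simp add: last_map del: last.simps list.map)
    have e: "neville (h x) (map (\<lambda>\<phi>. \<phi> x) \<phi>s) = smult (1 / (\<phi> x - ?l x))
      ([:- ?l x, 1:] * neville (h x) (map (\<lambda>\<phi>. \<phi> x) ?p) - [:- \<phi> x, 1:] * neville (h x) (map (\<lambda>\<phi>. \<phi> x) ?q))" for x
    proof -
      have "map (\<lambda>\<phi>. \<phi> x) \<phi>s = \<phi> x # \<psi> x # map (\<lambda>\<phi>. \<phi> x) \<psi>s" using 3 by simp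
      moreover have "map (\<lambda>\<phi>. \<phi> x) ?p = butlast (\<phi> x # \<psi> x # map (\<lambda>\<phi>. \<phi> x) \<psi>s)" using 3 map_butlast[of "\<lambda>\<phi>. \<phi> x" \<phi>s] by simp
      moreover have "map (\<lambda>\<phi>. \<phi> x) ?q = \<psi> x # map (\<lambda>\<phi>. \<phi> x) \<psi>s" by simp
      moreover have "?l x = last (\<psi> x # map (\<lambda>\<phi>. \<phi> x) \<psi>s)" using l[of x] by simp
      ultimately show ?thesis by (simp only: neville.simps)
    qed
    have ne: "\<phi> x - ?l x \<noteq> 0" if "x \<in> U" for x
    proof -
      have "\<phi> x \<notin> (\<lambda>\<phi>. \<phi> x) ` set ?q" using 1(4)[OF that] 3 by simp
      moreover have "?l \<in> set ?q" by (rule last_in_set) simp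
      ultimately show ?thesis by auto
    qed
    have hl: "?l holomorphic_on U" "\<phi> holomorphic_on U" using 1(2) sets 3 by auto
    have "(\<lambda>x. 1 / (\<phi> x - ?l x) * (coeff ([:- ?l x, 1:] * neville (h x) (map (\<lambda>\<phi>. \<phi> x) ?p)) i -
       coeff ([:- \<phi> x, 1:] * neville (h x) (map (\<lambda>\<phi>. \<phi> x) ?q)) i)) holomorphic_on U"
    proof (cases i)
      case 0
      show ?thesis unfolding 0 coeff_mult_0 coeff_pCons_0
        by (intro holomorphic_intros hl p q ne) (auto simp: hl[unfolded eta_contract_eq])
    next
      case (Suc j)
      show ?thesis unfolding Suc coeff_linear_mult by (intro holomorphic_intros hl p q ne)
    qed
    then show ?thesis unfolding e coeff_smult coeff_diff .
  qed simp
qed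

text \<open>
  Riemann's removable singularity theorem at the isolated zeros of \<open>\<delta>\<close>.
\<close>

lemma holomorphic_extend_off_zeros:
  assumes \<delta>: "\<delta> holomorphic_on A" "x1 \<in> A" "\<delta> x1 \<noteq> 0" and A: "open A" "connected A"
    and C: "C holomorphic_on {x \<in> A. \<delta> x \<noteq> 0}" and bd: "\<And>x. x \<in> A \<Longrightarrow> \<delta> x \<noteq> 0 \<Longrightarrow> cmod (C x) \<le> K"
  shows "\<exists>C'. C' holomorphic_on A \<and> (\<forall>x\<in>A. \<delta> x \<noteq> 0 \<longrightarrow> C' x = C x)"
proof -
  let ?A = "{x \<in> A. \<delta> x \<noteq> 0}"
  have loc: "\<exists>r>0. ball x r \<subseteq> A \<and> (\<forall>w\<in>ball x r - {x}. \<delta> w \<noteq> 0)" if x: "x \<in> A" for x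
  proof (cases "\<delta> x = 0")
    case True
    show ?thesis by (rule isolated_zeros[OF \<delta>(1) A x True \<delta>(2,3)]) blast
  next
    case False
    have "open (A \<inter> \<delta> -` (- {0}))"
      by (rule continuous_open_preimage[OF holomorphic_on_imp_continuous_on[OF \<delta>(1)] A(1)]) auto
    then obtain r where "r > 0" "ball x r \<subseteq> A \<inter> \<delta> -` (- {0})" using x False open_contains_ball by blast
    then show ?thesis by (intro exI[of _ r]) auto
  qed
  have "\<exists>g. \<exists>r>0. ball x r \<subseteq> A \<and> (\<forall>w\<in>ball x r - {x}. \<delta> w \<noteq> 0) \<and> g holomorphic_on ball x r \<and> (\<forall>w\<in>ball x r - {x}. g w = C w)"
    if x: "x \<in> A" for x
  proof -
    obtain r where r: "r > 0" "ball x r \<subseteq> A" "\<forall>w\<in>ball x r - {x}. \<delta> w \<noteq> 0" using loc[OF x] by blast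
    have h: "C holomorphic_on ball x r - {x}" by (rule holomorphic_on_subset[OF C]) (use r in auto)
    have i: "x \<in> interior (ball x r)" using r(1) by simp
    have "\<forall>\<^sub>F z in at x. cmod (C z) \<le> K"
      unfolding eventually_at using r bd by (intro exI[of _ r]) (auto simp: dist_commute subset_eq)
    then obtain g where "g holomorphic_on ball x r" "\<forall>z\<in>ball x r - {x}. g z = C z"
      using holomorphic_on_extend_bounded[OF h i] by blast
    then show ?thesis using r by blast
  qed
  then obtain g r where gr: "\<And>x. x \<in> A \<Longrightarrow> r x > 0 \<and> ball x (r x) \<subseteq> A \<and> (\<forall>w\<in>ball x (r x) - {x}. \<delta> w \<noteq> 0) \<and>
      g x holomorphic_on ball x (r x) \<and> (\<forall>w\<in>ball x (r x) - {x}. g x w = C w)" by metis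
  define C' where "C' x = (if \<delta> x = 0 then g x x else C x)" for x
  have eq: "C' w = g x w" if x: "x \<in> A" and w: "w \<in> ball x (r x)" and z: "\<delta> x = 0" for x w
    using gr[OF x] w z by (cases "w = x") (auto simp: C'_def)
  have "C' analytic_on A"
    unfolding analytic_on_def
  proof
    fix x assume x: "x \<in> A"
    show "\<exists>e>0. C' holomorphic_on ball x e"
    proof (cases "\<delta> x = 0")
      case True
      have "C' holomorphic_on ball x (r x)"
        by (rule holomorphic_transform[of "g x"]) (use gr[OF x] eq[OF x _ True] in auto)
      then show ?thesis using gr[OF x] by blast
    next
      case False
      have nz: "\<delta> w \<noteq> 0" if "w \<in> ball x (r x)" for w using gr[OF x] that False by (cases "w = x") auto
      have "C holomorphic_on ball x (r x)" by (rule holomorphic_on_subset[OF C]) (use gr[OF x] nz in auto)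
      then have "C' holomorphic_on ball x (r x)"
        by (rule holomorphic_transform) (use nz in \<open>auto simp: C'_def\<close>)
      then show ?thesis using gr[OF x] by blast
    qed
  qed
  then show ?thesis by (intro exI[of _ C']) (simp add: analytic_imp_holomorphic C'_def)
qed

lemma Cn_holomorphic_on_graph:
  assumes G: "Cn_holomorphic_on G V" and \<phi>: "\<phi> holomorphic_on U" "open U"
    and V: "\<And>x. x \<in> U \<Longrightarrow> affine_pt a \<eta> v x (\<phi> x) \<in> V"
  shows "(\<lambda>x. G (affine_pt a \<eta> v x (\<phi> x))) holomorphic_on U"
proof (rule holomorphic_onI)
  fix x assume x: "x \<in> U"
  let ?p = "affine_pt a \<eta> v x (\<phi> x)"
  have "(\<phi> has_derivative (\<lambda>h. deriv \<phi> x * h)) (at x)"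
    using holomorphic_derivI[OF \<phi> x] by (simp add: has_field_derivative_def)
  then have "((\<lambda>x. \<phi> x *s v) has_derivative (\<lambda>h. (deriv \<phi> x * h) *s v)) (at x)"
    by (rule bounded_linear.has_derivative[OF bounded_linear_vec_smult_left])
  moreover have "((\<lambda>x. x *s \<eta>) has_derivative (\<lambda>h. h *s \<eta>)) (at x)"
    by (rule bounded_linear.has_derivative[OF bounded_linear_vec_smult_left has_derivative_ident])
  ultimately have "((\<lambda>x. affine_pt a \<eta> v x (\<phi> x)) has_derivative (\<lambda>h. h *s \<eta> + (deriv \<phi> x * h) *s v)) (at x)"
    unfolding affine_pt_def by (auto intro!: derivative_eq_intros)
  from has_derivative_compose[OF this Cn_holomorphic_has_derivative(1)[OF G V[OF x]]]
  have "((\<lambda>x. G (affine_pt a \<eta> v x (\<phi> x))) has_derivative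
     (\<lambda>h. frechet_derivative G (at ?p) (h *s \<eta> + (deriv \<phi> x * h) *s v))) (at x)" .
  moreover have e: "h *s \<eta> + (deriv \<phi> x * h) *s v = h *s (\<eta> + deriv \<phi> x *s v)" for h
    by (simp add: vec_eq_iff algebra_simps)
  ultimately have "((\<lambda>x. G (affine_pt a \<eta> v x (\<phi> x))) has_derivative
     (\<lambda>h. h * frechet_derivative G (at ?p) (\<eta> + deriv \<phi> x *s v))) (at x)"
    unfolding e Cn_holomorphic_has_derivative(2)[OF G V[OF x]] by simp
  then have "((\<lambda>x. G (affine_pt a \<eta> v x (\<phi> x))) has_field_derivative
      frechet_derivative G (at ?p) (\<eta> + deriv \<phi> x *s v)) (at x)"
    by (simp add: has_field_derivative_def mult_commute_abs)
  then show "(\<lambda>x. G (affine_pt a \<eta> v x (\<phi> x))) field_differentiable at x within U"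
    by (meson DERIV_subset field_differentiable_def subset_UNIV)
qed

context weierstrass_disc
begin

lemma disc_nonzero_dense:
  assumes "x1 \<in> A" "disc x1 \<noteq> 0" "open U" "U \<noteq> {}" "U \<subseteq> A"
  shows "\<exists>x\<in>U. disc x \<noteq> 0"
proof (rule ccontr)
  assume "\<not> (\<exists>x\<in>U. disc x \<noteq> 0)"
  then have "disc x1 = (\<lambda>x. 0) x1"
    by (intro analytic_continuation_open[OF assms(3) opA assms(4) convex_connected[OF cvA] assms(5) disc_holomorphic _ _ assms(1)]) auto
  then show False using assms(2) by simp
qed

text \<open>
  The extension is obtained by interpolation along the complex lines in the direction \<open>v\<close>. The
  coefficients of the interpolation polynomials are symmetric in the zeros, so they are holomorphic off
  the zeros of the discriminant, and they are bounded, so they extend across these. The bounds and the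
  values there follow by continuity, because the discriminant has no zero on a dense set.
\<close>

lemma interpolating_extension:
  assumes fr: "unitary_frame \<eta> v" and x1: "x1 \<in> A" "disc x1 \<noteq> 0"
    and g: "\<And>p. p \<in> S \<Longrightarrow> f p = 0 \<Longrightarrow>
        \<exists>V G. open V \<and> p \<in> V \<and> Cn_holomorphic_on G V \<and> (\<forall>z\<in>V \<inter> S. f z = 0 \<longrightarrow> G z = g z)"
    and dd: "\<And>x ls. x \<in> A \<Longrightarrow> ls \<noteq> [] \<Longrightarrow> distinct ls \<Longrightarrow> set ls \<subseteq> Z x \<Longrightarrow>
        cmod (divided_diff (\<lambda>l. g (pt x l)) ls) * T ^ (length ls - 1) \<le> B"
    and T: "2 * R \<le> T" and m: "\<And>x. x \<in> A \<Longrightarrow> card (Z x) \<le> m" and B: "0 \<le> B"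
  shows "\<exists>G. Cn_holomorphic_on G {z. herm (z - a) \<eta> \<in> A \<and> herm (z - a) v \<in> ball c R} \<and>
    (\<forall>z. herm (z - a) \<eta> \<in> A \<and> herm (z - a) v \<in> ball c R \<longrightarrow> cmod (G z) \<le> m * B \<and> (f z = 0 \<longrightarrow> G z = g z))"
proof -
  define ls where "ls x = (SOME l. distinct l \<and> set l = Z x)" for x
  have ls: "distinct (ls x)" "set (ls x) = Z x" if "x \<in> A" for x
    using someI_ex[of "\<lambda>l. distinct l \<and> set l = Z x"] finite_distinct_list[OF finite_Z[OF that]]
    unfolding ls_def by blast+
  have len: "length (ls x) \<le> m" if "x \<in> A" for x using ls[OF that] m[OF that] distinct_card by metis
  define h where "h x = (\<lambda>l. g (pt x l))" for x
  define I where "I x = neville (h x) (ls x)" for x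
  let ?A = "{x \<in> A. disc x \<noteq> 0}"
  have Tpos: "T > 0" using T R by linarith
  have dd1: "cmod (divided_diff (h x) (take k (ls x))) * T ^ (k - 1) \<le> B"
    if "x \<in> A" "1 \<le> k" "k \<le> length (ls x)" for x k
  proof -
    have "take k (ls x) \<noteq> []" using that by auto
    moreover have "set (take k (ls x)) \<subseteq> Z x" using ls(2)[OF that(1)] set_take_subset[of k "ls x"] by simp
    ultimately have "cmod (divided_diff (\<lambda>l. g (pt x l)) (take k (ls x))) * T ^ (length (take k (ls x)) - 1) \<le> B"
      using dd[OF that(1)] ls(1)[OF that(1)] distinct_take by blast
    then show ?thesis using that(3) by (simp add: h_def)
  qed
  have Ibd: "cmod (poly (I x) y) \<le> m * B" if x: "x \<in> A" and y: "y \<in> ball c R" for x y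
  proof -
    have "cmod (poly (I x) y) \<le> length (ls x) * B"
      unfolding I_def
    proof (rule neville_bound[OF ls(1)[OF x] dd1[OF x]])
      fix l assume "l \<in> set (ls x)"
      then have "l \<in> ball c R" using ls(2)[OF x] by (simp add: zeros_in_def)
      then have "dist y l < 2 * R" using y dist_triangle2[of y l c] by (auto simp: dist_commute)
      then show "cmod (y - l) \<le> T" using T by (simp add: dist_norm)
    qed auto
    also have "\<dots> \<le> m * B" using len[OF x] B by (intro mult_right_mono) auto
    finally show ?thesis .
  qed
  have Ival: "poly (I x) y = g (pt x y)" if "x \<in> A" "y \<in> Z x" for x y
    unfolding I_def using neville_interpolates[OF ls(1)[OF that(1)], of y "h x"] ls(2)[OF that(1)] that(2)
    by (simp add: h_def)
  have Ideg: "degree (I x) \<le> m" if "x \<in> A" for x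
  proof (cases "ls x = []")
    case True then show ?thesis by (simp add: I_def)
  next
    case False then show ?thesis using neville_degree[OF False, of "h x"] len[OF that] by (simp add: I_def)
  qed
  \<comment> \<open>Locally, the zeros can be enumerated by holomorphic sheets; the enumeration does not matter.\<close>
  have Chol: "(\<lambda>x. coeff (I x) i) holomorphic_on ?A" for i
  proof -
    have "(\<lambda>x. coeff (I x) i) analytic_on ?A"
      unfolding analytic_on_def
    proof
      fix x0 assume "x0 \<in> ?A"
      then have x0: "x0 \<in> A" "disc x0 \<noteq> 0" by auto
      have mx: "card (Z x') \<le> card (Z x0)" if "x' \<in> A" for x'
        using disc_nonzero_card[OF x0] card_Z_le_num[OF that] num_constant[OF x0(1) that] by simp
      obtain e d \<phi> where "sheets x0 1 e d \<phi>" using local_sheets[OF x0(1) zero_less_one mx] by blast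
      note sh = sheetsD[OF this]
      have x0d: "x0 \<in> ball x0 d" using sh(3) by simp
      have inb: "\<phi> y x \<in> ball y e" if "y \<in> Z x0" "x \<in> ball x0 d" for x y
        using sh(8)[OF that] by (auto simp: zeros_in_def)
      have inZ: "\<phi> y x \<in> Z x" if "y \<in> Z x0" "x \<in> ball x0 d" for x y
        using sh(9)[OF that(2)] that(1) by auto
      have "\<exists>U. open U \<and> x0 \<in> U \<and> U \<subseteq> ball x0 d \<and> (\<lambda>x. h x (\<phi> y x)) holomorphic_on U" if y: "y \<in> Z x0" for y
      proof -
        let ?c = "\<lambda>x. pt x (\<phi> y x)"
        have cc: "continuous_on (ball x0 d) ?c"
          by (intro continuous_intros holomorphic_on_imp_continuous_on sh(7) y)
        have S: "?c x \<in> S \<and> f (?c x) = 0" if "x \<in> ball x0 d" for x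
        proof -
          have "\<phi> y x \<in> ball c R" "f (?c x) = 0" using inZ[OF y that] by (auto simp: zeros_in_def)
          then show ?thesis using inS[of x "\<phi> y x"] that sh(4) by (auto simp: dist_norm norm_minus_commute)
        qed
        obtain V G where VG: "open V" "?c x0 \<in> V" "Cn_holomorphic_on G V" "\<forall>z\<in>V \<inter> S. f z = 0 \<longrightarrow> G z = g z"
          using g[of "?c x0"] S[OF x0d] by blast
        let ?U = "ball x0 d \<inter> ?c -` V"
        have U: "open ?U" by (rule continuous_open_preimage[OF cc open_ball VG(1)])
        have "(\<lambda>x. G (?c x)) holomorphic_on ?U"
          by (rule Cn_holomorphic_on_graph[OF VG(3) _ U]) (use holomorphic_on_subset[OF sh(7)[OF y]] in auto)
        then have "(\<lambda>x. h x (\<phi> y x)) holomorphic_on ?U"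
          by (rule holomorphic_transform) (use VG(4) S in \<open>auto simp: h_def\<close>)
        then show ?thesis using U VG(2) x0d by blast
      qed
      then obtain U where U: "\<And>y. y \<in> Z x0 \<Longrightarrow> open (U y) \<and> x0 \<in> U y \<and> U y \<subseteq> ball x0 d \<and> (\<lambda>x. h x (\<phi> y x)) holomorphic_on U y"
        by metis
      define U' where "U' = ball x0 d \<inter> (\<Inter>y\<in>Z x0. U y)"
      have "open U'" "x0 \<in> U'" unfolding U'_def using finite_Z[OF x0(1)] U x0d by (auto intro!: open_Int open_INT)
      then obtain r where r: "r > 0" "ball x0 r \<subseteq> U'" using open_contains_ball by blast
      have rd: "x \<in> ball x0 d" if "x \<in> ball x0 r" for x using r that by (auto simp: U'_def)
      have dis: "distinct (map (\<lambda>\<phi>. \<phi> x) (map \<phi> (ls x0)))" if x: "x \<in> ball x0 r" for x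
      proof -
        have "inj_on (\<lambda>y. \<phi> y x) (Z x0)"
        proof (rule inj_onI, rule ccontr)
          fix y y' assume yy: "y \<in> Z x0" "y' \<in> Z x0" "\<phi> y x = \<phi> y' x" "y \<noteq> y'"
          have "\<phi> y x \<in> cball y e \<inter> cball y' e"
            using inb[OF yy(1) rd[OF x]] inb[OF yy(2) rd[OF x]] yy(3) ball_subset_cball by auto
          then show False using sh(6)[OF yy(1,2,4)] by blast
        qed
        then show ?thesis using ls[OF x0(1)] by (simp add: distinct_map o_def)
      qed
      have "(\<lambda>x. coeff (neville (h x) (map (\<lambda>\<phi>. \<phi> x) (map \<phi> (ls x0)))) i) holomorphic_on ball x0 r"
      proof (rule neville_coeff_holomorphic)
        fix \<psi> assume "\<psi> \<in> set (map \<phi> (ls x0))"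
        then obtain y where y: "y \<in> Z x0" "\<psi> = \<phi> y" using ls(2)[OF x0(1)] by auto
        show "\<psi> holomorphic_on ball x0 r" unfolding y(2)
          by (rule holomorphic_on_subset[OF sh(7)[OF y(1)]]) (use rd in auto)
        show "(\<lambda>x. h x (\<psi> x)) holomorphic_on ball x0 r" unfolding y(2)
          by (rule holomorphic_on_subset[of _ "U y"]) (use U[OF y(1)] r(2) y(1) in \<open>auto simp: U'_def\<close>)
      next
        fix x assume x: "x \<in> ball x0 r"
        show "distinct (map (\<lambda>\<phi>. \<phi> x) (map \<phi> (ls x0)))"
          by (rule dis[OF x])
      qed
      moreover have "coeff (neville (h x) (map (\<lambda>\<phi>. \<phi> x) (map \<phi> (ls x0)))) i = coeff (I x) i"
        if x: "x \<in> ball x0 r" for x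
      proof -
        have "distinct (map (\<lambda>\<phi>. \<phi> x) (map \<phi> (ls x0)))" by (rule dis[OF x])
        moreover have xA: "x \<in> A" using rd[OF x] sh(4) by blast
        moreover have "set (map (\<lambda>\<phi>. \<phi> x) (map \<phi> (ls x0))) = set (ls x)"
          using ls(2)[OF x0(1)] ls(2)[OF xA] sh(9)[OF rd[OF x]] by (simp add: image_image)
        ultimately show ?thesis unfolding I_def using neville_cong_set ls(1)[OF xA] by metis
      qed
      ultimately have "(\<lambda>x. coeff (I x) i) holomorphic_on ball x0 r" by (rule holomorphic_transform)
      then show "\<exists>e>0. (\<lambda>x. coeff (I x) i) holomorphic_on ball x0 e" using r(1) by blast
    qed
    then show ?thesis by (rule analytic_imp_holomorphic)
  qed
  define B' where "B' = B * max 1 (1 / T) ^ m"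
  have dd2: "cmod (divided_diff (h x) (take k (ls x))) \<le> B'" if x: "x \<in> A" and k: "1 \<le> k" "k \<le> length (ls x)" for x k
  proof -
    have "cmod (divided_diff (h x) (take k (ls x))) \<le> B * (1 / T) ^ (k - 1)"
      using dd1[OF that] Tpos by (simp add: field_simps power_divide)
    also have "\<dots> \<le> B * max 1 (1 / T) ^ (k - 1)" using B Tpos by (intro mult_left_mono power_mono) auto
    also have "\<dots> \<le> B'" unfolding B'_def using B k len[OF x] by (intro mult_left_mono power_increasing) auto
    finally show ?thesis .
  qed
  have B': "B' \<ge> 0" using B by (simp add: B'_def)
  let ?R = "cmod c + R"
  have Cbd: "cmod (coeff (I x) i) \<le> m * (B' * (1 + ?R) ^ m)" if x: "x \<in> A" for x i
  proof -
    have "cmod (coeff (I x) i) \<le> length (ls x) * (B' * (1 + ?R) ^ length (ls x))"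
      unfolding I_def
    proof (rule neville_coeff_bound[OF ls(1)[OF x] dd2[OF x]])
      fix l assume "l \<in> set (ls x)"
      then have "l \<in> ball c R" using ls(2)[OF x] by (simp add: zeros_in_def)
      then show "cmod l \<le> ?R" using norm_triangle_ineq[of c "l - c"] by (simp add: dist_norm norm_minus_commute)
    qed (use R in auto)
    also have "\<dots> \<le> m * (B' * (1 + ?R) ^ m)"
      using len[OF x] B' R by (intro mult_mono mult_left_mono power_increasing) auto
    finally show ?thesis .
  qed
  have "\<exists>C. C holomorphic_on A \<and> (\<forall>x\<in>A. disc x \<noteq> 0 \<longrightarrow> C x = coeff (I x) i)" for i
    by (rule holomorphic_extend_off_zeros[OF disc_holomorphic x1 opA convex_connected[OF cvA] Chol]) (rule Cbd)
  then obtain C where C: "\<And>i. C i holomorphic_on A" "\<And>i x. x \<in> A \<Longrightarrow> disc x \<noteq> 0 \<Longrightarrow> C i x = coeff (I x) i"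
    by metis
  define P where "P = {z. herm (z - a) \<eta> \<in> A \<and> herm (z - a) v \<in> ball c R}"
  define G where "G z = (\<Sum>i\<le>m. C i (herm (z - a) \<eta>) * herm (z - a) v ^ i)" for z
  have coord: "herm (pt x y - a) \<eta> = x" "herm (pt x y - a) v = y" for x y
    using affine_pt_coordinates[OF fr] by auto
  have Gpt: "G (pt x y) = (\<Sum>i\<le>m. C i x * y ^ i)" for x y unfolding G_def coord ..
  have Gpoly: "G (pt x y) = poly (I x) y" if "x \<in> A" "disc x \<noteq> 0" for x y
    unfolding Gpt poly_as_sum[OF Ideg[OF that(1)]] using C(2)[OF that] by simp
  have GP: "Cn_holomorphic_on G P"
    unfolding G_def
    by (intro Cn_holomorphic_sum Cn_holomorphic_mult Cn_holomorphic_power Cn_holomorphic_coordinate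
        Cn_holomorphic_of_coordinate[OF C(1) opA]) (simp add: P_def)
  have "open ((\<lambda>z. herm (z - a) \<eta>) -` A \<inter> (\<lambda>z. herm (z - a) v) -` ball c R)"
    by (intro open_Int open_vimage continuous_intros open_ball opA)
  then have oP: "open P" by (simp add: P_def vimage_def Collect_conj_eq[symmetric])
  have bound: "cmod (G (pt x0 y)) \<le> m * B" if x0: "x0 \<in> A" and y: "y \<in> ball c R" for x0 y
  proof (rule ccontr)
    assume big: "\<not> cmod (G (pt x0 y)) \<le> m * B"
    have cont: "continuous_on A (\<lambda>x. cmod (G (pt x y)))"
      unfolding Gpt by (intro continuous_intros holomorphic_on_imp_continuous_on C(1))
    have "open (A \<inter> (\<lambda>x. cmod (G (pt x y))) -` {m * B<..})"
      by (rule continuous_open_preimage[OF cont opA open_greaterThan])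
    moreover have "x0 \<in> A \<inter> (\<lambda>x. cmod (G (pt x y))) -` {m * B<..}" using x0 big by auto
    ultimately obtain x where "x \<in> A" "cmod (G (pt x y)) > m * B" "disc x \<noteq> 0"
      using disc_nonzero_dense[OF x1, of "A \<inter> (\<lambda>x. cmod (G (pt x y))) -` {m * B<..}"] by auto
    then show False using Gpoly[of x y] Ibd[of x y] y by auto
  qed
  \<comment> \<open>A zero over \<open>x0\<close> is a limit of zeros over parameters at which the discriminant does not vanish.\<close>
  have valG: "G (pt x0 y0) = g (pt x0 y0)" if x0: "x0 \<in> A" and y0: "y0 \<in> Z x0" for x0 y0
  proof (rule ccontr)
    assume ne: "G (pt x0 y0) \<noteq> g (pt x0 y0)"
    have y0': "y0 \<in> ball c R" "f (pt x0 y0) = 0" using y0 by (auto simp: zeros_in_def)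
    have "pt x0 y0 \<in> S" using inS[OF x0, of y0] y0' by (auto simp: dist_norm norm_minus_commute)
    then obtain V G' where VG: "open V" "pt x0 y0 \<in> V" "Cn_holomorphic_on G' V" "\<forall>z\<in>V \<inter> S. f z = 0 \<longrightarrow> G' z = g z"
      using g y0' by blast
    let ?H = "\<lambda>p. G (pt (fst p) (snd p)) - G' (pt (fst p) (snd p))"
    let ?E = "{p :: complex \<times> complex. fst p \<in> A \<and> snd p \<in> ball c R \<and> pt (fst p) (snd p) \<in> V \<inter> S}"
    have "open (fst -` A \<inter> snd -` ball c R \<inter> (\<lambda>p. pt (fst p) (snd p)) -` (V \<inter> S))"
      by (intro open_Int open_vimage opA open_ball VG(1) opS continuous_intros)
    then have oE: "open ?E" by (simp add: vimage_def Collect_conj_eq[symmetric] conj_assoc)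
    have "continuous_on ?E ?H"
      by (intro continuous_intros continuous_on_compose2[OF Cn_holomorphic_continuous_on[OF GP]]
            continuous_on_compose2[OF Cn_holomorphic_continuous_on[OF VG(3)]])
         (auto simp: P_def coord)
    then have o: "open (?E \<inter> ?H -` (- {0}))" by (rule continuous_open_preimage[OF _ oE]) auto
    define EE where "EE = ?E \<inter> ?H -` (- {0})"
    have "open EE" using o by (simp only: EE_def)
    moreover have "(x0, y0) \<in> EE"
      using x0 y0' VG \<open>pt x0 y0 \<in> S\<close> ne by (auto simp: EE_def)
    ultimately have "\<exists>X Y. open X \<and> open Y \<and> (x0, y0) \<in> X \<times> Y \<and> X \<times> Y \<subseteq> EE"
      unfolding open_prod_def by blast
    then obtain X Y where XY: "open X" "open Y" "x0 \<in> X" "y0 \<in> Y" "X \<times> Y \<subseteq> EE" by blast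
    obtain e0 where e0: "e0 > 0" "ball y0 e0 \<subseteq> Y" using XY open_contains_ball by blast
    obtain d where d: "d > 0" "ball x0 d \<subseteq> A" "\<And>x. x \<in> ball x0 d \<Longrightarrow> \<exists>y\<in>Z x. dist y0 y < e0"
      using zeros_lower[OF x0 y0 e0(1)] by metis
    obtain x where x: "x \<in> X \<inter> ball x0 d" "disc x \<noteq> 0"
    proof -
      have "open (X \<inter> ball x0 d)" "x0 \<in> X \<inter> ball x0 d" "X \<inter> ball x0 d \<subseteq> A"
        using XY d by auto
      then show ?thesis using disc_nonzero_dense[OF x1, of "X \<inter> ball x0 d"] that by blast
    qed
    then obtain y where y: "y \<in> Z x" "dist y0 y < e0" using d(3) by blast
    have "y \<in> Y" using y(2) e0(2) by auto
    then have "(x, y) \<in> EE" using XY(5) x(1) by blast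
    then have "pt x y \<in> V \<inter> S" "G (pt x y) \<noteq> G' (pt x y)" "x \<in> A" by (auto simp: EE_def)
    moreover have "G' (pt x y) = g (pt x y)" using VG(4) calculation(1) y(1) by (auto simp: zeros_in_def)
    moreover have "G (pt x y) = g (pt x y)" using Gpoly[OF \<open>x \<in> A\<close> x(2)] Ival[OF \<open>x \<in> A\<close> y(1)] by simp
    ultimately show False by simp
  qed
  have "cmod (G z) \<le> m * B \<and> (f z = 0 \<longrightarrow> G z = g z)" if z: "z \<in> P" for z
  proof -
    have e: "pt (herm (z - a) \<eta>) (herm (z - a) v) = z" by (rule affine_pt_coordinates(3)[OF fr])
    have "herm (z - a) \<eta> \<in> A" "herm (z - a) v \<in> ball c R" using z by (auto simp: P_def)
    with bound[OF this] valG[OF this(1), of "herm (z - a) v"] show ?thesis unfolding e by (auto simp: zeros_in_def e)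
  qed
  then show ?thesis using GP unfolding P_def by (intro exI[of _ G]) auto
qed

end

section \<open>The analytic set near a transverse boundary point\<close>

text \<open>
  Otherwise there are points of \<open>X\<close> converging to \<open>p\<close> that violate the condition for \<open>M = 1, 2, \<dots>\<close>; the
  limit of their normalized differences from \<open>p\<close> is a tangent vector orthogonal to \<open>\<eta>\<close>.
\<close>

lemma tangent_cone_imp_linear_cone:
  fixes X :: "(complex^2) set"
  assumes fr: "unitary_frame \<eta> v"
    and tc: "\<And>w. w \<in> tangent_cone X p \<Longrightarrow> w \<noteq> 0 \<Longrightarrow> herm w \<eta> \<noteq> 0"
  shows "\<exists>M\<ge>1. \<exists>R>0. \<forall>z\<in>X. dist p z < R \<longrightarrow> cmod (herm (z - p) v) \<le> M * cmod (herm (z - p) \<eta>)"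
proof (rule ccontr)
  assume neg: "\<not> ?thesis"
  have "\<exists>z. z \<in> X \<and> dist p z < inverse (real (Suc n)) \<and> real (Suc n) * cmod (herm (z - p) \<eta>) < cmod (herm (z - p) v)" for n
  proof (rule ccontr)
    assume "\<nexists>z. z \<in> X \<and> dist p z < inverse (real (Suc n)) \<and> real (Suc n) * cmod (herm (z - p) \<eta>) < cmod (herm (z - p) v)"
    then have "\<forall>z\<in>X. dist p z < inverse (real (Suc n)) \<longrightarrow> cmod (herm (z - p) v) \<le> real (Suc n) * cmod (herm (z - p) \<eta>)"
      using not_le by blast
    moreover have "real (Suc n) \<ge> 1" "inverse (real (Suc n)) > 0" by simp_all
    ultimately show False using neg by blast
  qed
  then obtain z where z: "\<And>n. z n \<in> X" "\<And>n. dist p (z n) < inverse (real (Suc n))"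
    "\<And>n. real (Suc n) * cmod (herm (z n - p) \<eta>) < cmod (herm (z n - p) v)" by metis
  define t where "t n = 1 / norm (z n - p)" for n
  define u where "u n = t n *\<^sub>R (z n - p)" for n
  have nz: "z n \<noteq> p" for n using z(3)[of n] by auto
  have tp: "t n > 0" for n using nz[of n] by (simp add: t_def)
  have un: "norm (u n) = 1" for n using nz[of n] by (simp add: u_def t_def)
  have "compact (sphere (0 :: complex^2) 1)" by simp
  then obtain w r where w: "w \<in> sphere 0 1" "strict_mono r" "(u \<circ> r) \<longlonglongrightarrow> w"
    using un unfolding compact_def by (metis dist_0_norm mem_sphere)
  have "z \<longlonglongrightarrow> p"
    unfolding LIMSEQ_iff dist_norm[symmetric]
  proof (intro allI impI)
    fix e :: real assume "e > 0"
    then obtain N where N: "inverse (real (Suc N)) < e" using reals_Archimedean by blast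
    show "\<exists>no. \<forall>n\<ge>no. dist (z n) p < e"
    proof (intro exI allI impI)
      fix n assume "n \<ge> N"
      then have "inverse (real (Suc n)) \<le> inverse (real (Suc N))" by (simp add: le_imp_inverse_le)
      then have "dist p (z n) < e" using z(2)[of n] N by linarith
      then show "dist (z n) p < e" by (simp add: dist_commute)
    qed
  qed
  then have "(z \<circ> r) \<longlonglongrightarrow> p" using w(2) LIMSEQ_subseq_LIMSEQ by blast
  then have "w \<in> tangent_cone X p"
    unfolding tangent_cone_def using z(1) tp w(3)
    by (intro CollectI exI[of _ "z \<circ> r"] exI[of _ "t \<circ> r"]) (auto simp: u_def o_def)
  moreover have "w \<noteq> 0" using w(1) by auto
  ultimately have ne: "herm w \<eta> \<noteq> 0" using tc by blast
  have small: "cmod (herm (u n) \<eta>) \<le> inverse (real (Suc n))" for n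
  proof -
    have h: "herm (u n) x = t n * herm (z n - p) x" for x
      unfolding u_def scaleR_vec_smult herm_smult ..
    have "real (Suc n) * cmod (herm (u n) \<eta>) = t n * (real (Suc n) * cmod (herm (z n - p) \<eta>))"
      using tp[of n] by (simp add: h norm_mult)
    also have "\<dots> \<le> t n * cmod (herm (z n - p) v)" using z(3)[of n] tp[of n] by (intro mult_left_mono) auto
    also have "\<dots> = cmod (herm (u n) v)" using tp[of n] by (simp add: h norm_mult)
    also have "\<dots> \<le> 1" using norm_herm_le[of "u n" v] un unitary_frameD(6)[OF fr] by simp
    finally show ?thesis by (simp add: field_simps)
  qed
  have lim0: "(\<lambda>n. herm ((u \<circ> r) n) \<eta>) \<longlonglongrightarrow> herm w \<eta>"
    by (rule bounded_linear.tendsto[OF bounded_linear_herm w(3)])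
  have "(\<lambda>n. herm (u n) \<eta>) \<longlonglongrightarrow> 0"
    by (rule Lim_null_comparison[OF _ LIMSEQ_inverse_real_of_nat]) (use small in auto)
  then have "(\<lambda>n. herm ((u \<circ> r) n) \<eta>) \<longlonglongrightarrow> 0"
    using LIMSEQ_subseq_LIMSEQ[OF _ w(2)] by (auto simp: o_def)
  then show False using lim0 ne LIMSEQ_unique by blast
qed

text \<open>
  The structure of an analytic curve near a point \<open>p\<close>, in coordinates that are transverse to its tangent
  cone. The discs have radius proportional to the distance of their centre from \<open>0\<close> because the sheets may
  branch at \<open>0\<close>, but nowhere else; the slopes are nevertheless bounded uniformly.
\<close>

definition graph_like :: "(complex^2) set \<Rightarrow> complex^2 \<Rightarrow> complex^2 \<Rightarrow> complex^2 \<Rightarrow> real \<Rightarrow> nat \<Rightarrow> real \<Rightarrow> bool" where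
  "graph_like X p \<eta> v M m R \<longleftrightarrow>
     (\<forall>z\<in>X. dist p z < R \<longrightarrow> cmod (herm (z - p) v) \<le> M * cmod (herm (z - p) \<eta>)) \<and>
     (\<forall>x. x \<noteq> 0 \<and> cmod x < 2 * R \<longrightarrow> (\<exists>\<Phi>. finite \<Phi> \<and> card \<Phi> \<le> m \<and>
        (\<forall>\<phi>\<in>\<Phi>. \<forall>s\<in>ball x (cmod x / 4). \<forall>t\<in>ball x (cmod x / 4). cmod (\<phi> s - \<phi> t) \<le> M * cmod (s - t)) \<and>
        (\<forall>z\<in>X. dist p z < R \<and> herm (z - p) \<eta> \<in> ball x (cmod x / 4) \<longrightarrow>
           (\<exists>\<phi>\<in>\<Phi>. herm (z - p) v = \<phi> (herm (z - p) \<eta>)))))"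

text \<open>
  The discriminant has at most an isolated zero at \<open>0\<close>, so sheets exist over all discs avoiding \<open>0\<close>, and
  by Cauchy's estimates the cone condition turns into a bound on their slopes.
\<close>

lemma transverse_imp_graph_like:
  fixes f :: "complex^2 \<Rightarrow> complex"
  assumes fr: "unitary_frame \<eta> v" and f: "Cn_holomorphic_on f \<Omega>" "open \<Omega>"
    and min: "\<And>V h. open V \<Longrightarrow> V \<subseteq> \<Omega> \<Longrightarrow> Cn_holomorphic_on h V \<Longrightarrow> (\<forall>z\<in>V. f z = 0 \<longrightarrow> h z = 0) \<Longrightarrow>
       \<exists>q. Cn_holomorphic_on q V \<and> (\<forall>z\<in>V. h z = f z * q z)"
    and p: "p \<in> \<Omega>"
    and tc: "\<And>w. w \<in> tangent_cone {z\<in>\<Omega>. f z = 0} p \<Longrightarrow> w \<noteq> 0 \<Longrightarrow> herm w \<eta> \<noteq> 0"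
  shows "\<exists>M\<ge>1. \<exists>m. \<exists>R>0. graph_like {z\<in>\<Omega>. f z = 0} p \<eta> v M m R"
proof -
  let ?X = "{z\<in>\<Omega>. f z = 0}"
  obtain M R1 where M: "M \<ge> 1" and R1: "R1 > 0"
    "\<And>z. z \<in> ?X \<Longrightarrow> dist p z < R1 \<Longrightarrow> cmod (herm (z - p) v) \<le> M * cmod (herm (z - p) \<eta>)"
    using tangent_cone_imp_linear_cone[OF fr tc] by blast
  obtain R2 where R2: "R2 > 0" "ball p R2 \<subseteq> \<Omega>" using f(2) p open_contains_ball by blast
  define R0 where "R0 = min R1 R2"
  have R0: "R0 > 0" using R1 R2 by (simp add: R0_def)
  define r2 where "r2 = R0 / 3"
  define r1 where "r1 = r2 / M"
  have r: "r2 > 0" "r1 > 0" "r1 \<le> r2" "M * r1 = r2" using R0 M by (auto simp: r2_def r1_def field_simps)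
  have near: "dist p (affine_pt p \<eta> v x y) < R0" if "cmod x < r1" "cmod y \<le> r2" for x y
  proof -
    have "dist p (affine_pt p \<eta> v x y) \<le> cmod x + cmod y"
      using unitary_frame_norm_le[OF fr, of "affine_pt p \<eta> v x y - p"] affine_pt_coordinates[OF fr]
      by (simp add: dist_norm norm_minus_commute)
    then show ?thesis using that r R0 unfolding r2_def by linarith
  qed
  have inO: "affine_pt p \<eta> v x y \<in> \<Omega>" if "cmod x < r1" "cmod y \<le> r2" for x y
    using near[OF that] R2 by (auto simp: R0_def)
  have cone: "cmod y \<le> M * cmod x" if "cmod x < r1" "cmod y \<le> r2" "f (affine_pt p \<eta> v x y) = 0" for x y
    using R1(2)[of "affine_pt p \<eta> v x y"] near[OF that(1,2)] inO[OF that(1,2)] that(3) affine_pt_coordinates[OF fr]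
    by (simp add: R0_def)
  interpret W: weierstrass_disc f \<Omega> p \<eta> v "ball 0 r1" 0 r2
  proof
    fix x y :: complex assume x: "x \<in> ball 0 r1"
    show "affine_pt p \<eta> v x y \<in> \<Omega>" if "cmod (y - 0) \<le> r2" using inO that x by simp
    show "f (affine_pt p \<eta> v x y) \<noteq> 0" if "cmod (y - 0) = r2"
    proof
      assume "f (affine_pt p \<eta> v x y) = 0"
      then have "r2 \<le> M * cmod x" using cone[of x y] that x by simp
      also have "\<dots> < M * r1" using x M by (intro mult_strict_left_mono) auto
      finally show False using r by simp
    qed
  qed (use f r in auto)
  obtain x1 where x1: "x1 \<in> ball 0 r1" "W.disc x1 \<noteq> 0"
  proof -
    have "\<exists>x\<in>ball 0 r1. W.disc x \<noteq> 0"
      by (rule W.minimal_imp_disc_nonzero[OF fr]) (use r in simp, rule min)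
    then show ?thesis using that by blast
  qed
  have "\<exists>r3>0. r3 \<le> r1 \<and> (\<forall>x\<in>ball 0 r3 - {0}. W.disc x \<noteq> 0)"
  proof (cases "W.disc 0 = 0")
    case True
    have 0: "0 \<in> ball 0 r1" using r by simp
    have "\<exists>r'>0. ball (0::complex) r' \<subseteq> ball 0 r1 \<and> (\<forall>z\<in>ball 0 r' - {0}. W.disc z \<noteq> 0)"
    proof (rule isolated_zeros[OF W.disc_holomorphic open_ball connected_ball 0 True x1])
      fix r' assume "0 < r'" "ball (0::complex) r' \<subseteq> ball 0 r1" "\<And>z. z \<in> ball 0 r' - {0} \<Longrightarrow> W.disc z \<noteq> 0"
      then show ?thesis by (intro exI[of _ r'] conjI ballI) simp_all
    qed
    then obtain r' where "0 < r'" "ball (0::complex) r' \<subseteq> ball 0 r1" "\<forall>z\<in>ball 0 r' - {0}. W.disc z \<noteq> 0" by blast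
    then show ?thesis using r by (intro exI[of _ "min r' r1"]) auto
  next
    case False
    have "open (ball 0 r1 \<inter> W.disc -` (- {0}))"
      by (rule continuous_open_preimage[OF holomorphic_on_imp_continuous_on[OF W.disc_holomorphic]]) auto
    moreover have "0 \<in> ball 0 r1 \<inter> W.disc -` (- {0})" using False r by simp
    ultimately obtain r' where "0 < r'" "ball (0::complex) r' \<subseteq> ball 0 r1 \<inter> W.disc -` (- {0})"
      using open_contains_ball by blast
    then show ?thesis using r by (intro exI[of _ "min r' r1"]) auto
  qed
  then obtain r3 where r3: "r3 > 0" "r3 \<le> r1" "\<And>x. x \<in> ball 0 r3 - {0} \<Longrightarrow> W.disc x \<noteq> 0" by blast
  define m where "m = W.num 0"
  define R where "R = r3 / 4"
  have R: "R > 0" "R < r2" "R < r1" "R \<le> R0" using r3 r R0 by (auto simp: R_def r2_def)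
  have cardm: "card (W.Z x) \<le> m" if "x \<in> ball 0 r1" for x
    unfolding m_def using W.card_Z_le_num[OF that] W.num_constant[OF that, of 0] r by simp
  have coord: "affine_pt p \<eta> v (herm (z - p) \<eta>) (herm (z - p) v) = z" for z
    by (rule affine_pt_coordinates(3)[OF fr])
  have small: "cmod (herm (z - p) \<eta>) < R" "cmod (herm (z - p) v) < R" if "dist p z < R" for z
    using norm_herm_le[of "z - p" \<eta>] norm_herm_le[of "z - p" v] unitary_frameD(5,6)[OF fr] that
    by (auto simp: dist_norm norm_minus_commute)
  have "\<exists>\<Phi>. finite \<Phi> \<and> card \<Phi> \<le> m \<and>
        (\<forall>\<phi>\<in>\<Phi>. \<forall>s\<in>ball x (cmod x / 4). \<forall>t\<in>ball x (cmod x / 4). cmod (\<phi> s - \<phi> t) \<le> (8 * M) * cmod (s - t)) \<and>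
        (\<forall>z\<in>?X. dist p z < R \<and> herm (z - p) \<eta> \<in> ball x (cmod x / 4) \<longrightarrow>
           (\<exists>\<phi>\<in>\<Phi>. herm (z - p) v = \<phi> (herm (z - p) \<eta>)))"
    if x: "x \<noteq> 0" "cmod x < 2 * R" for x
  proof -
    let ?B = "ball x (cmod x / 2)"
    have B: "cmod t < r3" "t \<noteq> 0" "t \<in> ball 0 r1" if "t \<in> ?B" for t
    proof -
      have "cmod t < 3/2 * cmod x" using that norm_triangle_ineq[of "t - x" x] by (simp add: dist_norm norm_minus_commute)
      also have "\<dots> \<le> r3" using x(2) r3(1) by (simp add: R_def)
      finally show "cmod t < r3" .
      then show "t \<in> ball 0 r1" using r3(2) by simp
      show "t \<noteq> 0" using that x by auto
    qed
    interpret V: weierstrass_disc f \<Omega> p \<eta> v ?B 0 r2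
    proof
      fix s y :: complex assume s: "s \<in> ?B"
      show "affine_pt p \<eta> v s y \<in> \<Omega>" if "cmod (y - 0) \<le> r2" using W.inS[OF B(3)[OF s] that] .
      show "f (affine_pt p \<eta> v s y) \<noteq> 0" if "cmod (y - 0) = r2" using W.nz[OF B(3)[OF s] that] .
    qed (use f r in auto)
    have disc: "V.disc t \<noteq> 0" if "t \<in> ?B" for t
    proof -
      have "t \<in> ball 0 r3 - {0}" using B[OF that] by auto
      then have "\<forall>y\<in>W.Z t. dir_derivs f [v] (affine_pt p \<eta> v t y) \<noteq> 0"
        using W.disc_nonzero_iff[OF B(3)[OF that]] r3(3) by blast
      then show ?thesis using V.disc_nonzero_iff[OF that] by blast
    qed
    have xB: "x \<in> ?B" using x by simp
    define \<psi> where "\<psi> y = (SOME \<phi>. V.sheet \<phi> \<and> \<phi> x = y)" for y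
    have \<psi>: "V.sheet (\<psi> y) \<and> \<psi> y x = y" if "y \<in> V.Z x" for y
      unfolding \<psi>_def by (rule someI_ex[OF V.sheet_through[OF disc xB that]])
    let ?\<Phi> = "\<psi> ` V.Z x"
    have fin: "finite (V.Z x)" by (rule V.finite_Z[OF xB])
    have lip: "cmod (\<psi> y s - \<psi> y t) \<le> 8 * M * cmod (s - t)"
      if y: "y \<in> V.Z x" and st: "s \<in> ball x (cmod x / 4)" "t \<in> ball x (cmod x / 4)" for y s t
    proof (rule linear_growth_lipschitz[OF _ x(1) _ _ st])
      show "\<psi> y holomorphic_on ?B" using \<psi>[OF y] by (simp add: V.sheet_def)
      fix u assume u: "u \<in> ?B"
      then have "\<psi> y u \<in> V.Z u" using \<psi>[OF y] by (simp add: V.sheet_def)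
      then show "cmod (\<psi> y u) \<le> M * cmod u"
        using cone[of u "\<psi> y u"] B(3)[OF u] by (simp add: zeros_in_def)
    qed (use M in simp)
    have "\<exists>\<phi>\<in>?\<Phi>. herm (z - p) v = \<phi> (herm (z - p) \<eta>)"
      if z: "z \<in> ?X" "dist p z < R" "herm (z - p) \<eta> \<in> ball x (cmod x / 4)" for z
    proof -
      let ?a = "herm (z - p) \<eta>" and ?b = "herm (z - p) v"
      have "dist x ?a < cmod x / 4" using z(3) by simp
      then have aB: "?a \<in> ?B" using zero_less_norm_iff[of x] x(1) unfolding mem_ball by linarith
      have "f (affine_pt p \<eta> v ?a ?b) = 0" unfolding coord using z(1) by simp
      then have bZ: "?b \<in> V.Z ?a" using small(2)[OF z(2)] R(2) unfolding zeros_in_def by simp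
      obtain \<xi> where \<xi>: "V.sheet \<xi>" "\<xi> ?a = ?b" using V.sheet_through[OF disc aB bZ] by blast
      have y: "\<xi> x \<in> V.Z x" using \<xi>(1) xB by (simp add: V.sheet_def)
      have "\<psi> (\<xi> x) ?a = \<xi> ?a"
        by (rule V.sheet_unique[OF disc _ \<xi>(1) xB _ aB]) (use \<psi>[OF y] in auto)
      then show ?thesis using y \<xi>(2) by (intro bexI[of _ "\<psi> (\<xi> x)"]) auto
    qed
    moreover have "card ?\<Phi> \<le> m" using card_image_le[OF fin, of \<psi>] cardm[OF B(3)[OF xB]] by simp
    ultimately show ?thesis using fin lip by (intro exI[of _ ?\<Phi>]) auto
  qed
  moreover have "cmod (herm (z - p) v) \<le> (8 * M) * cmod (herm (z - p) \<eta>)" if "z \<in> ?X" "dist p z < R" for z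
  proof -
    have "cmod (herm (z - p) v) \<le> M * cmod (herm (z - p) \<eta>)" using R1(2)[OF that(1)] that(2) R by (simp add: R0_def)
    also have "\<dots> \<le> (8 * M) * cmod (herm (z - p) \<eta>)" using M by (intro mult_right_mono) auto
    finally show ?thesis .
  qed
  ultimately have "graph_like ?X p \<eta> v (8 * M) m R" unfolding graph_like_def by blast
  moreover have "8 * M \<ge> 1" using M by simp
  ultimately show ?thesis using R(1) by blast
qed

text \<open>Among more equally spaced radii than there are points, one avoids a neighbourhood of all of them.\<close>

lemma avoid_radii:
  assumes T: "finite T" "card T \<le> m" and e: "e > 0"
    and E: "\<And>z. z \<in> E \<Longrightarrow> \<exists>t\<in>T. cmod (z - t) \<le> e / (9 * real (m + 1))"
  shows "\<exists>r. e / 2 \<le> r \<and> r \<le> e \<and> (\<forall>z\<in>E. cmod z \<noteq> r)"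
proof (rule ccontr)
  assume neg: "\<not> ?thesis"
  define r where "r k = e / 2 + real k * (e / (2 * real (m + 1)))" for k
  have rng: "e / 2 \<le> r k" "r k \<le> e" if "k \<le> m" for k
  proof -
    show "e / 2 \<le> r k" using e by (simp add: r_def)
    have "real k * (e / (2 * real (m + 1))) \<le> real (m + 1) * (e / (2 * real (m + 1)))"
      using that e by (intro mult_right_mono) auto
    also have "\<dots> = e / 2"
    proof -
      have "n * (e / (2 * n)) = e / 2" if "n > 0" for n :: real using that by simp
      then show ?thesis by (metis of_nat_0_less_iff zero_less_Suc Suc_eq_plus1)
    qed
    finally show "r k \<le> e" unfolding r_def by linarith
  qed
  have "\<exists>t\<in>T. \<bar>cmod t - r k\<bar> \<le> e / (9 * real (m + 1))" if k: "k \<le> m" for k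
  proof -
    obtain z where z: "z \<in> E" "cmod z = r k" using neg rng[OF k] by blast
    obtain t where "t \<in> T" "cmod (z - t) \<le> e / (9 * real (m + 1))" using E[OF z(1)] by blast
    then show ?thesis using z(2) norm_triangle_ineq3[of z t] by (intro bexI[of _ t]) auto
  qed
  then obtain t where t: "\<And>k. k \<le> m \<Longrightarrow> t k \<in> T \<and> \<bar>cmod (t k) - r k\<bar> \<le> e / (9 * real (m + 1))" by metis
  have "inj_on t {..m}"
  proof (rule inj_onI, rule ccontr)
    fix k l assume kl: "k \<in> {..m}" "l \<in> {..m}" "t k = t l" "k \<noteq> l"
    define d where "d = e / real (m + 1)"
    have d: "d > 0" using e by (simp add: d_def)
    have rk: "r k = e / 2 + real k * (d / 2)" for k by (simp add: r_def d_def)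
    have d9: "e / (9 * real (m + 1)) = d / 9" by (simp add: d_def)
    have "\<bar>cmod (t k) - r k\<bar> \<le> d / 9" "\<bar>cmod (t k) - r l\<bar> \<le> d / 9"
      using t[of k] t[of l] kl unfolding d9 by auto
    then have "\<bar>r k - r l\<bar> \<le> 2 * (d / 9)" by linarith
    moreover have "r k - r l = (real k - real l) * (d / 2)" by (simp add: rk algebra_simps)
    then have "\<bar>r k - r l\<bar> = \<bar>real k - real l\<bar> * (d / 2)" using d by (metis abs_mult abs_of_pos half_gt_zero)
    moreover have "1 \<le> \<bar>real k - real l\<bar>" using kl(4) by linarith
    then have "1 * (d / 2) \<le> \<bar>real k - real l\<bar> * (d / 2)" using d by (intro mult_right_mono) auto
    ultimately show False using d by linarith
  qed
  then have "card {..m} \<le> card T" using t T(1) by (intro card_inj_on_le) auto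
  then show False using T(2) by simp
qed

text \<open>
  What the construction of a polydisc around \<open>\<zeta>\<close> needs from \<open>X\<close>: a radius comparable to \<open>e\<close> at which a
  thickened circle in the direction \<open>v\<close> misses \<open>X\<close>, and a bound on the number of points of \<open>X\<close> on the
  lines in this direction. The constants are the same for all \<open>\<zeta>\<close> and all scales \<open>e\<close>.
\<close>

definition thin_in :: "(complex^2) set \<Rightarrow> complex^2 \<Rightarrow> real \<Rightarrow> nat \<Rightarrow> real \<Rightarrow> complex^2 \<Rightarrow> complex^2 \<Rightarrow> bool" where
  "thin_in X p R N \<theta> \<eta> v \<longleftrightarrow>
     (\<forall>\<zeta> e h. 0 < e \<and> 0 \<le> h \<and> h \<le> \<theta> * e \<longrightarrow> (\<exists>r. e / 2 \<le> r \<and> r \<le> e \<and>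
        (\<forall>x y. cmod x \<le> h \<and> cmod y = r \<and> dist p (affine_pt \<zeta> \<eta> v x y) < R \<longrightarrow> affine_pt \<zeta> \<eta> v x y \<notin> X))) \<and>
     (\<forall>w. finite {l. dist p (w + l *s v) < R \<and> w + l *s v \<in> X} \<and>
          card {l. dist p (w + l *s v) < R \<and> w + l *s v \<in> X} \<le> N)"

text \<open>
  Let \<open>\<eta>0, v0\<close> be a frame close to \<open>\<eta>, v\<close>. A line in the direction \<open>v0\<close> is steep compared with the
  graphs, so it meets each of them at most once. On a disc of radius \<open>e\<close> in the direction \<open>v0\<close>, thickened
  by \<open>h\<close>, the coordinate along \<open>\<eta>\<close> varies by \<open>O(\<theta> e)\<close> only, so the points of \<open>X\<close> are close to at most
  \<open>m + 1\<close> values of the other coordinate; \<open>\<theta>\<close> is chosen such that \<open>22 M \<theta> < 1 / (9 (m + 2))\<close>, which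
  leaves a gap between them.
\<close>

lemma graph_like_imp_thin:
  assumes gl: "graph_like X p \<eta> v M m R" and fr: "unitary_frame \<eta> v" and M: "M \<ge> 1" and R: "R > 0"
    and fr0: "unitary_frame \<eta>0 v0" and \<theta>: "0 < \<theta>" "\<theta> = 1 / (400 * M * real (m + 2))"
    and close: "cmod (herm v0 \<eta>) \<le> \<theta>"
  shows "thin_in X p R (m + 1) \<theta> \<eta>0 v0"
proof -
  have cone: "cmod (herm (z - p) v) \<le> M * cmod (herm (z - p) \<eta>)" if "z \<in> X" "dist p z < R" for z
    using gl that unfolding graph_like_def by blast
  have graphs: "\<exists>\<Phi>. finite \<Phi> \<and> card \<Phi> \<le> m \<and>
        (\<forall>\<phi>\<in>\<Phi>. \<forall>s\<in>ball x (cmod x / 4). \<forall>t\<in>ball x (cmod x / 4). cmod (\<phi> s - \<phi> t) \<le> M * cmod (s - t)) \<and>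
        (\<forall>z\<in>X. dist p z < R \<and> herm (z - p) \<eta> \<in> ball x (cmod x / 4) \<longrightarrow>
           (\<exists>\<phi>\<in>\<Phi>. herm (z - p) v = \<phi> (herm (z - p) \<eta>)))" if "x \<noteq> 0" "cmod x < 2 * R" for x
    using gl that unfolding graph_like_def by blast
  have M\<theta>: "M * \<theta> = 1 / (400 * real (m + 2))" using M \<theta>(2) by simp
  have "1 / (400 * real (m + 2)) \<le> 1 / 800" by (simp add: divide_simps)
  then have M\<theta>': "M * \<theta> \<le> 1 / 800" using M\<theta> by simp
  have \<theta>1: "\<theta> \<le> 1 / 800" using M\<theta>' M \<theta>(1) mult_right_mono[of 1 M \<theta>] by linarith
  define B B' where "B = herm v0 \<eta>" and "B' = herm v0 v"
  have B: "cmod B \<le> \<theta>" using close by (simp add: B_def)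
  have "(cmod B)\<^sup>2 + (cmod B')\<^sup>2 = 1"
    using unitary_frame_norm[OF fr, of v0] unitary_frameD(6)[OF fr0] by (simp add: B_def B'_def)
  moreover have "(cmod B)\<^sup>2 \<le> (1/800)\<^sup>2" using B \<theta>1 by (intro power_mono) auto
  ultimately have "(1/2)\<^sup>2 \<le> (cmod B')\<^sup>2" by (simp add: power2_eq_square)
  then have B': "1/2 \<le> cmod B'" by (rule power2_le_imp_le) simp
  then have B'0: "B' \<noteq> 0" by auto
  have divB': "cmod (u / B') \<le> 2 * cmod u" for u
  proof -
    have "cmod u / cmod B' \<le> cmod u / (1/2)" using B' by (intro divide_left_mono) auto
    then show ?thesis by (simp add: norm_divide)
  qed
  have count: "finite {l. dist p (w + l *s v0) < R \<and> w + l *s v0 \<in> X} \<and>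
          card {l. dist p (w + l *s v0) < R \<and> w + l *s v0 \<in> X} \<le> m + 1" (is "finite ?E \<and> _") for w
  proof -
    define a b where "a l = herm (w + l *s v0 - p) \<eta>" and "b l = herm (w + l *s v0 - p) v" for l
    have sh: "w + l *s v0 - p = (w - p) + l *s v0" for l by simp
    have a: "a l = herm (w - p) \<eta> + l * B" and b: "b l = herm (w - p) v + l * B'" for l
      unfolding a_def b_def sh herm_add herm_smult B_def B'_def by auto
    \<comment> \<open>The parameter at which the line meets the hyperplane through \<open>p\<close> orthogonal to \<open>v\<close>.\<close>
    define l0 where "l0 = - herm (w - p) v / B'"
    define a0 where "a0 = a l0"
    have bl: "b l = (l - l0) * B'" for l using B'0 by (simp add: b l0_def field_simps)
    have al: "a l - a0 = (b l / B') * B" for l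
    proof -
      have "b l / B' = l - l0" using B'0 by (simp add: bl)
      moreover have "a l - a0 = (l - l0) * B" by (simp add: a0_def a algebra_simps)
      ultimately show ?thesis by simp
    qed
    have E: "cmod (a l - a0) \<le> cmod (a l) / 10" "cmod (b l) \<le> M * cmod (a l)" "cmod (a l) < R" if "l \<in> ?E" for l
    proof -
      show bM: "cmod (b l) \<le> M * cmod (a l)" using cone that by (simp add: a_def b_def)
      have "cmod (a l - a0) \<le> (2 * cmod (b l)) * \<theta>"
        unfolding al norm_mult by (intro mult_mono divB' B) auto
      also have "\<dots> \<le> (2 * (M * cmod (a l))) * \<theta>" using bM \<theta>(1) by (intro mult_right_mono) auto
      also have "\<dots> = 2 * (M * \<theta>) * cmod (a l)" by simp
      also have "\<dots> \<le> 2 * (1/800) * cmod (a l)" using M\<theta>' by (intro mult_right_mono mult_left_mono) auto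
      also have "\<dots> \<le> cmod (a l) / 10" using norm_ge_zero[of "a l"] by linarith
      finally show "cmod (a l - a0) \<le> cmod (a l) / 10" .
      show "cmod (a l) < R"
        using norm_herm_le[of "w + l *s v0 - p" \<eta>] unitary_frameD(5)[OF fr] that
        by (simp add: a_def dist_norm norm_minus_commute)
    qed
    show ?thesis
    proof (cases "?E = {} \<or> a0 = 0")
      case True
      have "?E \<subseteq> {l0}"
      proof (cases "?E = {}")
        case False
        then have a0: "a0 = 0" using True by blast
        show ?thesis
        proof
          fix l assume l: "l \<in> ?E"
          have "cmod (a l) \<le> cmod (a l) / 10" using E(1)[OF l] a0 by simp
          then have "a l = 0" by simp
          then have "b l = 0" using E(2)[OF l] by simp
          then show "l \<in> {l0}" using bl[of l] B'0 by simp
        qed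
      qed blast
      from finite_subset[OF this] card_mono[OF _ this] show ?thesis by simp
    next
      case False
      then obtain l1 where l1: "l1 \<in> ?E" and a0: "a0 \<noteq> 0" by blast
      have "cmod a0 \<le> cmod (a l1) + cmod (a l1 - a0)" using norm_triangle_sub[of a0 "a l1"] by (simp add: norm_minus_commute)
      then have "cmod a0 < 2 * R" using E(1,3)[OF l1] R by linarith
      from graphs[OF a0 this] obtain \<Phi> where \<Phi>: "finite \<Phi>" "card \<Phi> \<le> m"
        "\<And>\<phi> s t. \<phi> \<in> \<Phi> \<Longrightarrow> s\<in>ball a0 (cmod a0 / 4) \<Longrightarrow> t\<in>ball a0 (cmod a0 / 4) \<Longrightarrow> cmod (\<phi> s - \<phi> t) \<le> M * cmod (s - t)"
        "\<And>z. z\<in>X \<Longrightarrow> dist p z < R \<Longrightarrow> herm (z - p) \<eta> \<in> ball a0 (cmod a0 / 4) \<Longrightarrow>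
           (\<exists>\<phi>\<in>\<Phi>. herm (z - p) v = \<phi> (herm (z - p) \<eta>))" by blast
      have ina: "a l \<in> ball a0 (cmod a0 / 4)" if "l \<in> ?E" for l
      proof -
        have "cmod (a l) \<le> cmod a0 + cmod (a l - a0)" using norm_triangle_sub[of "a l" a0] by simp
        then have "cmod (a l - a0) < cmod a0 / 4"
          using E(1)[OF that] zero_less_norm_iff[of a0] a0 by linarith
        then show ?thesis by (simp add: dist_norm norm_minus_commute)
      qed
      have "\<exists>\<phi>\<in>\<Phi>. b l = \<phi> (a l)" if "l \<in> ?E" for l
        using \<Phi>(4)[of "w + l *s v0"] ina[OF that] that by (simp add: a_def b_def)
      then have "\<forall>l\<in>?E. \<exists>\<phi>. \<phi> \<in> \<Phi> \<and> b l = \<phi> (a l)" by blast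
      from bchoice[OF this] obtain ph where "\<forall>l\<in>?E. ph l \<in> \<Phi> \<and> b l = ph l (a l)" ..
      then have ph: "\<And>l. l \<in> ?E \<Longrightarrow> ph l \<in> \<Phi> \<and> b l = ph l (a l)" by blast
      have inj: "inj_on ph ?E"
      proof (rule inj_onI, rule ccontr)
        fix l l' assume ll: "l \<in> ?E" "l' \<in> ?E" "ph l = ph l'" "l \<noteq> l'"
        have "b l - b l' = (l - l') * B'" by (simp add: bl algebra_simps)
        then have "cmod (l - l') * cmod B' = cmod (ph l (a l) - ph l (a l'))"
          using ph[OF ll(1)] ph[OF ll(2)] ll(3) by (metis norm_mult)
        also have "\<dots> \<le> M * cmod (a l - a l')" using \<Phi>(3) ph[OF ll(1)] ina ll by blast
        also have "a l - a l' = (l - l') * B" by (simp add: a algebra_simps)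
        also have "M * cmod ((l - l') * B) \<le> M * (cmod (l - l') * \<theta>)"
          unfolding norm_mult using M B by (intro mult_left_mono) auto
        also have "\<dots> = (M * \<theta>) * cmod (l - l')" by simp
        also have "\<dots> \<le> 1/800 * cmod (l - l')" using M\<theta>' by (intro mult_right_mono) auto
        finally have "cmod (l - l') * cmod B' \<le> 1/800 * cmod (l - l')" .
        moreover have "cmod (l - l') * (1/2) \<le> cmod (l - l') * cmod B'" using B' by (intro mult_left_mono) auto
        moreover have "cmod (l - l') > 0" using ll(4) by simp
        ultimately show False by linarith
      qed
      have "ph ` ?E \<subseteq> \<Phi>" using ph by auto
      then have "finite ?E" "card ?E \<le> card \<Phi>"
        using inj_on_finite[OF inj _ \<Phi>(1)] card_inj_on_le[OF inj _ \<Phi>(1)] by auto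
      then show ?thesis using \<Phi>(2) by linarith
    qed
  qed
  have gap: "\<exists>r. e / 2 \<le> r \<and> r \<le> e \<and>
        (\<forall>x y. cmod x \<le> h \<and> cmod y = r \<and> dist p (affine_pt \<zeta> \<eta>0 v0 x y) < R \<longrightarrow> affine_pt \<zeta> \<eta>0 v0 x y \<notin> X)"
    if e: "0 < e" and h: "0 \<le> h" "h \<le> \<theta> * e" for \<zeta> e h
  proof -
    define E where "E = {y. cmod y \<le> e \<and> (\<exists>x. cmod x \<le> h \<and> dist p (affine_pt \<zeta> \<eta>0 v0 x y) < R \<and> affine_pt \<zeta> \<eta>0 v0 x y \<in> X)}"
    define a0 b0 where "a0 = herm (\<zeta> - p) \<eta>" and "b0 = herm (\<zeta> - p) v"
    have sh: "affine_pt \<zeta> \<eta>0 v0 x y - p = (\<zeta> - p) + x *s \<eta>0 + y *s v0" for x y by (simp add: affine_pt_def)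
    have a: "herm (affine_pt \<zeta> \<eta>0 v0 x y - p) \<eta> = a0 + x * herm \<eta>0 \<eta> + y * B"
      and b: "herm (affine_pt \<zeta> \<eta>0 v0 x y - p) v = b0 + x * herm \<eta>0 v + y * B'" for x y
      unfolding sh herm_add herm_smult a0_def b0_def B_def B'_def by auto
    have h1: "cmod (herm \<eta>0 \<eta>) \<le> 1" "cmod (herm \<eta>0 v) \<le> 1"
      using norm_herm_le[of \<eta>0 \<eta>] norm_herm_le[of \<eta>0 v] unitary_frameD(5,6)[OF fr] unitary_frameD(5)[OF fr0] by auto
    define \<epsilon> where "\<epsilon> = \<theta> * e"
    have \<epsilon>: "\<epsilon> > 0" "h \<le> \<epsilon>" using \<theta>(1) e h by (auto simp: \<epsilon>_def)
    have xsm: "cmod (x * u) \<le> \<epsilon>" if "cmod x \<le> h" "cmod u \<le> 1" for x u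
      using mult_mono[OF that] \<epsilon>(2) h(1) by (simp add: norm_mult)
    have da: "cmod (herm (affine_pt \<zeta> \<eta>0 v0 x y - p) \<eta> - a0) \<le> 2 * \<epsilon>" if "cmod x \<le> h" "cmod y \<le> e" for x y
    proof -
      have "cmod (y * B) \<le> e * \<theta>" unfolding norm_mult using that B e by (intro mult_mono) auto
      then have "cmod (x * herm \<eta>0 \<eta> + y * B) \<le> \<epsilon> + \<epsilon>"
        using xsm[OF that(1) h1(1)] by (intro norm_triangle_le add_mono) (auto simp: \<epsilon>_def mult.commute)
      then show ?thesis unfolding a by (simp add: algebra_simps)
    qed
    have "\<exists>T. finite T \<and> card T \<le> m + 1 \<and> (\<forall>y\<in>E. \<exists>t\<in>T. cmod (y - t) \<le> 22 * (M * \<epsilon>))"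
    \<comment> \<open>If \<open>a0\<close> is small, the cone condition suffices; otherwise the graphs over a disc about \<open>a0\<close> are used.\<close>
    proof (cases "cmod a0 \<le> 8 * \<epsilon>")
      case True
      have "cmod (y - (- b0 / B')) \<le> 22 * (M * \<epsilon>)" if "y \<in> E" for y
      proof -
        obtain x where x: "cmod x \<le> h" "dist p (affine_pt \<zeta> \<eta>0 v0 x y) < R" "affine_pt \<zeta> \<eta>0 v0 x y \<in> X" "cmod y \<le> e"
          using \<open>y \<in> E\<close> by (auto simp: E_def)
        let ?a = "herm (affine_pt \<zeta> \<eta>0 v0 x y - p) \<eta>" and ?b = "herm (affine_pt \<zeta> \<eta>0 v0 x y - p) v"
        have "cmod ?a \<le> 10 * \<epsilon>" using da[OF x(1,4)] True norm_triangle_sub[of ?a a0] by linarith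
        then have "M * cmod ?a \<le> M * (10 * \<epsilon>)" using M by (intro mult_left_mono) auto
        then have bb: "cmod ?b \<le> 10 * (M * \<epsilon>)" using cone[OF x(3,2)] by simp
        have M\<epsilon>: "1 * \<epsilon> \<le> M * \<epsilon>" using M \<epsilon>(1) by (intro mult_right_mono) auto
        have "y - (- b0 / B') = (?b - x * herm \<eta>0 v) / B'" using B'0 by (simp add: b field_simps)
        then have "cmod (y - (- b0 / B')) \<le> 2 * cmod (?b - x * herm \<eta>0 v)" using divB' by metis
        also have "\<dots> \<le> 2 * (cmod ?b + cmod (x * herm \<eta>0 v))" by (intro mult_left_mono norm_triangle_ineq4) auto
        also have "\<dots> \<le> 2 * (10 * (M * \<epsilon>) + M * \<epsilon>)"
          using bb xsm[OF x(1) h1(2)] M\<epsilon> by simp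
        finally show ?thesis by simp
      qed
      then show ?thesis by (intro exI[of _ "{- b0 / B'}"]) auto
    next
      case False
      show ?thesis
      proof (cases "E = {}")
        case True then show ?thesis by (intro exI[of _ "{}"]) auto
      next
        case ne: False
        then obtain y1 x1 where y1: "cmod x1 \<le> h" "dist p (affine_pt \<zeta> \<eta>0 v0 x1 y1) < R" "cmod y1 \<le> e"
          by (auto simp: E_def)
        let ?a1 = "herm (affine_pt \<zeta> \<eta>0 v0 x1 y1 - p) \<eta>"
        have "cmod ?a1 < R" using norm_herm_le[of "affine_pt \<zeta> \<eta>0 v0 x1 y1 - p" \<eta>] unitary_frameD(5)[OF fr] y1(2)
          by (simp add: dist_norm norm_minus_commute)
        moreover have "cmod a0 \<le> cmod ?a1 + cmod (?a1 - a0)" using norm_triangle_sub[of a0 ?a1] by (simp add: norm_minus_commute)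
        ultimately have lt: "cmod a0 < 2 * R" using da[OF y1(1,3)] False R by linarith
        have "a0 \<noteq> 0" using False \<epsilon>(1) by auto
        from graphs[OF this lt] obtain \<Phi> where \<Phi>: "finite \<Phi>" "card \<Phi> \<le> m"
          "\<And>\<phi> s t. \<phi> \<in> \<Phi> \<Longrightarrow> s\<in>ball a0 (cmod a0 / 4) \<Longrightarrow> t\<in>ball a0 (cmod a0 / 4) \<Longrightarrow> cmod (\<phi> s - \<phi> t) \<le> M * cmod (s - t)"
          "\<And>z. z\<in>X \<Longrightarrow> dist p z < R \<Longrightarrow> herm (z - p) \<eta> \<in> ball a0 (cmod a0 / 4) \<Longrightarrow>
             (\<exists>\<phi>\<in>\<Phi>. herm (z - p) v = \<phi> (herm (z - p) \<eta>))" by blast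
        define tt where "tt \<phi> = (\<phi> a0 - b0) / B'" for \<phi> :: "complex \<Rightarrow> complex"
        have "\<exists>\<phi>\<in>\<Phi>. cmod (y - tt \<phi>) \<le> 22 * (M * \<epsilon>)" if "y \<in> E" for y
        proof -
          obtain x where x: "cmod x \<le> h" "dist p (affine_pt \<zeta> \<eta>0 v0 x y) < R" "affine_pt \<zeta> \<eta>0 v0 x y \<in> X" "cmod y \<le> e"
            using \<open>y \<in> E\<close> by (auto simp: E_def)
          let ?a = "herm (affine_pt \<zeta> \<eta>0 v0 x y - p) \<eta>" and ?b = "herm (affine_pt \<zeta> \<eta>0 v0 x y - p) v"
          have aB: "?a \<in> ball a0 (cmod a0 / 4)" using da[OF x(1,4)] False by (simp add: dist_norm norm_minus_commute)
          have a0B: "a0 \<in> ball a0 (cmod a0 / 4)" using \<open>a0 \<noteq> 0\<close> by simp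
          obtain \<phi> where \<phi>: "\<phi> \<in> \<Phi>" "?b = \<phi> ?a" using \<Phi>(4)[OF x(3,2) aB] by blast
          have "cmod (\<phi> ?a - \<phi> a0) \<le> M * cmod (?a - a0)" by (rule \<Phi>(3)[OF \<phi>(1) aB a0B])
          also have "\<dots> \<le> M * (2 * \<epsilon>)" using da[OF x(1,4)] M by (intro mult_left_mono) auto
          finally have b1: "cmod (?b - \<phi> a0) \<le> 2 * (M * \<epsilon>)" using \<phi>(2) by simp
          define K where "K = M * \<epsilon>"
          have M\<epsilon>: "\<epsilon> \<le> K" using mult_right_mono[OF M, of \<epsilon>] \<epsilon>(1) by (simp add: K_def)
          have "y - tt \<phi> = ((?b - \<phi> a0) - x * herm \<eta>0 v) / B'" using B'0 by (simp add: b tt_def field_simps)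
          then have "cmod (y - tt \<phi>) \<le> 2 * cmod ((?b - \<phi> a0) - x * herm \<eta>0 v)" using divB' by metis
          also have "\<dots> \<le> 2 * (cmod (?b - \<phi> a0) + cmod (x * herm \<eta>0 v))" by (intro mult_left_mono norm_triangle_ineq4) auto
          also have "\<dots> \<le> 2 * (2 * K + K)"
            using b1 order_trans[OF xsm[OF x(1) h1(2)] M\<epsilon>] by (intro mult_left_mono add_mono) (auto simp: K_def)
          also have "\<dots> \<le> 22 * K" using order_trans[OF less_imp_le[OF \<epsilon>(1)] M\<epsilon>] by simp
          also have "\<dots> = 22 * (M * \<epsilon>)" by (simp only: K_def)
          finally show ?thesis using \<phi>(1) by blast
        qed
        moreover have "card (tt ` \<Phi>) \<le> m + 1" using card_image_le[OF \<Phi>(1), of tt] \<Phi>(2) by linarith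
        ultimately show ?thesis using \<Phi>(1) by (intro exI[of _ "tt ` \<Phi>"]) auto
      qed
    qed
    then obtain T where T: "finite T" "card T \<le> m + 1" "\<And>y. y \<in> E \<Longrightarrow> \<exists>t\<in>T. cmod (y - t) \<le> 22 * (M * \<epsilon>)" by blast
    have "22 * (M * \<epsilon>) = 22 * e * (1 / (400 * real (m + 2)))" using M\<theta> by (simp add: \<epsilon>_def mult.assoc[symmetric])
    also have "\<dots> \<le> e / (9 * real (m + 1 + 1))" using e by (simp add: field_simps)
    finally have le: "22 * (M * \<epsilon>) \<le> e / (9 * real (m + 1 + 1))" .
    have "\<exists>r. e / 2 \<le> r \<and> r \<le> e \<and> (\<forall>z\<in>E. cmod z \<noteq> r)"
      by (rule avoid_radii[OF T(1,2) e]) (use T(3) le in \<open>meson order_trans\<close>)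
    then obtain r where r: "e / 2 \<le> r" "r \<le> e" "\<And>z. z \<in> E \<Longrightarrow> cmod z \<noteq> r" by blast
    then show ?thesis by (intro exI[of _ r]) (auto simp: E_def)
  qed
  show ?thesis unfolding thin_in_def using gap count by blast
qed

section \<open>Polydiscs adapted to the boundary\<close>

text \<open>
  The geometric facts about \<open>\<rho>\<close> near its zero set \<open>K\<close> on which the construction rests: the normal
  direction is Lipschitz, and \<open>\<rho>\<close> varies to first order in the direction \<open>\<eta>\<close> and to second
  order in the complex tangent direction. Hence at distance \<open>q = \<bar>\<rho>\<bar>\<close> from the boundary the natural
  unit of length is \<open>q\<close> along \<open>\<eta>\<close> and \<open>\<surd>q\<close> along \<open>v\<close>.
\<close>

locale boundary_frame =
  fixes \<rho> :: "complex^2 \<Rightarrow> real" and \<eta> v :: "complex^2 \<Rightarrow> complex^2" and K :: "(complex^2) set"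
    and r0 L B0 :: real
  assumes r0: "0 < r0" "r0 \<le> 1" and L: "1 \<le> L"
    and K0: "\<And>p. p \<in> K \<Longrightarrow> \<rho> p = 0"
    and frame: "\<And>x p. p \<in> K \<Longrightarrow> dist p x < r0 \<Longrightarrow> unitary_frame (\<eta> x) (v x)"
    and eta_lip: "\<And>x y p p'. p \<in> K \<Longrightarrow> dist p x < r0 \<Longrightarrow> p' \<in> K \<Longrightarrow> dist p' y < r0 \<Longrightarrow>
        norm (\<eta> x - \<eta> y) \<le> L * norm (x - y)"
    and rho_taylor: "\<And>x y p p'. p \<in> K \<Longrightarrow> dist p x < r0 \<Longrightarrow> p' \<in> K \<Longrightarrow> dist p' y < r0 \<Longrightarrow>
        \<bar>\<rho> y - \<rho> x\<bar> \<le> L * cmod (herm (y - x) (\<eta> x)) + L * (norm (y - x))\<^sup>2"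
    and rho_tangent: "\<And>\<zeta> z l p p'. p \<in> K \<Longrightarrow> dist p \<zeta> < r0 \<Longrightarrow> p' \<in> K \<Longrightarrow> dist p' z < r0 \<Longrightarrow> cmod l \<le> 1 \<Longrightarrow>
        \<bar>\<rho> (z + l *s v \<zeta>) - \<rho> z\<bar> \<le> L * norm (z - \<zeta>) * cmod l + L * (cmod l)\<^sup>2"
    and bounded_dom: "\<And>z. \<rho> z < 0 \<Longrightarrow> norm z \<le> B0"
begin

definition nb :: "real \<Rightarrow> (complex^2) set" where "nb r = {x. \<exists>p\<in>K. dist p x < r}"

text \<open>
  The radius is such that \<open>\<surd>\<bar>\<rho>\<bar> \<le> r0 / 8\<close> at the points of \<open>layer\<close>, where the construction takes place; the
  polydiscs about these points then stay within distance \<open>r0\<close> of \<open>K\<close>.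
\<close>

definition r1 :: real where "r1 = r0\<^sup>2 / (256 * L)"

definition layer :: "(complex^2) set" where "layer = {\<zeta> \<in> nb r1. \<rho> \<zeta> < 0}"

definition q :: "complex^2 \<Rightarrow> real" where "q \<zeta> = \<bar>\<rho> \<zeta>\<bar>"

definition s :: "complex^2 \<Rightarrow> real" where "s \<zeta> = sqrt (q \<zeta>)"

definition c0 :: real where "c0 = 1 / (16 * L)"

definition polydisc :: "complex^2 \<Rightarrow> real \<Rightarrow> (complex^2) set" where
  "polydisc \<zeta> c = {z. cmod (herm (z - \<zeta>) (\<eta> \<zeta>)) \<le> c * q \<zeta> \<and> cmod (herm (z - \<zeta>) (v \<zeta>)) \<le> c * s \<zeta>}"

definition dirs :: "complex^2 \<Rightarrow> (complex^2) set" where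
  "dirs \<zeta> = {w. cmod (herm w (\<eta> \<zeta>)) \<le> q \<zeta> \<and> norm w \<le> s \<zeta>}"

lemma nb_mono: "r \<le> r' \<Longrightarrow> nb r \<subseteq> nb r'" unfolding nb_def by force

lemma r1: "0 < r1" "r1 \<le> r0 / 2" "2 * L * r1 = r0\<^sup>2 / 128"
proof -
  show "0 < r1" using r0 L by (simp add: r1_def)
  show "2 * L * r1 = r0\<^sup>2 / 128" using L by (simp add: r1_def)
  have "r0\<^sup>2 \<le> r0" using r0 by (simp add: power2_eq_square mult_left_le)
  moreover have "r0\<^sup>2 / (256 * L) \<le> r0\<^sup>2 / 256" using L by (intro divide_left_mono) auto
  ultimately show "r1 \<le> r0 / 2" unfolding r1_def using r0 by linarith
qed

lemma c0: "0 < c0" "c0 \<le> 1/16" "16 * (L * c0) = 1"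
  using L by (auto simp: c0_def divide_simps)

lemma small_c: assumes "c \<le> c0" shows "L * c \<le> 1/16" "c \<le> 1/16"
proof -
  show "L * c \<le> 1/16" using mult_left_mono[OF assms, of L] L c0(3) by linarith
  show "c \<le> 1/16" using assms c0(2) by linarith
qed

lemma layer:
  assumes "\<zeta> \<in> layer"
  shows "\<rho> \<zeta> = - q \<zeta>" "0 < q \<zeta>" "q \<zeta> \<le> r0\<^sup>2 / 128" "q \<zeta> \<le> 1" "0 < s \<zeta>" "(s \<zeta>)\<^sup>2 = q \<zeta>" "s \<zeta> \<le> r0 / 8" "q \<zeta> \<le> s \<zeta>"
    "\<zeta> \<in> nb r0" "s \<zeta> \<le> 1"
proof -
  show 1: "\<rho> \<zeta> = - q \<zeta>" "0 < q \<zeta>" using assms by (auto simp: layer_def q_def)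
  obtain p where p: "p \<in> K" "dist p \<zeta> < r1" using assms by (auto simp: layer_def nb_def)
  have d: "norm (\<zeta> - p) < r1" "r1 \<le> 1" using p r1 r0 by (auto simp: dist_norm norm_minus_commute)
  have fr: "unitary_frame (\<eta> p) (v p)" using frame[OF p(1), of p] r0 by simp
  have "\<bar>\<rho> \<zeta> - \<rho> p\<bar> \<le> L * cmod (herm (\<zeta> - p) (\<eta> p)) + L * (norm (\<zeta> - p))\<^sup>2"
    by (rule rho_taylor[OF p(1) _ p(1)]) (use p r0 r1 in auto)
  also have "\<dots> \<le> L * r1 + L * r1"
  proof (intro add_mono mult_left_mono)
    show "cmod (herm (\<zeta> - p) (\<eta> p)) \<le> r1"
      using norm_herm_le[of "\<zeta> - p" "\<eta> p"] unitary_frameD(5)[OF fr] d by simp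
    have "(norm (\<zeta> - p))\<^sup>2 \<le> norm (\<zeta> - p)" using d by (simp add: power2_eq_square mult_left_le)
    then show "(norm (\<zeta> - p))\<^sup>2 \<le> r1" using d by simp
  qed (use L in auto)
  finally show 2: "q \<zeta> \<le> r0\<^sup>2 / 128" using r1(3) K0[OF p(1)] by (simp add: q_def)
  have r02: "r0\<^sup>2 \<le> 1" using r0 by (simp add: power2_eq_square mult_le_one)
  then show 3: "q \<zeta> \<le> 1" using 2 by simp
  show s: "0 < s \<zeta>" "(s \<zeta>)\<^sup>2 = q \<zeta>" using 1 by (auto simp: s_def)
  have "(s \<zeta>)\<^sup>2 \<le> (r0 / 8)\<^sup>2" unfolding s power_divide using 2 zero_le_power2[of r0] by (simp only: power2_eq_square)
  then show s8: "s \<zeta> \<le> r0 / 8" by (rule power2_le_imp_le) (use r0 in simp)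
  then show s1: "s \<zeta> \<le> 1" using r0 by simp
  have "s \<zeta> * s \<zeta> \<le> s \<zeta> * 1" using s s1 by (intro mult_left_mono) auto
  then show "q \<zeta> \<le> s \<zeta>" using s(2) by (simp only: power2_eq_square mult_1_right)
  show "\<zeta> \<in> nb r0" using assms nb_mono[of r1 r0] r1 r0 by (auto simp: layer_def)
qed

lemma frame_nb: "\<zeta> \<in> nb r0 \<Longrightarrow> unitary_frame (\<eta> \<zeta>) (v \<zeta>)"
  using frame by (auto simp: nb_def)

lemma herm_le_norm:
  assumes "\<zeta> \<in> nb r0"
  shows "cmod (herm w (\<eta> \<zeta>)) \<le> norm w" "cmod (herm w (v \<zeta>)) \<le> norm w"
  using norm_herm_le[of w "\<eta> \<zeta>"] norm_herm_le[of w "v \<zeta>"] unitary_frameD(5,6)[OF frame_nb[OF assms]] by auto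

lemma herm_change:
  assumes "\<zeta> \<in> nb r0" "z \<in> nb r0"
  shows "cmod (herm w (\<eta> z)) \<le> cmod (herm w (\<eta> \<zeta>)) + norm w * (L * norm (z - \<zeta>))"
proof -
  have "herm w (\<eta> z) = herm w (\<eta> \<zeta>) + herm w (\<eta> z - \<eta> \<zeta>)" by (simp add: herm_diff_right)
  then have "cmod (herm w (\<eta> z)) \<le> cmod (herm w (\<eta> \<zeta>)) + cmod (herm w (\<eta> z - \<eta> \<zeta>))"
    by (metis norm_triangle_ineq)
  also have "cmod (herm w (\<eta> z - \<eta> \<zeta>)) \<le> norm w * norm (\<eta> z - \<eta> \<zeta>)" by (rule norm_herm_le)
  also have "\<dots> \<le> norm w * (L * norm (z - \<zeta>))"
    using eta_lip assms by (intro mult_left_mono) (auto simp: nb_def)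
  finally show ?thesis by simp
qed

lemma polydisc_mono: "\<zeta> \<in> layer \<Longrightarrow> c \<le> c' \<Longrightarrow> polydisc \<zeta> c \<subseteq> polydisc \<zeta> c'"
proof
  fix z assume a: "\<zeta> \<in> layer" "c \<le> c'" "z \<in> polydisc \<zeta> c"
  have "c * q \<zeta> \<le> c' * q \<zeta>" "c * s \<zeta> \<le> c' * s \<zeta>"
    using layer(2,5)[OF a(1)] a(2) by (auto intro: mult_right_mono)
  then show "z \<in> polydisc \<zeta> c'" using a(3) unfolding polydisc_def by (auto intro: order_trans)
qed

lemma polydisc_near:
  assumes \<zeta>: "\<zeta> \<in> layer" and c: "0 \<le> c" "c \<le> c0" and z: "z \<in> polydisc \<zeta> c"
  shows "norm (z - \<zeta>) \<le> 2 * c * s \<zeta>" "z \<in> nb r0"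
proof -
  note l = layer[OF \<zeta>]
  have "norm (z - \<zeta>) \<le> c * q \<zeta> + c * s \<zeta>"
    using unitary_frame_norm_le[OF frame_nb[OF l(9)], of "z - \<zeta>"] z by (auto simp: polydisc_def)
  also have "\<dots> \<le> c * s \<zeta> + c * s \<zeta>" using l(8) c by (intro add_mono mult_left_mono) auto
  finally show 1: "norm (z - \<zeta>) \<le> 2 * c * s \<zeta>" by simp
  have "2 * c * s \<zeta> \<le> 2 * (1/16) * (r0 / 8)" using c small_c[OF c(2)] l by (intro mult_mono) auto
  then have "dist \<zeta> z < r0 / 2" using 1 r0 by (simp add: dist_norm norm_minus_commute)
  moreover obtain p where "p \<in> K" "dist p \<zeta> < r1" using \<zeta> by (auto simp: layer_def nb_def)
  ultimately have "p \<in> K" "dist p z < r0" using dist_triangle[of p z \<zeta>] r1 by auto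
  then show "z \<in> nb r0" by (auto simp: nb_def)
qed

text \<open>
  Up to a factor \<open>2\<close>, the scales \<open>q\<close> and \<open>s\<close> are constant on small polydiscs.
\<close>

lemma polydisc_rho:
  assumes \<zeta>: "\<zeta> \<in> layer" and c: "0 \<le> c" "c \<le> c0" and z: "z \<in> polydisc \<zeta> c"
  shows "\<rho> z < 0" "q \<zeta> / 2 \<le> q z" "q z \<le> 2 * q \<zeta>" "s \<zeta> \<le> 2 * s z" "s z \<le> 2 * s \<zeta>" "q z = (s z)\<^sup>2" "0 \<le> s z"
proof -
  note l = layer[OF \<zeta>] and n = polydisc_near[OF assms]
  have "\<bar>\<rho> z - \<rho> \<zeta>\<bar> \<le> L * cmod (herm (z - \<zeta>) (\<eta> \<zeta>)) + L * (norm (z - \<zeta>))\<^sup>2"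
    using rho_taylor n(2) l(9) by (auto simp: nb_def)
  also have "\<dots> \<le> L * (c * q \<zeta>) + L * (2 * c * s \<zeta>)\<^sup>2"
    using n(1) z L by (intro add_mono mult_left_mono power_mono) (auto simp: polydisc_def)
  also have "\<dots> = (L * c) * q \<zeta> + 4 * c * (L * c) * q \<zeta>" using l(6) by (simp add: power2_eq_square algebra_simps)
  also have "\<dots> \<le> (1/16) * q \<zeta> + 4 * (1/16) * (1/16) * q \<zeta>"
    using small_c[OF c(2)] c L l by (intro add_mono mult_mono) auto
  also have "\<dots> < q \<zeta> / 2" using l(2) by simp
  finally have d: "\<bar>\<rho> z - \<rho> \<zeta>\<bar> < q \<zeta> / 2" .
  then show r: "\<rho> z < 0" using l(1,2) by linarith
  show 1: "q \<zeta> / 2 \<le> q z" "q z \<le> 2 * q \<zeta>" using d r l(1,2) unfolding q_def by linarith+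
  have "q \<zeta> \<le> 4 * q z" "q z \<le> 4 * q \<zeta>" using 1 l(2) by linarith+
  then have "sqrt (q \<zeta>) \<le> sqrt (4 * q z)" "sqrt (q z) \<le> sqrt (4 * q \<zeta>)" by (auto intro: real_sqrt_le_mono)
  then show "s \<zeta> \<le> 2 * s z" "s z \<le> 2 * s \<zeta>" unfolding s_def by (auto simp: real_sqrt_mult)
  show "q z = (s z)\<^sup>2" "0 \<le> s z" by (simp_all add: s_def q_def)
qed

lemma polydisc_sym:
  assumes \<zeta>: "\<zeta> \<in> layer" and c: "0 \<le> c" "c \<le> c0" and z: "z \<in> polydisc \<zeta> c"
  shows "\<zeta> \<in> polydisc z (4 * c)"
proof -
  note l = layer[OF \<zeta>] and n = polydisc_near[OF assms] and r = polydisc_rho[OF assms]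
  have m: "herm (\<zeta> - z) u = - herm (z - \<zeta>) u" for u by (simp add: herm_diff)
  have "cmod (herm (z - \<zeta>) (\<eta> z)) \<le> cmod (herm (z - \<zeta>) (\<eta> \<zeta>)) + norm (z - \<zeta>) * (L * norm (z - \<zeta>))"
    by (rule herm_change[OF l(9) n(2)])
  also have "\<dots> \<le> c * q \<zeta> + (2 * c * s \<zeta>) * (L * (2 * c * s \<zeta>))"
    using n(1) z L l c by (intro add_mono mult_mono mult_left_mono) (auto simp: polydisc_def)
  also have "\<dots> = c * q \<zeta> + 4 * c * (L * c) * q \<zeta>" using l(6) by (simp add: power2_eq_square algebra_simps)
  also have "\<dots> \<le> c * q \<zeta> + 4 * c * (1/16) * q \<zeta>"
    using small_c[OF c(2)] c l by (intro add_mono mult_right_mono mult_left_mono) auto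
  also have "\<dots> \<le> 2 * c * q \<zeta>" using c l by simp
  also have "\<dots> \<le> 2 * c * (2 * q z)" using r(2) c by (intro mult_left_mono) auto
  finally have 1: "cmod (herm (\<zeta> - z) (\<eta> z)) \<le> 4 * c * q z" by (simp add: m)
  have "cmod (herm (\<zeta> - z) (v z)) \<le> norm (z - \<zeta>)" using herm_le_norm(2)[OF n(2)] by (simp add: m)
  also have "\<dots> \<le> 2 * c * s \<zeta>" by (rule n(1))
  also have "\<dots> \<le> 2 * c * (2 * s z)" using r(4) c by (intro mult_left_mono) auto
  finally show ?thesis using 1 by (simp add: polydisc_def)
qed

lemma dirs_change:
  assumes \<zeta>: "\<zeta> \<in> layer" and c: "0 \<le> c" "c \<le> c0" and z: "z \<in> polydisc \<zeta> c" and w: "w \<in> dirs z"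
  shows "cmod (herm w (\<eta> \<zeta>)) \<le> 3 * q \<zeta>" "cmod (herm w (v \<zeta>)) \<le> 2 * s \<zeta>"
proof -
  note l = layer[OF \<zeta>] and n = polydisc_near[OF assms(1-4)] and r = polydisc_rho[OF assms(1-4)]
  have "cmod (herm w (\<eta> \<zeta>)) \<le> cmod (herm w (\<eta> z)) + norm w * (L * norm (\<zeta> - z))"
    by (rule herm_change[OF n(2) l(9)])
  also have "\<dots> \<le> 2 * q \<zeta> + (2 * s \<zeta>) * (L * (2 * c * s \<zeta>))"
    using n(1) w r L l c by (intro add_mono mult_mono mult_left_mono) (auto simp: dirs_def norm_minus_commute)
  also have "\<dots> = 2 * q \<zeta> + 4 * (L * c) * q \<zeta>" using l(6) by (simp add: power2_eq_square algebra_simps)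
  also have "\<dots> \<le> 2 * q \<zeta> + 4 * (1/16) * q \<zeta>"
    using small_c[OF c(2)] l by (intro add_mono mult_right_mono mult_left_mono) auto
  also have "\<dots> \<le> 3 * q \<zeta>" using l by simp
  finally show "cmod (herm w (\<eta> \<zeta>)) \<le> 3 * q \<zeta>" .
  show "cmod (herm w (v \<zeta>)) \<le> 2 * s \<zeta>"
    using herm_le_norm(2)[OF l(9), of w] w r(5) by (auto simp: dirs_def)
qed

text \<open>
  In the direction \<open>v\<close> the function \<open>\<rho>\<close> varies to second order only, so it takes a step of order \<open>\<surd>\<bar>\<rho>\<bar>\<close>
  to increase it by \<open>\<bar>\<rho>\<bar>\<close>. Boundedness of the domain makes the supremum in the definition of \<open>\<tau>\<close> that of a
  bounded set.
\<close>

lemma tau_lower: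
  assumes \<zeta>: "\<zeta> \<in> layer" and c: "0 \<le> c" "c \<le> c0" and z: "z \<in> polydisc \<zeta> c"
  shows "s \<zeta> / (12 * L) \<le> tau \<rho> z (v \<zeta>) \<bar>\<rho> z\<bar>"
proof -
  note l = layer[OF \<zeta>] and n = polydisc_near[OF assms] and r = polydisc_rho[OF assms]
  let ?T = "{t. t > 0 \<and> (\<forall>l. cmod l < t \<longrightarrow> \<rho> (z + l *s v \<zeta>) - \<rho> z < \<bar>\<rho> z\<bar>)}"
  let ?t = "s \<zeta> / (12 * L)"
  have "?t \<in> ?T"
  proof (intro CollectI conjI allI impI)
    show "?t > 0" using l(5) L by simp
    fix \<mu> :: complex assume \<mu>: "cmod \<mu> < ?t"
    have "?t \<le> s \<zeta> / 1" using L l(5) by (intro divide_left_mono) auto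
    then have "cmod \<mu> \<le> 1" using \<mu> l(10) by simp
    then have "\<bar>\<rho> (z + \<mu> *s v \<zeta>) - \<rho> z\<bar> \<le> L * norm (z - \<zeta>) * cmod \<mu> + L * (cmod \<mu>)\<^sup>2"
      using rho_tangent n(2) l(9) by (auto simp: nb_def)
    also have "\<dots> \<le> L * (2 * c * s \<zeta>) * ?t + L * ?t\<^sup>2"
      using n(1) \<mu> L c l by (intro add_mono mult_mono mult_left_mono power_mono) auto
    also have "\<dots> = (2 * c) / 12 * q \<zeta> + 1 / (144 * L) * q \<zeta>"
      using L unfolding l(6)[symmetric] by (simp add: power2_eq_square field_simps)
    also have "\<dots> \<le> (2 * (1/16)) / 12 * q \<zeta> + 1 / 144 * q \<zeta>"
      using small_c[OF c(2)] L l by (intro add_mono mult_right_mono divide_right_mono mult_left_mono divide_left_mono) auto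
    also have "\<dots> < q \<zeta> / 2" using l(2) by simp
    also have "\<dots> \<le> \<bar>\<rho> z\<bar>" using r(2) by (simp add: q_def)
    finally show "\<rho> (z + \<mu> *s v \<zeta>) - \<rho> z < \<bar>\<rho> z\<bar>" by linarith
  qed
  moreover have "bdd_above ?T"
  proof (rule bdd_aboveI)
    fix t assume t: "t \<in> ?T"
    show "t \<le> 2 * B0 + norm z + 1"
    proof (rule ccontr)
      assume neg: "\<not> t \<le> 2 * B0 + norm z + 1"
      have B0: "0 \<le> B0" using bounded_dom[OF r(1)] norm_ge_zero order_trans by blast
      let ?l = "of_real (B0 + norm z + 1) :: complex"
      have "cmod ?l = B0 + norm z + 1" unfolding norm_of_real using B0 by (intro abs_of_nonneg) simp
      then have "cmod ?l < t" using neg B0 norm_ge_zero[of z] by linarith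
      then have "\<rho> (z + ?l *s v \<zeta>) < 0" using t r(1) by force
      then have "norm (z + ?l *s v \<zeta>) \<le> B0" by (rule bounded_dom)
      moreover have "norm (?l *s v \<zeta>) \<le> norm (z + ?l *s v \<zeta>) + norm z"
        using norm_triangle_ineq4[of "z + ?l *s v \<zeta>" z] by simp
      moreover have "norm (?l *s v \<zeta>) = B0 + norm z + 1"
        using B0 unitary_frameD(6)[OF frame_nb[OF l(9)]] norm_ge_zero[of z]
        by (simp only: norm_vec_smult norm_of_real) simp
      ultimately show False by linarith
    qed
  qed
  ultimately show ?thesis unfolding tau_def by (rule cSup_upper)
qed

section \<open>A covering with bounded overlap\<close>

definition separated :: "real \<Rightarrow> (complex^2) set \<Rightarrow> bool" where
  "separated a J \<longleftrightarrow> J \<subseteq> layer \<and> (\<forall>j\<in>J. \<forall>j'\<in>J. j \<noteq> j' \<longrightarrow> j' \<notin> polydisc j a)"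

lemma maximal_separated:
  assumes a: "0 \<le> a" "a \<le> c0"
  obtains J where "separated a J" "\<And>\<zeta>. \<zeta> \<in> layer \<Longrightarrow> \<exists>j\<in>J. \<zeta> \<in> polydisc j (4 * a)"
proof -
  have "\<exists>J\<in>{J. separated a J}. \<forall>J'\<in>{J. separated a J}. J \<subseteq> J' \<longrightarrow> J' = J"
  proof (rule subset_Zorn_nonempty)
    show "{J. separated a J} \<noteq> {}" by (auto simp: separated_def intro!: exI[of _ "{}"])
    fix C assume C: "C \<noteq> {}" "subset.chain {J. separated a J} C"
    have "j' \<notin> polydisc j a" if jj: "j \<in> \<Union>C" "j' \<in> \<Union>C" "j \<noteq> j'" for j j'
    proof -
      obtain I I' where "I \<in> C" "j \<in> I" "I' \<in> C" "j' \<in> I'" using UnionE[OF jj(1)] UnionE[OF jj(2)] by metis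
      moreover have "I \<subseteq> I' \<or> I' \<subseteq> I" using C(2) calculation unfolding subset_chain_def by blast
      ultimately have "\<exists>I''\<in>C. j \<in> I'' \<and> j' \<in> I''" by blast
      then show ?thesis using C(2) jj(3) unfolding subset_chain_def separated_def by blast
    qed
    moreover have "\<Union>C \<subseteq> layer" using C(2) unfolding subset_chain_def separated_def by blast
    ultimately show "\<Union>C \<in> {J. separated a J}" by (simp add: separated_def)
  qed
  then obtain J where J: "separated a J" "\<And>J'. separated a J' \<Longrightarrow> J \<subseteq> J' \<Longrightarrow> J' = J" by blast
  have "\<exists>j\<in>J. \<zeta> \<in> polydisc j (4 * a)" if \<zeta>: "\<zeta> \<in> layer" for \<zeta>
  proof (rule ccontr)
    assume neg: "\<not> ?thesis"
    have self: "\<zeta> \<in> polydisc \<zeta> (4 * a)" using layer[OF \<zeta>] a by (simp add: polydisc_def)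
    have Jl: "J \<subseteq> layer" using J(1) by (simp add: separated_def)
    have 1: "\<zeta> \<notin> polydisc j a" if "j \<in> J" for j
      using neg that polydisc_mono[of j a "4 * a"] Jl a by auto
    have 2: "j \<notin> polydisc \<zeta> a" if "j \<in> J" for j
      using neg that polydisc_sym[OF \<zeta> a, of j] by blast
    have "separated a (insert \<zeta> J)" using J(1) 1 2 \<zeta> unfolding separated_def by auto
    then have "insert \<zeta> J = J" by (rule J(2)) auto
    then show False using neg self by blast
  qed
  then show ?thesis using that J(1) by blast
qed

text \<open>
  The cell of \<open>z\<close> in a grid of mesh \<open>b q\<close> and \<open>b s\<close> in the coordinates given by the frame at \<open>\<zeta>\<close>.
\<close>

definition cell :: "real \<Rightarrow> complex^2 \<Rightarrow> complex^2 \<Rightarrow> int \<times> int \<times> int \<times> int" where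
  "cell b \<zeta> z = (\<lfloor>Re (herm (z - \<zeta>) (\<eta> \<zeta>)) / (b * q \<zeta>)\<rfloor>, \<lfloor>Im (herm (z - \<zeta>) (\<eta> \<zeta>)) / (b * q \<zeta>)\<rfloor>,
     \<lfloor>Re (herm (z - \<zeta>) (v \<zeta>)) / (b * s \<zeta>)\<rfloor>, \<lfloor>Im (herm (z - \<zeta>) (v \<zeta>)) / (b * s \<zeta>)\<rfloor>)"

lemma floor_eq_imp_close:
  assumes "\<lfloor>x / d\<rfloor> = \<lfloor>y / d\<rfloor>" "d > 0" shows "\<bar>x - y\<bar> \<le> (d :: real)"
proof -
  have "\<bar>x / d - y / d\<bar> < 1" using assms(1) by linarith
  then have "\<bar>x - y\<bar> / d < 1" using assms(2) by (simp add: diff_divide_distrib[symmetric] abs_divide)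
  then show ?thesis using assms(2) by (simp add: divide_simps)
qed

lemma floor_range:
  assumes "\<bar>x\<bar> \<le> of_int k * d" "d > 0" shows "\<lfloor>x / d\<rfloor> \<in> {- k .. k}"
proof -
  have "\<bar>x\<bar> / d \<le> of_int k" using assms by (simp add: divide_simps)
  then have "\<bar>x / d\<bar> \<le> of_int k" using assms(2) by (simp add: abs_divide)
  then have "- of_int k \<le> x / d" "x / d \<le> of_int k" by linarith+
  then have "- k \<le> \<lfloor>x / d\<rfloor>" "\<lfloor>x / d\<rfloor> \<le> k" by (auto simp: le_floor_iff floor_le_iff)
  then show ?thesis by simp
qed

text \<open>
  Centres of polydiscs containing a given point are pigeonholed by their coordinates in the frame at
  that point: two in the same cell of the grid would be too close to each other. The mesh is \<open>a / 8\<close> and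
  the coordinates are bounded by \<open>48 a = 384 a / 8\<close>, whence \<open>2 * 384 + 1\<close> intervals for each of the four
  real coordinates.
\<close>

lemma overlap_bound:
  assumes J: "separated a J" and a: "0 < a" "48 * a \<le> c0" and \<zeta>: "\<zeta> \<in> layer"
  shows "finite {j\<in>J. \<zeta> \<in> polydisc j (12 * a)} \<and> card {j\<in>J. \<zeta> \<in> polydisc j (12 * a)} \<le> 769 ^ 4"
proof -
  let ?I = "{j\<in>J. \<zeta> \<in> polydisc j (12 * a)}"
  define b where "b = a / 8"
  have b: "b > 0" using a by (simp add: b_def)
  note l = layer[OF \<zeta>]
  have a12: "0 \<le> 12 * a" "12 * a \<le> c0" "0 \<le> 48 * a" using a by auto
  have Jl: "j \<in> layer" if "j \<in> ?I" for j using J that by (auto simp: separated_def)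
  have near: "j \<in> polydisc \<zeta> (48 * a)" if "j \<in> ?I" for j
    using polydisc_sym[OF Jl[OF that] a12(1,2)] that by simp
  have bq: "b * q \<zeta> > 0" "b * s \<zeta> > 0" using b l by auto
  have rng: "cell b \<zeta> j \<in> {-384..384} \<times> {-384..384} \<times> {-384..384} \<times> {-384..384}" if "j \<in> ?I" for j
  proof -
    have "cmod (herm (j - \<zeta>) (\<eta> \<zeta>)) \<le> of_int 384 * (b * q \<zeta>)" "cmod (herm (j - \<zeta>) (v \<zeta>)) \<le> of_int 384 * (b * s \<zeta>)"
      using near[OF that] by (auto simp: polydisc_def b_def)
    then have "\<bar>Re (herm (j - \<zeta>) (\<eta> \<zeta>))\<bar> \<le> of_int 384 * (b * q \<zeta>)" "\<bar>Im (herm (j - \<zeta>) (\<eta> \<zeta>))\<bar> \<le> of_int 384 * (b * q \<zeta>)"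
       "\<bar>Re (herm (j - \<zeta>) (v \<zeta>))\<bar> \<le> of_int 384 * (b * s \<zeta>)" "\<bar>Im (herm (j - \<zeta>) (v \<zeta>))\<bar> \<le> of_int 384 * (b * s \<zeta>)"
      using abs_Re_le_cmod abs_Im_le_cmod order_trans by blast+
    then show ?thesis unfolding cell_def mem_Times_iff fst_conv snd_conv
      by (intro conjI floor_range bq)
  qed
  have inj: "inj_on (cell b \<zeta>) ?I"
  proof (rule inj_onI, rule ccontr)
    fix j j' assume jj: "j \<in> ?I" "j' \<in> ?I" "cell b \<zeta> j = cell b \<zeta> j'" "j \<noteq> j'"
    have dd: "(j' - \<zeta>) - (j - \<zeta>) = j' - j" by simp
    have "\<bar>Re (herm (j' - \<zeta>) (\<eta> \<zeta>)) - Re (herm (j - \<zeta>) (\<eta> \<zeta>))\<bar> \<le> b * q \<zeta>"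
      "\<bar>Im (herm (j' - \<zeta>) (\<eta> \<zeta>)) - Im (herm (j - \<zeta>) (\<eta> \<zeta>))\<bar> \<le> b * q \<zeta>"
      "\<bar>Re (herm (j' - \<zeta>) (v \<zeta>)) - Re (herm (j - \<zeta>) (v \<zeta>))\<bar> \<le> b * s \<zeta>"
      "\<bar>Im (herm (j' - \<zeta>) (v \<zeta>)) - Im (herm (j - \<zeta>) (v \<zeta>))\<bar> \<le> b * s \<zeta>"
      using jj(3) bq unfolding cell_def by (auto intro!: floor_eq_imp_close)
    then have h: "\<bar>Re (herm (j' - j) (\<eta> \<zeta>))\<bar> \<le> b * q \<zeta>" "\<bar>Im (herm (j' - j) (\<eta> \<zeta>))\<bar> \<le> b * q \<zeta>"
       "\<bar>Re (herm (j' - j) (v \<zeta>))\<bar> \<le> b * s \<zeta>" "\<bar>Im (herm (j' - j) (v \<zeta>))\<bar> \<le> b * s \<zeta>"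
      unfolding minus_complex.sel[symmetric] herm_diff[symmetric] dd by auto
    have 1: "cmod (herm (j' - j) (\<eta> \<zeta>)) \<le> 2 * b * q \<zeta>" "cmod (herm (j' - j) (v \<zeta>)) \<le> 2 * b * s \<zeta>"
      using cmod_le[of "herm (j' - j) (\<eta> \<zeta>)"] cmod_le[of "herm (j' - j) (v \<zeta>)"] h by linarith+
    have "norm (j' - j) \<le> cmod (herm (j' - j) (\<eta> \<zeta>)) + cmod (herm (j' - j) (v \<zeta>))"
      by (rule unitary_frame_norm_le[OF frame_nb[OF l(9)]])
    also have "\<dots> \<le> 2 * b * s \<zeta> + 2 * b * s \<zeta>"
      using 1 mult_left_mono[OF l(8), of "2 * b"] b by linarith
    finally have 2: "norm (j' - j) \<le> 4 * b * s \<zeta>" by simp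
    note lj = layer[OF Jl[OF jj(1)]]
    have \<zeta>j: "\<zeta> \<in> polydisc j (12 * a)" using jj(1) by simp
    note r = polydisc_rho[OF Jl[OF jj(1)] a12(1,2) \<zeta>j] and n = polydisc_near[OF Jl[OF jj(1)] a12(1,2) \<zeta>j]
    have nj: "norm (j - \<zeta>) \<le> 24 * a * s j" using n(1) by (simp add: norm_minus_commute)
    have "cmod (herm (j' - j) (\<eta> j)) \<le> cmod (herm (j' - j) (\<eta> \<zeta>)) + norm (j' - j) * (L * norm (j - \<zeta>))"
      by (rule herm_change[OF l(9) lj(9)])
    also have "\<dots> \<le> 2 * b * (2 * q j) + (4 * b * (2 * s j)) * (L * (24 * a * s j))"
    proof (intro add_mono mult_mono)
      show "cmod (herm (j' - j) (\<eta> \<zeta>)) \<le> 2 * b * (2 * q j)"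
        using order_trans[OF 1(1) mult_left_mono[OF r(3), of "2 * b"]] b by simp
      show "norm (j' - j) \<le> 4 * b * (2 * s j)"
        using order_trans[OF 2 mult_left_mono[OF r(5), of "4 * b"]] b by simp
    qed (use nj L b lj a in auto)
    also have "\<dots> = 4 * b * q j + 16 * b * (L * (12 * a)) * q j" using lj(6) by (simp add: power2_eq_square algebra_simps)
    also have "\<dots> \<le> 4 * b * q j + 16 * b * (1/16) * q j"
      using small_c(1)[OF a12(2)] b lj by (intro add_mono mult_right_mono mult_left_mono) auto
    also have "\<dots> \<le> a * q j" using lj a by (simp add: b_def)
    finally have 3: "cmod (herm (j' - j) (\<eta> j)) \<le> a * q j" .
    have "cmod (herm (j' - j) (v j)) \<le> norm (j' - j)" by (rule herm_le_norm(2)[OF lj(9)])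
    also have "\<dots> \<le> 4 * b * s \<zeta>" by (rule 2)
    also have "\<dots> \<le> 4 * b * (2 * s j)" using r(5) b by (intro mult_left_mono) auto
    also have "\<dots> = a * s j" by (simp add: b_def)
    finally have "j' \<in> polydisc j a" using 3 by (simp add: polydisc_def)
    then show False using J jj by (auto simp: separated_def)
  qed
  let ?R = "{-384..384::int} \<times> {-384..384::int} \<times> {-384..384::int} \<times> {-384..384::int}"
  have sub: "cell b \<zeta> ` ?I \<subseteq> ?R" using rng by blast
  have fin: "finite ?R" by simp
  have "card ?R = 769 ^ 4" by (simp add: card_cartesian_product)
  then show ?thesis using inj_on_finite[OF inj sub fin] card_inj_on_le[OF inj sub fin] by simp
qed

text \<open>
  In a neighbourhood of \<open>\<zeta>\<close> that depends on \<open>\<zeta>\<close> only, all polydiscs of size \<open>8 a\<close> belong to centres whose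
  polydisc of size \<open>12 a\<close> contains \<open>\<zeta>\<close>, and there are boundedly many of these.
\<close>

lemma polydisc_locally_finite:
  assumes J: "separated a J" and a: "0 < a" "48 * a \<le> c0" and \<zeta>: "\<zeta> \<in> layer"
    and z: "dist \<zeta> z < a * q \<zeta>" and j: "j \<in> J" "z \<in> polydisc j (8 * a)"
  shows "\<zeta> \<in> polydisc j (12 * a)"
proof -
  note l = layer[OF \<zeta>]
  have jl: "j \<in> layer" using J j by (auto simp: separated_def)
  note lj = layer[OF jl]
  have a8: "0 \<le> 8 * a" "8 * a \<le> c0" "0 \<le> a" "a \<le> c0" using a by auto
  have nz: "norm (z - \<zeta>) \<le> a * q \<zeta>" using z by (simp add: dist_norm norm_minus_commute)
  have "z \<in> polydisc \<zeta> a"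
    using order_trans[OF herm_le_norm(1)[OF l(9), of "z - \<zeta>"] nz]
      order_trans[OF herm_le_norm(2)[OF l(9), of "z - \<zeta>"] order_trans[OF nz mult_left_mono[OF l(8) a8(3)]]]
    unfolding polydisc_def by simp
  note r = polydisc_rho[OF \<zeta> a8(3,4) this] and rj = polydisc_rho[OF jl a8(1,2) j(2)]
  have q: "q \<zeta> \<le> 4 * q j" "s \<zeta> \<le> 4 * s j" using r rj by linarith+
  have e: "\<zeta> - j = (z - j) - (z - \<zeta>)" by simp
  have "cmod (herm (\<zeta> - j) (\<eta> j)) \<le> cmod (herm (z - j) (\<eta> j)) + cmod (herm (z - \<zeta>) (\<eta> j))"
    unfolding e herm_diff[of "z - j"] by (rule norm_triangle_ineq4)
  also have "\<dots> \<le> 8 * a * q j + a * (4 * q j)"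
    using j(2) order_trans[OF herm_le_norm(1)[OF lj(9)] order_trans[OF nz mult_left_mono[OF q(1) a8(3)]]]
    by (intro add_mono) (auto simp: polydisc_def)
  finally have 1: "cmod (herm (\<zeta> - j) (\<eta> j)) \<le> 12 * a * q j" by simp
  have "cmod (herm (\<zeta> - j) (v j)) \<le> cmod (herm (z - j) (v j)) + cmod (herm (z - \<zeta>) (v j))"
    unfolding e herm_diff[of "z - j"] by (rule norm_triangle_ineq4)
  also have "\<dots> \<le> 8 * a * s j + a * (4 * s j)"
    using j(2) order_trans[OF herm_le_norm(2)[OF lj(9)] order_trans[OF nz mult_left_mono[OF order_trans[OF l(8) q(2)] a8(3)]]]
    by (intro add_mono) (auto simp: polydisc_def)
  finally show ?thesis using 1 by (simp add: polydisc_def)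
qed

end

section \<open>A smooth cutoff function\<close>

text \<open>The functions \<open>P(1/x) exp(-1/x)\<close>, extended by \<open>0\<close> to \<open>x \<le> 0\<close>; they are closed under differentiation.\<close>

definition flat_fn :: "real poly \<Rightarrow> real \<Rightarrow> real" where
  "flat_fn P x = (if x > 0 then poly P (1 / x) * exp (- (1 / x)) else 0)"

lemma poly_exp_tendsto_0: "((\<lambda>y. poly P y * exp (- y)) \<longlongrightarrow> (0::real)) at_top"
proof -
  have "((\<lambda>y. \<Sum>i\<le>degree P. coeff P i * (y ^ i / exp y)) \<longlongrightarrow> (\<Sum>i\<le>degree P. coeff P i * 0)) at_top"
    by (intro tendsto_sum tendsto_mult tendsto_const tendsto_power_div_exp_0)
  then have "((\<lambda>y. \<Sum>i\<le>degree P. coeff P i * (y ^ i / exp y)) \<longlongrightarrow> 0) at_top" by simp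
  moreover have "(\<Sum>i\<le>degree P. coeff P i * (y ^ i / exp y)) = poly P y * exp (- y)" for y
    unfolding poly_altdef sum_distrib_right by (intro sum.cong) (auto simp: exp_minus field_simps)
  ultimately show ?thesis by simp
qed

lemma flat_fn_deriv: "(flat_fn P has_real_derivative flat_fn ([:0, 0, 1:] * (P - pderiv P)) x) (at x)"
proof -
  consider "x > 0" | "x < 0" | "x = 0" by linarith
  then show ?thesis
  proof cases
    case 1
    have "((\<lambda>x. poly P (1 / x) * exp (- (1 / x))) has_real_derivative
       poly (pderiv P) (1 / x) * (- 1 / x\<^sup>2) * exp (- (1 / x)) + poly P (1 / x) * (exp (- (1 / x)) * (1 / x\<^sup>2))) (at x)"
      by (rule derivative_eq_intros refl DERIV_chain2[OF poly_DERIV] | use 1 in \<open>simp add: power2_eq_square field_simps\<close>)+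
    then have "((\<lambda>x. poly P (1 / x) * exp (- (1 / x))) has_real_derivative flat_fn ([:0, 0, 1:] * (P - pderiv P)) x) (at x)"
      by (rule DERIV_cong) (use 1 in \<open>simp add: flat_fn_def power2_eq_square field_simps\<close>)
    then show ?thesis
      by (rule has_field_derivative_transform_within_open[where S="{0<..}"]) (use 1 in \<open>auto simp: flat_fn_def\<close>)
  next
    case 2
    have "((\<lambda>x. 0) has_real_derivative flat_fn ([:0, 0, 1:] * (P - pderiv P)) x) (at x)" using 2 by (simp add: flat_fn_def)
    then show ?thesis
      by (rule has_field_derivative_transform_within_open[where S="{..<0}"]) (use 2 in \<open>auto simp: flat_fn_def\<close>)
  next
    case 3
    have "((\<lambda>y. flat_fn P y / y) \<longlongrightarrow> 0) (at_right 0)"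
    proof -
      have "((\<lambda>x. poly ([:0, 1:] * P) (inverse x) * exp (- inverse x)) \<longlongrightarrow> 0) (at_right (0::real))"
        by (rule filterlim_compose[OF poly_exp_tendsto_0 filterlim_inverse_at_top_right])
      then show ?thesis
        by (rule Lim_transform_eventually)
          (auto simp: eventually_at_filter flat_fn_def field_simps)
    qed
    moreover have "((\<lambda>y. flat_fn P y / y) \<longlongrightarrow> 0) (at_left 0)"
      by (rule Lim_transform_eventually[OF tendsto_const]) (auto simp: eventually_at_filter flat_fn_def)
    ultimately have "((\<lambda>y. flat_fn P y / y) \<longlongrightarrow> 0) (at 0)" by (rule filterlim_split_at[rotated])
    then show ?thesis using 3 by (simp add: has_field_derivative_iff flat_fn_def)
  qed
qed

definition cutoff :: "nat \<Rightarrow> real \<Rightarrow> real" where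
  "cutoff k = flat_fn (((\<lambda>P. [:0, 0, 1:] * (P - pderiv P)) ^^ k) 1)"

lemma cutoff_deriv: "(cutoff k has_real_derivative cutoff (Suc k) x) (at x)"
  unfolding cutoff_def using flat_fn_deriv by simp

lemma cutoff_bounded: "\<exists>B. \<forall>t\<in>{..1}. \<bar>cutoff k t\<bar> \<le> B"
proof -
  have "continuous_on {0..1} (cutoff k)" by (rule DERIV_continuous_on[OF has_field_derivative_at_within[OF cutoff_deriv]])
  then have "compact (cutoff k ` {0..1})" by (rule compact_continuous_image) simp
  then obtain B where B: "\<And>t. t \<in> {0..1} \<Longrightarrow> \<bar>cutoff k t\<bar> \<le> B"
    using compact_imp_bounded bounded_iff by (metis (no_types, lifting) image_eqI real_norm_def)
  have "\<bar>cutoff k t\<bar> \<le> B" if "t \<le> 1" for t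
  proof (cases "t \<ge> 0")
    case False
    have "0 \<le> B" using order_trans[OF abs_ge_zero B[of 0]] by simp
    then show ?thesis using False by (simp add: cutoff_def flat_fn_def)
  qed (use B that in auto)
  then show ?thesis by auto
qed

lemma cutoff_pos: "cutoff 0 t > 0 \<longleftrightarrow> t > 0" "cutoff 0 t \<ge> 0" "t \<ge> 3/4 \<Longrightarrow> cutoff 0 t \<ge> exp (- 2)"
proof -
  show "cutoff 0 t > 0 \<longleftrightarrow> t > 0" "cutoff 0 t \<ge> 0" by (auto simp: cutoff_def flat_fn_def)
  assume t: "t \<ge> 3/4"
  then have "1 / t \<le> 2" by (simp add: divide_simps)
  then show "cutoff 0 t \<ge> exp (- 2)" using t by (simp add: cutoff_def flat_fn_def)
qed

section \<open>Antiholomorphic derivatives\<close>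

text \<open>
  The Wirtinger derivative along a vector, as an operator on functions of several variables that can be
  iterated and estimated by \<open>symbol_bd\<close>.
\<close>

definition dbar_dir :: "complex^'n \<Rightarrow> (complex^'n \<Rightarrow> complex) \<Rightarrow> complex^'n \<Rightarrow> complex" where
  "dbar_dir w G x = (dir_derivs G [w] x + \<i> * dir_derivs G [\<i> *s w] x) / 2"

lemma dbar_cong_open:
  assumes "open T" "l \<in> T" "\<And>m. m \<in> T \<Longrightarrow> F m = F' m"
  shows "dbar F l = dbar F' l"
  unfolding dbar_def using frechet_derivative_cong_open[OF assms] by simp

lemma dbar_pow_cong_open:
  assumes "open T" "\<And>m. m \<in> T \<Longrightarrow> F m = F' m"
  shows "l \<in> T \<Longrightarrow> (dbar ^^ k) F l = (dbar ^^ k) F' l"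
proof (induction k arbitrary: l)
  case (Suc k)
  then show ?case using dbar_cong_open[OF assms(1) Suc.prems, of "(dbar ^^ k) F" "(dbar ^^ k) F'"] by simp
qed (use assms in auto)

lemma smooth_on_dbar_dir:
  assumes "open S" "smooth_on S G" shows "smooth_on S (dbar_dir w G)"
proof -
  have "smooth_on S (\<lambda>x. (1/2) * (dir_derivs G [w] x + \<i> * dir_derivs G [\<i> *s w] x))"
    by (intro smooth_on_mult smooth_on_add smooth_on_const smooth_on_dir_derivs assms)
  moreover have "(\<lambda>x. (1/2) * (dir_derivs G [w] x + \<i> * dir_derivs G [\<i> *s w] x)) = dbar_dir w G"
    by (simp add: dbar_dir_def fun_eq_iff)
  ultimately show ?thesis by simp
qed

lemma smooth_on_dbar_dir_pow: "open S \<Longrightarrow> smooth_on S G \<Longrightarrow> smooth_on S ((dbar_dir w ^^ k) G)"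
  by (induction k) (auto intro: smooth_on_dbar_dir)

lemma dbar_along_line:
  assumes "H differentiable (at (p + m *s v))"
  shows "dbar (\<lambda>m. H (p + m *s v)) m = dbar_dir v H (p + m *s v)"
proof -
  have "((\<lambda>m. p + m *s v) has_derivative (\<lambda>h. h *s v)) (at m)"
    using bounded_linear.has_derivative[OF bounded_linear_vec_smult_left has_derivative_ident]
    by (auto intro!: derivative_eq_intros)
  from has_derivative_compose[OF this assms[unfolded frechet_derivative_works]]
  have "frechet_derivative (\<lambda>m. H (p + m *s v)) (at m) = (\<lambda>h. frechet_derivative H (at (p + m *s v)) (h *s v))"
    by (rule frechet_derivative_at[symmetric])
  then show ?thesis by (simp add: dbar_def dbar_dir_def)
qed

lemma open_line_preimage: "open S \<Longrightarrow> open {m. p + m *s (v :: complex^'n) \<in> S}"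
proof -
  assume S: "open S"
  have "continuous_on UNIV (\<lambda>m. p + m *s v)" by (intro continuous_intros)
  from open_vimage[OF S this] show ?thesis by (simp add: vimage_def)
qed

lemma dbar_pow_along_line:
  assumes "open S" "smooth_on S G"
  shows "p + m *s v \<in> S \<Longrightarrow> (dbar ^^ k) (\<lambda>m. G (p + m *s v)) m = (dbar_dir v ^^ k) G (p + m *s v)"
proof (induction k arbitrary: m)
  case (Suc k)
  have "(dbar ^^ Suc k) (\<lambda>m. G (p + m *s v)) m = dbar (\<lambda>m. (dbar_dir v ^^ k) G (p + m *s v)) m"
    unfolding funpow.simps o_apply
    by (rule dbar_cong_open[OF open_line_preimage[OF assms(1), of p v]]) (use Suc in auto)
  also have "\<dots> = dbar_dir v ((dbar_dir v ^^ k) G) (p + m *s v)"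
    by (rule dbar_along_line[OF smooth_on_differentiable[OF smooth_on_dbar_dir_pow[OF assms] Suc.prems]])
  finally show ?case by simp
qed simp

text \<open>
  Since the directions are not differentiated, the derivatives in the parameters of the plane spanned by
  \<open>\<eta>\<close> and \<open>v\<close> are iterated derivatives along these vectors.
\<close>

lemma dbar_frame_eq:
  assumes "open S" "smooth_on S G" "\<zeta> \<in> S"
  shows "dbar_frame \<alpha> \<beta> \<eta> v G \<zeta> = (dbar_dir \<eta> ^^ \<alpha>) ((dbar_dir v ^^ \<beta>) G) \<zeta>"
proof -
  have in0: "0 \<in> {l. \<zeta> + l *s \<eta> \<in> S}" using assms(3) by simp
  have "(dbar ^^ \<beta>) (\<lambda>m. G (\<zeta> + l *s \<eta> + m *s v)) 0 = (dbar_dir v ^^ \<beta>) G (\<zeta> + l *s \<eta>)"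
    if "l \<in> {l. \<zeta> + l *s \<eta> \<in> S}" for l
    using dbar_pow_along_line[OF assms(1,2), of "\<zeta> + l *s \<eta>" 0 v \<beta>] that by simp
  then have "dbar_frame \<alpha> \<beta> \<eta> v G \<zeta> = (dbar ^^ \<alpha>) (\<lambda>l. (dbar_dir v ^^ \<beta>) G (\<zeta> + l *s \<eta>)) 0"
    unfolding dbar_frame_def by (rule dbar_pow_cong_open[OF open_line_preimage[OF assms(1)] _ in0])
  also have "\<dots> = (dbar_dir \<eta> ^^ \<alpha>) ((dbar_dir v ^^ \<beta>) G) \<zeta>"
    using dbar_pow_along_line[OF assms(1) smooth_on_dbar_dir_pow[OF assms(1,2)], of \<zeta> 0 \<eta> \<alpha>] assms(3) by simp
  finally show ?thesis .
qed

lemma dbar_dir_cong_open: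
  assumes "open S" "\<And>y. y \<in> S \<Longrightarrow> F y = G y" "x \<in> S"
  shows "dbar_dir w F x = dbar_dir w G x"
  unfolding dbar_dir_def using dir_derivs_cong_open[OF assms(1), of F G x] assms(2,3) by metis

lemma dbar_dir_pow_cong_open:
  assumes "open S" "\<And>y. y \<in> S \<Longrightarrow> F y = G y"
  shows "x \<in> S \<Longrightarrow> (dbar_dir w ^^ k) F x = (dbar_dir w ^^ k) G x"
proof (induction k arbitrary: x)
  case (Suc k)
  then show ?case using dbar_dir_cong_open[OF assms(1), of "(dbar_dir w ^^ k) F" "(dbar_dir w ^^ k) G"] by simp
qed (use assms in auto)

lemma dir_derivs_scale:
  assumes "f differentiable (at x)" shows "dir_derivs f [r *\<^sub>R w] x = r *\<^sub>R dir_derivs f [w] x"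
  using linear_frechet_derivative[OF assms] by (simp add: linear_cmul)

lemma dbar_dir_scale:
  assumes "G differentiable (at x)"
  shows "dbar_dir (r *\<^sub>R w) G x = of_real r * dbar_dir w G x"
proof -
  have "\<i> *s (r *\<^sub>R w) = r *\<^sub>R (\<i> *s w)" by (simp add: scaleR_vec_smult vec_eq_iff mult_ac)
  then have "dir_derivs G [\<i> *s (r *\<^sub>R w)] x = r *\<^sub>R dir_derivs G [\<i> *s w] x"
    using dir_derivs_scale[OF assms, of r "\<i> *s w"] by simp
  then show ?thesis
    unfolding dbar_dir_def dir_derivs_scale[OF assms] by (simp add: scaleR_conv_of_real algebra_simps add_divide_distrib)
qed

lemma dbar_dir_mult_const:
  assumes "G differentiable (at x)" shows "dbar_dir w (\<lambda>x. c * G x) x = c * dbar_dir w G x"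
proof -
  have "dir_derivs (\<lambda>x. c * G x) [u] x = c * dir_derivs G [u] x" for u
    using frechet_mult[of "\<lambda>_. c" x G u] assms by simp
  then show ?thesis unfolding dbar_dir_def by (simp add: algebra_simps)
qed

lemma dbar_dir_pow_scale:
  assumes "open S" "smooth_on S G"
  shows "x \<in> S \<Longrightarrow> (dbar_dir (r *\<^sub>R w) ^^ k) G x = of_real r ^ k * (dbar_dir w ^^ k) G x"
proof (induction k arbitrary: x)
  case (Suc k)
  note d = smooth_on_differentiable[OF smooth_on_dbar_dir_pow[OF assms] Suc.prems]
  have "(dbar_dir (r *\<^sub>R w) ^^ Suc k) G x = dbar_dir (r *\<^sub>R w) (\<lambda>x. of_real r ^ k * (dbar_dir w ^^ k) G x) x"
    using dbar_dir_cong_open[OF assms(1) Suc.IH Suc.prems] by simp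
  also have "\<dots> = of_real r * dbar_dir w (\<lambda>x. of_real r ^ k * (dbar_dir w ^^ k) G x) x"
    by (rule dbar_dir_scale) (use d in simp)
  also have "\<dots> = of_real r * (of_real r ^ k * dbar_dir w ((dbar_dir w ^^ k) G) x)"
    by (subst dbar_dir_mult_const[OF d]) simp
  finally show ?case by simp
qed simp

lemma dbar_dir_pow_mult_const:
  assumes "open S" "smooth_on S G"
  shows "x \<in> S \<Longrightarrow> (dbar_dir w ^^ k) (\<lambda>x. c * G x) x = c * (dbar_dir w ^^ k) G x"
proof (induction k arbitrary: x)
  case (Suc k)
  note d = smooth_on_differentiable[OF smooth_on_dbar_dir_pow[OF assms] Suc.prems]
  show ?case using dbar_dir_cong_open[OF assms(1) Suc.IH Suc.prems] dbar_dir_mult_const[OF d] by simp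
qed simp

lemma symbol_bd_dbar_dir:
  assumes "open S" "x \<in> S" "smooth_on S u" "symbol_bd (Suc n) u x Q A" "w \<in> Q" "\<i> *s w \<in> Q"
  shows "symbol_bd n (dbar_dir w u) x Q A"
  unfolding symbol_bd_def
proof (intro allI impI)
  fix vs assume vs: "length vs \<le> n" "set vs \<subseteq> Q"
  have sm: "smooth_on S (dir_derivs u [z])" for z by (rule smooth_on_dir_derivs[OF assms(3)])
  have bl: "bounded_linear (\<lambda>z::complex. z / 2)" "bounded_linear (\<lambda>z::complex. \<i> * z)"
    by (simp_all add: bounded_linear_divide bounded_linear_mult_right)
  have smi: "smooth_on S (\<lambda>x. \<i> * dir_derivs u [\<i> *s w] x)"
    by (rule smooth_on_linear_comp[OF bl(2) assms(1) sm])
  have "dir_derivs (dbar_dir w u) vs x = dir_derivs (\<lambda>x. (dir_derivs u [w] x + \<i> * dir_derivs u [\<i> *s w] x) / 2) vs x"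
    by (simp add: dbar_dir_def[abs_def])
  also have "\<dots> = dir_derivs (\<lambda>x. dir_derivs u [w] x + \<i> * dir_derivs u [\<i> *s w] x) vs x / 2"
    by (rule dir_derivs_linear_comp[OF bl(1) assms(1) smooth_on_add[OF assms(1) sm smi] assms(2)])
  also have "\<dots> = (dir_derivs (dir_derivs u [w]) vs x + dir_derivs (\<lambda>x. \<i> * dir_derivs u [\<i> *s w] x) vs x) / 2"
    by (subst dir_derivs_add[OF assms(1) sm smi assms(2)]) (rule refl)
  also have "\<dots> = (dir_derivs u (vs @ [w]) x + \<i> * dir_derivs u (vs @ [\<i> *s w]) x) / 2"
    by (subst dir_derivs_linear_comp[OF bl(2) assms(1) sm assms(2)]) (simp only: dir_derivs_snoc)
  finally have e: "dir_derivs (dbar_dir w u) vs x = (dir_derivs u (vs @ [w]) x + \<i> * dir_derivs u (vs @ [\<i> *s w]) x) / 2" .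
  have "cmod (dir_derivs u (vs @ [z]) x) \<le> A" if "z \<in> Q" for z
    using assms(4) vs that unfolding symbol_bd_def by (metis length_append_singleton Suc_le_mono Un_insert_right insert_subset list.simps(15) set_append sup_bot_right list.set(1))
  then have "cmod (dir_derivs u (vs @ [w]) x) \<le> A" "cmod (\<i> * dir_derivs u (vs @ [\<i> *s w]) x) \<le> A"
    using assms(5,6) by (auto simp: norm_mult)
  then have "cmod (dir_derivs u (vs @ [w]) x + \<i> * dir_derivs u (vs @ [\<i> *s w]) x) \<le> A + A"
    by (rule order_trans[OF norm_triangle_ineq add_mono])
  then show "cmod (dir_derivs (dbar_dir w u) vs x) \<le> A" unfolding e norm_divide by simp
qed

lemma symbol_bd_dbar_dir_pow:
  assumes "open S" "x \<in> S" "w \<in> Q" "\<i> *s w \<in> Q"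
  shows "smooth_on S u \<Longrightarrow> symbol_bd (k + n) u x Q A \<Longrightarrow> symbol_bd n ((dbar_dir w ^^ k) u) x Q A"
proof (induction k arbitrary: n)
  case (Suc k)
  have "symbol_bd (Suc n) ((dbar_dir w ^^ k) u) x Q A" by (rule Suc.IH) (use Suc.prems in auto)
  then show ?case
    using symbol_bd_dbar_dir[OF assms(1,2) smooth_on_dbar_dir_pow[OF assms(1) Suc.prems(1)] _ assms(3,4)] by simp
qed simp

lemma dbar_dir_sum_mult_holomorphic:
  assumes S: "open S" "x \<in> S" and fin: "finite I"
    and \<phi>: "\<And>i. i \<in> I \<Longrightarrow> smooth_on S (\<phi> i)" and G: "\<And>i. i \<in> I \<Longrightarrow> Cn_holomorphic_on (G i) S"
  shows "dbar_dir w (\<lambda>x. \<Sum>i\<in>I. \<phi> i x * G i x) x = (\<Sum>i\<in>I. dbar_dir w (\<phi> i) x * G i x)"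
proof -
  have sG: "smooth_on S (G i)" if "i \<in> I" for i using Cn_holomorphic_smooth_on[OF G[OF that] S(1)] .
  have d: "dir_derivs (\<lambda>x. \<Sum>i\<in>I. \<phi> i x * G i x) [u] x =
      (\<Sum>i\<in>I. \<phi> i x * dir_derivs (G i) [u] x + dir_derivs (\<phi> i) [u] x * G i x)" for u
  proof -
    have "dir_derivs (\<lambda>x. \<Sum>i\<in>I. \<phi> i x * G i x) [u] x = (\<Sum>i\<in>I. dir_derivs (\<lambda>x. \<phi> i x * G i x) [u] x)"
      by (rule dir_derivs_sum[OF S fin]) (intro smooth_on_mult S \<phi> sG)
    also have "\<dots> = (\<Sum>i\<in>I. \<phi> i x * dir_derivs (G i) [u] x + dir_derivs (\<phi> i) [u] x * G i x)"
      by (intro sum.cong refl frechet_mult smooth_on_differentiable[OF \<phi> S(2)] smooth_on_differentiable[OF sG S(2)])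
    finally show ?thesis .
  qed
  have i: "dir_derivs (G i) [\<i> *s w] x = \<i> * dir_derivs (G i) [w] x" if "i \<in> I" for i
    using Cn_holomorphic_has_derivative(2)[OF G[OF that] S(2)] by simp
  have "dbar_dir w (\<lambda>x. \<Sum>i\<in>I. \<phi> i x * G i x) x =
     (\<Sum>i\<in>I. ((\<phi> i x * dir_derivs (G i) [w] x + dir_derivs (\<phi> i) [w] x * G i x) +
       \<i> * (\<phi> i x * dir_derivs (G i) [\<i> *s w] x + dir_derivs (\<phi> i) [\<i> *s w] x * G i x)) / 2)"
    by (simp only: dbar_dir_def d sum_distrib_left sum.distrib[symmetric] sum_divide_distrib)
  also have "\<dots> = (\<Sum>i\<in>I. dbar_dir w (\<phi> i) x * G i x)"
    by (intro sum.cong refl) (simp add: i dbar_dir_def[of w] field_simps del: dir_derivs.simps)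
  finally show ?thesis .
qed

lemma dbar_dir_pow_sum_mult_holomorphic:
  assumes S: "open S" and fin: "finite I"
    and \<phi>: "\<And>i. i \<in> I \<Longrightarrow> smooth_on S (\<phi> i)" and G: "\<And>i. i \<in> I \<Longrightarrow> Cn_holomorphic_on (G i) S"
  shows "x \<in> S \<Longrightarrow> (dbar_dir w ^^ k) (\<lambda>x. \<Sum>i\<in>I. \<phi> i x * G i x) x = (\<Sum>i\<in>I. (dbar_dir w ^^ k) (\<phi> i) x * G i x)"
proof (induction k arbitrary: x)
  case (Suc k)
  have "(dbar_dir w ^^ Suc k) (\<lambda>x. \<Sum>i\<in>I. \<phi> i x * G i x) x =
      dbar_dir w (\<lambda>x. \<Sum>i\<in>I. (dbar_dir w ^^ k) (\<phi> i) x * G i x) x"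
    using dbar_dir_cong_open[OF S Suc.IH Suc.prems] by simp
  also have "\<dots> = (\<Sum>i\<in>I. dbar_dir w ((dbar_dir w ^^ k) (\<phi> i)) x * G i x)"
    by (rule dbar_dir_sum_mult_holomorphic[OF S Suc.prems fin smooth_on_dbar_dir_pow[OF S \<phi>] G])
  finally show ?case by simp
qed simp

lemma dbar_dir_pow_const: "(dbar_dir w ^^ k) (\<lambda>x. c) = (\<lambda>x. if k = 0 then c else 0)"
proof (induction k)
  case (Suc k)
  have "dbar_dir w (\<lambda>x. b) = (\<lambda>x. 0)" for b by (simp add: dbar_dir_def fun_eq_iff)
  then show ?case using Suc by (cases "k = 0") auto
qed simp

text \<open>
  The derivatives fall on the weights only. Where the functions all have the same value, the derivatives
  of the sum of the weights, which is constant, appear as a factor.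
\<close>

lemma dbar_partition_vanish:
  assumes S: "open S" "x \<in> S" and fin: "finite I"
    and \<phi>: "\<And>i. i \<in> I \<Longrightarrow> smooth_on S (\<phi> i)" and G: "\<And>i. i \<in> I \<Longrightarrow> Cn_holomorphic_on (G i) S"
    and one: "\<And>y. y \<in> S \<Longrightarrow> (\<Sum>i\<in>I. \<phi> i y) = 1" and val: "\<And>i. i \<in> I \<Longrightarrow> G i x = c"
    and ab: "\<alpha> + \<beta> \<ge> (1::nat)"
  shows "(dbar_dir \<eta> ^^ \<alpha>) ((dbar_dir v ^^ \<beta>) (\<lambda>x. \<Sum>i\<in>I. \<phi> i x * G i x)) x = 0"
proof -
  have chain: "(dbar_dir \<eta> ^^ \<alpha>) ((dbar_dir v ^^ \<beta>) (\<lambda>x. \<Sum>i\<in>I. \<phi> i x * H i x)) x =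
     (\<Sum>i\<in>I. (dbar_dir \<eta> ^^ \<alpha>) ((dbar_dir v ^^ \<beta>) (\<phi> i)) x * H i x)"
    if H: "\<And>i. i \<in> I \<Longrightarrow> Cn_holomorphic_on (H i) S" for H
  proof -
    have "(dbar_dir \<eta> ^^ \<alpha>) ((dbar_dir v ^^ \<beta>) (\<lambda>x. \<Sum>i\<in>I. \<phi> i x * H i x)) x =
       (dbar_dir \<eta> ^^ \<alpha>) (\<lambda>x. \<Sum>i\<in>I. (dbar_dir v ^^ \<beta>) (\<phi> i) x * H i x) x"
      by (rule dbar_dir_pow_cong_open[OF S(1) _ S(2)]) (rule dbar_dir_pow_sum_mult_holomorphic[OF S(1) fin \<phi> H])
    also have "\<dots> = (\<Sum>i\<in>I. (dbar_dir \<eta> ^^ \<alpha>) ((dbar_dir v ^^ \<beta>) (\<phi> i)) x * H i x)"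
      by (rule dbar_dir_pow_sum_mult_holomorphic[OF S(1) fin smooth_on_dbar_dir_pow[OF S(1) \<phi>] H S(2)])
    finally show ?thesis .
  qed
  have "(\<Sum>i\<in>I. (dbar_dir \<eta> ^^ \<alpha>) ((dbar_dir v ^^ \<beta>) (\<phi> i)) x * 1) =
     (dbar_dir \<eta> ^^ \<alpha>) ((dbar_dir v ^^ \<beta>) (\<lambda>x. \<Sum>i\<in>I. \<phi> i x * 1)) x"
    by (rule chain[of "\<lambda>_ _. 1", symmetric]) (rule Cn_holomorphic_const)
  also have "\<dots> = (dbar_dir \<eta> ^^ \<alpha>) ((dbar_dir v ^^ \<beta>) (\<lambda>x. 1)) x"
    by (intro dbar_dir_pow_cong_open[OF S(1) _ S(2)] dbar_dir_pow_cong_open[OF S(1)]) (use one in auto)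
  also have "\<dots> = 0" using ab by (cases "\<beta> = 0") (auto simp: dbar_dir_pow_const)
  finally have z: "(\<Sum>i\<in>I. (dbar_dir \<eta> ^^ \<alpha>) ((dbar_dir v ^^ \<beta>) (\<phi> i)) x) = 0" by simp
  have "(dbar_dir \<eta> ^^ \<alpha>) ((dbar_dir v ^^ \<beta>) (\<lambda>x. \<Sum>i\<in>I. \<phi> i x * G i x)) x =
      (\<Sum>i\<in>I. (dbar_dir \<eta> ^^ \<alpha>) ((dbar_dir v ^^ \<beta>) (\<phi> i)) x * G i x)"
    by (rule chain[OF G])
  also have "\<dots> = (\<Sum>i\<in>I. (dbar_dir \<eta> ^^ \<alpha>) ((dbar_dir v ^^ \<beta>) (\<phi> i)) x * c)"
    using val by (intro sum.cong) auto
  finally show ?thesis using z by (simp add: sum_distrib_right[symmetric])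
qed

context boundary_frame
begin

section \<open>Gluing the local extensions\<close>

definition opolydisc :: "complex^2 \<Rightarrow> real \<Rightarrow> (complex^2) set" where
  "opolydisc \<zeta> c = {z. cmod (herm (z - \<zeta>) (\<eta> \<zeta>)) < c * q \<zeta> \<and> cmod (herm (z - \<zeta>) (v \<zeta>)) < c * s \<zeta>}"

lemma open_opolydisc: "open (opolydisc \<zeta> c)"
proof -
  have "open ({z. cmod (herm (z - \<zeta>) (\<eta> \<zeta>)) < c * q \<zeta>} \<inter> {z. cmod (herm (z - \<zeta>) (v \<zeta>)) < c * s \<zeta>})"
    by (intro open_Int open_Collect_less continuous_intros)
  then show ?thesis by (simp add: opolydisc_def Collect_conj_eq[symmetric])
qed

lemma polydisc_subset_opolydisc: "\<zeta> \<in> layer \<Longrightarrow> c < c' \<Longrightarrow> polydisc \<zeta> c \<subseteq> opolydisc \<zeta> c'"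
proof
  fix z assume a: "\<zeta> \<in> layer" "c < c'" "z \<in> polydisc \<zeta> c"
  have "c * q \<zeta> < c' * q \<zeta>" "c * s \<zeta> < c' * s \<zeta>" using layer(2,5)[OF a(1)] a(2) by auto
  then show "z \<in> opolydisc \<zeta> c'" using a(3) by (auto simp: polydisc_def opolydisc_def)
qed

text \<open>One minus the square of a coordinate about \<open>j\<close>, in units of \<open>b\<close>.\<close>

definition coord_defect :: "complex^2 \<Rightarrow> complex^2 \<Rightarrow> real \<Rightarrow> complex^2 \<Rightarrow> real" where
  "coord_defect u j b z = 1 - ((Re (herm (z - j) u) / b)\<^sup>2 + (Im (herm (z - j) u) / b)\<^sup>2)"

lemma coord_defect_eq: "b > 0 \<Longrightarrow> coord_defect u j b z = 1 - (cmod (herm (z - j) u) / b)\<^sup>2"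
  by (simp add: coord_defect_def power_divide cmod_power2 add_divide_distrib)

lemma coord_defect_le_1: "coord_defect u j b z \<le> 1"
  by (simp add: coord_defect_def)

lemma smooth_coord_defect:
  "smooth_on UNIV (coord_defect u j b)"
  "b > 0 \<Longrightarrow> cmod (herm (\<zeta> - j) u) \<le> A * b \<Longrightarrow> (\<And>w. w \<in> Q \<Longrightarrow> cmod (herm w u) \<le> A * b) \<Longrightarrow>
    symbol_bd n (coord_defect u j b) \<zeta> Q (1 + (2 ^ n * A * A + 2 ^ n * A * A))"
proof -
  define P where "P part z = part (herm (z - j) u) / b" for part :: "complex \<Rightarrow> real" and z
  have bl: "bounded_linear (\<lambda>w. part (herm w u) / b)" if "bounded_linear part" for part :: "complex \<Rightarrow> real"
    by (intro bounded_linear_compose[OF bounded_linear_divide] bounded_linear_compose[OF that] bounded_linear_herm)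
  have P: "P part = (\<lambda>z. part (herm z u) / b + (- (part (herm j u) / b)))" if "bounded_linear part" for part
    by (simp add: P_def fun_eq_iff herm_diff linear_diff[OF bounded_linear.linear[OF that]] diff_divide_distrib)
  have smP: "smooth_on UNIV (P part)" if "bounded_linear part" for part
    unfolding P[OF that] by (rule smooth_on_affine[OF bl[OF that]])
  note parts = bounded_linear_Re bounded_linear_Im
  have e: "coord_defect u j b = (\<lambda>z. 1 + (- 1) * (P Re z * P Re z + P Im z * P Im z))"
    by (simp add: coord_defect_def P_def fun_eq_iff power2_eq_square)
  have sm2: "smooth_on UNIV (\<lambda>z. P Re z * P Re z + P Im z * P Im z)"
    by (intro smooth_on_add smooth_on_mult smP parts open_UNIV)
  show "smooth_on UNIV (coord_defect u j b)"
    unfolding e by (intro smooth_on_add smooth_on_mult smooth_on_const sm2[unfolded] smP parts open_UNIV)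
  assume b: "b > 0" and A: "cmod (herm (\<zeta> - j) u) \<le> A * b" "\<And>w. w \<in> Q \<Longrightarrow> cmod (herm w u) \<le> A * b"
  have bdP: "symbol_bd n (P part) \<zeta> Q A" if part: "bounded_linear part" "\<And>x. \<bar>part x\<bar> \<le> cmod x" for part
  proof -
    have le: "\<bar>part (herm w u) / b\<bar> \<le> A" if "cmod (herm w u) \<le> A * b" for w
      using order_trans[OF part(2) that] b by (simp add: abs_divide divide_simps)
    have "P part \<zeta> = part (herm \<zeta> u) / b + (- (part (herm j u) / b))" using P[OF part(1)] by metis
    then have 1: "norm (part (herm \<zeta> u) / b + (- (part (herm j u) / b))) \<le> A" using le[OF A(1)] by (simp add: P_def)
    show ?thesis unfolding P[OF part(1)]
      by (rule symbol_bd_affine[OF bl[OF part(1)] 1]) (use le[OF A(2)] in simp)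
  qed
  have m: "symbol_bd n (\<lambda>z. P part z * P part z) \<zeta> Q (2 ^ n * A * A)"
    if part: "bounded_linear part" "\<And>x. \<bar>part x\<bar> \<le> cmod x" for part
    by (rule symbol_bd_mult[OF open_UNIV UNIV_I smP[OF part(1)] smP[OF part(1)] bdP[OF part] bdP[OF part]])
  have "symbol_bd n (\<lambda>z. P Re z * P Re z + P Im z * P Im z) \<zeta> Q (2 ^ n * A * A + 2 ^ n * A * A)"
    by (rule symbol_bd_add[OF open_UNIV UNIV_I _ _ m m])
      (auto intro!: smooth_on_mult smP parts simp: abs_Re_le_cmod abs_Im_le_cmod)
  then have neg: "symbol_bd n (\<lambda>z. (- 1) * (P Re z * P Re z + P Im z * P Im z)) \<zeta> Q (1 * (2 ^ n * A * A + 2 ^ n * A * A))"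
    by (intro symbol_bd_linear_comp[OF bounded_linear_mult_right open_UNIV UNIV_I sm2]) auto
  have one: "symbol_bd n (\<lambda>z. 1 :: real) \<zeta> Q 1" unfolding symbol_bd_def dir_derivs_const by simp
  have sneg: "smooth_on UNIV (\<lambda>z. (- 1) * (P Re z * P Re z + P Im z * P Im z))"
    by (intro smooth_on_mult smooth_on_const sm2 open_UNIV)
  show "symbol_bd n (coord_defect u j b) \<zeta> Q (1 + (2 ^ n * A * A + 2 ^ n * A * A))"
    unfolding e using symbol_bd_add[OF open_UNIV UNIV_I smooth_on_const sneg one neg] by simp
qed

text \<open>
  A smooth function that is positive on the open polydisc of size \<open>8 a\<close> about \<open>j\<close>, zero outside, and
  bounded below on the polydisc of size \<open>4 a\<close>.
\<close>

definition bump :: "real \<Rightarrow> complex^2 \<Rightarrow> complex^2 \<Rightarrow> real" where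
  "bump a j z = cutoff 0 (coord_defect (\<eta> j) j (8 * a * q j) z) * cutoff 0 (coord_defect (v j) j (8 * a * s j) z)"

lemma smooth_cutoff_coord_defect: "smooth_on UNIV (\<lambda>z. cutoff 0 (coord_defect u j b z))"
  by (rule smooth_on_comp_real[where \<psi>=cutoff, OF open_UNIV _ smooth_coord_defect(1)]) (rule cutoff_deriv)

lemma smooth_bump: "smooth_on UNIV (bump a j)"
  unfolding bump_def by (intro smooth_on_mult smooth_cutoff_coord_defect open_UNIV)

lemma bump_nonneg: "0 \<le> bump a j z"
  unfolding bump_def by (intro mult_nonneg_nonneg cutoff_pos)

lemma bump_support:
  assumes "j \<in> layer" "0 < a" "bump a j z \<noteq> 0" shows "z \<in> polydisc j (8 * a)"
proof -
  have b: "8 * a * q j > 0" "8 * a * s j > 0" using layer[OF assms(1)] assms(2) by auto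
  have "coord_defect (\<eta> j) j (8 * a * q j) z > 0" "coord_defect (v j) j (8 * a * s j) z > 0"
    using assms(3) cutoff_pos(1,2) unfolding bump_def by (metis mult_eq_0_iff less_le)+
  then have "(cmod (herm (z - j) (\<eta> j)) / (8 * a * q j))\<^sup>2 < 1" "(cmod (herm (z - j) (v j)) / (8 * a * s j))\<^sup>2 < 1"
    unfolding coord_defect_eq[OF b(1)] coord_defect_eq[OF b(2)] by auto
  then have "cmod (herm (z - j) (\<eta> j)) / (8 * a * q j) < 1" "cmod (herm (z - j) (v j)) / (8 * a * s j) < 1"
    using power2_less_imp_less[of "cmod (herm (z - j) (\<eta> j)) / (8 * a * q j)" 1]
      power2_less_imp_less[of "cmod (herm (z - j) (v j)) / (8 * a * s j)" 1] by auto
  then show ?thesis using b by (simp add: polydisc_def divide_simps)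
qed

lemma bump_lower:
  assumes "j \<in> layer" "0 < a" "z \<in> polydisc j (4 * a)" shows "exp (- 4) \<le> bump a j z"
proof -
  have b: "8 * a * q j > 0" "8 * a * s j > 0" using layer[OF assms(1)] assms(2) by auto
  have "cmod (herm (z - j) (\<eta> j)) / (8 * a * q j) \<le> 1/2" "cmod (herm (z - j) (v j)) / (8 * a * s j) \<le> 1/2"
    using assms(3) b by (auto simp: polydisc_def divide_simps)
  then have "(cmod (herm (z - j) (\<eta> j)) / (8 * a * q j))\<^sup>2 \<le> (1/2)\<^sup>2" "(cmod (herm (z - j) (v j)) / (8 * a * s j))\<^sup>2 \<le> (1/2)\<^sup>2"
    using b by (auto intro!: power_mono simp del: power_divide)
  then have "3/4 \<le> coord_defect (\<eta> j) j (8 * a * q j) z" "3/4 \<le> coord_defect (v j) j (8 * a * s j) z"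
    unfolding coord_defect_eq[OF b(1)] coord_defect_eq[OF b(2)] by (auto simp: power2_eq_square)
  then have "exp (- 2) * exp (- 2) \<le> bump a j z"
    unfolding bump_def by (intro mult_mono cutoff_pos) auto
  then show ?thesis by (simp add: exp_add[symmetric])
qed

text \<open>
  In units of \<open>q\<close> and \<open>s\<close>, the cutoff functions at all points \<open>j\<close> look the same.
\<close>

lemma bump_symbol:
  assumes a: "0 < a" "48 * a \<le> c0"
  shows "\<exists>C. \<forall>j \<zeta>. j \<in> layer \<longrightarrow> \<zeta> \<in> polydisc j (12 * a) \<longrightarrow> symbol_bd n (bump a j) \<zeta> (dirs \<zeta>) C"
proof -
  define A where "A = 2 + 3 / (8 * a)"
  define A' where "A' = 1 + (2 ^ n * A * A + 2 ^ n * A * A)"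
  have "\<exists>Kc. \<forall>(u :: complex^2 \<Rightarrow> real) x S Q. open S \<longrightarrow> x \<in> S \<longrightarrow> smooth_on S u \<longrightarrow>
     u x \<in> {..1} \<longrightarrow> symbol_bd n u x Q A' \<longrightarrow> symbol_bd n (\<lambda>y. cutoff 0 (u y)) x Q Kc"
    by (rule symbol_bd_comp_real[of cutoff "{..1}", OF cutoff_deriv cutoff_bounded])
  then obtain Kc where Kc: "\<And>(u :: complex^2 \<Rightarrow> real) x S Q. open S \<Longrightarrow> x \<in> S \<Longrightarrow> smooth_on S u \<Longrightarrow>
     u x \<in> {..1} \<Longrightarrow> symbol_bd n u x Q A' \<Longrightarrow> symbol_bd n (\<lambda>y. cutoff 0 (u y)) x Q Kc" by metis
  have "symbol_bd n (bump a j) \<zeta> (dirs \<zeta>) (2 ^ n * Kc * Kc)" if j: "j \<in> layer" and \<zeta>: "\<zeta> \<in> polydisc j (12 * a)" for j \<zeta>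
  proof -
    note l = layer[OF j]
    have b: "8 * a * q j > 0" "8 * a * s j > 0" using l a by auto
    have a12: "0 \<le> 12 * a" "12 * a \<le> c0" using a by auto
    note d = dirs_change[OF j a12 \<zeta>]
    have Aq: "12 * a * t \<le> A * (8 * a * t)" "3 * t \<le> A * (8 * a * t)" "2 * t \<le> A * (8 * a * t)" if "t > 0" for t
    proof -
      have "A * (8 * a * t) = 16 * (a * t) + 3 * t" using a by (simp add: A_def field_simps)
      moreover have "a * t > 0" using a that by simp
      ultimately show "12 * a * t \<le> A * (8 * a * t)" "3 * t \<le> A * (8 * a * t)" "2 * t \<le> A * (8 * a * t)" using that by auto
    qed
    have "symbol_bd n (coord_defect (\<eta> j) j (8 * a * q j)) \<zeta> (dirs \<zeta>) A'" unfolding A'_def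
      by (rule smooth_coord_defect(2)[OF b(1)])
        (use \<zeta> Aq(1)[OF l(2)] order_trans[OF d(1) Aq(2)[OF l(2)]] in \<open>auto simp: polydisc_def\<close>)
    then have 1: "symbol_bd n (\<lambda>z. cutoff 0 (coord_defect (\<eta> j) j (8 * a * q j) z)) \<zeta> (dirs \<zeta>) Kc"
      by (intro Kc[OF open_UNIV UNIV_I smooth_coord_defect(1)]) (simp_all add: coord_defect_le_1)
    have "symbol_bd n (coord_defect (v j) j (8 * a * s j)) \<zeta> (dirs \<zeta>) A'" unfolding A'_def
      by (rule smooth_coord_defect(2)[OF b(2)])
        (use \<zeta> Aq(1)[OF l(5)] order_trans[OF d(2) Aq(3)[OF l(5)]] in \<open>auto simp: polydisc_def\<close>)
    then have 2: "symbol_bd n (\<lambda>z. cutoff 0 (coord_defect (v j) j (8 * a * s j) z)) \<zeta> (dirs \<zeta>) Kc"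
      by (intro Kc[OF open_UNIV UNIV_I smooth_coord_defect(1)]) (simp_all add: coord_defect_le_1)
    show ?thesis unfolding bump_def[abs_def]
      by (rule symbol_bd_mult[OF open_UNIV UNIV_I _ _ 1 2])
        (rule smooth_cutoff_coord_defect)+
  qed
  then show ?thesis by blast
qed

text \<open>
  The polydisc of size \<open>24 a\<close> leaves room for Cauchy's estimates at the points of the one of size \<open>12 a\<close>.
\<close>

lemma local_extension_symbol:
  assumes a: "0 < a" "48 * a \<le> c0" and j: "j \<in> layer" and \<zeta>: "\<zeta> \<in> polydisc j (12 * a)"
    and G: "Cn_holomorphic_on G (opolydisc j (24 * a))" "\<And>z. z \<in> opolydisc j (24 * a) \<Longrightarrow> cmod (G z) \<le> B" and B: "B \<ge> 0"
  shows "symbol_bd n G \<zeta> (dirs \<zeta>) (B * max 1 ((real n + 1) / (3 * a)) ^ n)"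
proof -
  note l = layer[OF j]
  have a12: "0 \<le> 12 * a" "12 * a \<le> c0" using a by auto
  note d = dirs_change[OF j a12 \<zeta>]
  define R where "R t = polydisc j (12 * a + 3 * t)" for t
  show ?thesis
  proof (rule Cn_holomorphic_symbol_bd[OF G(1) open_opolydisc, where R=R])
    show "z \<in> opolydisc j (24 * a) \<and> cmod (G z) \<le> B" if "t \<ge> 0" "z \<in> R t" "t \<le> 3 * a" for t z
    proof -
      have "z \<in> opolydisc j (24 * a)"
        using that polydisc_subset_opolydisc[OF j, of "12 * a + 3 * t" "24 * a"] a by (auto simp: R_def)
      then show ?thesis using G(2) by blast
    qed
    show "\<zeta> \<in> R 0" using \<zeta> by (simp add: R_def)
    fix t \<sigma> :: real and z w c assume h: "t \<ge> 0" "\<sigma> \<ge> 0" "z \<in> R t" "w \<in> dirs \<zeta>" "cmod c \<le> \<sigma>"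
    have e: "herm (z + c *s w - j) u = herm (z - j) u + c * herm w u" for u
    proof -
      have "z + c *s w - j = (z - j) + c *s w" by simp
      then show ?thesis by (simp only: herm_add herm_smult)
    qed
    have "cmod (c * herm w (\<eta> j)) \<le> \<sigma> * (3 * q j)" unfolding norm_mult using h d(1)[OF h(4)] by (intro mult_mono) auto
    then have 1: "cmod (herm (z + c *s w - j) (\<eta> j)) \<le> (12 * a + 3 * t) * q j + \<sigma> * (3 * q j)"
      unfolding e using h(3) by (intro norm_triangle_le add_mono) (auto simp: R_def polydisc_def)
    have "cmod (c * herm w (v j)) \<le> \<sigma> * (2 * s j)" unfolding norm_mult using h d(2)[OF h(4)] by (intro mult_mono) auto
    also have "\<dots> \<le> \<sigma> * (3 * s j)" using h(2) l by (intro mult_left_mono) auto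
    finally have 2: "cmod (herm (z + c *s w - j) (v j)) \<le> (12 * a + 3 * t) * s j + \<sigma> * (3 * s j)"
      unfolding e using h(3) by (intro norm_triangle_le add_mono) (auto simp: R_def polydisc_def)
    show "z + c *s w \<in> R (t + \<sigma>)" using 1 2 by (simp add: R_def polydisc_def algebra_simps)
  qed (use a B in auto)
qed

definition local_extension_at ::
    "real \<Rightarrow> real \<Rightarrow> (complex^2 \<Rightarrow> complex) \<Rightarrow> (complex^2) set \<Rightarrow> complex^2 \<Rightarrow> (complex^2 \<Rightarrow> complex) \<Rightarrow> bool" where
  "local_extension_at a B g X j G \<longleftrightarrow> Cn_holomorphic_on G (opolydisc j (24 * a)) \<and>
     (\<forall>z\<in>opolydisc j (24 * a). cmod (G z) \<le> B \<and> (z \<in> X \<longrightarrow> G z = g z))"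

definition symbol_extension ::
    "(nat \<Rightarrow> real) \<Rightarrow> (complex^2 \<Rightarrow> complex) \<Rightarrow> (complex^2) set \<Rightarrow> (complex^2 \<Rightarrow> complex) \<Rightarrow> bool" where
  "symbol_extension C g X gt \<longleftrightarrow> smooth_on layer gt \<and> (\<forall>n. \<forall>\<zeta>\<in>layer. symbol_bd n gt \<zeta> (dirs \<zeta>) (C n)) \<and>
      (\<forall>\<zeta>\<in>layer. \<zeta> \<in> X \<longrightarrow> gt \<zeta> = g \<zeta>) \<and>
      (\<forall>\<zeta>\<in>layer. \<zeta> \<in> X \<longrightarrow> (\<forall>\<alpha> \<beta>. \<alpha> + \<beta> \<ge> 1 \<longrightarrow> (dbar_dir (\<eta> \<zeta>) ^^ \<alpha>) ((dbar_dir (v \<zeta>) ^^ \<beta>) gt) \<zeta> = 0))"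

text \<open>
  The local extensions are combined with a partition of unity subordinate to a covering by adapted
  polydiscs. All functions involved satisfy symbol estimates in the adapted directions, at each
  point only boundedly many of them matter, and antiholomorphic derivatives fall on the weights only.
\<close>

theorem glue_local_extensions:
  assumes a: "0 < a" "48 * a \<le> c0"
  shows "\<exists>C. \<forall>G g X B. 0 \<le> B \<longrightarrow> (\<forall>j\<in>layer. local_extension_at a B g X j (G j)) \<longrightarrow>
    (\<exists>gt. symbol_extension (\<lambda>n. C n * B) g X gt)"
proof -
  have a': "0 \<le> a" "a \<le> c0" "0 \<le> 8 * a" "8 * a \<le> c0" using a by auto
  obtain J where J: "separated a J" "\<And>\<zeta>. \<zeta> \<in> layer \<Longrightarrow> \<exists>j\<in>J. \<zeta> \<in> polydisc j (4 * a)"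
    using maximal_separated[OF a'(1,2)] by blast
  have Jl: "j \<in> layer" if "j \<in> J" for j using J(1) that by (auto simp: separated_def)
  define N where "N = (769 ^ 4 :: nat)"
  obtain Cb where Cb: "\<And>n j \<zeta>. j \<in> layer \<Longrightarrow> \<zeta> \<in> polydisc j (12 * a) \<Longrightarrow> symbol_bd n (bump a j) \<zeta> (dirs \<zeta>) (Cb n)"
    using bump_symbol[OF a] by metis
  have "\<exists>Ki. \<forall>(f :: complex^2 \<Rightarrow> complex) x S Q. open S \<longrightarrow> x \<in> S \<longrightarrow> smooth_on S f \<longrightarrow>
     (\<forall>y\<in>S. f y \<noteq> 0) \<longrightarrow> symbol_bd n f x Q (real N * \<bar>Cb n\<bar>) \<longrightarrow> norm (inverse (f x)) \<le> exp 4 \<longrightarrow>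
     symbol_bd n (\<lambda>y. inverse (f y)) x Q Ki" for n by (rule symbol_bd_inverse)
  then obtain Ki where Ki: "\<And>n (f :: complex^2 \<Rightarrow> complex) x S Q. open S \<Longrightarrow> x \<in> S \<Longrightarrow> smooth_on S f \<Longrightarrow>
     (\<forall>y\<in>S. f y \<noteq> 0) \<Longrightarrow> symbol_bd n f x Q (real N * \<bar>Cb n\<bar>) \<Longrightarrow> norm (inverse (f x)) \<le> exp 4 \<Longrightarrow>
     symbol_bd n (\<lambda>y. inverse (f y)) x Q (Ki n)" by metis
  define gf where "gf n = max 1 ((real n + 1) / (3 * a)) ^ n" for n
  define C where "C n = 2 ^ n * (real N * (2 ^ n * \<bar>Cb n\<bar> * gf n)) * Ki n" for n
  have "\<exists>gt. symbol_extension (\<lambda>n. C n * B) g X gt"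
    if B: "0 \<le> B" and Gl: "\<forall>j\<in>layer. local_extension_at a B g X j (G j)" for G g X B
  proof -
    have G: "\<forall>j\<in>layer. Cn_holomorphic_on (G j) (opolydisc j (24 * a)) \<and>
        (\<forall>z\<in>opolydisc j (24 * a). cmod (G j z) \<le> B \<and> (z \<in> X \<longrightarrow> G j z = g z))"
      using Gl unfolding local_extension_at_def .
    define Jz where "Jz z = {j\<in>J. bump a j z \<noteq> 0}" for z
    define I where "I \<zeta> = {j\<in>J. \<zeta> \<in> polydisc j (12 * a)}" for \<zeta>
    define gt where "gt z = (\<Sum>j\<in>Jz z. of_real (bump a j z) * G j z) * inverse (\<Sum>j\<in>Jz z. of_real (bump a j z))" for z
    have I: "finite (I \<zeta>)" "card (I \<zeta>) \<le> N" if "\<zeta> \<in> layer" for \<zeta>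
      using overlap_bound[OF J(1) a that] by (auto simp: I_def N_def)
    define den where "den \<zeta> z = (\<Sum>j\<in>I \<zeta>. of_real (bump a j z) :: complex)" for \<zeta> z
    \<comment> \<open>A neighbourhood of \<open>\<zeta>\<close> on which \<open>gt\<close> is a combination of the finitely many functions from \<open>I \<zeta>\<close>.\<close>
    define O' where "O' \<zeta> = (ball \<zeta> (a * q \<zeta>) \<inter> (\<Inter>j\<in>I \<zeta>. opolydisc j (24 * a))) \<inter> den \<zeta> -` (- {0})" for \<zeta>
    have smb: "smooth_on S (\<lambda>z. of_real (bump a j z) :: complex)" for j S
      by (rule smooth_on_subset[OF smooth_on_linear_comp[OF bounded_linear_of_real open_UNIV smooth_bump]]) simp
    have loc: "open (O' \<zeta>)" "\<zeta> \<in> O' \<zeta>" "\<And>z. z \<in> O' \<zeta> \<Longrightarrow> den \<zeta> z \<noteq> 0"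
      "\<And>j. j \<in> I \<zeta> \<Longrightarrow> O' \<zeta> \<subseteq> opolydisc j (24 * a)" "exp (- 4) \<le> cmod (den \<zeta> \<zeta>)"
      "\<And>z. z \<in> O' \<zeta> \<Longrightarrow> gt z = (\<Sum>j\<in>I \<zeta>. of_real (bump a j z) * G j z) * inverse (den \<zeta> z)"
      if \<zeta>: "\<zeta> \<in> layer" for \<zeta>
    proof -
      have sd: "smooth_on UNIV (den \<zeta>)" unfolding den_def by (intro smooth_on_sum I \<zeta> smb open_UNIV)
      have o: "open (ball \<zeta> (a * q \<zeta>) \<inter> (\<Inter>j\<in>I \<zeta>. opolydisc j (24 * a)))"
        using I[OF \<zeta>] open_opolydisc by (intro open_Int open_ball open_INT) auto
      show "open (O' \<zeta>)" unfolding O'_def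
        by (rule continuous_open_preimage[OF continuous_on_subset[OF smooth_on_continuous_on[OF sd]] o]) auto
      obtain j0 where j0: "j0 \<in> J" "\<zeta> \<in> polydisc j0 (4 * a)" using J(2)[OF \<zeta>] by blast
      have j0I: "j0 \<in> I \<zeta>" using j0 polydisc_mono[OF Jl[OF j0(1)], of "4 * a" "12 * a"] a by (auto simp: I_def)
      have dr: "den \<zeta> \<zeta> = of_real (\<Sum>j\<in>I \<zeta>. bump a j \<zeta>)" by (simp add: den_def)
      have "exp (- 4) \<le> bump a j0 \<zeta>" by (rule bump_lower[OF Jl[OF j0(1)] a(1) j0(2)])
      also have "\<dots> \<le> (\<Sum>j\<in>I \<zeta>. bump a j \<zeta>)" by (rule member_le_sum[OF j0I]) (auto simp: bump_nonneg I[OF \<zeta>])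
      finally have dl: "exp (- 4) \<le> (\<Sum>j\<in>I \<zeta>. bump a j \<zeta>)" .
      then show dn: "exp (- 4) \<le> cmod (den \<zeta> \<zeta>)" unfolding dr norm_of_real by linarith
      have "cmod (den \<zeta> \<zeta>) > 0" using dn exp_gt_zero[of "-4::real"] by linarith
      moreover have "\<zeta> \<in> opolydisc j (24 * a)" if "j \<in> I \<zeta>" for j
        using that polydisc_subset_opolydisc[of j "12 * a" "24 * a"] Jl a by (auto simp: I_def)
      ultimately show "\<zeta> \<in> O' \<zeta>" using a layer(2)[OF \<zeta>] by (auto simp: O'_def)
      show "den \<zeta> z \<noteq> 0" if "z \<in> O' \<zeta>" for z using that by (auto simp: O'_def)
      show "O' \<zeta> \<subseteq> opolydisc j (24 * a)" if "j \<in> I \<zeta>" for j using that by (auto simp: O'_def)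
      fix z assume z: "z \<in> O' \<zeta>"
      have "Jz z \<subseteq> I \<zeta>"
      proof
        fix j assume j: "j \<in> Jz z"
        then have "z \<in> polydisc j (8 * a)" using bump_support[OF Jl a(1)] by (auto simp: Jz_def)
        moreover have "dist \<zeta> z < a * q \<zeta>" using z by (simp add: O'_def)
        ultimately show "j \<in> I \<zeta>"
          using polydisc_locally_finite[OF J(1) a \<zeta>] j by (auto simp: I_def Jz_def)
      qed
      moreover have "\<forall>j\<in>I \<zeta> - Jz z. bump a j z = 0" by (auto simp: I_def Jz_def)
      ultimately have "(\<Sum>j\<in>Jz z. of_real (bump a j z) * G j z) = (\<Sum>j\<in>I \<zeta>. of_real (bump a j z) * G j z)"
        "(\<Sum>j\<in>Jz z. of_real (bump a j z) :: complex) = den \<zeta> z"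
        unfolding den_def by (auto intro!: sum.mono_neutral_left I[OF \<zeta>])
      then show "gt z = (\<Sum>j\<in>I \<zeta>. of_real (bump a j z) * G j z) * inverse (den \<zeta> z)" unfolding gt_def by simp
    qed
    have GO: "Cn_holomorphic_on (G j) (O' \<zeta>)" if "\<zeta> \<in> layer" "j \<in> I \<zeta>" for \<zeta> j
    proof -
      have "j \<in> layer" using that(2) Jl by (simp add: I_def)
      then have "Cn_holomorphic_on (G j) (opolydisc j (24 * a))" using G by blast
      then show ?thesis by (rule Cn_holomorphic_on_subset[OF _ loc(4)[OF that]])
    qed
    have smG: "smooth_on (O' \<zeta>) (G j)" if "\<zeta> \<in> layer" "j \<in> I \<zeta>" for \<zeta> j
      by (rule Cn_holomorphic_smooth_on[OF GO[OF that] loc(1)[OF that(1)]])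
    have smden: "smooth_on (O' \<zeta>) (\<lambda>z. inverse (den \<zeta> z))" if "\<zeta> \<in> layer" for \<zeta>
      unfolding den_def by (rule smooth_on_inverse[OF loc(1)[OF that] _ smooth_on_sum[OF loc(1)[OF that] I(1)[OF that] smb]])
        (use loc(3)[OF that] in \<open>simp add: den_def\<close>)
    have smnum: "smooth_on (O' \<zeta>) (\<lambda>z. \<Sum>j\<in>I \<zeta>. of_real (bump a j z) * G j z)" if "\<zeta> \<in> layer" for \<zeta>
      by (intro smooth_on_sum[OF loc(1)[OF that] I(1)[OF that]] smooth_on_mult[OF loc(1)[OF that] smb smG[OF that]])
    have smgt: "smooth_on (O' \<zeta>) gt" if "\<zeta> \<in> layer" for \<zeta>
      by (rule smooth_on_cong_open[OF loc(1)[OF that] loc(6)[OF that, symmetric]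
            smooth_on_mult[OF loc(1)[OF that] smnum[OF that] smden[OF that]]])
    have 1: "smooth_on layer gt"
      by (rule smooth_on_local) (use loc(1,2) smgt in blast)
    have 2: "symbol_bd n gt \<zeta> (dirs \<zeta>) (C n * B)" if \<zeta>: "\<zeta> \<in> layer" for n \<zeta>
    proof -
      have bs: "symbol_bd n (\<lambda>z. of_real (bump a j z) :: complex) \<zeta> (dirs \<zeta>) \<bar>Cb n\<bar>" if "j \<in> I \<zeta>" for j
      proof -
        have "symbol_bd n (\<lambda>z. of_real (bump a j z) :: complex) \<zeta> (dirs \<zeta>) (1 * Cb n)"
          by (rule symbol_bd_linear_comp[OF bounded_linear_of_real open_UNIV UNIV_I smooth_bump])
            (use Cb Jl that in \<open>auto simp: I_def\<close>)
        then show ?thesis by (rule symbol_bd_mono) auto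
      qed
      have gs: "symbol_bd n (G j) \<zeta> (dirs \<zeta>) (B * gf n)" if "j \<in> I \<zeta>" for j
        unfolding gf_def by (rule local_extension_symbol[OF a Jl]) (use that G Jl B in \<open>auto simp: I_def\<close>)
      have "symbol_bd n (\<lambda>z. \<Sum>j\<in>I \<zeta>. of_real (bump a j z) * G j z) \<zeta> (dirs \<zeta>) (real (card (I \<zeta>)) * (2 ^ n * \<bar>Cb n\<bar> * (B * gf n)))"
        by (intro symbol_bd_sum[OF loc(1,2)[OF \<zeta>] I(1)[OF \<zeta>]] symbol_bd_mult[OF loc(1,2)[OF \<zeta>]] smooth_on_mult[OF loc(1)[OF \<zeta>]] smb smG[OF \<zeta>] bs gs)
      then have num: "symbol_bd n (\<lambda>z. \<Sum>j\<in>I \<zeta>. of_real (bump a j z) * G j z) \<zeta> (dirs \<zeta>) (real N * (2 ^ n * \<bar>Cb n\<bar> * (B * gf n)))"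
        by (rule symbol_bd_mono) (use I(2)[OF \<zeta>] B in \<open>auto simp: gf_def intro!: mult_right_mono mult_nonneg_nonneg\<close>)
      have "symbol_bd n (den \<zeta>) \<zeta> (dirs \<zeta>) (real (card (I \<zeta>)) * \<bar>Cb n\<bar>)"
        unfolding den_def by (rule symbol_bd_sum[OF open_UNIV UNIV_I I(1)[OF \<zeta>] smb bs])
      then have dn: "symbol_bd n (den \<zeta>) \<zeta> (dirs \<zeta>) (real N * \<bar>Cb n\<bar>)"
        by (rule symbol_bd_mono) (use I(2)[OF \<zeta>] in \<open>auto intro!: mult_right_mono\<close>)
      have di: "norm (inverse (den \<zeta> \<zeta>)) \<le> exp 4"
      proof -
        have "norm (inverse (den \<zeta> \<zeta>)) \<le> inverse (exp (- 4))"
          unfolding norm_inverse by (intro le_imp_inverse_le loc(5)[OF \<zeta>] exp_gt_zero)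
        then show ?thesis by (simp add: exp_minus)
      qed
      have smd: "smooth_on (O' \<zeta>) (den \<zeta>)" unfolding den_def
        by (rule smooth_on_sum[OF loc(1)[OF \<zeta>] I(1)[OF \<zeta>] smb])
      have inv: "symbol_bd n (\<lambda>z. inverse (den \<zeta> z)) \<zeta> (dirs \<zeta>) (Ki n)"
        by (rule Ki[OF loc(1,2)[OF \<zeta>] smd _ dn di]) (use loc(3)[OF \<zeta>] in blast)
      have "symbol_bd n (\<lambda>z. (\<Sum>j\<in>I \<zeta>. of_real (bump a j z) * G j z) * inverse (den \<zeta> z)) \<zeta> (dirs \<zeta>)
         (2 ^ n * (real N * (2 ^ n * \<bar>Cb n\<bar> * (B * gf n))) * Ki n)"
        by (rule symbol_bd_mult[OF loc(1,2)[OF \<zeta>] smnum[OF \<zeta>] smden[OF \<zeta>] num inv])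
      moreover have "2 ^ n * (real N * (2 ^ n * \<bar>Cb n\<bar> * (B * gf n))) * Ki n = C n * B" by (simp add: C_def)
      ultimately show ?thesis using symbol_bd_cong_open[OF loc(1,2)[OF \<zeta>] loc(6)[OF \<zeta>]] by simp
    qed
    have val: "G j \<zeta> = g \<zeta>" if "\<zeta> \<in> layer" "\<zeta> \<in> X" "j \<in> I \<zeta>" for j \<zeta>
    proof -
      have "j \<in> layer" using that(3) Jl by (simp add: I_def)
      moreover have "\<zeta> \<in> opolydisc j (24 * a)" using loc(2)[OF that(1)] loc(4)[OF that(1,3)] by blast
      ultimately show ?thesis using G that(2) by blast
    qed
    have 3: "gt \<zeta> = g \<zeta>" if \<zeta>: "\<zeta> \<in> layer" "\<zeta> \<in> X" for \<zeta>
    proof -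
      have "(\<Sum>j\<in>I \<zeta>. of_real (bump a j \<zeta>) * G j \<zeta>) = den \<zeta> \<zeta> * g \<zeta>"
        unfolding den_def sum_distrib_right using val[OF \<zeta>] by (intro sum.cong) auto
      then show ?thesis using loc(6)[OF \<zeta>(1) loc(2)[OF \<zeta>(1)]] loc(3)[OF \<zeta>(1) loc(2)[OF \<zeta>(1)]] by simp
    qed
    have 4: "(dbar_dir (\<eta> \<zeta>) ^^ \<alpha>) ((dbar_dir (v \<zeta>) ^^ \<beta>) gt) \<zeta> = 0"
      if \<zeta>: "\<zeta> \<in> layer" "\<zeta> \<in> X" and ab: "\<alpha> + \<beta> \<ge> 1" for \<zeta> \<alpha> \<beta>
    proof -
      define \<phi> where "\<phi> j z = of_real (bump a j z) * inverse (den \<zeta> z)" for j z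
      have sm\<phi>: "smooth_on (O' \<zeta>) (\<phi> j)" for j
        unfolding \<phi>_def by (rule smooth_on_mult[OF loc(1)[OF \<zeta>(1)] smb smden[OF \<zeta>(1)]])
      have one: "(\<Sum>j\<in>I \<zeta>. \<phi> j z) = 1" if "z \<in> O' \<zeta>" for z
        using loc(3)[OF \<zeta>(1) that] unfolding \<phi>_def sum_distrib_right[symmetric] den_def by simp
      have eq: "gt z = (\<Sum>j\<in>I \<zeta>. \<phi> j z * G j z)" if "z \<in> O' \<zeta>" for z
        unfolding loc(6)[OF \<zeta>(1) that] \<phi>_def sum_distrib_right by (intro sum.cong) auto
      have "(dbar_dir (\<eta> \<zeta>) ^^ \<alpha>) ((dbar_dir (v \<zeta>) ^^ \<beta>) gt) \<zeta> =
         (dbar_dir (\<eta> \<zeta>) ^^ \<alpha>) ((dbar_dir (v \<zeta>) ^^ \<beta>) (\<lambda>z. \<Sum>j\<in>I \<zeta>. \<phi> j z * G j z)) \<zeta>"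
        by (intro dbar_dir_pow_cong_open[OF loc(1)[OF \<zeta>(1)] _ loc(2)[OF \<zeta>(1)]] dbar_dir_pow_cong_open[OF loc(1)[OF \<zeta>(1)] eq])
      also have "\<dots> = 0"
        by (rule dbar_partition_vanish[OF loc(1,2)[OF \<zeta>(1)] I(1)[OF \<zeta>(1)] sm\<phi> GO[OF \<zeta>(1)] one val[OF \<zeta>] ab])
      finally show ?thesis .
    qed
    show ?thesis unfolding symbol_extension_def using 1 2 3 4 by blast
  qed
  then show ?thesis by blast
qed

end

section \<open>The geometry of a smooth defining function\<close>

lemma smooth_on_gradient:
  fixes \<rho> :: "'a::euclidean_space \<Rightarrow> real"
  assumes "smooth_on S \<rho>" "x \<in> S"
  shows "(\<rho> has_derivative (\<lambda>h. h \<bullet> gradient \<rho> x)) (at x)"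
    and "gradient \<rho> x = (\<Sum>b\<in>Basis. dir_derivs \<rho> [b] x *\<^sub>R b)"
proof -
  let ?D = "frechet_derivative \<rho> (at x)"
  define g where "g = (\<Sum>b\<in>Basis. ?D b *\<^sub>R b)"
  have der: "(\<rho> has_derivative ?D) (at x)" by (rule smooth_on_has_derivative[OF assms])
  have D: "?D h = h \<bullet> g" for h
  proof -
    have "?D h = ?D (\<Sum>b\<in>Basis. (h \<bullet> b) *\<^sub>R b)" by (simp only: euclidean_representation)
    also have "\<dots> = (\<Sum>b\<in>Basis. (h \<bullet> b) * ?D b)"
      using has_derivative_linear[OF der] by (simp add: linear_sum linear_cmul)
    also have "\<dots> = h \<bullet> g" by (simp add: g_def inner_sum_right mult.commute)
    finally show ?thesis .
  qed
  then have der': "(\<rho> has_derivative (\<lambda>h. h \<bullet> g)) (at x)"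
  proof -
    have "?D = (\<lambda>h. h \<bullet> g)" using D by (rule ext)
    with der show ?thesis by metis
  qed
  have "gradient \<rho> x = g" unfolding gradient_def
  proof (rule the_equality)
    show "GDERIV \<rho> x :> g" using der' by (simp add: gderiv_def)
    fix d assume "GDERIV \<rho> x :> d"
    then have "(\<rho> has_derivative (\<lambda>h. h \<bullet> d)) (at x)" by (simp add: gderiv_def)
    then have "(\<lambda>h. h \<bullet> d) = (\<lambda>h. h \<bullet> g)" by (rule has_derivative_unique[OF _ der'])
    then have "\<forall>h. h \<bullet> d = h \<bullet> g" by meson
    then show "d = g" by (simp only: vector_eq_ldot)
  qed
  then show "(\<rho> has_derivative (\<lambda>h. h \<bullet> gradient \<rho> x)) (at x)"
    "gradient \<rho> x = (\<Sum>b\<in>Basis. dir_derivs \<rho> [b] x *\<^sub>R b)"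
    using der' by (simp_all add: g_def)
qed

lemma smooth_on_gradient_fn:
  fixes \<rho> :: "'a::euclidean_space \<Rightarrow> real"
  assumes "open S" "smooth_on S \<rho>" shows "smooth_on S (gradient \<rho>)"
proof (rule smooth_on_cong_open[OF assms(1)])
  show "smooth_on S (\<lambda>x. \<Sum>b\<in>Basis. dir_derivs \<rho> [b] x *\<^sub>R b)"
    by (intro smooth_on_sum assms finite_Basis smooth_on_linear_comp[OF bounded_linear_scaleR_left] smooth_on_dir_derivs)
qed (simp only: smooth_on_gradient(2)[OF assms(2)])

lemma smooth_on_UNIV_bounded:
  assumes "smooth_on UNIV u" shows "\<exists>C\<ge>0. \<forall>x\<in>cball 0 R. norm (u x) \<le> C"
proof -
  have "compact (u ` cball 0 R)"
    by (rule compact_continuous_image[OF continuous_on_subset[OF smooth_on_continuous_on[OF assms]]]) auto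
  then obtain C where C: "\<And>y. y \<in> u ` cball 0 R \<Longrightarrow> norm y \<le> C" using compact_imp_bounded bounded_iff by metis
  show ?thesis by (rule exI[of _ "max C 0"]) (auto intro: order_trans[OF C])
qed

lemma smooth_on_UNIV_lipschitz:
  fixes u :: "'a::euclidean_space \<Rightarrow> 'b::real_normed_vector"
  assumes sm: "smooth_on UNIV u"
  shows "\<exists>C\<ge>0. \<forall>x\<in>cball 0 R. \<forall>y\<in>cball 0 R. norm (u x - u y) \<le> C * norm (x - y)"
proof -
  have "\<forall>b\<in>Basis. \<exists>C\<ge>0. \<forall>x\<in>cball 0 R. norm (dir_derivs u [b] x) \<le> C"
    by (intro ballI smooth_on_UNIV_bounded smooth_on_dir_derivs sm)
  then obtain C where C: "\<And>b. b \<in> Basis \<Longrightarrow> C b \<ge> 0" "\<And>b x. b \<in> Basis \<Longrightarrow> x \<in> cball 0 R \<Longrightarrow> norm (dir_derivs u [b] x) \<le> C b"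
    by metis
  let ?D = "\<lambda>x. frechet_derivative u (at x)"
  have der: "(u has_derivative ?D x) (at x)" for x by (rule smooth_on_has_derivative[OF sm UNIV_I])
  have on: "onorm (?D x) \<le> (\<Sum>b\<in>Basis. C b)" if x: "x \<in> cball 0 R" for x
  proof (rule onorm_bound)
    show "0 \<le> (\<Sum>b\<in>Basis. C b)" by (intro sum_nonneg C)
    fix h :: 'a
    have "?D x h = ?D x (\<Sum>b\<in>Basis. (h \<bullet> b) *\<^sub>R b)" by (simp only: euclidean_representation)
    also have "\<dots> = (\<Sum>b\<in>Basis. (h \<bullet> b) *\<^sub>R ?D x b)"
      using has_derivative_linear[OF der] by (simp add: linear_sum linear_cmul)
    also have "norm \<dots> \<le> (\<Sum>b\<in>Basis. norm h * C b)"
    proof (rule sum_norm_le)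
      fix b :: 'a assume b: "b \<in> Basis"
      have "norm (?D x b) \<le> C b" using C(2)[OF b x] by simp
      then show "norm ((h \<bullet> b) *\<^sub>R ?D x b) \<le> norm h * C b"
        unfolding norm_scaleR using Basis_le_norm[OF b] by (intro mult_mono) auto
    qed
    also have "\<dots> = (\<Sum>b\<in>Basis. C b) * norm h" by (metis (no_types) sum_distrib_left mult.commute)
    finally show "norm (?D x h) \<le> (\<Sum>b\<in>Basis. C b) * norm h" .
  qed
  have "norm (u x - u y) \<le> (\<Sum>b\<in>Basis. C b) * norm (x - y)" if "x \<in> cball 0 R" "y \<in> cball 0 R" for x y
    by (rule differentiable_bound[OF convex_cball has_derivative_at_withinI[OF der] on that(1,2)])
  moreover have "0 \<le> (\<Sum>b\<in>Basis. C b)" by (intro sum_nonneg C)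
  ultimately show ?thesis by blast
qed

text \<open>
  The mean value inequality on the segment from \<open>x\<close> to \<open>y\<close>.
\<close>

lemma first_order_expansion:
  fixes \<rho> :: "'a::euclidean_space \<Rightarrow> real"
  assumes sm: "smooth_on UNIV \<rho>"
    and C: "\<And>x y. x \<in> cball 0 R \<Longrightarrow> y \<in> cball 0 R \<Longrightarrow> norm (gradient \<rho> x - gradient \<rho> y) \<le> C * norm (x - y)" "0 \<le> C"
    and x: "x \<in> cball 0 R" and y: "y \<in> cball 0 R"
  shows "\<bar>\<rho> y - \<rho> x - (y - x) \<bullet> gradient \<rho> x\<bar> \<le> C * (norm (y - x))\<^sup>2"
proof -
  let ?u = "\<lambda>z. \<rho> z - (z - x) \<bullet> gradient \<rho> x"
  let ?D = "\<lambda>z h. h \<bullet> gradient \<rho> z - h \<bullet> gradient \<rho> x"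
  have "norm (?u y - ?u x) \<le> (C * norm (y - x)) * norm (y - x)"
  proof (rule differentiable_bound[of "closed_segment x y" ?u ?D])
    fix z assume z: "z \<in> closed_segment x y"
    show "(?u has_derivative ?D z) (at z within closed_segment x y)"
      by (rule has_derivative_at_withinI) (auto intro!: derivative_eq_intros smooth_on_gradient(1)[OF sm UNIV_I])
    have zR: "z \<in> cball 0 R" using z closed_segment_subset[OF x y convex_cball] by blast
    show "onorm (?D z) \<le> C * norm (y - x)"
    proof (rule onorm_bound)
      show "0 \<le> C * norm (y - x)" using C(2) by simp
      fix h
      have "norm (?D z h) = \<bar>h \<bullet> (gradient \<rho> z - gradient \<rho> x)\<bar>" by (simp add: inner_diff_right)
      also have "\<dots> \<le> norm h * norm (gradient \<rho> z - gradient \<rho> x)" by (rule Cauchy_Schwarz_ineq2)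
      also have "\<dots> \<le> norm h * (C * norm (z - x))" by (intro mult_left_mono C(1) zR x) auto
      also have "\<dots> \<le> norm h * (C * norm (y - x))"
        using segment_bound1[OF z] C(2) by (intro mult_left_mono) (auto simp: norm_minus_commute)
      finally show "norm (?D z h) \<le> C * norm (y - x) * norm h" by (simp add: mult_ac)
    qed
  qed auto
  then show ?thesis by (simp add: power2_eq_square algebra_simps)
qed

lemma norm_normalize_diff_le:
  fixes a b :: "'a::real_normed_vector"
  assumes "0 < \<gamma>" "\<gamma> \<le> norm a" "\<gamma> \<le> norm b"
  shows "norm (a /\<^sub>R norm a - b /\<^sub>R norm b) \<le> 2 / \<gamma> * norm (a - b)"
proof -
  have pos: "norm a > 0" "norm b > 0" using assms by linarith+
  have "a /\<^sub>R norm a - b /\<^sub>R norm b = inverse (norm a) *\<^sub>R (a - b) + ((norm b - norm a) / (norm a * norm b)) *\<^sub>R b"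
  proof -
    have "(norm b - norm a) / (norm a * norm b) = inverse (norm a) - inverse (norm b)"
      using pos by (simp add: field_simps)
    then show ?thesis by (simp only: scaleR_diff_right scaleR_diff_left) simp
  qed
  also have "norm \<dots> \<le> norm (a - b) / norm a + \<bar>norm b - norm a\<bar> / norm a"
  proof (intro norm_triangle_le add_mono)
    show "norm (((norm b - norm a) / (norm a * norm b)) *\<^sub>R b) \<le> \<bar>norm b - norm a\<bar> / norm a"
      using pos by (simp add: abs_divide abs_mult)
  qed (simp add: divide_inverse mult.commute)
  also have "\<dots> \<le> norm (a - b) / norm a + norm (a - b) / norm a"
    using norm_triangle_ineq3[of b a] by (intro add_left_mono divide_right_mono) (auto simp: norm_minus_commute)
  also have "\<dots> \<le> norm (a - b) / \<gamma> + norm (a - b) / \<gamma>"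
    using assms pos by (intro add_mono divide_left_mono mult_pos_pos) auto
  finally show ?thesis by (simp add: field_simps)
qed

lemma frontier_sublevel:
  fixes \<rho> :: "'a::euclidean_space \<Rightarrow> real"
  assumes "continuous_on UNIV \<rho>"
  shows "open (sublevel \<rho> 0)" "p \<in> frontier (sublevel \<rho> 0) \<Longrightarrow> \<rho> p = 0"
proof -
  have c: "continuous_on UNIV (\<lambda>z. \<rho> z)" using assms by simp
  show o: "open (sublevel \<rho> 0)" unfolding sublevel_def by (intro open_Collect_less c continuous_on_const)
  assume p: "p \<in> frontier (sublevel \<rho> 0)"
  have "closed {z. \<rho> z \<le> 0}" by (intro closed_Collect_le c continuous_on_const)
  then have "closure (sublevel \<rho> 0) \<subseteq> {z. \<rho> z \<le> 0}" by (intro closure_minimal) (auto simp: sublevel_def)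
  moreover have "p \<in> closure (sublevel \<rho> 0)" "p \<notin> sublevel \<rho> 0"
    using p o by (auto simp: frontier_def interior_open)
  ultimately show "\<rho> p = 0" by (force simp: sublevel_def)
qed

text \<open>
  A compact neighbourhood of the boundary on which the gradient of \<open>\<rho>\<close> stays away from \<open>0\<close>, with
  Lipschitz constants for \<open>\<rho>\<close>, its gradient and the normal direction there.
\<close>

theorem boundary_frame_exists:
  fixes \<rho> :: "complex^2 \<Rightarrow> real"
  assumes sm: "smooth_on UNIV \<rho>" and bd: "bounded (sublevel \<rho> 0)"
    and W: "open W" "frontier (sublevel \<rho> 0) \<subseteq> W"
    and grad: "\<And>\<zeta>. \<zeta> \<in> W \<Longrightarrow> gradient \<rho> \<zeta> \<noteq> 0"
    and v_unit: "\<And>\<zeta>. \<zeta> \<in> W \<Longrightarrow> norm (v \<zeta>) = 1"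
    and v_tan: "\<And>\<zeta>. \<zeta> \<in> W \<Longrightarrow> v \<zeta> \<in> complex_tangent_space \<rho> \<zeta>"
  shows "\<exists>R>0. \<exists>L B0. (\<forall>p\<in>frontier (sublevel \<rho> 0). ball p R \<subseteq> W) \<and>
    (\<forall>r0. 0 < r0 \<and> r0 \<le> R \<longrightarrow>
       boundary_frame \<rho> (outer_unit_normal \<rho>) v (frontier (sublevel \<rho> 0)) r0 L B0)"
proof -
  let ?D = "sublevel \<rho> 0" and ?g = "gradient \<rho>" and ?\<eta> = "outer_unit_normal \<rho>"
  let ?K = "frontier ?D"
  obtain B0 where B0: "B0 \<ge> 0" "\<And>z. z \<in> ?D \<Longrightarrow> norm z \<le> B0"
    using bd unfolding bounded_iff by (metis linear norm_ge_zero order_trans)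
  have K: "compact ?K" using bd by (rule compact_frontier_bounded)
  have "?D \<subseteq> cball 0 B0" using B0(2) by auto
  then have KB: "?K \<subseteq> cball 0 B0" using closure_minimal[of ?D "cball 0 B0"] by (auto simp: frontier_def)
  obtain e where e: "e > 0" "(\<Union>p\<in>?K. ball p e) \<subseteq> W"
    using compact_subset_open_imp_ball_epsilon_subset[OF K W] by blast
  define R where "R = min (e / 2) 1"
  have R: "R > 0" "R \<le> 1" "R < e" using e(1) by (auto simp: R_def)
  have inW: "x \<in> W" if "p \<in> ?K" "dist p x < R" for p x using that e(2) R(3) by fastforce
  have inB: "x \<in> cball 0 (B0 + 1)" if "p \<in> ?K" "dist p x < R" for p x
  proof -
    have "norm p \<le> B0" using that(1) KB by auto
    then show ?thesis using that(2) R(2) norm_triangle_ineq2[of x p] by (simp add: dist_norm norm_minus_commute)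
  qed
  have smg: "smooth_on UNIV ?g" by (rule smooth_on_gradient_fn[OF open_UNIV sm])
  obtain C where C: "C \<ge> 0" "\<And>x y. x \<in> cball 0 (B0 + 2) \<Longrightarrow> y \<in> cball 0 (B0 + 2) \<Longrightarrow> norm (?g x - ?g y) \<le> C * norm (x - y)"
    using smooth_on_UNIV_lipschitz[OF smg] by metis
  obtain G where G: "G \<ge> 0" "\<And>x. x \<in> cball 0 (B0 + 2) \<Longrightarrow> norm (?g x) \<le> G"
    using smooth_on_UNIV_bounded[OF smg] by metis
  define T where "T = {x + y |x y. x \<in> ?K \<and> y \<in> cball 0 R}"
  have "compact T" unfolding T_def by (rule compact_sums[OF K compact_cball])
  have TW: "T \<subseteq> W"
  proof
    fix z assume "z \<in> T"
    then obtain x y where "z = x + y" "x \<in> ?K" "norm y \<le> R" by (auto simp: T_def)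
    then have "x \<in> ?K" "dist x z < e" using R(3) by (auto simp: dist_norm)
    then show "z \<in> W" using e(2) by fastforce
  qed
  have "\<exists>\<gamma>>0. \<forall>x\<in>T. \<gamma> \<le> norm (?g x)"
  proof (cases "T = {}")
    case False
    have "continuous_on T (\<lambda>x. norm (?g x))"
      by (intro continuous_on_norm continuous_on_subset[OF smooth_on_continuous_on[OF smg]]) auto
    then obtain x where x: "x \<in> T" "\<forall>y\<in>T. norm (?g x) \<le> norm (?g y)"
      using continuous_attains_inf[OF \<open>compact T\<close> False] by blast
    then show ?thesis using grad TW by (intro exI[of _ "norm (?g x)"]) auto
  qed (auto intro: exI[of _ 1])
  then obtain \<gamma> where \<gamma>: "\<gamma> > 0" "\<And>x. x \<in> T \<Longrightarrow> \<gamma> \<le> norm (?g x)" by blast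
  have inT: "x \<in> T" if "p \<in> ?K" "dist p x < R" for p x
  proof -
    have "x = p + (x - p)" "x - p \<in> cball 0 R" using that(2) by (auto simp: dist_norm norm_minus_commute)
    then show ?thesis using that(1) unfolding T_def by blast
  qed
  define L where "L = Max {1, 2 / \<gamma> * C, G, C}"
  have L: "1 \<le> L" "2 / \<gamma> * C \<le> L" "G \<le> L" "C \<le> L" unfolding L_def by (rule Max_ge; simp)+
  have v0: "(c *s v x) \<bullet> ?g x = 0" if "x \<in> W" for x c
    using v_tan[OF that] by (simp add: complex_tangent_space_def level_tangent_space_def)
  have g\<eta>: "?g x = norm (?g x) *\<^sub>R ?\<eta> x" if "x \<in> W" for x
    using grad[OF that] by (simp add: outer_unit_normal_def)
  have frame: "unitary_frame (?\<eta> x) (v x)" if "x \<in> W" for x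
  proof -
    have "Re (herm (c *s v x) (?\<eta> x)) = 0" for c
      unfolding Re_herm outer_unit_normal_def inner_scaleR_right using v0[OF that] by simp
    from this[of 1] this[of "\<i>"] have "herm (v x) (?\<eta> x) = 0"
      by (simp add: herm_smult complex_eq_iff)
    moreover have "norm (?\<eta> x) = 1" using grad[OF that] by (simp add: outer_unit_normal_def)
    ultimately show ?thesis using v_unit[OF that] by (simp add: unitary_frame_def)
  qed
  have exp1: "\<bar>\<rho> y - \<rho> x - (y - x) \<bullet> ?g x\<bar> \<le> C * (norm (y - x))\<^sup>2"
    if "x \<in> cball 0 (B0 + 2)" "y \<in> cball 0 (B0 + 2)" for x y
    by (rule first_order_expansion[OF sm C(2) C(1) that])
  have sub: "x \<in> cball 0 (B0 + 2)" if "x \<in> cball 0 (B0 + 1)" for x :: "complex^2" using that by simp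
  have "boundary_frame \<rho> ?\<eta> v ?K r0 L B0" if r0: "0 < r0" "r0 \<le> R" for r0
  proof
    show "0 < r0" "r0 \<le> 1" "1 \<le> L" using r0 R L by auto
    show "\<rho> p = 0" if "p \<in> ?K" for p by (rule frontier_sublevel(2)[OF smooth_on_continuous_on[OF sm] that])
    show "norm z \<le> B0" if "\<rho> z < 0" for z using B0(2) that by (simp add: sublevel_def)
    fix x p assume x0: "p \<in> ?K" "dist p x < r0"
    then have x: "p \<in> ?K" "dist p x < R" using r0 by auto
    note xB = sub[OF inB[OF x]]
    show "unitary_frame (?\<eta> x) (v x)" by (rule frame[OF inW[OF x]])
    fix y p' assume y0: "p' \<in> ?K" "dist p' y < r0"
    then have y: "p' \<in> ?K" "dist p' y < R" using r0 by auto
    note yB = sub[OF inB[OF y]]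
    have "norm (?\<eta> x - ?\<eta> y) \<le> 2 / \<gamma> * norm (?g x - ?g y)"
      unfolding outer_unit_normal_def by (rule norm_normalize_diff_le[OF \<gamma>(1) \<gamma>(2)[OF inT[OF x]] \<gamma>(2)[OF inT[OF y]]])
    also have "\<dots> \<le> 2 / \<gamma> * (C * norm (x - y))" using C(2)[OF xB yB] \<gamma>(1) by (intro mult_left_mono) auto
    also have "\<dots> \<le> L * norm (x - y)" using mult_right_mono[OF L(2) norm_ge_zero[of "x - y"]] by (simp add: mult_ac)
    finally show "norm (?\<eta> x - ?\<eta> y) \<le> L * norm (x - y)" .
    have "\<bar>(y - x) \<bullet> ?g x\<bar> = norm (?g x) * \<bar>(y - x) \<bullet> ?\<eta> x\<bar>"
      using grad[OF inW[OF x]] by (simp add: outer_unit_normal_def abs_mult)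
    also have "\<dots> \<le> L * cmod (herm (y - x) (?\<eta> x))"
      using G(2)[OF xB] L(3) L(1) abs_Re_le_cmod[of "herm (y - x) (?\<eta> x)"] unfolding Re_herm by (intro mult_mono) auto
    finally have 1: "\<bar>(y - x) \<bullet> ?g x\<bar> \<le> L * cmod (herm (y - x) (?\<eta> x))" .
    have "C * (norm (y - x))\<^sup>2 \<le> L * (norm (y - x))\<^sup>2" using L(4) by (intro mult_right_mono) auto
    then show "\<bar>\<rho> y - \<rho> x\<bar> \<le> L * cmod (herm (y - x) (?\<eta> x)) + L * (norm (y - x))\<^sup>2"
      using exp1[OF xB yB] 1 by linarith
    fix l :: complex assume l: "cmod l \<le> 1"
    have nl: "norm (l *s v x) = cmod l" using v_unit[OF inW[OF x]] by (simp add: norm_vec_smult)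
    have zB: "y + l *s v x \<in> cball 0 (B0 + 2)"
      using inB[OF y] l nl norm_triangle_ineq[of y "l *s v x"] by simp
    have "\<bar>(l *s v x) \<bullet> ?g y\<bar> = \<bar>(l *s v x) \<bullet> (?g y - ?g x)\<bar>" using v0[OF inW[OF x]] by (simp add: inner_diff_right)
    also have "\<dots> \<le> cmod l * norm (?g y - ?g x)" using Cauchy_Schwarz_ineq2[of "l *s v x" "?g y - ?g x"] nl by simp
    also have "\<dots> \<le> cmod l * (C * norm (y - x))" by (intro mult_left_mono C(2) xB yB) auto
    also have "\<dots> \<le> L * norm (y - x) * cmod l"
      using mult_right_mono[OF L(4), of "norm (y - x) * cmod l"] by (simp add: mult_ac)
    finally have 2: "\<bar>(l *s v x) \<bullet> ?g y\<bar> \<le> L * norm (y - x) * cmod l" .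
    have "C * (cmod l)\<^sup>2 \<le> L * (cmod l)\<^sup>2" using L(4) by (intro mult_right_mono) auto
    then show "\<bar>\<rho> (y + l *s v x) - \<rho> y\<bar> \<le> L * norm (y - x) * cmod l + L * (cmod l)\<^sup>2"
      using exp1[OF yB zB] 2 nl by simp
  qed
  moreover have "ball p R \<subseteq> W" if "p \<in> ?K" for p using inW[OF that] by auto
  ultimately show ?thesis using R(1) by blast
qed

section \<open>Uniformity along the boundary\<close>

lemma thin_in_mono:
  assumes "thin_in X p R N \<theta> \<eta> v" "ball p' R' \<subseteq> ball p R" "N \<le> N'" "\<theta>' \<le> \<theta>"
  shows "thin_in X p' R' N' \<theta>' \<eta> v"
  unfolding thin_in_def
proof (intro conjI allI impI)
  have sub: "dist p z < R" if "dist p' z < R'" for z using assms(2) that by auto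
  fix \<zeta> and e h :: real assume h: "0 < e \<and> 0 \<le> h \<and> h \<le> \<theta>' * e"
  then have "h \<le> \<theta> * e" using mult_right_mono[OF assms(4), of e] by linarith
  then obtain r where "e / 2 \<le> r" "r \<le> e"
    "\<And>x y. cmod x \<le> h \<Longrightarrow> cmod y = r \<Longrightarrow> dist p (affine_pt \<zeta> \<eta> v x y) < R \<Longrightarrow> affine_pt \<zeta> \<eta> v x y \<notin> X"
    using assms(1) h unfolding thin_in_def by meson
  then show "\<exists>r\<ge>e / 2. r \<le> e \<and> (\<forall>x y. cmod x \<le> h \<and> cmod y = r \<and> dist p' (affine_pt \<zeta> \<eta> v x y) < R' \<longrightarrow> affine_pt \<zeta> \<eta> v x y \<notin> X)"
    using sub by blast
next
  fix w
  have s: "{l. dist p' (w + l *s v) < R' \<and> w + l *s v \<in> X} \<subseteq> {l. dist p (w + l *s v) < R \<and> w + l *s v \<in> X}"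
    using assms(2) by auto
  have f: "finite {l. dist p (w + l *s v) < R \<and> w + l *s v \<in> X}" "card {l. dist p (w + l *s v) < R \<and> w + l *s v \<in> X} \<le> N"
    using assms(1) unfolding thin_in_def by blast+
  show "finite {l. dist p' (w + l *s v) < R' \<and> w + l *s v \<in> X}" by (rule finite_subset[OF s f(1)])
  show "card {l. dist p' (w + l *s v) < R' \<and> w + l *s v \<in> X} \<le> N'"
    using card_mono[OF f(1) s] f(2) assms(3) by linarith
qed

lemma thin_in_empty:
  assumes "\<And>z. dist p z < R \<Longrightarrow> z \<notin> X" shows "thin_in X p R N \<theta> \<eta> v"
proof -
  have e: "{l. dist p (w + l *s v) < R \<and> w + l *s v \<in> X} = {}" for w using assms by auto
  show ?thesis unfolding thin_in_def e
  proof (intro conjI allI impI)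
    fix \<zeta> and e h :: real assume "0 < e \<and> 0 \<le> h \<and> h \<le> \<theta> * e"
    then show "\<exists>r\<ge>e / 2. r \<le> e \<and> (\<forall>x y. cmod x \<le> h \<and> cmod y = r \<and> dist p (affine_pt \<zeta> \<eta> v x y) < R \<longrightarrow> affine_pt \<zeta> \<eta> v x y \<notin> X)"
      using assms by (intro exI[of _ e]) auto
  qed auto
qed

text \<open>
  If \<open>w\<close> is orthogonal to the normal in the Hermitian sense, then its complex multiples are all tangent to
  the level set, so they do not complement the tangent space.
\<close>

lemma transverse_imp_herm_nonzero:
  assumes "{c *s w + t | c t. t \<in> level_tangent_space \<rho> p} = UNIV" and g: "gradient \<rho> p \<noteq> 0"
  shows "herm w (outer_unit_normal \<rho> p) \<noteq> 0"
proof
  assume 0: "herm w (outer_unit_normal \<rho> p) = 0"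
  obtain c t where ct: "gradient \<rho> p = c *s w + t" "t \<bullet> gradient \<rho> p = 0"
    using assms(1) unfolding level_tangent_space_def by blast
  have "(c *s w) \<bullet> outer_unit_normal \<rho> p = 0" using 0 by (simp add: Re_herm[symmetric] herm_smult)
  then have "(c *s w) \<bullet> gradient \<rho> p = 0" using g by (simp add: outer_unit_normal_def)
  then have "(c *s w + t) \<bullet> gradient \<rho> p = 0" using ct(2) by (simp add: inner_add_left)
  then have "gradient \<rho> p \<bullet> gradient \<rho> p = 0" using ct(1) by simp
  then show False using g by simp
qed

context boundary_frame
begin

text \<open>
  Near each boundary point the analytic set is thin in all directions close to the complex tangent
  direction there; by compactness the constants may be chosen independently of the point.
\<close>

lemma uniformly_thin:
  assumes K: "compact K" and f: "Cn_holomorphic_on f \<Omega>" "open \<Omega>" "K \<subseteq> \<Omega>"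
    and min: "\<And>V h. open V \<Longrightarrow> V \<subseteq> \<Omega> \<Longrightarrow> Cn_holomorphic_on h V \<Longrightarrow> (\<forall>z\<in>V. f z = 0 \<longrightarrow> h z = 0) \<Longrightarrow>
       \<exists>q. Cn_holomorphic_on q V \<and> (\<forall>z\<in>V. h z = f z * q z)"
    and tc: "\<And>p w. p \<in> K \<Longrightarrow> f p = 0 \<Longrightarrow> w \<in> tangent_cone {z\<in>\<Omega>. f z = 0} p \<Longrightarrow> w \<noteq> 0 \<Longrightarrow> herm w (\<eta> p) \<noteq> 0"
  shows "\<exists>R>0. \<exists>\<theta>>0. \<exists>N. \<forall>\<zeta> p. p \<in> K \<and> dist p \<zeta> < R \<longrightarrow> thin_in {z\<in>\<Omega>. f z = 0} \<zeta> R N \<theta> (\<eta> \<zeta>) (v \<zeta>)"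
proof -
  let ?X = "{z\<in>\<Omega>. f z = 0}"
  have pt: "\<exists>R>0. \<exists>\<theta>>0. \<exists>N. \<forall>\<zeta>. dist p \<zeta> < R \<longrightarrow> thin_in ?X p (2 * R) N \<theta> (\<eta> \<zeta>) (v \<zeta>)" if p: "p \<in> K" for p
  proof (cases "f p = 0")
    case True
    have fr: "unitary_frame (\<eta> p) (v p)" by (rule frame[OF p]) (use r0 in simp)
    have p\<Omega>: "p \<in> \<Omega>" using p f(3) by blast
    obtain M m R where g: "M \<ge> 1" "R > 0" "graph_like ?X p (\<eta> p) (v p) M m R"
      using transverse_imp_graph_like[OF fr f(1,2) min p\<Omega> tc[OF p True]] by blast
    define \<theta> where "\<theta> = 1 / (400 * M * real (m + 2))"
    have \<theta>: "\<theta> > 0" using g(1) by (simp add: \<theta>_def)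
    define R' where "R' = min (R / 2) (min (\<theta> / L) r0)"
    have R': "R' > 0" "2 * R' \<le> R" "R' \<le> \<theta> / L" "R' \<le> r0" using g(2) \<theta> L r0 by (auto simp: R'_def)
    have "thin_in ?X p (2 * R') (m + 1) \<theta> (\<eta> \<zeta>) (v \<zeta>)" if \<zeta>: "dist p \<zeta> < R'" for \<zeta>
    proof -
      have \<zeta>r: "dist p \<zeta> < r0" using \<zeta> R'(4) by linarith
      note fr\<zeta> = frame[OF p \<zeta>r]
      have "herm (v \<zeta>) (\<eta> p) = herm (v \<zeta>) (\<eta> p - \<eta> \<zeta>)"
        using unitary_frameD(3)[OF fr\<zeta>] by (simp add: herm_diff_right)
      also have "cmod \<dots> \<le> norm (v \<zeta>) * norm (\<eta> p - \<eta> \<zeta>)" by (rule norm_herm_le)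
      also have "\<dots> \<le> L * norm (p - \<zeta>)"
        using eta_lip[OF p _ p \<zeta>r, of p] r0 unitary_frameD(6)[OF fr\<zeta>] by simp
      also have "\<dots> \<le> L * (\<theta> / L)" using \<zeta> R'(3) L by (intro mult_left_mono) (auto simp: dist_norm)
      finally have "cmod (herm (v \<zeta>) (\<eta> p)) \<le> \<theta>" using L by simp
      then have "thin_in ?X p R (m + 1) \<theta> (\<eta> \<zeta>) (v \<zeta>)"
        by (rule graph_like_imp_thin[OF g(3) fr g(1,2) fr\<zeta> \<theta> \<theta>_def])
      then show ?thesis by (rule thin_in_mono) (use R'(2) in auto)
    qed
    then show ?thesis using R'(1) \<theta> by blast
  next
    case False
    have "continuous_on \<Omega> f" by (rule Cn_holomorphic_continuous_on[OF f(1)])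
    then have "open (\<Omega> \<inter> f -` (- {0}))" by (intro continuous_open_preimage f(2)) auto
    moreover have "p \<in> \<Omega> \<inter> f -` (- {0})" using False p f(3) by auto
    ultimately obtain R where R: "R > 0" "ball p R \<subseteq> \<Omega> \<inter> f -` (- {0})" using open_contains_ball by blast
    have "z \<notin> ?X" if "dist p z < 2 * (R / 2)" for z using R(2) that by auto
    then have "thin_in ?X p (2 * (R / 2)) 0 1 (\<eta> \<zeta>) (v \<zeta>)" for \<zeta> by (rule thin_in_empty)
    then show ?thesis using R(1) by (intro exI[of _ "R / 2"] conjI exI[of _ 1] exI[of _ 0]) auto
  qed
  then have "\<forall>p\<in>K. \<exists>t. fst t > 0 \<and> fst (snd t) > 0 \<and>
      (\<forall>\<zeta>. dist p \<zeta> < fst t \<longrightarrow> thin_in ?X p (2 * fst t) (snd (snd t)) (fst (snd t)) (\<eta> \<zeta>) (v \<zeta>))"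
    by (fastforce simp: split_paired_Ex)
  from bchoice[OF this] obtain t where t: "\<forall>p\<in>K. fst (t p) > 0 \<and> fst (snd (t p)) > 0 \<and>
      (\<forall>\<zeta>. dist p \<zeta> < fst (t p) \<longrightarrow> thin_in ?X p (2 * fst (t p)) (snd (snd (t p))) (fst (snd (t p))) (\<eta> \<zeta>) (v \<zeta>))"
    by blast
  define R \<theta> N where "R p = fst (t p)" and "\<theta> p = fst (snd (t p))" and "N p = snd (snd (t p))" for p
  have RN: "\<And>p. p \<in> K \<Longrightarrow> R p > 0" "\<And>p. p \<in> K \<Longrightarrow> \<theta> p > 0"
    "\<And>p \<zeta>. p \<in> K \<Longrightarrow> dist p \<zeta> < R p \<Longrightarrow> thin_in ?X p (2 * R p) (N p) (\<theta> p) (\<eta> \<zeta>) (v \<zeta>)"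
    using t by (auto simp: R_def \<theta>_def N_def)
  obtain P where P: "finite P" "P \<subseteq> K" "K \<subseteq> (\<Union>p\<in>P. ball p (R p / 2))"
  proof (rule compactE_image[OF K, of K "\<lambda>p. ball p (R p / 2)"])
    show "K \<subseteq> (\<Union>p\<in>K. ball p (R p / 2))" using RN(1) by auto
  qed auto
  define R1 where "R1 = Min (insert 1 ((\<lambda>p. R p / 2) ` P))"
  define \<theta>1 where "\<theta>1 = Min (insert 1 (\<theta> ` P))"
  define N1 where "N1 = Max (insert 0 (N ` P))"
  have pos: "R1 > 0" "\<theta>1 > 0" unfolding R1_def \<theta>1_def using P RN(1,2) by (auto simp: subset_iff)
  have le: "R1 \<le> R p / 2" "\<theta>1 \<le> \<theta> p" "N p \<le> N1" if "p \<in> P" for p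
    unfolding R1_def \<theta>1_def N1_def using P(1) that by (intro Min_le Max_ge; simp)+
  have "thin_in ?X \<zeta> R1 N1 \<theta>1 (\<eta> \<zeta>) (v \<zeta>)" if \<zeta>: "p' \<in> K" "dist p' \<zeta> < R1" for \<zeta> p'
  proof -
    obtain p where p: "p \<in> P" "dist p p' < R p / 2" using P(3) \<zeta>(1) by auto
    have d: "dist p \<zeta> < R p" using dist_triangle[of p \<zeta> p'] p(2) \<zeta>(2) le(1)[OF p(1)] by linarith
    have pK: "p \<in> K" using p(1) P(2) by blast
    have "ball \<zeta> R1 \<subseteq> ball p (2 * R p)"
    proof
      fix z assume "z \<in> ball \<zeta> R1"
      then show "z \<in> ball p (2 * R p)" using dist_triangle[of p z \<zeta>] d le(1)[OF p(1)] RN(1)[OF pK] by simp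
    qed
    from thin_in_mono[OF RN(3)[OF pK d] this le(3,2)[OF p(1)]] show ?thesis .
  qed
  then show ?thesis using pos by blast
qed

end

section \<open>Existence and estimates of the local extensions\<close>

lemma enn2real_Sup_upper:
  assumes "ennreal t \<in> A" "Sup A < \<infinity>" shows "t \<le> enn2real (Sup A)"
proof -
  have "ennreal t \<le> Sup A" by (rule Sup_upper[OF assms(1)])
  also have "\<dots> = ennreal (enn2real (Sup A))" using assms(2) by (simp add: less_top)
  finally show ?thesis by (simp add: ennreal_le_iff)
qed

context boundary_frame
begin

lemma open_layer: "open {z. \<rho> z < 0} \<Longrightarrow> open layer"
proof -
  assume o: "open {z. \<rho> z < 0}"
  have "layer = (\<Union>p\<in>K. ball p r1) \<inter> {z. \<rho> z < 0}" by (auto simp: layer_def nb_def)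
  then show ?thesis using o by auto
qed

text \<open>
  The construction around one point \<open>j\<close> of the layer. A polydisc is chosen whose vertical boundary
  misses \<open>X\<close>, with radius comparable to \<open>s j\<close> in the tangential direction; this radius is less than
  half of a lower bound for \<open>\<tau>\<close>, so that the divided differences of \<open>g\<close> control the interpolation
  along the lines in the direction \<open>v j\<close>.
\<close>

lemma local_extension:
  fixes f g :: "complex^2 \<Rightarrow> complex" and \<Omega> :: "(complex^2) set"
  defines "X \<equiv> {z\<in>\<Omega>. f z = 0}"
  assumes eta: "\<eta> = outer_unit_normal \<rho>" and opD: "open {z. \<rho> z < 0}" and D\<Omega>: "{z. \<rho> z < 0} \<subseteq> \<Omega>"
    and f: "Cn_holomorphic_on f \<Omega>"
    and min: "\<And>V h. open V \<Longrightarrow> V \<subseteq> \<Omega> \<Longrightarrow> Cn_holomorphic_on h V \<Longrightarrow> (\<forall>z\<in>V. f z = 0 \<longrightarrow> h z = 0) \<Longrightarrow>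
       \<exists>q. Cn_holomorphic_on q V \<and> (\<forall>z\<in>V. h z = f z * q z)"
    and thin: "thin_in X j R N \<theta> (\<eta> j) (v j)" and R: "r0 \<le> R" and \<theta>: "0 < \<theta>"
    and \<kappa>: "0 < \<kappa>" "\<kappa> \<le> 1" and \<epsilon>: "r0 \<le> \<epsilon>"
    and g: "holomorphic_on_analytic_set g (X \<inter> {z. \<rho> z < 0})" and fin: "c_infty \<rho> X v \<kappa> \<epsilon> g < \<infinity>"
    and a: "0 < a" "24 * a \<le> \<theta> * (\<kappa> / (24 * L))" "48 * a \<le> \<kappa> / (24 * L)" and j: "j \<in> layer"
  shows "\<exists>G. local_extension_at a (real N * enn2real (c_infty \<rho> X v \<kappa> \<epsilon> g)) g X j G"
proof -
  note l = layer[OF j]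
  note fr = frame_nb[OF l(9)]
  let ?D = "{z. \<rho> z < 0}" and ?B = "enn2real (c_infty \<rho> X v \<kappa> \<epsilon> g)" and ?T = "s j / (12 * L)"
  \<comment> \<open>The size of the polydisc: the factor \<open>1 / (24 L)\<close> makes its radius small compared with the lower
    bound \<open>s j / (12 L)\<close> for \<open>\<tau>\<close>, and the factor \<open>\<kappa>\<close> puts its points of \<open>X\<close> into \<open>Lambda_set\<close>.\<close>
  define \<delta> where "\<delta> = \<kappa> / (24 * L)"
  have \<delta>: "0 < \<delta>" "\<delta> \<le> \<kappa>" "\<delta> \<le> c0" "2 * \<delta> \<le> 1 / (12 * L)" "\<delta> < 3 * \<kappa> * (1 / (12 * L))"
  proof -
    show "0 < \<delta>" using \<kappa> L by (simp add: \<delta>_def)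
    have "\<kappa> / (24 * L) \<le> \<kappa> / 1" using \<kappa> L by (intro divide_left_mono) auto
    then show "\<delta> \<le> \<kappa>" by (simp add: \<delta>_def)
    have "\<kappa> / (24 * L) \<le> 1 / (24 * L)" using \<kappa> L by (intro divide_right_mono) auto
    moreover have "1 / (24 * L) \<le> 1 / (16 * L)" using L by (intro divide_left_mono) auto
    ultimately show "\<delta> \<le> c0" by (simp add: \<delta>_def c0_def)
    show "2 * \<delta> \<le> 1 / (12 * L)" using \<kappa> L by (simp add: \<delta>_def divide_simps)
    show "\<delta> < 3 * \<kappa> * (1 / (12 * L))" using \<kappa> L by (simp add: \<delta>_def divide_simps)
  qed
  define c1 where "c1 = min (\<theta> * \<delta>) \<delta>"
  have c1: "0 < c1" "c1 \<le> \<theta> * \<delta>" "c1 \<le> \<delta>" using \<theta> \<delta>(1) by (auto simp: c1_def)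
  define h where "h = c1 * q j"
  have h: "0 < h" "h \<le> \<delta> * q j" "h \<le> \<kappa> * \<bar>\<rho> j\<bar>" "h \<le> \<theta> * (\<delta> * s j)"
  proof -
    show "0 < h" using c1 l by (simp add: h_def)
    show h1: "h \<le> \<delta> * q j" unfolding h_def using c1 l by (intro mult_right_mono) auto
    also have "\<dots> \<le> \<kappa> * q j" using \<delta> l by (intro mult_right_mono) auto
    finally show "h \<le> \<kappa> * \<bar>\<rho> j\<bar>" by (simp add: q_def)
    have "c1 * q j \<le> (\<theta> * \<delta>) * s j" using c1 l by (intro mult_mono) auto
    then show "h \<le> \<theta> * (\<delta> * s j)" by (simp add: h_def mult_ac)
  qed
  have e: "0 < \<delta> * s j" using \<delta> l by simp
  obtain r where r: "\<delta> * s j / 2 \<le> r" "r \<le> \<delta> * s j"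
    and gap: "\<And>x y. cmod x \<le> h \<Longrightarrow> cmod y = r \<Longrightarrow> dist j (affine_pt j (\<eta> j) (v j) x y) < R \<Longrightarrow>
       affine_pt j (\<eta> j) (v j) x y \<notin> X"
  proof -
    have "\<exists>r\<ge>\<delta> * s j / 2. r \<le> \<delta> * s j \<and> (\<forall>x y. cmod x \<le> h \<and> cmod y = r \<and>
        dist j (affine_pt j (\<eta> j) (v j) x y) < R \<longrightarrow> affine_pt j (\<eta> j) (v j) x y \<notin> X)"
      using thin e h(1,4) unfolding thin_in_def by (meson less_imp_le)
    then show ?thesis using that by blast
  qed
  have r_pos: "0 < r" using r(1) e by linarith
  have pd: "affine_pt j (\<eta> j) (v j) x y \<in> polydisc j \<delta>" if "cmod x \<le> h" "cmod y \<le> r" for x y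
    using that h(2) r(2) affine_pt_coordinates(1,2)[OF fr, of j x y] by (simp add: polydisc_def)
  have inD: "affine_pt j (\<eta> j) (v j) x y \<in> ?D" if "cmod x \<le> h" "cmod y \<le> r" for x y
    using polydisc_rho(1)[OF j _ \<delta>(3) pd[OF that]] \<delta>(1) by simp
  have near: "dist j (affine_pt j (\<eta> j) (v j) x y) < R" if "cmod x \<le> h" "cmod y \<le> r" for x y
  proof -
    have "norm (affine_pt j (\<eta> j) (v j) x y - j) \<le> 2 * \<delta> * s j"
      using polydisc_near(1)[OF j _ \<delta>(3) pd[OF that]] \<delta>(1) by simp
    also have "\<dots> \<le> 2 * (1/16) * (r0 / 8)" using \<delta> c0(2) l by (intro mult_mono) auto
    also have "\<dots> < R" using R r0 by simp
    finally show ?thesis by (simp add: dist_norm norm_minus_commute)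
  qed
  have fD: "Cn_holomorphic_on f ?D" by (rule Cn_holomorphic_on_subset[OF f D\<Omega>])
  interpret W: weierstrass_disc f ?D j "\<eta> j" "v j" "ball 0 h" 0 r
  proof
    show "affine_pt j (\<eta> j) (v j) x y \<in> ?D" if "x \<in> ball 0 h" "cmod (y - 0) \<le> r" for x y
      using inD[of x y] that by simp
    show "f (affine_pt j (\<eta> j) (v j) x y) \<noteq> 0" if "x \<in> ball 0 h" "cmod (y - 0) = r" for x y
    proof -
      have "cmod x \<le> h" "cmod y = r" "cmod y \<le> r" using that by auto
      then show ?thesis using gap[OF _ _ near] inD[of x y] D\<Omega> unfolding X_def by blast
    qed
  qed (use fD opD r_pos in auto)
  have Z: "l \<in> W.Z x \<longleftrightarrow> cmod l < r \<and> f (W.pt x l) = 0" for l x by (simp add: zeros_in_def)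
  have ZX: "W.pt x l \<in> X" "cmod l \<le> r" if "x \<in> ball 0 h" "l \<in> W.Z x" for x l
    using that inD[of x l] D\<Omega> unfolding X_def Z by auto
  have card: "card (W.Z x) \<le> N" if x: "x \<in> ball 0 h" for x
  proof -
    let ?w = "j + x *s \<eta> j"
    have t: "finite {l. dist j (?w + l *s v j) < R \<and> ?w + l *s v j \<in> X}"
      "card {l. dist j (?w + l *s v j) < R \<and> ?w + l *s v j \<in> X} \<le> N"
      using thin unfolding thin_in_def by blast+
    have "W.Z x \<subseteq> {l. dist j (?w + l *s v j) < R \<and> ?w + l *s v j \<in> X}"
      using ZX[OF x] near[of x] x by (auto simp: affine_pt_def)
    from card_mono[OF t(1) this] t(2) show ?thesis by linarith
  qed
  have "\<exists>x\<in>ball 0 h. W.disc x \<noteq> 0"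
    by (rule W.minimal_imp_disc_nonzero[OF fr]) (use h(1) min D\<Omega> in auto)
  then obtain x1 where x1: "x1 \<in> ball 0 h" "W.disc x1 \<noteq> 0" by blast
  have B: "0 \<le> ?B" by simp
  have loc: "\<exists>V G. open V \<and> p \<in> V \<and> Cn_holomorphic_on G V \<and> (\<forall>z\<in>V \<inter> ?D. f z = 0 \<longrightarrow> G z = g z)"
    if p: "p \<in> ?D" "f p = 0" for p
  proof -
    have "p \<in> X \<inter> ?D" using p D\<Omega> by (auto simp: X_def)
    then obtain V G where "open V" "p \<in> V" "Cn_holomorphic_on G V" "\<forall>z\<in>V \<inter> (X \<inter> ?D). G z = g z"
      using g unfolding holomorphic_on_analytic_set_def by blast
    moreover have "z \<in> X" if "z \<in> ?D" "f z = 0" for z using that D\<Omega> by (auto simp: X_def)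
    ultimately show ?thesis by (intro exI[of _ V] exI[of _ G]) auto
  qed
  have T: "2 * r \<le> ?T"
  proof -
    have "2 * r \<le> (2 * \<delta>) * s j" using r(2) by simp
    also have "\<dots> \<le> (1 / (12 * L)) * s j" using \<delta>(4) l by (intro mult_right_mono) auto
    finally show ?thesis by simp
  qed
  have tau: "?T \<le> tau \<rho> (j + x *s \<eta> j) (v j) \<bar>\<rho> (j + x *s \<eta> j)\<bar>" if "cmod x \<le> h" for x
    using tau_lower[OF j _ \<delta>(3) pd[OF that, of 0]] \<delta>(1) r_pos by (simp add: affine_pt_def)
  have dd: "cmod (divided_diff (\<lambda>l. g (W.pt x l)) ls) * ?T ^ (length ls - 1) \<le> ?B"
    if x: "x \<in> ball 0 h" and ls: "ls \<noteq> []" "distinct ls" "set ls \<subseteq> W.Z x" for x ls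
  proof -
    have xh: "cmod x \<le> h" using x by simp
    have "\<bar>\<rho> j\<bar> \<le> \<epsilon>"
    proof -
      have "r0\<^sup>2 \<le> r0" using r0 by (simp add: power2_eq_square mult_left_le)
      then show ?thesis using l(3) \<epsilon> r0(1) by (simp add: q_def)
    qed
    then have jD: "j \<in> sublevel \<rho> 0 - sublevel \<rho> (- \<epsilon>)" using l(1,2) by (auto simp: sublevel_def)
    have x\<kappa>: "cmod x \<le> \<kappa> * \<bar>\<rho> j\<bar>" using xh h(3) by linarith
    have \<Lambda>: "set ls \<subseteq> Lambda_set \<rho> X \<kappa> (j + x *s \<eta> j) (v j)"
    proof
      fix l' assume "l' \<in> set ls"
      then have l': "l' \<in> W.Z x" using ls(3) by blast
      have "cmod l' \<le> \<delta> * s j" using ZX(2)[OF x l'] r(2) by linarith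
      also have "\<dots> < 3 * \<kappa> * (1 / (12 * L)) * s j" using \<delta>(5) l(5) by (rule mult_strict_right_mono)
      also have "\<dots> = 3 * \<kappa> * ?T" by simp
      also have "\<dots> \<le> 3 * \<kappa> * tau \<rho> (j + x *s \<eta> j) (v j) \<bar>\<rho> (j + x *s \<eta> j)\<bar>"
        using tau[OF xh] \<kappa> by (intro mult_left_mono) auto
      finally show "l' \<in> Lambda_set \<rho> X \<kappa> (j + x *s \<eta> j) (v j)"
        using ZX(1)[OF x l'] by (simp add: Lambda_set_def affine_pt_def)
    qed
    have t0: "0 \<le> ?T" using l L by simp
    have "?T \<le> tau \<rho> j (v j) \<bar>\<rho> j\<bar>" using tau[of 0] h(1) by simp
    then have "cmod (divided_diff (\<lambda>l. g (W.pt x l)) ls) * ?T ^ (length ls - 1) \<le>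
        cmod (divided_diff (\<lambda>l. g (W.pt x l)) ls) * tau \<rho> j (v j) \<bar>\<rho> j\<bar> ^ (length ls - 1)"
      using t0 by (intro mult_left_mono power_mono) auto
    also have "\<dots> \<le> ?B"
      unfolding c_infty_def
    proof (rule enn2real_Sup_upper[OF CollectI])
      show "\<exists>\<zeta> z1 ls'. ennreal (cmod (divided_diff (\<lambda>l. g (W.pt x l)) ls) * tau \<rho> j (v j) \<bar>\<rho> j\<bar> ^ (length ls - 1)) =
          ennreal (cmod (divided_diff (\<lambda>l. g (\<zeta> + z1 *s outer_unit_normal \<rho> \<zeta> + l *s v \<zeta>)) ls') *
            tau \<rho> \<zeta> (v \<zeta>) \<bar>\<rho> \<zeta>\<bar> ^ (length ls' - 1)) \<and>
          \<zeta> \<in> sublevel \<rho> 0 - sublevel \<rho> (- \<epsilon>) \<and> cmod z1 \<le> \<kappa> * \<bar>\<rho> \<zeta>\<bar> \<and> ls' \<noteq> [] \<and> distinct ls' \<and>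
          set ls' \<subseteq> Lambda_set \<rho> X \<kappa> (\<zeta> + z1 *s outer_unit_normal \<rho> \<zeta>) (v \<zeta>)"
        using jD x\<kappa> ls(1,2) \<Lambda> unfolding eta affine_pt_def by blast
      show "Sup {ennreal (cmod (divided_diff (\<lambda>l. g (\<zeta> + z1 *s outer_unit_normal \<rho> \<zeta> + l *s v \<zeta>)) ls') *
            tau \<rho> \<zeta> (v \<zeta>) \<bar>\<rho> \<zeta>\<bar> ^ (length ls' - 1)) |\<zeta> z1 ls'.
          \<zeta> \<in> sublevel \<rho> 0 - sublevel \<rho> (- \<epsilon>) \<and> cmod z1 \<le> \<kappa> * \<bar>\<rho> \<zeta>\<bar> \<and> ls' \<noteq> [] \<and> distinct ls' \<and>
          set ls' \<subseteq> Lambda_set \<rho> X \<kappa> (\<zeta> + z1 *s outer_unit_normal \<rho> \<zeta>) (v \<zeta>)} < \<infinity>"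
        using fin unfolding c_infty_def .
    qed
    finally show ?thesis .
  qed
  obtain G where G: "Cn_holomorphic_on G {z. herm (z - j) (\<eta> j) \<in> ball 0 h \<and> herm (z - j) (v j) \<in> ball 0 r}"
    "\<And>z. herm (z - j) (\<eta> j) \<in> ball 0 h \<Longrightarrow> herm (z - j) (v j) \<in> ball 0 r \<Longrightarrow> cmod (G z) \<le> N * ?B \<and> (f z = 0 \<longrightarrow> G z = g z)"
    using W.interpolating_extension[OF fr x1 loc dd T card B] by blast
  have sub: "herm (z - j) (\<eta> j) \<in> ball 0 h" "herm (z - j) (v j) \<in> ball 0 r" if z: "z \<in> opolydisc j (24 * a)" for z
  proof -
    have "24 * a \<le> c1" using a by (simp add: c1_def \<delta>_def)
    then have "24 * a * q j \<le> h" unfolding h_def using l by (intro mult_right_mono) auto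
    then show "herm (z - j) (\<eta> j) \<in> ball 0 h" using z by (simp add: opolydisc_def)
    have "24 * a * s j \<le> (\<delta> / 2) * s j" using a(3) l by (intro mult_right_mono) (auto simp: \<delta>_def)
    then show "herm (z - j) (v j) \<in> ball 0 r" using z r(1) by (simp add: opolydisc_def)
  qed
  have "Cn_holomorphic_on G (opolydisc j (24 * a))"
    by (rule Cn_holomorphic_on_subset[OF G(1)]) (use sub in blast)
  moreover have "cmod (G z) \<le> real N * ?B \<and> (z \<in> X \<longrightarrow> G z = g z)" if "z \<in> opolydisc j (24 * a)" for z
    using G(2)[OF sub[OF that]] by (auto simp: X_def)
  ultimately show ?thesis unfolding local_extension_at_def by blast
qed

section \<open>Consequences of the symbol estimates\<close>

text \<open>
  The vectors \<open>q \<eta>\<close> and \<open>\<surd>q v\<close> are admissible directions; homogeneity produces the weights.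
\<close>

lemma dbar_frame_bound:
  assumes o: "open layer" and sm: "smooth_on layer G" and \<zeta>: "\<zeta> \<in> layer"
    and bd: "symbol_bd (\<alpha> + \<beta>) G \<zeta> (dirs \<zeta>) C"
  shows "cmod (dbar_frame \<alpha> \<beta> (\<eta> \<zeta>) (v \<zeta>) G \<zeta>) * \<bar>\<rho> \<zeta>\<bar> powr (real \<alpha> + real \<beta> / 2) \<le> C"
proof -
  note l = layer[OF \<zeta>] and fr = unitary_frameD[OF frame_nb[OF layer(9)[OF \<zeta>]]]
  define w1 w2 where "w1 = q \<zeta> *\<^sub>R \<eta> \<zeta>" and "w2 = s \<zeta> *\<^sub>R v \<zeta>"
  have w: "w1 \<in> dirs \<zeta>" "\<i> *s w1 \<in> dirs \<zeta>" "w2 \<in> dirs \<zeta>" "\<i> *s w2 \<in> dirs \<zeta>"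
    using fr l by (simp_all add: w1_def w2_def dirs_def scaleR_vec_smult herm_smult norm_vec_smult norm_mult)
  have smv: "smooth_on layer ((dbar_dir u ^^ \<beta>) G)" for u by (rule smooth_on_dbar_dir_pow[OF o sm])
  have "symbol_bd (\<beta> + (\<alpha> + 0)) G \<zeta> (dirs \<zeta>) C" using bd by (simp add: add.commute)
  then have "symbol_bd (\<alpha> + 0) ((dbar_dir w2 ^^ \<beta>) G) \<zeta> (dirs \<zeta>) C"
    by (rule symbol_bd_dbar_dir_pow[OF o \<zeta> w(3,4) sm])
  then have "symbol_bd 0 ((dbar_dir w1 ^^ \<alpha>) ((dbar_dir w2 ^^ \<beta>) G)) \<zeta> (dirs \<zeta>) C"
    by (rule symbol_bd_dbar_dir_pow[OF o \<zeta> w(1,2) smv])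
  then have 1: "cmod ((dbar_dir w1 ^^ \<alpha>) ((dbar_dir w2 ^^ \<beta>) G) \<zeta>) \<le> C" by (simp add: symbol_bd_0)
  have "(dbar_dir w1 ^^ \<alpha>) ((dbar_dir w2 ^^ \<beta>) G) \<zeta> =
      (dbar_dir w1 ^^ \<alpha>) (\<lambda>x. of_real (s \<zeta>) ^ \<beta> * (dbar_dir (v \<zeta>) ^^ \<beta>) G x) \<zeta>"
    unfolding w2_def by (rule dbar_dir_pow_cong_open[OF o dbar_dir_pow_scale[OF o sm] \<zeta>])
  also have "\<dots> = of_real (s \<zeta>) ^ \<beta> * (dbar_dir w1 ^^ \<alpha>) ((dbar_dir (v \<zeta>) ^^ \<beta>) G) \<zeta>"
    by (rule dbar_dir_pow_mult_const[OF o smv \<zeta>])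
  also have "(dbar_dir w1 ^^ \<alpha>) ((dbar_dir (v \<zeta>) ^^ \<beta>) G) \<zeta> =
      of_real (q \<zeta>) ^ \<alpha> * (dbar_dir (\<eta> \<zeta>) ^^ \<alpha>) ((dbar_dir (v \<zeta>) ^^ \<beta>) G) \<zeta>"
    unfolding w1_def by (rule dbar_dir_pow_scale[OF o smv \<zeta>])
  finally have "cmod ((dbar_dir w1 ^^ \<alpha>) ((dbar_dir w2 ^^ \<beta>) G) \<zeta>) =
      cmod (dbar_frame \<alpha> \<beta> (\<eta> \<zeta>) (v \<zeta>) G \<zeta>) * (q \<zeta> ^ \<alpha> * s \<zeta> ^ \<beta>)"
    using l unfolding dbar_frame_eq[OF o sm \<zeta>] by (simp add: norm_mult norm_power mult_ac)
  moreover have "\<bar>\<rho> \<zeta>\<bar> powr (real \<alpha> + real \<beta> / 2) = q \<zeta> ^ \<alpha> * s \<zeta> ^ \<beta>"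
  proof -
    have "s \<zeta> ^ \<beta> = s \<zeta> powr real \<beta>" using l by (simp add: powr_realpow)
    also have "\<dots> = q \<zeta> powr (real \<beta> / 2)" unfolding s_def using l by (simp add: powr_half_sqrt[symmetric] powr_powr)
    finally have "s \<zeta> ^ \<beta> = q \<zeta> powr (real \<beta> / 2)" .
    then show ?thesis using l(2) by (simp add: powr_add powr_realpow q_def)
  qed
  ultimately show ?thesis using 1 by simp
qed

end

lemma dir_derivs_scale_list:
  assumes "open S" "smooth_on S f"
  shows "x \<in> S \<Longrightarrow> dir_derivs f (map ((*\<^sub>R) t) vs) x = t ^ length vs *\<^sub>R dir_derivs f vs x"
proof (induction vs arbitrary: x)
  case (Cons w vs)
  have sm: "smooth_on S (dir_derivs f vs)" by (rule smooth_on_dir_derivs[OF assms(2)])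
  have "dir_derivs f (map ((*\<^sub>R) t) (w # vs)) x = dir_derivs (dir_derivs f (map ((*\<^sub>R) t) vs)) [t *\<^sub>R w] x" by simp
  also have "\<dots> = dir_derivs (\<lambda>y. t ^ length vs *\<^sub>R dir_derivs f vs y) [t *\<^sub>R w] x"
    by (rule dir_derivs_cong_open[OF assms(1) Cons.IH Cons.prems])
  also have "\<dots> = t ^ length vs *\<^sub>R dir_derivs (dir_derivs f vs) [t *\<^sub>R w] x"
    by (rule dir_derivs_linear_comp[OF bounded_linear_scaleR_right assms(1) sm Cons.prems])
  also have "\<dots> = t ^ length (w # vs) *\<^sub>R dir_derivs f (w # vs) x"
    using dir_derivs_scale[OF smooth_on_differentiable[OF sm Cons.prems], of t w] by (simp add: mult.commute)
  finally show ?case .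
qed simp

lemma symbol_bd_power:
  fixes f :: "'a::euclidean_space \<Rightarrow> 'b::real_normed_field"
  assumes "open S" "x \<in> S" "smooth_on S f" "symbol_bd n f x Q A"
  shows "symbol_bd n (\<lambda>x. f x ^ k) x Q (2 ^ (n * k) * A ^ k)"
proof (induction k)
  case 0 show ?case by (simp add: symbol_bd_def dir_derivs_const)
next
  case (Suc k)
  have "symbol_bd n (\<lambda>x. f x * f x ^ k) x Q (2 ^ n * A * (2 ^ (n * k) * A ^ k))"
    by (rule symbol_bd_mult[OF assms(1,2,3) smooth_on_power[OF assms(1,3)] assms(4) Suc])
  then show ?case by (simp add: power_add mult_ac)
qed

lemma finitely_many_derivs_bounded:
  assumes sm: "smooth_on UNIV u" and "finite V"
  shows "\<exists>E\<ge>1. \<forall>ws. set ws \<subseteq> V \<and> length ws \<le> N \<longrightarrow> (\<forall>x\<in>cball 0 R. norm (dir_derivs u ws x) \<le> E)"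
proof -
  let ?F = "{ws. set ws \<subseteq> V \<and> length ws \<le> N}"
  have fin: "finite ?F" by (rule finite_lists_length_le[OF assms(2)])
  have "\<forall>ws\<in>?F. \<exists>C\<ge>0. \<forall>x\<in>cball 0 R. norm (dir_derivs u ws x) \<le> C"
    by (intro ballI smooth_on_UNIV_bounded smooth_on_dir_derivs sm)
  from bchoice[OF this] obtain C
    where C: "\<And>ws x. ws \<in> ?F \<Longrightarrow> x \<in> cball 0 R \<Longrightarrow> norm (dir_derivs u ws x) \<le> C ws"
    by blast
  have "norm (dir_derivs u ws x) \<le> Max (insert 1 (C ` ?F))" if "ws \<in> ?F" "x \<in> cball 0 R" for ws x
    by (rule order_trans[OF C[OF that]]) (use fin that in \<open>intro Max_ge; simp\<close>)
  moreover have "1 \<le> Max (insert 1 (C ` ?F))" using fin by (intro Max_ge) auto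
  ultimately show ?thesis by blast
qed

context boundary_frame
begin

text \<open>
  A fixed vector becomes admissible in \<^term>\<open>dirs \<zeta>\<close> when it is scaled by a multiple of \<open>q \<zeta>\<close>, so each
  ordinary derivative costs at most one factor \<open>1 / q\<close>; the factor \<open>\<bar>\<rho>\<bar> ^ (N + 1)\<close> pays for \<open>N\<close> of them
  and leaves one factor \<open>q\<close>.
\<close>

lemma symbol_bd_imp_vanishes:
  fixes G :: "complex^2 \<Rightarrow> complex"
  assumes sm: "smooth_on UNIV \<rho>" and K: "K = frontier {z. \<rho> z < 0}" and o: "open layer"
    and G: "smooth_on layer G" "\<And>\<zeta>. \<zeta> \<in> layer \<Longrightarrow> symbol_bd N G \<zeta> (dirs \<zeta>) C"
  shows "vanishes_to_order_on_boundary N {z. \<rho> z < 0} (\<lambda>\<zeta>. complex_of_real (\<bar>\<rho> \<zeta>\<bar> ^ (N + 1)) * G \<zeta>)"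
  unfolding vanishes_to_order_on_boundary_def
proof (intro ballI allI impI)
  let ?D = "{z. \<rho> z < 0}" and ?h = "\<lambda>\<zeta>. complex_of_real (\<bar>\<rho> \<zeta>\<bar> ^ (N + 1)) * G \<zeta>"
  fix p and vs :: "(complex^2) list" assume p: "p \<in> frontier ?D" and vs: "length vs \<le> N"
  have pK: "p \<in> K" using p K by simp
  define M where "M = 1 + (\<Sum>w\<in>set vs. norm w)"
  have M: "1 \<le> M" "norm w \<le> M" if "w \<in> set vs" for w
    unfolding M_def using member_le_sum[of w "set vs" norm] that by (auto intro: sum_nonneg)
  have M1: "1 \<le> M" unfolding M_def by (auto intro: sum_nonneg)
  obtain E where E: "E \<ge> 1" "\<And>ws x. set ws \<subseteq> set vs \<Longrightarrow> length ws \<le> N \<Longrightarrow> x \<in> cball 0 (norm p + 1) \<Longrightarrow> norm (dir_derivs \<rho> ws x) \<le> E"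
    using finitely_many_derivs_bounded[OF sm, of "set vs" N "norm p + 1"] by (metis List.finite_set)
  define A where "A = 2 ^ N * (2 ^ (N * (N + 1)) * E ^ (N + 1)) * C * M ^ N"
  have bound: "norm (dir_derivs ?h vs \<zeta>) \<le> A * \<bar>\<rho> \<zeta>\<bar>" if \<zeta>: "\<zeta> \<in> layer" "dist p \<zeta> < 1" for \<zeta>
  proof -
    note l = layer[OF \<zeta>(1)] and fr = unitary_frameD[OF frame_nb[OF layer(9)[OF \<zeta>(1)]]]
    define t where "t = q \<zeta> / M"
    have t: "0 < t" "t \<le> q \<zeta>" "t \<le> 1" "t * M = q \<zeta>"
    proof -
      show "0 < t" "t * M = q \<zeta>" using l M1 by (auto simp: t_def)
      have "q \<zeta> / M \<le> q \<zeta> / 1" using M1 l by (intro divide_left_mono) auto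
      then show "t \<le> q \<zeta>" "t \<le> 1" using l(4) by (auto simp: t_def)
    qed
    let ?Q = "(\<lambda>w. t *\<^sub>R w) ` set vs"
    have Q: "?Q \<subseteq> dirs \<zeta>"
    proof
      fix u assume "u \<in> ?Q"
      then obtain w where w: "w \<in> set vs" "u = t *\<^sub>R w" by blast
      have "norm u \<le> t * M" using M(2)[OF w(1)] t(1) w(2) by simp
      then have u: "norm u \<le> q \<zeta>" using t(4) by simp
      moreover have "cmod (herm u (\<eta> \<zeta>)) \<le> norm u" using norm_herm_le[of u "\<eta> \<zeta>"] fr by simp
      ultimately show "u \<in> dirs \<zeta>" using l(8) by (auto simp: dirs_def)
    qed
    have \<zeta>p: "\<zeta> \<in> cball 0 (norm p + 1)"
      using \<zeta>(2) norm_triangle_ineq2[of \<zeta> p] by (simp add: dist_norm norm_minus_commute)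
    have "symbol_bd N \<rho> \<zeta> ?Q (E * q \<zeta>)"
      unfolding symbol_bd_def
    proof (intro allI impI)
      fix us assume us: "length us \<le> N" "set us \<subseteq> ?Q"
      then have "us \<in> map ((*\<^sub>R) t) ` lists (set vs)" by (simp add: lists_image[symmetric] in_lists_conv_set subset_iff)
      then obtain ws where ws: "us = map ((*\<^sub>R) t) ws" "set ws \<subseteq> set vs" by auto
      have len: "length ws \<le> N" using us(1) ws(1) by simp
      have "norm (dir_derivs \<rho> us \<zeta>) = t ^ length ws * norm (dir_derivs \<rho> ws \<zeta>)"
        unfolding ws(1) dir_derivs_scale_list[OF open_UNIV sm UNIV_I] norm_scaleR using t(1) by simp
      also have "\<dots> \<le> E * q \<zeta>"
      proof (cases ws)
        case Nil then show ?thesis using E(1) l mult_right_mono[OF E(1), of "q \<zeta>"] by (simp add: q_def)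
      next
        case (Cons w ws')
        have "t ^ length ws \<le> t" using t Cons by (simp add: mult_left_le power_le_one)
        then have "t ^ length ws \<le> q \<zeta>" using t(2) by linarith
        then have "t ^ length ws * norm (dir_derivs \<rho> ws \<zeta>) \<le> q \<zeta> * E"
          using E(2)[OF ws(2) len \<zeta>p] l by (intro mult_mono) auto
        then show ?thesis by (simp add: mult.commute)
      qed
      finally show "norm (dir_derivs \<rho> us \<zeta>) \<le> E * q \<zeta>" .
    qed
    then have "symbol_bd N (\<lambda>x. - complex_of_real (\<rho> x)) \<zeta> ?Q (1 * (E * q \<zeta>))"
      by (intro symbol_bd_linear_comp[OF bounded_linear_minus[OF bounded_linear_of_real] open_UNIV UNIV_I sm]) auto
    then have s1: "symbol_bd N (\<lambda>x. - complex_of_real (\<rho> x)) \<zeta> ?Q (E * q \<zeta>)" by simp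
    have sm1: "smooth_on UNIV (\<lambda>x. - complex_of_real (\<rho> x))"
      by (rule smooth_on_linear_comp[OF bounded_linear_minus[OF bounded_linear_of_real] open_UNIV sm])
    have s2: "symbol_bd N (\<lambda>x. (- complex_of_real (\<rho> x)) ^ (N + 1)) \<zeta> ?Q (2 ^ (N * (N + 1)) * (E * q \<zeta>) ^ (N + 1))"
      by (rule symbol_bd_power[OF open_UNIV UNIV_I sm1 s1])
    have sm2: "smooth_on layer (\<lambda>x. (- complex_of_real (\<rho> x)) ^ (N + 1))"
      by (rule smooth_on_subset[OF smooth_on_power[OF open_UNIV sm1]]) simp
    have s3: "symbol_bd N G \<zeta> ?Q C" by (rule symbol_bd_mono[OF G(2)[OF \<zeta>(1)] order_refl Q order_refl])
    have "symbol_bd N (\<lambda>x. (- complex_of_real (\<rho> x)) ^ (N + 1) * G x) \<zeta> ?Q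
        (2 ^ N * (2 ^ (N * (N + 1)) * (E * q \<zeta>) ^ (N + 1)) * C)"
      by (rule symbol_bd_mult[OF o \<zeta>(1) sm2 G(1) s2 s3])
    moreover have heq: "(- complex_of_real (\<rho> x)) ^ (N + 1) * G x = ?h x" if "x \<in> layer" for x
      using layer(1)[OF that] by (simp add: q_def)
    ultimately have sh: "symbol_bd N ?h \<zeta> ?Q (2 ^ N * (2 ^ (N * (N + 1)) * (E * q \<zeta>) ^ (N + 1)) * C)"
      using symbol_bd_cong_open[of layer \<zeta> "\<lambda>x. (- complex_of_real (\<rho> x)) ^ (N + 1) * G x" ?h, OF o \<zeta>(1) heq] by simp
    have smh: "smooth_on layer ?h" by (rule smooth_on_cong_open[OF o heq smooth_on_mult[OF o sm2 G(1)]])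
    have "norm (dir_derivs ?h (map ((*\<^sub>R) t) vs) \<zeta>) \<le> 2 ^ N * (2 ^ (N * (N + 1)) * (E * q \<zeta>) ^ (N + 1)) * C"
      using sh vs unfolding symbol_bd_def by simp
    then have "t ^ length vs * norm (dir_derivs ?h vs \<zeta>) \<le> 2 ^ N * (2 ^ (N * (N + 1)) * (E * q \<zeta>) ^ (N + 1)) * C"
      unfolding dir_derivs_scale_list[OF o smh \<zeta>(1)] using t(1) by simp
    moreover have "t ^ N * norm (dir_derivs ?h vs \<zeta>) \<le> t ^ length vs * norm (dir_derivs ?h vs \<zeta>)"
      using t vs by (intro mult_right_mono power_decreasing) auto
    ultimately have "t ^ N * norm (dir_derivs ?h vs \<zeta>) \<le> 2 ^ N * (2 ^ (N * (N + 1)) * (E * q \<zeta>) ^ (N + 1)) * C"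
      by linarith
    also have "\<dots> = t ^ N * (A * q \<zeta>)"
    proof -
      have "(E * q \<zeta>) ^ (N + 1) = E ^ (N + 1) * ((t * M) ^ N * q \<zeta>)"
        unfolding t(4) by (simp add: power_mult_distrib)
      then show ?thesis unfolding A_def by (simp add: power_mult_distrib mult_ac)
    qed
    finally show ?thesis using t(1) by (simp add: q_def)
  qed
  have "((\<lambda>\<zeta>. A * \<bar>\<rho> \<zeta>\<bar>) \<longlongrightarrow> A * \<bar>\<rho> p\<bar>) (at p within ?D)"
  proof -
    have "continuous (at p) \<rho>"
      using smooth_on_continuous_on[OF sm] by (simp add: continuous_on_eq_continuous_at)
    then have "(\<rho> \<longlongrightarrow> \<rho> p) (at p within ?D)" unfolding isCont_def by (rule tendsto_within_subset) simp
    then show ?thesis by (intro tendsto_mult tendsto_const tendsto_rabs)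
  qed
  then have lim: "((\<lambda>\<zeta>. A * \<bar>\<rho> \<zeta>\<bar>) \<longlongrightarrow> 0) (at p within ?D)" using K0[OF pK] by simp
  have "eventually (\<lambda>\<zeta>. norm (dir_derivs ?h vs \<zeta>) \<le> A * \<bar>\<rho> \<zeta>\<bar>) (at p within ?D)"
    unfolding eventually_at
  proof (intro exI[of _ "min r1 1"] conjI ballI impI)
    show "0 < min r1 1" using r1(1) by simp
    fix \<zeta> assume "\<zeta> \<in> ?D" "\<zeta> \<noteq> p \<and> dist \<zeta> p < min r1 1"
    then have "\<zeta> \<in> layer" "dist p \<zeta> < 1" using pK by (auto simp: layer_def nb_def dist_commute)
    then show "norm (dir_derivs ?h vs \<zeta>) \<le> A * \<bar>\<rho> \<zeta>\<bar>" by (rule bound)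
  qed
  then show "(dir_derivs ?h vs \<longlongrightarrow> 0) (at p within ?D)" by (rule Lim_null_comparison[OF _ lim])
qed

end

theorem lemma5p2:
  fixes \<rho> :: "complex^2 \<Rightarrow> real"
    and f :: "complex^2 \<Rightarrow> complex"
    and v :: "complex^2 \<Rightarrow> complex^2"
    and D X \<Omega> W :: "(complex^2) set"
  assumes D_def: "D = sublevel \<rho> 0"
    and D_bounded: "bounded D"
    and rho_smooth: "smooth_on UNIV \<rho>"
    and rho_convex: "strictly_convex_fun \<rho>"
    and W: "open W" "frontier D \<subseteq> W"
    and rho_gradient: "\<And>\<zeta>. \<zeta> \<in> W \<Longrightarrow> gradient \<rho> \<zeta> \<noteq> 0"
    and v_smooth: "smooth_on W v"
    and v_unit: "\<And>\<zeta>. \<zeta> \<in> W \<Longrightarrow> norm (v \<zeta>) = 1"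
    and v_tangent: "\<And>\<zeta>. \<zeta> \<in> W \<Longrightarrow> v \<zeta> \<in> complex_tangent_space \<rho> \<zeta>"
    and Omega: "open \<Omega>" "closure D \<subseteq> \<Omega>"
    and f_minimal: "minimal_defining_function \<Omega> f"
    and X_def: "X = zero_set_on \<Omega> f"
    and X_meets_D: "X \<inter> D \<noteq> {}"
    and X_transverse: "transverse_tangent_cones X \<rho>"
  shows "\<exists>\<kappa>\<^sub>1>0. \<exists>\<epsilon>\<^sub>1>0. \<forall>\<kappa> \<epsilon>\<^sub>0. 0 < \<kappa> \<and> \<kappa> \<le> \<kappa>\<^sub>1 \<and> 0 < \<epsilon>\<^sub>0 \<and> \<epsilon>\<^sub>0 \<le> \<epsilon>\<^sub>1 \<longrightarrow>
    (\<exists>C :: nat \<Rightarrow> nat \<Rightarrow> real. \<forall>g :: complex^2 \<Rightarrow> complex.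
       holomorphic_on_analytic_set g (X \<inter> D) \<and> c_infty \<rho> X v \<kappa> \<epsilon>\<^sub>0 g < \<infinity> \<longrightarrow>
       (\<exists>U gt. open U \<and> frontier D \<subseteq> U \<and> U \<subseteq> W \<and>
          smooth_on (D \<inter> U) gt \<and> (\<forall>\<zeta> \<in> X \<inter> D \<inter> U. gt \<zeta> = g \<zeta>) \<and>
          (\<forall>N. vanishes_to_order_on_boundary N D
                 (\<lambda>\<zeta>. complex_of_real (\<bar>\<rho> \<zeta>\<bar> ^ (N + 1)) * gt \<zeta>)) \<and>
          (\<forall>\<alpha> \<beta>. \<forall>\<zeta> \<in> D \<inter> U.
             cmod (dbar_frame \<alpha> \<beta> (outer_unit_normal \<rho> \<zeta>) (v \<zeta>) gt \<zeta>)
               * \<bar>\<rho> \<zeta>\<bar> powr (real \<alpha> + real \<beta> / 2)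
             \<le> C \<alpha> \<beta> * enn2real (c_infty \<rho> X v \<kappa> \<epsilon>\<^sub>0 g)) \<and>
          (\<forall>\<alpha> \<beta>. \<alpha> + \<beta> \<ge> 1 \<longrightarrow> (\<forall>\<zeta> \<in> X \<inter> D \<inter> U.
             dbar_frame \<alpha> \<beta> (outer_unit_normal \<rho> \<zeta>) (v \<zeta>) gt \<zeta> = 0))))"
proof -
  let ?\<eta> = "outer_unit_normal \<rho>"
  have D: "D = {z. \<rho> z < 0}" using D_def by (simp add: sublevel_def)
  have X: "X = {z\<in>\<Omega>. f z = 0}" using X_def by (simp add: zero_set_on_def)
  have f: "Cn_holomorphic_on f \<Omega>" using f_minimal by (simp add: minimal_defining_function_def)
  have min: "\<exists>q. Cn_holomorphic_on q V \<and> (\<forall>z\<in>V. h z = f z * q z)"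
    if "open V" "V \<subseteq> \<Omega>" "Cn_holomorphic_on h V" "\<forall>z\<in>V. f z = 0 \<longrightarrow> h z = 0" for V h
    using f_minimal that unfolding minimal_defining_function_def zero_set_on_def by blast
  have opD: "open {z. \<rho> z < 0}"
    using frontier_sublevel(1)[OF smooth_on_continuous_on[OF rho_smooth]] by (simp add: sublevel_def)
  have D\<Omega>: "{z. \<rho> z < 0} \<subseteq> \<Omega>" using Omega(2) closure_subset[of D] D by blast
  have K\<Omega>: "frontier D \<subseteq> \<Omega>" using Omega(2) by (auto simp: frontier_def)
  have K: "compact (frontier D)" by (rule compact_frontier_bounded[OF D_bounded])
  obtain R0 L B0 where R0: "0 < R0" "\<And>p. p \<in> frontier D \<Longrightarrow> ball p R0 \<subseteq> W"
    and bf: "\<And>r0. 0 < r0 \<Longrightarrow> r0 \<le> R0 \<Longrightarrow> boundary_frame \<rho> ?\<eta> v (frontier D) r0 L B0"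
    using boundary_frame_exists[OF rho_smooth D_bounded[unfolded D_def] W(1) W(2)[unfolded D_def]
        rho_gradient v_unit v_tangent] unfolding D_def by blast
  have tc: "herm w (?\<eta> p) \<noteq> 0"
    if "p \<in> frontier D" "f p = 0" "w \<in> tangent_cone {z\<in>\<Omega>. f z = 0} p" "w \<noteq> 0" for p w
  proof (rule transverse_imp_herm_nonzero)
    have "p \<in> X \<inter> frontier (sublevel \<rho> 0)" using that(1,2) K\<Omega> unfolding X D_def by blast
    then show "{c *s w + t |c t. t \<in> level_tangent_space \<rho> p} = UNIV"
      using X_transverse that(3,4) unfolding transverse_tangent_cones_def X by blast
    show "gradient \<rho> p \<noteq> 0" using rho_gradient W(2) that(1) by blast
  qed
  obtain R \<theta> N where R: "0 < R" and \<theta>: "0 < \<theta>"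
    and thin: "\<And>\<zeta> p. p \<in> frontier D \<Longrightarrow> dist p \<zeta> < R \<Longrightarrow> thin_in X \<zeta> R N \<theta> (?\<eta> \<zeta>) (v \<zeta>)"
    using boundary_frame.uniformly_thin[OF bf[OF R0(1) order_refl] K f Omega(1) K\<Omega> min tc] unfolding X by blast
  \<comment> \<open>All \<open>\<kappa>\<close> and \<open>\<epsilon>\<^sub>0\<close> up to \<open>1\<close> are allowed, as the sizes of the polydiscs and of the layer may depend on them.\<close>
  show ?thesis
  proof (rule exI[of _ 1], intro conjI zero_less_one, rule exI[of _ 1], intro conjI zero_less_one allI impI)
    fix \<kappa> \<epsilon>\<^sub>0 :: real assume *: "0 < \<kappa> \<and> \<kappa> \<le> 1 \<and> 0 < \<epsilon>\<^sub>0 \<and> \<epsilon>\<^sub>0 \<le> 1"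
    define r where "r = Min {R0, R, \<epsilon>\<^sub>0}"
    have r: "0 < r" "r \<le> R0" "r \<le> R" "r \<le> \<epsilon>\<^sub>0" using R0(1) R * by (auto simp: r_def)
    interpret boundary_frame \<rho> ?\<eta> v "frontier D" r L B0 by (rule bf[OF r(1,2)])
    define \<delta> where "\<delta> = \<kappa> / (24 * L)"
    have \<delta>: "0 < \<delta>" "\<delta> \<le> c0"
    proof -
      show "0 < \<delta>" using * L by (simp add: \<delta>_def)
      have "\<kappa> / (24 * L) \<le> 1 / (16 * L)" using * L by (intro frac_le) auto
      then show "\<delta> \<le> c0" by (simp add: \<delta>_def c0_def)
    qed
    \<comment> \<open>Polydiscs of size \<open>24 a\<close> fit into those of size \<open>\<theta> \<delta>\<close> by \<open>\<delta> / 2\<close>, on which the local extensions exist.\<close>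
    define a where "a = min (\<theta> * \<delta> / 24) (\<delta> / 48)"
    have a: "0 < a" "24 * a \<le> \<theta> * \<delta>" "48 * a \<le> \<delta>" using \<delta> \<theta> by (auto simp: a_def)
    have a48: "48 * a \<le> c0" using a(3) \<delta>(2) by linarith
    obtain C where C: "\<forall>G g X B. 0 \<le> B \<longrightarrow> (\<forall>j\<in>layer. local_extension_at a B g X j (G j)) \<longrightarrow>
        (\<exists>gt. symbol_extension (\<lambda>n. C n * B) g X gt)"
      using glue_local_extensions[OF a(1) a48] by blast
    have ol: "open layer" by (rule open_layer[OF opD])
    have DU: "D \<inter> nb r1 = layer" unfolding layer_def by (auto simp: D)
    show "\<exists>C :: nat \<Rightarrow> nat \<Rightarrow> real. \<forall>g :: complex^2 \<Rightarrow> complex.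
       holomorphic_on_analytic_set g (X \<inter> D) \<and> c_infty \<rho> X v \<kappa> \<epsilon>\<^sub>0 g < \<infinity> \<longrightarrow>
       (\<exists>U gt. open U \<and> frontier D \<subseteq> U \<and> U \<subseteq> W \<and>
          smooth_on (D \<inter> U) gt \<and> (\<forall>\<zeta> \<in> X \<inter> D \<inter> U. gt \<zeta> = g \<zeta>) \<and>
          (\<forall>N. vanishes_to_order_on_boundary N D
                 (\<lambda>\<zeta>. complex_of_real (\<bar>\<rho> \<zeta>\<bar> ^ (N + 1)) * gt \<zeta>)) \<and>
          (\<forall>\<alpha> \<beta>. \<forall>\<zeta> \<in> D \<inter> U.
             cmod (dbar_frame \<alpha> \<beta> (?\<eta> \<zeta>) (v \<zeta>) gt \<zeta>)
               * \<bar>\<rho> \<zeta>\<bar> powr (real \<alpha> + real \<beta> / 2)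
             \<le> C \<alpha> \<beta> * enn2real (c_infty \<rho> X v \<kappa> \<epsilon>\<^sub>0 g)) \<and>
          (\<forall>\<alpha> \<beta>. \<alpha> + \<beta> \<ge> 1 \<longrightarrow> (\<forall>\<zeta> \<in> X \<inter> D \<inter> U.
             dbar_frame \<alpha> \<beta> (?\<eta> \<zeta>) (v \<zeta>) gt \<zeta> = 0)))"
    proof (rule exI[of _ "\<lambda>\<alpha> \<beta>. C (\<alpha> + \<beta>) * real N"], intro allI impI, elim conjE)
      fix g assume g: "holomorphic_on_analytic_set g (X \<inter> D)" and fin: "c_infty \<rho> X v \<kappa> \<epsilon>\<^sub>0 g < \<infinity>"
      let ?c = "enn2real (c_infty \<rho> X v \<kappa> \<epsilon>\<^sub>0 g)"
      have "\<exists>G. local_extension_at a (real N * ?c) g X j G" if j: "j \<in> layer" for j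
      proof -
        obtain p where p: "p \<in> frontier D" "dist p j < r" using layer(9)[OF j] by (auto simp: nb_def)
        have th: "thin_in {z\<in>\<Omega>. f z = 0} j R N \<theta> (?\<eta> j) (v j)"
          using thin[of p j] p r(3) unfolding X by linarith
        show ?thesis unfolding X
          by (rule local_extension[OF refl opD D\<Omega> f min th r(3) \<theta> _ _ r(4) g[unfolded X D] fin[unfolded X]
                a(1) a(2,3)[unfolded \<delta>_def] j]) (use * in auto)
      qed
      then have "\<forall>j\<in>layer. \<exists>G. local_extension_at a (real N * ?c) g X j G" by blast
      from bchoice[OF this] obtain G where G: "\<forall>j\<in>layer. local_extension_at a (real N * ?c) g X j (G j)"
        by blast
      have "\<exists>gt. symbol_extension (\<lambda>n. C n * (real N * ?c)) g X gt"
        using C[THEN spec, THEN spec, THEN spec, THEN spec, THEN mp, THEN mp, OF _ G] by simp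
      then obtain gt where "symbol_extension (\<lambda>n. C n * (real N * ?c)) g X gt" by blast
      then have gt: "smooth_on layer gt" "\<And>n \<zeta>. \<zeta> \<in> layer \<Longrightarrow> symbol_bd n gt \<zeta> (dirs \<zeta>) (C n * (real N * ?c))"
        "\<And>\<zeta>. \<zeta> \<in> layer \<Longrightarrow> \<zeta> \<in> X \<Longrightarrow> gt \<zeta> = g \<zeta>"
        "\<And>\<zeta> \<alpha> \<beta>. \<zeta> \<in> layer \<Longrightarrow> \<zeta> \<in> X \<Longrightarrow> \<alpha> + \<beta> \<ge> 1 \<Longrightarrow> (dbar_dir (?\<eta> \<zeta>) ^^ \<alpha>) ((dbar_dir (v \<zeta>) ^^ \<beta>) gt) \<zeta> = 0"
        unfolding symbol_extension_def by blast+
      show "\<exists>U gt. open U \<and> frontier D \<subseteq> U \<and> U \<subseteq> W \<and>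
          smooth_on (D \<inter> U) gt \<and> (\<forall>\<zeta> \<in> X \<inter> D \<inter> U. gt \<zeta> = g \<zeta>) \<and>
          (\<forall>N. vanishes_to_order_on_boundary N D
                 (\<lambda>\<zeta>. complex_of_real (\<bar>\<rho> \<zeta>\<bar> ^ (N + 1)) * gt \<zeta>)) \<and>
          (\<forall>\<alpha> \<beta>. \<forall>\<zeta> \<in> D \<inter> U.
             cmod (dbar_frame \<alpha> \<beta> (?\<eta> \<zeta>) (v \<zeta>) gt \<zeta>)
               * \<bar>\<rho> \<zeta>\<bar> powr (real \<alpha> + real \<beta> / 2)
             \<le> C (\<alpha> + \<beta>) * real N * ?c) \<and>
          (\<forall>\<alpha> \<beta>. \<alpha> + \<beta> \<ge> 1 \<longrightarrow> (\<forall>\<zeta> \<in> X \<inter> D \<inter> U.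
             dbar_frame \<alpha> \<beta> (?\<eta> \<zeta>) (v \<zeta>) gt \<zeta> = 0))"
      proof (rule exI[of _ "nb r1"], rule exI[of _ gt], unfold DU Int_assoc, intro conjI allI ballI impI)
        have "nb r1 = (\<Union>p\<in>frontier D. ball p r1)" by (auto simp: nb_def)
        then show "open (nb r1)" by auto
        show "frontier D \<subseteq> nb r1" using r1(1) by (force simp: nb_def)
        have "r1 \<le> R0" using r1 r by linarith
        then show "nb r1 \<subseteq> W" using R0(2) by (force simp: nb_def)
        show "smooth_on layer gt" by (rule gt(1))
        show "gt \<zeta> = g \<zeta>" if "\<zeta> \<in> X \<inter> layer" for \<zeta> using gt(3) that by blast
        show "vanishes_to_order_on_boundary n D (\<lambda>\<zeta>. complex_of_real (\<bar>\<rho> \<zeta>\<bar> ^ (n + 1)) * gt \<zeta>)" for n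
          unfolding D by (rule symbol_bd_imp_vanishes[OF rho_smooth _ ol gt(1) gt(2)]) (simp add: D)
        show "cmod (dbar_frame \<alpha> \<beta> (?\<eta> \<zeta>) (v \<zeta>) gt \<zeta>) * \<bar>\<rho> \<zeta>\<bar> powr (real \<alpha> + real \<beta> / 2)
            \<le> C (\<alpha> + \<beta>) * real N * ?c" if "\<zeta> \<in> layer" for \<alpha> \<beta> \<zeta>
          using dbar_frame_bound[OF ol gt(1) that gt(2)[OF that]] by (simp add: mult_ac)
        show "dbar_frame \<alpha> \<beta> (?\<eta> \<zeta>) (v \<zeta>) gt \<zeta> = 0" if "1 \<le> \<alpha> + \<beta>" "\<zeta> \<in> X \<inter> layer" for \<alpha> \<beta> \<zeta>
          using gt(4)[of \<zeta> \<alpha> \<beta>] dbar_frame_eq[OF ol gt(1), of \<zeta>] that by simp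
      qed
    qed
  qed
qed

end
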